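(* The parameters $\alpha,\ c_0,\ \vartheta,\ \widehat\vartheta,\ \mathfrak H,\ \beta$ and $\gamma$ are invariant under TRO-equivalence of noncommutative graphs: if $H,K$ are finite-dimensional Hilbert spaces and $\mathcal S\subseteq\mathcal B(H)$, $\mathcal T\subseteq\mathcal B(K)$ are noncommutative graphs with $\mathcal S\sim_{\mathrm{TRO}}\mathcal T$, then $p(\mathcal S)=p(\mathcal T)$ for each $p\in\{\alpha,c_0,\vartheta,\widehat\vartheta,\mathfrak H,\beta,\gamma\}$. In particular, these parameters are invariant under $\Delta$-equivalence of irreducibly acting noncommutative graphs: if $\mathcal S$ and $\mathcal T$ act irreducibly on $H$ and $K$ and $\mathcal S\sim_\Delta\mathcal T$, then $p(\mathcal S)=p(\mathcal T)$ for each such $p$.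
   Context: Inner products are linear in the second variable; $\xi\eta^*$ denotes the rank one operator $\zeta\mapsto\langle\eta,\zeta\rangle\xi$. A noncommutative graph is an operator system $\mathcal S\subseteq\mathcal B(H)$ (selfadjoint subspace containing $I_H$), $H$ finite-dimensional. $\mathcal S^\perp$ is the orthogonal complement in $\mathcal B(H)$ for $\langle x,y\rangle=\operatorname{Tr}(x^*y)$. $[\,\cdot\,]$ denotes closed linear span. Equivalences. A TRO is a norm-closed subspace $\mathcal M\subseteq\mathcal B(H,K)$ with $\mathcal M\mathcal M^*\mathcal M\subseteq\mathcal M$, non-degenerate if $I_H\in[\mathcal M^*\mathcal M]$ and $I_K\in[\mathcal M\mathcal M^*]$. Operator systems $\mathcal S\subseteq\mathcal B(H)$, $\mathcal T\subseteq\mathcal B(K)$ satisfy $\mathcal S\sim_{\mathrm{TRO}}\mathcal T$ if there is a non-degenerate TRO $\mathcal M\subseteq\mathcal B(H,K)$ with $x^*ty\in\mathcal S$ and $xsy^*\in\mathcal T$ for all $x,y\in\mathcal M$, $s\in\mathcal S$, $t\in\mathcal T$. They satisfy $\mathcal S\sim_\Delta\mathcal T$ if there are Hilbert spaces $H_1,K_1$ and unital complete order embeddings $\varphi\colon\mathcal S\to\mathcal B(H_1)$, $\psi\colon\mathcal T\to\mathcal B(K_1)$ with $\varphi(\mathcal S)\sim_{\mathrm{TRO}}\psi(\mathcal T)$. $\mathcal S$ acts irreducibly on $H$ if there is no non-trivial closed subspace $L\subseteq H$ reducing $\mathcal S$ for which $s\mapsto s|_L$, $\mathcal S\to\mathcal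 B(L)$, is completely isometric. Channels. A quantum channel $\Phi\colon\mathcal B(H)\to M_k$ is a completely positive trace-preserving map; writing $\Phi(c)=\sum_{i=1}^rv_icv_i^*$ with $v_i\colon H\to\mathbb C^k$ and $\sum_iv_i^*v_i=I_H$, set $\mathcal S_\Phi=\operatorname{span}\{v_i^*v_j: i,j\in\{1,\dots,r\}\}$ (independent of the representation). Let $\mathfrak C(\mathcal S)$ be the set of all quantum channels $\Phi\colon\mathcal B(H)\to M_k$, $k\in\mathbb N$, with $\mathcal S_\Phi\subseteq\mathcal S$. Parameters. - $\alpha(\mathcal S)$ (independence number): the largest $n$ for which there are orthonormal vectors $\xi_1,\dots,\xi_n\in H$ with $\xi_i\xi_j^*\in\mathcal S^\perp$ for all $i\ne j$. - $c_0(\mathcal S)=\lim_{n\to\infty}\sqrt[n]{\alpha(\mathcal S^{\otimes n})}$ (Shannon capacity), where $\mathcal S^{\otimes n}\subseteq\mathcal B(H^{\otimes n})$ is the $n$-fold (minimal) tensor product. - $\widehat\vartheta(\mathcal S)^{-1}=\sup\{\inf\{\|\Phi(\rho)\|:\rho\text{ a state of }\mathcal B(H)\}:\Phi\in\mathfrak C(\mathcal S)\}$ and $\vartheta(\mathcal S)^{-1}=\inf\{\sup\{\|\Phi(\rho)\|:\Phi\in\mathfrak C(\mathcal S)\}:\rho\text{ a state of }\mathcal B(H)\}$ (Lovász numbers), where a state is a positive operator of trace one and $\|\cdot\|$ is the operator norm. - $\gamma(\mathcal S)$ (quantum complexity): the least $k\in\mathbb N$ for which there is a quantum channel $\Phi\colon\mathcal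 B(H)\to M_k$ with $\mathcal S_\Phi=\mathcal S$. - $\beta(\mathcal S)$ (quantum subcomplexity): the least $k\in\mathbb N$ for which there is a quantum channel $\Phi\colon\mathcal B(H)\to M_k$ with $\mathcal S_\Phi\subseteq\mathcal S$. - $\mathfrak H(\mathcal S)$ (Haemers bound): the least $k\in\mathbb N$ for which there is a trace-preserving linear map $\Phi\colon\mathcal B(H)\to M_k$, $\Phi(c)=\sum_{i=1}^rv_icw_i^*$ with $v_i,w_i\colon H\to\mathbb C^k$ and $\sum_iw_i^*v_i=I_H$, such that $\operatorname{span}\{w_i^*v_j: i,j\in\{1,\dots,r\}\}\subseteq\mathcal S$. *)

theory Defs
  imports
    "HOL-Analysis.Bounded_Linear_Function"
    "HOL-Analysis.Inner_Product"
    "Jordan_Normal_Form.Schur_Decomposition"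
begin

text \<open>A finite-dimensional Hilbert space \<open>H\<close> is \<open>\<complex>\<^sup>n\<close>, with vectors in \<open>carrier_vec n\<close>;
  \<open>\<B>(\<complex>\<^sup>n, \<complex>\<^sup>m)\<close> is \<open>carrier_mat m n\<close>. The library product \<open>\<bullet>c\<close> conjugates its second argument,
  so the arguments are swapped to make inner products linear in the second variable.\<close>

definition cip :: "complex vec \<Rightarrow> complex vec \<Rightarrow> complex" where
  "cip \<xi> \<eta> = \<eta> \<bullet>c \<xi>"

definition vnorm :: "complex vec \<Rightarrow> real" where
  "vnorm \<xi> = sqrt (Re (cip \<xi> \<xi>))"

definition op_norm :: "complex mat \<Rightarrow> real" where
  "op_norm x = Sup {vnorm (x *\<^sub>v \<xi>) | \<xi>. \<xi> \<in> carrier_vec (dim_col x) \<and> vnorm \<xi> \<le> 1}"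

definition mat_trace :: "complex mat \<Rightarrow> complex" where
  "mat_trace x = (\<Sum>i<dim_row x. x $$ (i, i))"

definition rank_one :: "nat \<Rightarrow> complex vec \<Rightarrow> complex vec \<Rightarrow> complex mat" where
  "rank_one n \<xi> \<eta> = mat n n (\<lambda>(i, j). \<xi> $ i * conjugate (\<eta> $ j))"

text \<open>Matrices of varying dimensions form a single type without a neutral element for addition,
  so finite sums of \<open>r \<times> c\<close> matrices are taken entrywise.\<close>

definition mat_sum :: "nat \<Rightarrow> nat \<Rightarrow> ('i \<Rightarrow> complex mat) \<Rightarrow> 'i set \<Rightarrow> complex mat" where
  "mat_sum r c x I = mat r c (\<lambda>(a, b). \<Sum>i\<in>I. x i $$ (a, b))"

definition mat_subspace :: "nat \<Rightarrow> nat \<Rightarrow> complex mat set \<Rightarrow> bool" where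
  "mat_subspace r c V \<longleftrightarrow> V \<subseteq> carrier_mat r c \<and> 0\<^sub>m r c \<in> V \<and>
     (\<forall>x\<in>V. \<forall>y\<in>V. x + y \<in> V) \<and> (\<forall>z. \<forall>x\<in>V. z \<cdot>\<^sub>m x \<in> V)"

text \<open>Meaningful for \<open>X \<subseteq> carrier_mat r c\<close>.\<close>

definition mat_span :: "nat \<Rightarrow> nat \<Rightarrow> complex mat set \<Rightarrow> complex mat set" where
  "mat_span r c X = mat_subspace r c hull X"

definition psd :: "nat \<Rightarrow> complex mat \<Rightarrow> bool" where
  "psd n x \<longleftrightarrow> x \<in> carrier_mat n n \<and> (\<forall>\<xi>\<in>carrier_vec n. 0 \<le> cip \<xi> (x *\<^sub>v \<xi>))"

definition states :: "nat \<Rightarrow> complex mat set" where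
  "states n = {\<rho>. psd n \<rho> \<and> mat_trace \<rho> = 1}"

text \<open>An element of \<open>M\<^sub>p(\<B>(\<complex>\<^sup>n))\<close> is a family \<open>x i j\<close> with \<open>i, j < p\<close>, acting on \<open>(\<complex>\<^sup>n)\<^sup>p\<close>.\<close>

definition block_psd :: "nat \<Rightarrow> nat \<Rightarrow> (nat \<Rightarrow> nat \<Rightarrow> complex mat) \<Rightarrow> bool" where
  "block_psd n p x \<longleftrightarrow>
     (\<forall>\<xi>. (\<forall>i<p. \<xi> i \<in> carrier_vec n) \<longrightarrow> 0 \<le> (\<Sum>i<p. \<Sum>j<p. cip (\<xi> i) (x i j *\<^sub>v \<xi> j)))"

text \<open>The norm of the restriction to \<open>L\<^sup>p\<close> of a matrix \<open>x\<close> of operators on \<open>\<complex>\<^sup>n\<close>.\<close>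

definition block_norm_on :: "nat \<Rightarrow> complex vec set \<Rightarrow> nat \<Rightarrow> (nat \<Rightarrow> nat \<Rightarrow> complex mat) \<Rightarrow> real" where
  "block_norm_on n L p x =
     Sup {sqrt (\<Sum>i<p. (vnorm (finsum_vec TYPE(complex) n (\<lambda>j. x i j *\<^sub>v \<xi> j) {..<p}))\<^sup>2) | \<xi>.
            (\<forall>j<p. \<xi> j \<in> L) \<and> (\<Sum>j<p. (vnorm (\<xi> j))\<^sup>2) \<le> 1}"

definition operator_system :: "nat \<Rightarrow> complex mat set \<Rightarrow> bool" where
  "operator_system n S \<longleftrightarrow> mat_subspace n n S \<and> 1\<^sub>m n \<in> S \<and> (\<forall>x\<in>S. mat_adjoint x \<in> S)"

text \<open>Norm closedness and closed spans need no mention here, since all subspaces of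
  \<open>carrier_mat m n\<close> are closed.\<close>

definition mat_tro :: "nat \<Rightarrow> nat \<Rightarrow> complex mat set \<Rightarrow> bool" where
  "mat_tro n m M \<longleftrightarrow> mat_subspace m n M \<and> (\<forall>x\<in>M. \<forall>y\<in>M. \<forall>z\<in>M. x * mat_adjoint y * z \<in> M)"

definition mat_nondegenerate :: "nat \<Rightarrow> nat \<Rightarrow> complex mat set \<Rightarrow> bool" where
  "mat_nondegenerate n m M \<longleftrightarrow>
     1\<^sub>m n \<in> mat_span n n {mat_adjoint x * y | x y. x \<in> M \<and> y \<in> M} \<and>
     1\<^sub>m m \<in> mat_span m m {x * mat_adjoint y | x y. x \<in> M \<and> y \<in> M}"

definition mat_tro_equivalent ::
  "nat \<Rightarrow> complex mat set \<Rightarrow> nat \<Rightarrow> complex mat set \<Rightarrow> bool" where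
  "mat_tro_equivalent n S m T \<longleftrightarrow> (\<exists>M. mat_tro n m M \<and> mat_nondegenerate n m M \<and>
     (\<forall>x\<in>M. \<forall>y\<in>M. (\<forall>t\<in>T. mat_adjoint x * t * y \<in> S) \<and> (\<forall>s\<in>S. x * s * mat_adjoint y \<in> T)))"

definition reducing :: "nat \<Rightarrow> complex mat set \<Rightarrow> complex vec set \<Rightarrow> bool" where
  "reducing n S L \<longleftrightarrow>
     L \<subseteq> carrier_vec n \<and> 0\<^sub>v n \<in> L \<and> (\<forall>\<xi>\<in>L. \<forall>\<eta>\<in>L. \<xi> + \<eta> \<in> L) \<and> (\<forall>z. \<forall>\<xi>\<in>L. z \<cdot>\<^sub>v \<xi> \<in> L) \<and>
     (\<forall>s\<in>S. \<forall>\<xi>\<in>L. s *\<^sub>v \<xi> \<in> L \<and> mat_adjoint s *\<^sub>v \<xi> \<in> L)"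

definition acts_irreducibly :: "nat \<Rightarrow> complex mat set \<Rightarrow> bool" where
  "acts_irreducibly n S \<longleftrightarrow>
     \<not> (\<exists>L. reducing n S L \<and> L \<noteq> {0\<^sub>v n} \<and> L \<noteq> carrier_vec n \<and>
          (\<forall>p x. (\<forall>i<p. \<forall>j<p. x i j \<in> S) \<longrightarrow>
             block_norm_on n L p x = block_norm_on n (carrier_vec n) p x))"

class chilbert_space = real_inner + complete_space +
  fixes scaleC :: "complex \<Rightarrow> 'a \<Rightarrow> 'a"
    and cinner :: "'a \<Rightarrow> 'a \<Rightarrow> complex"
  assumes scaleC_add_right: "scaleC a (x + y) = scaleC a x + scaleC a y"
    and scaleC_add_left: "scaleC (a + b) x = scaleC a x + scaleC b x"
    and scaleC_scaleC: "scaleC a (scaleC b x) = scaleC (a * b) x"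
    and scaleC_of_real: "scaleC (complex_of_real r) x = r *\<^sub>R x"
    and cinner_commute: "cinner x y = cnj (cinner y x)"
    and cinner_add_right: "cinner x (y + z) = cinner x y + cinner x z"
    and cinner_scaleC_right: "cinner x (scaleC a y) = a * cinner x y"
    and inner_eq_Re_cinner: "inner x y = Re (cinner x y)"

instantiation complex :: chilbert_space
begin

definition scaleC_complex :: "complex \<Rightarrow> complex \<Rightarrow> complex" where
  "scaleC_complex a x = a * x"

definition cinner_complex :: "complex \<Rightarrow> complex \<Rightarrow> complex" where
  "cinner_complex x y = cnj x * y"

instance
  by standard
    (auto simp: scaleC_complex_def cinner_complex_def inner_complex_def scaleR_conv_of_real
      algebra_simps)

end

lemma norm_scaleC: "norm (scaleC a x) = cmod a * norm (x :: 'a::chilbert_space)"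
proof -
  have "cinner (scaleC a x) (scaleC a x) = a * cnj (cinner x (scaleC a x))"
    by (metis cinner_commute cinner_scaleC_right)
  also have "\<dots> = (a * cnj a) * cinner x x"
    by (metis cinner_commute cinner_scaleC_right complex_cnj_mult mult.assoc)
  also have "\<dots> = complex_of_real ((cmod a)\<^sup>2) * cinner x x"
    by (simp only: complex_norm_square)
  finally have "(norm (scaleC a x))\<^sup>2 = (cmod a * norm x)\<^sup>2"
    by (simp add: power2_norm_eq_inner inner_eq_Re_cinner power_mult_distrib)
  then show ?thesis
    by (simp add: power2_eq_iff_nonneg)
qed

lemma bounded_linear_scaleC: "bounded_linear (scaleC a :: 'a::chilbert_space \<Rightarrow> 'a)"
proof (rule bounded_linear_intro[where K = "cmod a"])
  fix x y :: 'a and r :: real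
  show "scaleC a (x + y) = scaleC a x + scaleC a y"
    by (rule scaleC_add_right)
  show "scaleC a (r *\<^sub>R x) = r *\<^sub>R scaleC a x"
    by (metis scaleC_of_real scaleC_scaleC mult.commute)
  show "norm (scaleC a x) \<le> norm x * cmod a"
    by (simp add: norm_scaleC)
qed

lift_definition scaleC_blinfun ::
  "complex \<Rightarrow> ('a::real_normed_vector \<Rightarrow>\<^sub>L 'b::chilbert_space) \<Rightarrow> 'a \<Rightarrow>\<^sub>L 'b"
  is "\<lambda>a x \<xi>. scaleC a (x \<xi>)"
  by (rule bounded_linear_compose[OF bounded_linear_scaleC])

text \<open>\<open>\<Rightarrow>\<^sub>L\<close> consists of the real-linear bounded maps; the operators between complex Hilbert
  spaces are the complex-linear ones among them.\<close>

definition bounded_ops :: "('a::chilbert_space \<Rightarrow>\<^sub>L 'b::chilbert_space) set" where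
  "bounded_ops = {x. \<forall>a \<xi>. blinfun_apply x (scaleC a \<xi>) = scaleC a (blinfun_apply x \<xi>)}"

definition cadjoint :: "('a::chilbert_space \<Rightarrow>\<^sub>L 'b::chilbert_space) \<Rightarrow> 'b \<Rightarrow>\<^sub>L 'a" where
  "cadjoint x = (THE y. \<forall>\<xi> \<eta>. cinner (blinfun_apply y \<eta>) \<xi> = cinner \<eta> (blinfun_apply x \<xi>))"

definition op_subspace :: "('a::chilbert_space \<Rightarrow>\<^sub>L 'b::chilbert_space) set \<Rightarrow> bool" where
  "op_subspace V \<longleftrightarrow> V \<subseteq> bounded_ops \<and> 0 \<in> V \<and>
     (\<forall>x\<in>V. \<forall>y\<in>V. x + y \<in> V) \<and> (\<forall>a. \<forall>x\<in>V. scaleC_blinfun a x \<in> V)"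

definition closed_span ::
  "('a::chilbert_space \<Rightarrow>\<^sub>L 'b::chilbert_space) set \<Rightarrow> ('a \<Rightarrow>\<^sub>L 'b) set" where
  "closed_span X = (\<lambda>V. op_subspace V \<and> closed V) hull X"

definition tro :: "('a::chilbert_space \<Rightarrow>\<^sub>L 'b::chilbert_space) set \<Rightarrow> bool" where
  "tro M \<longleftrightarrow> op_subspace M \<and> closed M \<and>
     (\<forall>x\<in>M. \<forall>y\<in>M. \<forall>z\<in>M. x o\<^sub>L cadjoint y o\<^sub>L z \<in> M)"

definition nondegenerate :: "('a::chilbert_space \<Rightarrow>\<^sub>L 'b::chilbert_space) set \<Rightarrow> bool" where
  "nondegenerate M \<longleftrightarrow>
     id_blinfun \<in> closed_span {cadjoint x o\<^sub>L y | x y. x \<in> M \<and> y \<in> M} \<and>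
     id_blinfun \<in> closed_span {x o\<^sub>L cadjoint y | x y. x \<in> M \<and> y \<in> M}"

definition tro_equivalent ::
  "('a::chilbert_space \<Rightarrow>\<^sub>L 'a) set \<Rightarrow> ('b::chilbert_space \<Rightarrow>\<^sub>L 'b) set \<Rightarrow> bool" where
  "tro_equivalent S T \<longleftrightarrow> (\<exists>M :: ('a \<Rightarrow>\<^sub>L 'b) set. tro M \<and> nondegenerate M \<and>
     (\<forall>x\<in>M. \<forall>y\<in>M. (\<forall>t\<in>T. cadjoint x o\<^sub>L t o\<^sub>L y \<in> S) \<and> (\<forall>s\<in>S. x o\<^sub>L s o\<^sub>L cadjoint y \<in> T)))"

definition op_block_psd :: "nat \<Rightarrow> (nat \<Rightarrow> nat \<Rightarrow> 'a::chilbert_space \<Rightarrow>\<^sub>L 'a) \<Rightarrow> bool" where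
  "op_block_psd p x \<longleftrightarrow>
     (\<forall>\<xi>. 0 \<le> (\<Sum>i<p. \<Sum>j<p. cinner (\<xi> i) (blinfun_apply (x i j) (\<xi> j))))"

text \<open>Only the values of \<open>\<phi>\<close> on \<open>S\<close> matter. Injectivity follows from the equivalence of the
  positivity conditions.\<close>

definition unital_complete_order_embedding ::
  "nat \<Rightarrow> complex mat set \<Rightarrow> (complex mat \<Rightarrow> 'a::chilbert_space \<Rightarrow>\<^sub>L 'a) \<Rightarrow> bool" where
  "unital_complete_order_embedding n S \<phi> \<longleftrightarrow>
     \<phi> ` S \<subseteq> bounded_ops \<and>
     (\<forall>x\<in>S. \<forall>y\<in>S. \<phi> (x + y) = \<phi> x + \<phi> y) \<and>
     (\<forall>a. \<forall>x\<in>S. \<phi> (a \<cdot>\<^sub>m x) = scaleC_blinfun a (\<phi> x)) \<and>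
     \<phi> (1\<^sub>m n) = id_blinfun \<and>
     (\<forall>p x. (\<forall>i<p. \<forall>j<p. x i j \<in> S) \<longrightarrow>
        (block_psd n p x \<longleftrightarrow> op_block_psd p (\<lambda>i j. \<phi> (x i j))))"

text \<open>Types cannot be quantified inside a definition, so the Hilbert spaces \<open>H\<^sub>1\<close> and \<open>K\<^sub>1\<close> are
  type parameters. When this predicate is a hypothesis of a theorem with \<open>'h\<close> and \<open>'k\<close> free, the
  implicit universal quantification over them expresses the existence of some \<open>H\<^sub>1\<close> and \<open>K\<^sub>1\<close>.\<close>

definition delta_equivalent ::
  "'h::chilbert_space itself \<Rightarrow> 'k::chilbert_space itself \<Rightarrow>
   nat \<Rightarrow> complex mat set \<Rightarrow> nat \<Rightarrow> complex mat set \<Rightarrow> bool" where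
  "delta_equivalent _ _ n S m T \<longleftrightarrow>
     (\<exists>(\<phi> :: complex mat \<Rightarrow> 'h \<Rightarrow>\<^sub>L 'h) (\<psi> :: complex mat \<Rightarrow> 'k \<Rightarrow>\<^sub>L 'k).
        unital_complete_order_embedding n S \<phi> \<and> unital_complete_order_embedding m T \<psi> \<and>
        tro_equivalent (\<phi> ` S) (\<psi> ` T))"

definition linear_map :: "nat \<Rightarrow> nat \<Rightarrow> (complex mat \<Rightarrow> complex mat) \<Rightarrow> bool" where
  "linear_map n k \<Phi> \<longleftrightarrow>
     (\<forall>c\<in>carrier_mat n n. \<Phi> c \<in> carrier_mat k k) \<and>
     (\<forall>c\<in>carrier_mat n n. \<forall>d\<in>carrier_mat n n. \<Phi> (c + d) = \<Phi> c + \<Phi> d) \<and>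
     (\<forall>a. \<forall>c\<in>carrier_mat n n. \<Phi> (a \<cdot>\<^sub>m c) = a \<cdot>\<^sub>m \<Phi> c)"

definition trace_preserving :: "nat \<Rightarrow> (complex mat \<Rightarrow> complex mat) \<Rightarrow> bool" where
  "trace_preserving n \<Phi> \<longleftrightarrow> (\<forall>c\<in>carrier_mat n n. mat_trace (\<Phi> c) = mat_trace c)"

definition completely_positive :: "nat \<Rightarrow> nat \<Rightarrow> (complex mat \<Rightarrow> complex mat) \<Rightarrow> bool" where
  "completely_positive n k \<Phi> \<longleftrightarrow>
     (\<forall>p x. (\<forall>i<p. \<forall>j<p. x i j \<in> carrier_mat n n) \<and> block_psd n p x \<longrightarrow>
        block_psd k p (\<lambda>i j. \<Phi> (x i j)))"

definition quantum_channel :: "nat \<Rightarrow> nat \<Rightarrow> (complex mat \<Rightarrow> complex mat) \<Rightarrow> bool" where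
  "quantum_channel n k \<Phi> \<longleftrightarrow>
     linear_map n k \<Phi> \<and> completely_positive n k \<Phi> \<and> trace_preserving n \<Phi>"

text \<open>\<open>\<Phi>(c) = \<Sum>\<^sub>i v\<^sub>i c w\<^sub>i\<^sup>*\<close> with \<open>\<Sum>\<^sub>i w\<^sub>i\<^sup>* v\<^sub>i = I\<close>; Kraus representations are the case \<open>w = v\<close>.\<close>

definition represents ::
  "nat \<Rightarrow> nat \<Rightarrow> (complex mat \<Rightarrow> complex mat) \<Rightarrow> nat \<Rightarrow>
   (nat \<Rightarrow> complex mat) \<Rightarrow> (nat \<Rightarrow> complex mat) \<Rightarrow> bool" where
  "represents n k \<Phi> r v w \<longleftrightarrow>
     (\<forall>i<r. v i \<in> carrier_mat k n \<and> w i \<in> carrier_mat k n) \<and>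
     (\<forall>c\<in>carrier_mat n n. \<Phi> c = mat_sum k k (\<lambda>i. v i * c * mat_adjoint (w i)) {..<r}) \<and>
     mat_sum n n (\<lambda>i. mat_adjoint (w i) * v i) {..<r} = 1\<^sub>m n"

definition representation_span ::
  "nat \<Rightarrow> nat \<Rightarrow> (nat \<Rightarrow> complex mat) \<Rightarrow> (nat \<Rightarrow> complex mat) \<Rightarrow> complex mat set" where
  "representation_span n r v w = mat_span n n {mat_adjoint (w i) * v j | i j. i < r \<and> j < r}"

text \<open>\<open>R = \<S>\<^sub>\<Phi>\<close>. For a quantum channel \<open>\<Phi>\<close> there is exactly one such \<open>R\<close>, as \<open>\<Phi>\<close> has a Kraus
  representation and \<open>\<S>\<^sub>\<Phi>\<close> does not depend on its choice.\<close>

definition channel_graph ::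
  "nat \<Rightarrow> nat \<Rightarrow> (complex mat \<Rightarrow> complex mat) \<Rightarrow> complex mat set \<Rightarrow> bool" where
  "channel_graph n k \<Phi> R \<longleftrightarrow>
     (\<exists>r v. represents n k \<Phi> r v v \<and> R = representation_span n r v v)"

definition channels ::
  "nat \<Rightarrow> complex mat set \<Rightarrow> (nat \<times> (complex mat \<Rightarrow> complex mat)) set" where
  "channels n S = {(k, \<Phi>). quantum_channel n k \<Phi> \<and> (\<exists>R. channel_graph n k \<Phi> R \<and> R \<subseteq> S)}"

definition mat_perp :: "nat \<Rightarrow> complex mat set \<Rightarrow> complex mat set" where
  "mat_perp n S = {y \<in> carrier_mat n n. \<forall>x\<in>S. mat_trace (mat_adjoint x * y) = 0}"

definition independence_number :: "nat \<Rightarrow> complex mat set \<Rightarrow> nat" where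
  "independence_number n S = (GREATEST N. \<exists>\<xi> :: nat \<Rightarrow> complex vec.
     (\<forall>i<N. \<xi> i \<in> carrier_vec n) \<and>
     (\<forall>i<N. \<forall>j<N. cip (\<xi> i) (\<xi> j) = (if i = j then 1 else 0)) \<and>
     (\<forall>i<N. \<forall>j<N. i \<noteq> j \<longrightarrow> rank_one n (\<xi> i) (\<xi> j) \<in> mat_perp n S))"

definition kronecker :: "complex mat \<Rightarrow> complex mat \<Rightarrow> complex mat" where
  "kronecker x y = mat (dim_row x * dim_row y) (dim_col x * dim_col y)
     (\<lambda>(i, j). x $$ (i div dim_row y, j div dim_col y) * y $$ (i mod dim_row y, j mod dim_col y))"

primrec tensor_power :: "nat \<Rightarrow> complex mat set \<Rightarrow> nat \<Rightarrow> complex mat set" where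
  "tensor_power n S 0 = mat_span 1 1 {1\<^sub>m 1}"
| "tensor_power n S (Suc N) =
     mat_span (n ^ Suc N) (n ^ Suc N) {kronecker x y | x y. x \<in> S \<and> y \<in> tensor_power n S N}"

definition shannon_capacity :: "nat \<Rightarrow> complex mat set \<Rightarrow> real" where
  "shannon_capacity n S =
     lim (\<lambda>N. root N (real (independence_number (n ^ N) (tensor_power n S N))))"

definition lovasz :: "nat \<Rightarrow> complex mat set \<Rightarrow> real" where
  "lovasz n S = inverse (INF \<rho>\<in>states n. SUP (k, \<Phi>)\<in>channels n S. op_norm (\<Phi> \<rho>))"

definition lovasz_hat :: "nat \<Rightarrow> complex mat set \<Rightarrow> real" where
  "lovasz_hat n S = inverse (SUP (k, \<Phi>)\<in>channels n S. INF \<rho>\<in>states n. op_norm (\<Phi> \<rho>))"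

definition quantum_complexity :: "nat \<Rightarrow> complex mat set \<Rightarrow> nat" where
  "quantum_complexity n S = (LEAST k. \<exists>\<Phi>. quantum_channel n k \<Phi> \<and> channel_graph n k \<Phi> S)"

definition quantum_subcomplexity :: "nat \<Rightarrow> complex mat set \<Rightarrow> nat" where
  "quantum_subcomplexity n S =
     (LEAST k. \<exists>\<Phi> R. quantum_channel n k \<Phi> \<and> channel_graph n k \<Phi> R \<and> R \<subseteq> S)"

definition haemers_bound :: "nat \<Rightarrow> complex mat set \<Rightarrow> nat" where
  "haemers_bound n S =
     (LEAST k. \<exists>\<Phi> r v w. linear_map n k \<Phi> \<and> trace_preserving n \<Phi> \<and>
        represents n k \<Phi> r v w \<and> representation_span n r v w \<subseteq> S)"

end

theory Submission
  imports Defs "HOL-Computational_Algebra.Fundamental_Theorem_Algebra"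
begin

text \<open>All parameters behave well under one operation. Call \<open>S\<close> a pullback of \<open>T\<close> if there are
\<open>x\<^sub>1, \<dots>, x\<^sub>r : \<complex>\<^sup>n \<rightarrow> \<complex>\<^sup>m\<close> with \<open>\<Sum> x\<^sub>i\<^sup>* x\<^sub>i = 1\<close> and \<open>S = span {x\<^sub>i\<^sup>* t x\<^sub>j}\<close>, \<open>t \<in> T\<close>. If \<open>(v\<^sub>a)\<close> is a Kraus
family of a channel \<open>\<Phi>\<close> on \<open>\<complex>\<^sup>m\<close> with graph contained in (equal to) \<open>T\<close>, then \<open>(v\<^sub>a x\<^sub>i)\<close> is a Kraus family of
\<open>\<Phi> \<circ> \<Theta>\<close> with graph contained in (equal to) \<open>S\<close>, where \<open>\<Theta>(c) = \<Sum> x\<^sub>i c x\<^sub>i\<^sup>*\<close>. This compares the two quantum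
complexities, the Haemers bounds and, as \<open>\<Theta>\<close> maps states to states, the Lovasz numbers
(\<open>pullback_represents\<close>, \<open>lovasz_mono\<close>). An independent family \<open>(\<xi>\<^sub>k)\<close> for \<open>S\<close> is carried to \<open>T\<close> by replacing each
\<open>\<xi>\<^sub>k\<close> with a normalised nonzero \<open>x\<^sub>i \<xi>\<^sub>k\<close>; this needs only \<open>x\<^sub>i\<^sup>* T x\<^sub>j \<subseteq> S\<close>, a property that Kronecker products of
the \<open>x\<^sub>i\<close> pass on to tensor powers (\<open>independent_transfer\<close>, \<open>connects_tensor_power\<close>). Hence all seven parameters
agree as soon as \<open>S\<close> and \<open>T\<close> are pullbacks of each other (\<open>pullback_parameters\<close>).

For TRO-equivalence by \<open>M\<close>, non-degeneracy writes \<open>1\<close> as \<open>\<Sum> y\<^sub>k\<^sup>* z\<^sub>k\<close> with \<open>y\<^sub>k, z\<^sub>k \<in> M\<close>. For the finitely many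
elements \<open>x\<^sub>i\<close> involved, \<open>a = \<Sum> x\<^sub>i\<^sup>* x\<^sub>i\<close> is invertible and multiplies \<open>S\<close> into itself, so the operators
\<open>x\<^sub>i a\<^sup>-\<^sup>1\<^sup>/\<^sup>2\<close> exhibit \<open>S\<close> as a pullback of \<open>T\<close> (\<open>pullback_normalise\<close>); \<open>M\<^sup>*\<close> gives the other direction.

For \<open>\<Delta>\<close>-equivalence the TRO acts between Hilbert spaces of arbitrary dimension and has to be brought back to
\<open>\<complex>\<^sup>n\<close> and \<open>\<complex>\<^sup>m\<close>. An irreducibly acting \<open>S\<close> is incompressible: no compression of \<open>S\<close> to a space of smaller
dimension is a complete order embedding (\<open>irreducible_incompressible\<close>). Incompressible operator systems are
rigid: if \<open>\<Sum> z\<^sub>a\<^sup>* s z\<^sub>a = s\<close> for all \<open>s \<in> S\<close>, then all \<open>z\<^sub>a\<close> commute with \<open>S\<close> (\<open>rigidity\<close>). For \<open>x, y\<close> in the TRO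
the maps \<open>t \<mapsto> x\<^sup>* t y\<close> and \<open>s \<mapsto> x s y\<^sup>*\<close> become maps between \<open>T\<close> and \<open>S\<close>, and by extension of positive functionals
they have Kraus families (\<open>kraus_family\<close>). Sums of their composites are the identity, so that rigidity applies
to the composed Kraus operators. Their intertwining relations then show that products of the form \<open>x\<^sup>* y\<close> act on
\<open>S\<close> by matrix multiplication, and that the Kraus operators can be combined to operators
\<open>w\<^sub>k : \<complex>\<^sup>m \<rightarrow> \<complex>\<^sup>n\<close> which implement the TRO up to an invertible element commuting with \<open>S\<close>; normalising them gives the pullback
(\<open>incompressible_pullback\<close>, \<open>delta_pullback\<close>).\<close>

section \<open>Adjointable operators\<close>

text \<open>All spaces \<open>\<complex>\<^sup>n\<close> are realised inside the space of complex polynomials, with the monomials as an orthonormal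
basis. Operators between spaces of different dimensions then belong to one ring with adjoint, which frees the
algebra from dimension conditions.\<close>

definition ip :: "complex poly => complex poly => complex" where
 "ip p q = (\<Sum>i\<le>degree p. cnj (coeff p i) * coeff q i)"

definition bvec :: "nat => complex poly" where
 "bvec i = monom 1 i"

lemma ip_eq_sum:
 assumes "!!i. N \<le> i ==> coeff p i = 0 \<or> coeff q i = 0"
 shows "ip p q = (\<Sum>i<N. cnj (coeff p i) * coeff q i)"
proof -
 let ?f = "%i. cnj (coeff p i) * coeff q i"
 have "(\<Sum>i\<le>degree p. ?f i) = (\<Sum>i\<in>{..degree p} \<union> {..<N}. ?f i)"
 by (rule sum.mono_neutral_left) (auto simp: coeff_eq_0)
 also have "... = (\<Sum>i<N. ?f i)"
 using assms by (intro sum.mono_neutral_right) (auto simp: not_less)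
 finally show ?thesis by (simp add: ip_def)
qed

lemma ip_eq_sum_degree: "degree p < N \<or> degree q < N ==>
 ip p q = (\<Sum>i<N. cnj (coeff p i) * coeff q i)"
 by (rule ip_eq_sum) (auto intro: coeff_eq_0)

lemma ip_add_right [simp]: "ip p (q + r) = ip p q + ip p r"
 by (simp add: ip_def algebra_simps sum.distrib)

lemma ip_smult_right [simp]: "ip p (smult c q) = c * ip p q"
 by (simp add: ip_def sum_distrib_left algebra_simps)

lemma ip_commute: "ip p q = cnj (ip q p)"
proof -
 let ?N = "Suc (max (degree p) (degree q))"
 have "ip p q = (\<Sum>i<?N. cnj (coeff p i) * coeff q i)"
 by (rule ip_eq_sum_degree) auto
 moreover have "ip q p = (\<Sum>i<?N. cnj (coeff q i) * coeff p i)"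
 by (rule ip_eq_sum_degree) auto
 ultimately show ?thesis by (simp add: mult.commute del: sum.lessThan_Suc)
qed

lemma ip_add_left [simp]: "ip (p + q) r = ip p r + ip q r"
 by (metis ip_commute complex_cnj_add ip_add_right)

lemma ip_smult_left [simp]: "ip (smult c p) q = cnj c * ip p q"
 by (metis ip_commute complex_cnj_mult ip_smult_right)

lemma ip_0 [simp]: "ip 0 q = 0" "ip p 0 = 0"
 by (simp_all add: ip_def)

lemma ip_minus_right [simp]: "ip p (- q) = - ip p q"
 by (simp add: ip_def sum_negf)

lemma ip_minus_left [simp]: "ip (- p) q = - ip p q"
 by (metis ip_commute complex_cnj_minus ip_minus_right)

lemma ip_diff_right [simp]: "ip p (q - r) = ip p q - ip p r"
 by (simp add: ip_def algebra_simps sum_subtractf)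

lemma ip_diff_left [simp]: "ip (p - q) r = ip p r - ip q r"
 by (metis ip_commute complex_cnj_diff ip_diff_right)

lemma ip_sum_right: "ip p (sum f A) = (\<Sum>a\<in>A. ip p (f a))"
 by (induction A rule: infinite_finite_induct) auto

lemma ip_sum_left: "ip (sum f A) p = (\<Sum>a\<in>A. ip (f a) p)"
 by (induction A rule: infinite_finite_induct) auto

lemma ip_bvec_left [simp]: "ip (bvec i) q = coeff q i"
 by (subst ip_eq_sum[where N = "Suc i"]) (auto simp: bvec_def if_distrib cong: if_cong)

lemma ip_bvec_right [simp]: "ip q (bvec i) = cnj (coeff q i)"
 by (subst ip_commute) simp

lemma ip_eqI: "(!!y. ip y p = ip y q) ==> p = q"
 by (metis ip_bvec_left poly_eqI)

definition sqn :: "complex poly => real" where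
 "sqn p = Re (ip p p)"

lemma ip_self: "ip p p = complex_of_real (sqn p)"
proof -
 have "Im (ip p p) = 0"
 using ip_commute[of p p] by (simp add: complex_eq_iff)
 then show ?thesis by (simp add: complex_eq_iff sqn_def)
qed

lemma sqn_eq_sum: "degree p < N ==> sqn p = (\<Sum>i<N. (cmod (coeff p i))\<^sup>2)"
 using ip_eq_sum_degree[of p N p] unfolding sqn_def
 by (simp add: cmod_power2) (simp add: power2_eq_square sum.distrib)

lemma sqn_nonneg [simp]: "0 \<le> sqn p"
 by (simp add: sqn_eq_sum[where N = "Suc (degree p)"] sum_nonneg)

lemma sqn_eq_0 [simp]: "sqn p = 0 \<longleftrightarrow> p = 0"
proof
 assume "sqn p = 0"
 then have "(\<Sum>i<Suc (degree p). (cmod (coeff p i))\<^sup>2) = 0"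
 by (simp add: sqn_eq_sum[where N = "Suc (degree p)"])
 then have "coeff p (degree p) = 0"
 by (subst (asm) sum_nonneg_eq_0_iff) auto
 then show "p = 0" by simp
qed (simp add: sqn_def)

lemma ip_self_nonneg [simp]: "0 \<le> ip p p"
 by (simp add: ip_self less_eq_complex_def)

lemma ip_self_eq_0 [simp]: "ip p p = 0 \<longleftrightarrow> p = 0"
 by (simp add: ip_self)

lemma sqn_smult [simp]: "sqn (smult c p) = (cmod c)\<^sup>2 * sqn p"
proof -
 have "ip (smult c p) (smult c p) = (c * cnj c) * complex_of_real (sqn p)"
 by (simp add: ip_self[symmetric])
 also have "... = complex_of_real ((cmod c)\<^sup>2 * sqn p)"
 by (simp only: complex_norm_square of_real_mult)
 finally show ?thesis by (simp add: sqn_def)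
qed

lemma sqn_pos: "p ~= 0 ==> 0 < sqn p"
 using sqn_nonneg[of p] sqn_eq_0[of p] by linarith

typedef aop = "{T :: complex poly => complex poly. \<exists>T'. \<forall>x y. ip (T x) y = ip x (T' y)}"
 morphisms ap Abs_aop
 by (rule exI[of _ id]) auto

setup_lifting type_definition_aop

notation ap (infixr "\<rhd>" 75)

lemma aop_eqI: "(!!x. S \<rhd> x = T \<rhd> x) ==> S = T"
 by transfer auto

lift_definition ad :: "aop => aop" is "%T y. THE z. \<forall>x. ip (T x) y = ip x z"
proof -
 fix T :: "complex poly => complex poly"
 assume "\<exists>T'. \<forall>x y. ip (T x) y = ip x (T' y)"
 then obtain T' where T': "!!x y. ip (T x) y = ip x (T' y)" by blast
 have "(THE z. \<forall>x. ip (T x) y = ip x z) = T' y" for y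
 by (rule the_equality) (auto simp: T' intro: ip_eqI)
 moreover have "ip (T' x) y = ip x (T y)" for x y
 by (metis T' ip_commute)
 ultimately show "\<exists>T''. \<forall>x y. ip (THE z. \<forall>x'. ip (T x') x = ip x' z) y = ip x (T'' y)"
 by auto
qed

lemma ip_ad_right: "ip x (ad T \<rhd> y) = ip (T \<rhd> x) y"
proof transfer
 fix T :: "complex poly => complex poly" and x y
 assume "\<exists>T'. \<forall>x y. ip (T x) y = ip x (T' y)"
 then obtain T' where T': "!!x y. ip (T x) y = ip x (T' y)" by blast
 have "(THE z. \<forall>x. ip (T x) y = ip x z) = T' y" for y
 by (rule the_equality) (auto simp: T' intro: ip_eqI)
 then show "ip x (THE z. \<forall>x. ip (T x) y = ip x z) = ip (T x) y"
 by (simp add: T')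
qed

lemma ip_ad_left: "ip (ad T \<rhd> x) y = ip x (T \<rhd> y)"
 by (metis ip_ad_right ip_commute)

lemma ad_unique: "(!!x y. ip (T \<rhd> x) y = ip x (T' \<rhd> y)) ==> ad T = T'"
 by (intro aop_eqI ip_eqI) (metis ip_ad_right)

lemma ap_add_right [simp]: "T \<rhd> (x + y) = T \<rhd> x + T \<rhd> y"
 by (rule ip_eqI) (simp flip: ip_ad_left)

lemma ap_smult_right [simp]: "T \<rhd> smult c x = smult c (T \<rhd> x)"
 by (rule ip_eqI) (simp flip: ip_ad_left)

lemma ap_0_right [simp]: "T \<rhd> 0 = 0"
 by (rule ip_eqI) (simp flip: ip_ad_left)

lemma ap_minus_right [simp]: "T \<rhd> (- x) = - (T \<rhd> x)"
 by (rule ip_eqI) (simp flip: ip_ad_left)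

lemma ap_diff_right [simp]: "T \<rhd> (x - y) = T \<rhd> x - T \<rhd> y"
 by (rule ip_eqI) (simp flip: ip_ad_left)

lemma ap_sum_right: "T \<rhd> sum f A = (\<Sum>a\<in>A. T \<rhd> f a)"
 by (induction A rule: infinite_finite_induct) auto

instantiation aop :: ring_1
begin

lift_definition zero_aop :: aop is "%x. 0" by (rule exI[of _ "%x. 0"]) auto

lift_definition one_aop :: aop is "%x. x" by (rule exI[of _ "%x. x"]) auto

lift_definition plus_aop :: "aop => aop => aop" is "%S T x. S x + T x"
proof -
 fix S T :: "complex poly => complex poly"
 assume "\<exists>S'. \<forall>x y. ip (S x) y = ip x (S' y)" "\<exists>T'. \<forall>x y. ip (T x) y = ip x (T' y)"
 then obtain S' T' where "\<forall>x y. ip (S x) y = ip x (S' y)" "\<forall>x y. ip (T x) y = ip x (T' y)"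
 by blast
 then show "\<exists>T'. \<forall>x y. ip (S x + T x) y = ip x (T' y)"
 by (intro exI[of _ "%y. S' y + T' y"]) simp
qed

lift_definition uminus_aop :: "aop => aop" is "%S x. - S x"
proof -
 fix S :: "complex poly => complex poly"
 assume "\<exists>S'. \<forall>x y. ip (S x) y = ip x (S' y)"
 then obtain S' where "\<forall>x y. ip (S x) y = ip x (S' y)"
 by blast
 then show "\<exists>T'. \<forall>x y. ip (- S x) y = ip x (T' y)"
 by (intro exI[of _ "%y. - S' y"]) simp
qed

lift_definition minus_aop :: "aop => aop => aop" is "%S T x. S x - T x"
proof -
 fix S T :: "complex poly => complex poly"
 assume "\<exists>S'. \<forall>x y. ip (S x) y = ip x (S' y)" "\<exists>T'. \<forall>x y. ip (T x) y = ip x (T' y)"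
 then obtain S' T' where "\<forall>x y. ip (S x) y = ip x (S' y)" "\<forall>x y. ip (T x) y = ip x (T' y)"
 by blast
 then show "\<exists>T'. \<forall>x y. ip (S x - T x) y = ip x (T' y)"
 by (intro exI[of _ "%y. S' y - T' y"]) simp
qed

lift_definition times_aop :: "aop => aop => aop" is "%S T x. S (T x)"
proof -
 fix S T :: "complex poly => complex poly"
 assume "\<exists>S'. \<forall>x y. ip (S x) y = ip x (S' y)" "\<exists>T'. \<forall>x y. ip (T x) y = ip x (T' y)"
 then obtain S' T' where "\<forall>x y. ip (S x) y = ip x (S' y)" "\<forall>x y. ip (T x) y = ip x (T' y)"
 by blast
 then show "\<exists>T'. \<forall>x y. ip (S (T x)) y = ip x (T' y)"
 by (intro exI[of _ "%y. T' (S' y)"]) simp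
qed

lemma ap_times: "(S * T) \<rhd> x = S \<rhd> T \<rhd> x" by transfer simp

lemma ap_plus: "(S + T) \<rhd> x = S \<rhd> x + T \<rhd> x" by transfer simp

instance
proof
 fix a b c :: aop
 show "a * b * c = a * (b * c)" by transfer simp
 show "1 * a = a" "a * 1 = a" by (transfer; simp)+
 show "a + b + c = a + (b + c)" "a + b = b + a" by (transfer; simp add: algebra_simps)+
 show "0 + a = a" "- a + a = 0" by (transfer; simp)+
 show "a - b = a + - b" by transfer simp
 show "(a + b) * c = a * c + b * c" by transfer simp
 show "a * (b + c) = a * b + a * c"
 by (rule aop_eqI) (simp add: ap_times ap_plus)
 have "(1 :: aop) \<rhd> bvec 0 ~= 0 \<rhd> bvec 0"
 by transfer (simp add: bvec_def monom_eq_0_iff)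
 then show "(0 :: aop) ~= 1" by metis
qed

end

lemma ap_simps [simp]:
 shows "(S * T) \<rhd> x = S \<rhd> T \<rhd> x" and "(S + T) \<rhd> x = S \<rhd> x + T \<rhd> x"
 and "(S - T) \<rhd> x = S \<rhd> x - T \<rhd> x" and "(- T) \<rhd> x = - (T \<rhd> x)"
 and "0 \<rhd> x = 0" and "1 \<rhd> x = x"
 by (simp_all add: times_aop.rep_eq plus_aop.rep_eq minus_aop.rep_eq uminus_aop.rep_eq
 zero_aop.rep_eq one_aop.rep_eq)

lemma ap_sum_left: "sum f A \<rhd> x = (\<Sum>a\<in>A. f a \<rhd> x)"
 by (induction A rule: infinite_finite_induct) auto

lift_definition scl :: "complex => aop => aop" is "%c S x. smult c (S x)"
proof -
 fix c and S :: "complex poly => complex poly"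
 assume "\<exists>S'. \<forall>x y. ip (S x) y = ip x (S' y)"
 then obtain S' where "\<forall>x y. ip (S x) y = ip x (S' y)"
 by blast
 then show "\<exists>T'. \<forall>x y. ip (smult c (S x)) y = ip x (T' y)"
 by (intro exI[of _ "%y. smult (cnj c) (S' y)"]) simp
qed

lemma ap_scl [simp]: "scl c S \<rhd> x = smult c (S \<rhd> x)"
 by transfer simp

interpretation scl: vector_space scl
 by standard (auto intro!: aop_eqI simp: smult_add_right smult_add_left)

lemma scl_mult [simp]: "scl c x * y = scl c (x * y)" "x * scl c y = scl c (x * y)"
 by (auto intro!: aop_eqI)

lemma scl_minus_one: "scl (-1) x = - x" by (rule aop_eqI) simp

lemma ad_simps [simp]:
 shows "ad (S * T) = ad T * ad S" and "ad (S + T) = ad S + ad T" and "ad (S - T) = ad S - ad T"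
 and "ad (- S) = - ad S" and "ad 0 = 0" and "ad 1 = 1" and "ad (scl c S) = scl (cnj c) (ad S)"
 and "ad (ad S) = S"
 by (rule ad_unique, simp add: ip_ad_right ip_ad_left)+

lemma ad_sum: "ad (sum f A) = (\<Sum>a\<in>A. ad (f a))"
 by (induction A rule: infinite_finite_induct) auto

lemma ad_eq_iff [simp]: "ad x = ad y \<longleftrightarrow> x = y"
 by (metis ad_simps(8))

lemma ad_eq_0 [simp]: "ad x = 0 \<longleftrightarrow> x = 0"
 by (metis ad_simps(5,8))

definition hermitian :: "aop => bool" where
 "hermitian x \<longleftrightarrow> ad x = x"

definition positive :: "aop => bool" where
 "positive x \<longleftrightarrow> (\<forall>\<xi>. 0 \<le> ip \<xi> (x \<rhd> \<xi>))"

lemma aop_polarize: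
 assumes "!!\<xi>. ip \<xi> (x \<rhd> \<xi>) = 0"
 shows "x = 0"
proof (intro aop_eqI ip_eqI)
 fix \<xi> \<eta>
 have 1: "ip \<eta> (x \<rhd> \<xi>) + ip \<xi> (x \<rhd> \<eta>) = 0"
 using assms[of "\<xi> + \<eta>"] assms[of \<xi>] assms[of \<eta>] by (simp add: algebra_simps)
 have "\<i> * ip \<eta> (x \<rhd> \<xi>) - \<i> * ip \<xi> (x \<rhd> \<eta>) = 0"
 using assms[of "smult \<i> \<xi> + \<eta>"] assms[of \<xi>] assms[of \<eta>] by (simp add: algebra_simps)
 then have "ip \<eta> (x \<rhd> \<xi>) = ip \<xi> (x \<rhd> \<eta>)"
 by (metis complex_i_not_zero eq_iff_diff_eq_0 mult_cancel_left)
 with 1 show "ip \<eta> (x \<rhd> \<xi>) = ip \<eta> (0 \<rhd> \<xi>)" by simp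
qed

lemma complex_nonneg_iff: "0 \<le> (z :: complex) \<longleftrightarrow> 0 \<le> Re z & Im z = 0"
 by (auto simp: less_eq_complex_def)

lemma positive_hermitian:
 assumes "positive x"
 shows "hermitian x"
proof -
 have "ip \<xi> ((ad x - x) \<rhd> \<xi>) = 0" for \<xi>
 proof -
 have "ip (x \<rhd> \<xi>) \<xi> = cnj (ip \<xi> (x \<rhd> \<xi>))" by (rule ip_commute)
 also have "... = ip \<xi> (x \<rhd> \<xi>)"
 using assms by (auto simp: positive_def complex_nonneg_iff complex_eq_iff)
 finally show ?thesis by (simp add: ip_ad_right)
 qed
 then have "ad x - x = 0" by (rule aop_polarize)
 then show ?thesis by (simp add: hermitian_def)
qed

lemma positive_ad_mult_mult: "positive x ==> positive (ad y * x * y)"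
 by (simp add: positive_def ip_ad_right)

lemma positive_ad_mult: "positive (ad y * y)"
 by (simp add: positive_def ip_ad_right)

lemma positive_mult_ad: "positive (y * ad y)"
 using positive_ad_mult[of "ad y"] by simp

lemma positive_add:
 assumes "positive x" "positive y"
 shows "positive (x + y)"
proof -
 have "0 \<le> ip \<xi> (x \<rhd> \<xi>) + ip \<xi> (y \<rhd> \<xi>)" for \<xi>
 using assms unfolding positive_def by (intro add_nonneg_nonneg) auto
 then show ?thesis by (simp add: positive_def)
qed

lemma positive_0 [simp]: "positive 0"
 by (simp add: positive_def)

lemma positive_sum:
 assumes "!!a. a : A ==> positive (f a)"
 shows "positive (sum f A)"
 unfolding positive_def
proof
 fix \<xi>
 have "0 \<le> (\<Sum>a\<in>A. ip \<xi> (f a \<rhd> \<xi>))"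
 using assms by (intro sum_nonneg) (metis positive_def)
 then show "0 \<le> ip \<xi> (sum f A \<rhd> \<xi>)" unfolding ap_sum_left ip_sum_right .
qed

lemma positive_scl: "positive x ==> 0 \<le> r ==> positive (scl (complex_of_real r) x)"
 by (simp add: positive_def complex_nonneg_iff)

text \<open>The Cauchy-Schwarz argument: otherwise the form becomes negative at a small perturbation of \<open>\<xi>\<close>.\<close>

lemma positive_kernel:
 assumes "positive x" "ip \<xi> (x \<rhd> \<xi>) = 0"
 shows "x \<rhd> \<xi> = 0"
proof (rule ccontr)
 assume ne: "x \<rhd> \<xi> ~= 0"
 define \<eta> where "\<eta> = x \<rhd> \<xi>"
 define b where "b = Re (ip \<eta> (x \<rhd> \<eta>))"
 define r where "r = sqn \<eta>"
 have r: "0 < r" using ne by (simp add: r_def \<eta>_def sqn_pos)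
 have h: "ip \<xi> (x \<rhd> \<eta>) = ip (x \<rhd> \<xi>) \<eta>"
 using positive_hermitian[OF assms(1)] by (metis hermitian_def ip_ad_right)
 have b: "0 \<le> b" using assms(1) by (simp add: positive_def complex_nonneg_iff b_def)
 define t where "t = r / (b + 1)"
 have "0 \<le> Re (ip (\<xi> - smult (complex_of_real t) \<eta>) (x \<rhd> (\<xi> - smult (complex_of_real t) \<eta>)))"
 using assms(1) unfolding positive_def complex_nonneg_iff by blast
 also have "... = t * t * b - 2 * t * r"
 using assms(2) h by (simp add: \<eta>_def[symmetric] ip_self r_def b_def algebra_simps)
 also have "... = t * (t * b - 2 * r)" by (simp add: algebra_simps)
 also have "... < 0"
 proof -
 have "t * b \<le> r" using r b by (simp add: t_def field_simps)
 then have "t * b - 2 * r < 0" using r by linarith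
 moreover have "0 < t" using r b by (simp add: t_def)
 ultimately show ?thesis by (rule mult_pos_neg[rotated])
 qed
 finally show False by simp
qed

lemma ad_mult_eq_0: "ad x * x = 0 ==> x = 0"
proof (rule aop_eqI)
 fix \<xi> assume "ad x * x = 0"
 then have "ip (x \<rhd> \<xi>) (x \<rhd> \<xi>) = 0"
 by (metis ap_simps(1,5) ip_0(2) ip_ad_right)
 then show "x \<rhd> \<xi> = 0 \<rhd> \<xi>" by simp
qed

lemma sum_ad_mult_eq_0:
 assumes "finite A" "(\<Sum>a\<in>A. ad (f a) * f a) = 0" "a : A"
 shows "f a = 0"
proof (rule aop_eqI)
 fix \<xi>
 have "(\<Sum>a\<in>A. ip (f a \<rhd> \<xi>) (f a \<rhd> \<xi>)) = ip \<xi> ((\<Sum>a\<in>A. ad (f a) * f a) \<rhd> \<xi>)"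
 by (simp add: ap_sum_left ip_sum_right ip_ad_right)
 also have "... = 0" using assms(2) by simp
 finally have "ip (f a \<rhd> \<xi>) (f a \<rhd> \<xi>) = 0"
 using assms(1,3) by (subst (asm) sum_nonneg_eq_0_iff) auto
 then show "f a \<rhd> \<xi> = 0 \<rhd> \<xi>" by simp
qed

lift_definition rk :: "complex poly => complex poly => aop" is "%\<xi> \<eta> \<zeta>. smult (ip \<eta> \<zeta>) \<xi>"
proof -
 fix \<xi> \<eta> :: "complex poly"
 have "ip (smult (ip \<eta> x) \<xi>) y = ip x (smult (ip \<xi> y) \<eta>)" for x y
 using ip_commute[of \<eta> x] by simp
 then show "\<exists>T'. \<forall>x y. ip (smult (ip \<eta> x) \<xi>) y = ip x (T' y)"
 by (intro exI[of _ "%y. smult (ip \<xi> y) \<eta>"]) blast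
qed

lemma ap_rk [simp]: "rk \<xi> \<eta> \<rhd> \<zeta> = smult (ip \<eta> \<zeta>) \<xi>"
 by transfer simp

lemma ad_rk [simp]: "ad (rk \<xi> \<eta>) = rk \<eta> \<xi>"
 by (rule ad_unique) (simp add: ip_commute[of \<eta>])

lemma mult_rk: "x * rk \<xi> \<eta> = rk (x \<rhd> \<xi>) \<eta>"
 by (rule aop_eqI) simp

lemma rk_mult: "rk \<xi> \<eta> * x = rk \<xi> (ad x \<rhd> \<eta>)"
 by (rule aop_eqI) (simp add: ip_ad_left)

lemma rk_mult_rk: "rk \<xi> \<eta> * rk \<xi>' \<eta>' = scl (ip \<eta> \<xi>') (rk \<xi> \<eta>')"
 by (rule aop_eqI) (simp add: mult.commute)

definition pr :: "nat => aop" where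
 "pr n = (\<Sum>i<n. rk (bvec i) (bvec i))"

lemma coeff_bvec: "coeff (bvec i) j = (if i = j then 1 else 0)"
 by (simp add: bvec_def)

lemma coeff_pr [simp]: "coeff (pr n \<rhd> x) j = (if j < n then coeff x j else 0)"
 by (simp add: pr_def ap_sum_left coeff_sum coeff_bvec if_distrib cong: if_cong)

lemma ad_pr [simp]: "ad (pr n) = pr n"
 by (simp add: pr_def ad_sum)

lemma pr_idem [simp]: "pr n * pr n = pr n"
 by (intro aop_eqI poly_eqI) simp

lemma pr_bvec [simp]: "i < n ==> pr n \<rhd> bvec i = bvec i"
 by (intro poly_eqI) (auto simp: coeff_bvec)

lemma pr_0 [simp]: "pr 0 = 0" by (simp add: pr_def)

text \<open>The corner cut out by the coordinate projections; it is a copy of \<open>\<B>(\<complex>\<^sup>c, \<complex>\<^sup>r)\<close>.\<close>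

definition ops :: "nat => nat => aop set" where
 "ops r c = {x. pr r * x = x & x * pr c = x}"

definition spc :: "nat => complex poly set" where
 "spc n = {\<xi>. pr n \<rhd> \<xi> = \<xi>}"

lemma opsD: "x : ops r c ==> pr r * x = x" "x : ops r c ==> x * pr c = x"
 by (auto simp: ops_def)

lemma ops_mult_pr: "x : ops r c ==> pr r * (x * y) = x * y" "x : ops r c ==> x * (pr c * y) = x * y"
 by (auto simp: ops_def simp flip: mult.assoc)

lemma ops_add [simp, intro]: "x : ops r c ==> y : ops r c ==> x + y : ops r c"
 by (simp add: ops_def algebra_simps)
lemma ops_diff [simp, intro]: "x : ops r c ==> y : ops r c ==> x - y : ops r c"
 by (simp add: ops_def algebra_simps)
lemma ops_scl [simp, intro]: "x : ops r c ==> scl a x : ops r c"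
 by (simp add: ops_def)
lemma ops_0 [simp, intro]: "0 : ops r c"
 by (simp add: ops_def)
lemma ops_minus [simp, intro]: "x : ops r c ==> - x : ops r c"
 by (simp add: ops_def)
lemma ops_mult [simp, intro]: "x : ops r k ==> y : ops k c ==> x * y : ops r c"
 by (simp add: ops_def mult.assoc) (simp flip: mult.assoc)
lemma ops_ad [simp, intro]: "x : ops r c ==> ad x : ops c r"
 unfolding ops_def by (metis (mono_tags, lifting) ad_pr ad_simps(1) mem_Collect_eq)
lemma ops_pr [simp, intro]: "pr n : ops n n"
 by (simp add: ops_def)
lemma ops_sum [simp, intro]: "(!!a. a : A ==> f a : ops r c) ==> sum f A : ops r c"
 by (induction A rule: infinite_finite_induct) auto

lemma ops_subspace: "scl.subspace (ops r c)"
 by (auto simp: scl.subspace_def)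

lemma ops_ap [simp, intro]: "x : ops r c ==> x \<rhd> \<xi> : spc r"
 by (simp add: ops_def spc_def flip: ap_simps(1))

lemma ops_ap_pr: "x : ops r c ==> x \<rhd> pr c \<rhd> \<xi> = x \<rhd> \<xi>"
 by (simp add: ops_def flip: ap_simps(1))

lemma ops_rk [simp, intro]: "\<xi> : spc r ==> \<eta> : spc c ==> rk \<xi> \<eta> : ops r c"
 by (simp add: ops_def spc_def mult_rk rk_mult)

lemma bvec_spc [simp, intro]: "i < n ==> bvec i : spc n"
 by (simp add: spc_def)

lemma spc_expand: "\<xi> : spc n ==> \<xi> = (\<Sum>i<n. smult (coeff \<xi> i) (bvec i))"
 by (auto simp: spc_def pr_def ap_sum_left)

lemma spc_iff: "\<xi> : spc n \<longleftrightarrow> (\<forall>i\<ge>n. coeff \<xi> i = 0)"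
 by (auto simp: spc_def poly_eq_iff not_le[symmetric])

lemma ops_eqI:
 assumes "x : ops r c" "y : ops r c" "!!j. j < c ==> x \<rhd> bvec j = y \<rhd> bvec j"
 shows "x = y"
proof (rule aop_eqI)
 fix \<xi>
 have "x \<rhd> pr c \<rhd> \<xi> = y \<rhd> pr c \<rhd> \<xi>"
 using assms(3) by (simp add: pr_def ap_sum_left ap_sum_right)
 then show "x \<rhd> \<xi> = y \<rhd> \<xi>"
 using assms(1,2) by (simp add: ops_ap_pr)
qed

lemma pr_ap_spc [simp]: "pr n \<rhd> \<xi> : spc n"
 by (auto simp: spc_iff)

lemma spc_add [simp]: "\<xi> : spc n ==> \<eta> : spc n ==> \<xi> + \<eta> : spc n"
 by (simp add: spc_iff)
lemma spc_smult [simp]: "\<xi> : spc n ==> smult c \<xi> : spc n"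
 by (simp add: spc_iff)
lemma spc_0 [simp]: "0 : spc n"
 by (simp add: spc_iff)
lemma spc_diff [simp]: "\<xi> : spc n ==> \<eta> : spc n ==> \<xi> - \<eta> : spc n"
 by (simp add: spc_iff)

lemma ops_expand:
 assumes "x : ops r c"
 shows "x = (\<Sum>i<r. \<Sum>j<c. scl (coeff (x \<rhd> bvec j) i) (rk (bvec i) (bvec j)))"
proof (rule ops_eqI[of _ r c])
 show "(\<Sum>i<r. \<Sum>j<c. scl (coeff (x \<rhd> bvec j) i) (rk (bvec i) (bvec j))) : ops r c"
 by (intro ops_sum ops_scl ops_rk) auto
 fix k assume k: "k < c"
 have "(\<Sum>i<r. \<Sum>j<c. scl (coeff (x \<rhd> bvec j) i) (rk (bvec i) (bvec j))) \<rhd> bvec k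
 = (\<Sum>i<r. \<Sum>j<c. if j = k then smult (coeff (x \<rhd> bvec j) i) (bvec i) else 0)"
 by (simp add: ap_sum_left coeff_bvec if_distrib[of "%c. smult c _"]) 
 (intro sum.cong refl, auto simp: if_distrib[of cnj] if_distrib[of "(*) _"] if_distrib[of "%c. smult c _"] cong: if_cong)
 also have "... = (\<Sum>i<r. smult (coeff (x \<rhd> bvec k) i) (bvec i))"
 using k by simp
 also have "... = x \<rhd> bvec k"
 by (rule spc_expand[symmetric]) (use assms in auto)
 finally show "x \<rhd> bvec k = (\<Sum>i<r. \<Sum>j<c. scl (coeff (x \<rhd> bvec j) i) (rk (bvec i) (bvec j))) \<rhd> bvec k"
 by simp
qed (fact assms)

text \<open>Any \<open>r * c + 1\<close> operators in the \<open>r * c\<close>-dimensional space \<open>ops r c\<close> are linearly dependent.\<close>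

text \<open>Dimension counting: the corner is spanned by finitely many rank one operators.\<close>

lemma ops_dependent:
 fixes x :: "nat => aop"
 assumes "!!k. x k : ops r c"
 obtains D a where "\<exists>k<D. a k ~= 0" "(\<Sum>k<D. scl (a k) (x k)) = 0"
proof (cases "inj x")
 case True
 let ?B = "(%(i, j). rk (bvec i) (bvec j)) ` ({..<r} \<times> {..<c})"
 have "ops r c \<subseteq> scl.span ?B"
 proof
 fix x assume "x : ops r c"
 show "x : scl.span ?B"
 by (subst ops_expand[OF \<open>x : ops r c\<close>])
 (intro scl.span_sum scl.span_scale scl.span_base, auto)
 qed
 then have sub: "range x \<subseteq> scl.span ?B" using assms by auto
 have "infinite (range x)" by (rule range_inj_infinite[OF True])
 then have "scl.dependent (range x)"
 using scl.independent_span_bound[OF _ _ sub] by (meson finite_SigmaI finite_imageI finite_lessThan)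
 then obtain t u where t: "finite t" "t \<subseteq> range x" "(\<Sum>v\<in>t. scl (u v) v) = 0" "\<exists>v\<in>t. u v ~= 0"
 unfolding scl.dependent_explicit by blast
 define K where "K = x -` t"
 have K: "finite K" "x ` K = t"
 using t True by (auto simp: K_def finite_vimageI)
 obtain D where D: "!!k. k : K ==> k < D"
 using K(1) finite_nat_set_iff_bounded by auto
 define a where "a k = (if k : K then u (x k) else 0)" for k
 show ?thesis
 proof
 obtain v where "v : t" "u v ~= 0" using t by auto
 then obtain k where "k : K" "x k = v" using K by auto
 then show "\<exists>k<D. a k ~= 0" using D \<open>u v ~= 0\<close> by (auto simp: a_def)
 have "(\<Sum>k<D. scl (a k) (x k)) = (\<Sum>k\<in>K. scl (u (x k)) (x k))"
 using D by (intro sum.mono_neutral_cong_right) (auto simp: a_def)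
 also have "... = (\<Sum>v\<in>x ` K. scl (u v) v)"
 using True by (subst sum.reindex) (auto simp: inj_on_def)
 finally show "(\<Sum>k<D. scl (a k) (x k)) = 0" using K t by simp
 qed
next
 case False
 then obtain i j where ij: "x i = x j" "i < j"
 by (metis injI linorder_less_linear)
 show ?thesis
 proof
 let ?a = "%k. if k = i then 1 else if k = j then -1 else (0::complex)"
 show "\<exists>k<Suc j. ?a k ~= 0" by auto
 have "(\<Sum>k<Suc j. scl (?a k) (x k)) = (\<Sum>k\<in>{i, j}. scl (?a k) (x k))"
 using ij by (intro sum.mono_neutral_right) auto
 also have "... = x i - x j"
 using \<open>i < j\<close> by (auto simp: scl_minus_one)
 also have "... = 0" by (simp add: ij(1))
 finally show "(\<Sum>k<Suc j. scl (?a k) (x k)) = 0" .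
 qed
qed

section \<open>Spectral theorem and functional calculus\<close>

text \<open>A substitute for the algebra generated by \<open>a\<close> and the unit: whatever is constructed from \<open>a\<close> by polynomial
calculus lies in every such \<open>C\<close>.\<close>

definition alg_closed :: "nat => aop => aop set => bool" where
 "alg_closed n a C \<longleftrightarrow> scl.subspace C & pr n : C & (\<forall>x\<in>C. a * x : C)"

definition peval :: "nat => aop => complex poly => aop" where
 "peval n a p = fold_coeffs (%c x. scl c (pr n) + a * x) p 0"

lemma peval_0 [simp]: "peval n a 0 = 0"
 by (simp add: peval_def)

lemma peval_pCons [simp]: "peval n a (pCons c p) = scl c (pr n) + a * peval n a p"
 by (cases "p = 0 & c = 0") (auto simp: peval_def)

lemma peval_add: "peval n a (p + q) = peval n a p + peval n a q"
proof (induction p arbitrary: q)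
 case (pCons c p)
 then show ?case
 by (cases q) (simp_all add: scl.scale_left_distrib algebra_simps)
qed simp

lemma peval_smult: "peval n a (smult c p) = scl c (peval n a p)"
 by (induction p) (auto simp: scl.scale_right_distrib)

lemma peval_sum: "peval n a (sum f A) = (\<Sum>x\<in>A. peval n a (f x))"
 by (induction A rule: infinite_finite_induct) (auto simp: peval_add)

lemma peval_ops: "a : ops n n ==> peval n a p : ops n n"
 by (induction p) auto

lemma peval_mult:
 assumes "a : ops n n"
 shows "peval n a (p * q) = peval n a p * peval n a q"
proof (induction p)
 case (pCons c p)
 have "pr n * peval n a q = peval n a q"
 using peval_ops[OF assms] by (rule opsD(1))
 with pCons show ?case
 by (simp add: peval_add peval_smult algebra_simps)
qed simp

lemma peval_monom: "peval n a (monom c k) = scl c (a ^ k * pr n)"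
 by (induction k) (auto simp: monom_0 monom_Suc mult.assoc)

lemma peval_in: "alg_closed n a C ==> peval n a p : C"
 by (induction p) (auto simp: alg_closed_def scl.subspace_def)

lemma peval_linear_mult:
 assumes "a : ops n n"
 shows "peval n a ([:- c, 1:] * q) = (a - scl c 1) * peval n a q"
proof -
 have "[:- c, 1:] * q = smult (- c) q + pCons 0 q" by simp
 then show ?thesis by (simp only: peval_add peval_smult peval_pCons) (simp add: algebra_simps)
qed

lemma exists_annihilator:
 assumes "a : ops n n"
 obtains p where "p ~= 0" "peval n a p = 0"
proof -
 have "a ^ k * pr n : ops n n" for k
 proof (induction k)
 case (Suc k)
 then have "a * (a ^ k * pr n) : ops n n" using assms by blast
 then show ?case by (simp add: mult.assoc)
 qed simp
 then obtain D c where c: "\<exists>k<D. c k ~= 0" "(\<Sum>k<D. scl (c k) (a ^ k * pr n)) = 0"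
 using ops_dependent[of "%k. a ^ k * pr n" n n] by blast
 let ?p = "\<Sum>k<D. monom (c k) k"
 show ?thesis
 proof
 have "coeff ?p k = c k" if "k < D" for k
 using that by (simp add: coeff_sum if_distrib cong: if_cong)
 then show "?p ~= 0" using c(1) by (metis coeff_0)
 show "peval n a ?p = 0" using c(2) by (simp add: peval_sum peval_monom)
 qed
qed

definition lin_prod :: "real set => complex poly" where
 "lin_prod \<Lambda> = (\<Prod>\<kappa>\<in>\<Lambda>. [:- complex_of_real \<kappa>, 1:])"

lemma hermitian_sub_square:
 assumes "hermitian a" "(a - scl (complex_of_real \<kappa>) 1) * ((a - scl (complex_of_real \<kappa>) 1) * x) = 0"
 shows "(a - scl (complex_of_real \<kappa>) 1) * x = 0"
proof (rule ad_mult_eq_0)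
 have "ad (a - scl (complex_of_real \<kappa>) 1) = a - scl (complex_of_real \<kappa>) 1"
 using assms(1) by (simp add: hermitian_def)
 then show "ad ((a - scl (complex_of_real \<kappa>) 1) * x) * ((a - scl (complex_of_real \<kappa>) 1) * x) = 0"
 using assms(2) by (simp only: ad_simps mult.assoc mult_zero_right)
qed

lemma hermitian_nonreal:
 assumes "hermitian a" "(a - scl c 1) * x = 0" "c \<notin> \<real>"
 shows "x = 0"
proof (rule ad_mult_eq_0)
 have ax: "a * x = scl c x"
 using assms(2) by (simp add: algebra_simps)
 have "ad x * (a * x) = scl c (ad x * x)"
 by (simp add: ax)
 moreover have "ad x * (a * x) = scl (cnj c) (ad x * x)"
 proof -
 have "ad x * a = ad (a * x)" using assms(1) by (simp add: hermitian_def)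
 then have "ad x * a = scl (cnj c) (ad x)" by (simp only: ax ad_simps)
 then show ?thesis by (simp only: mult.assoc[symmetric] scl_mult)
 qed
 ultimately have "scl (c - cnj c) (ad x * x) = 0"
 by (metis scl.scale_left_diff_distrib diff_self)
 moreover have "c - cnj c ~= 0" using assms(3) by (simp add: Reals_cnj_iff)
 ultimately show "ad x * x = 0" by simp
qed

text \<open>An annihilating polynomial is stripped of its factors one at a time. A factor with non-real root can be
dropped, since \<open>a - c\<close> is then injective, and a repeated real root can be reduced to a simple one, since \<open>a - \<kappa>\<close> is
hermitian.\<close>

lemma hermitian_annihilator:
 assumes a: "a : ops n n" "hermitian a" and "p ~= 0" "peval n a (p * r) = 0"
 shows "\<exists>\<Lambda>. finite \<Lambda> & peval n a (lin_prod \<Lambda> * r) = 0"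
 using assms(3,4)
proof (induction "degree p" arbitrary: p r rule: less_induct)
 case less
 show ?case
 proof (cases "degree p = 0")
 case True
 then obtain c where c: "p = [:c:]" by (metis degree_eq_zeroE)
 then have "peval n a r = 0"
 using less.prems by (simp add: peval_smult)
 then show ?thesis by (intro exI[of _ "{}"]) (simp add: lin_prod_def)
 next
 case False
 then obtain c where "poly p c = 0"
 by (metis fundamental_theorem_of_algebra constant_degree)
 then obtain q where q: "p = [:- c, 1:] * q"
 using poly_eq_0_iff_dvd by (metis dvdE)
 have "q ~= 0" using q less.prems by auto
 then have "degree q < degree p" unfolding q by (subst degree_mult_eq) auto
 moreover have "peval n a (q * ([:- c, 1:] * r)) = 0"
 using less.prems(2) unfolding q by (simp only: ac_simps)
 ultimately obtain \<Lambda> where \<Lambda>: "finite \<Lambda>" "peval n a (lin_prod \<Lambda> * ([:- c, 1:] * r)) = 0"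
 using less.hyps \<open>q ~= 0\<close> by blast
 have 1: "(a - scl c 1) * peval n a (lin_prod \<Lambda> * r) = 0"
 using \<Lambda>(2) by (simp only: peval_linear_mult[OF a(1), symmetric] ac_simps)
 show ?thesis
 proof (cases "c : \<real>")
 case False
 then have "peval n a (lin_prod \<Lambda> * r) = 0"
 using hermitian_nonreal[OF a(2) 1] by simp
 then show ?thesis using \<Lambda> by blast
 next
 case True
 then obtain \<kappa> where c: "c = complex_of_real \<kappa>" by (metis Reals_cases)
 show ?thesis
 proof (cases "\<kappa> : \<Lambda>")
 case True
 then have prod: "lin_prod \<Lambda> = [:- c, 1:] * lin_prod (\<Lambda> - {\<kappa>})"
 unfolding lin_prod_def c by (rule prod.remove[OF \<Lambda>(1)])
 have "(a - scl c 1) * ((a - scl c 1) * peval n a (lin_prod (\<Lambda> - {\<kappa>}) * r)) = 0"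
 using 1 unfolding prod by (simp only: peval_linear_mult[OF a(1), symmetric] mult.assoc)
 then have "(a - scl c 1) * peval n a (lin_prod (\<Lambda> - {\<kappa>}) * r) = 0"
 unfolding c by (rule hermitian_sub_square[OF a(2)])
 then have "peval n a (lin_prod \<Lambda> * r) = 0"
 unfolding prod by (simp only: peval_linear_mult[OF a(1), symmetric] mult.assoc)
 then show ?thesis using \<Lambda> by blast
 next
 case False
 then have "lin_prod (insert \<kappa> \<Lambda>) = [:- c, 1:] * lin_prod \<Lambda>"
 unfolding lin_prod_def c by (rule prod.insert[OF \<Lambda>(1)])
 then have "peval n a (lin_prod (insert \<kappa> \<Lambda>) * r) = 0"
 using 1 by (simp only: peval_linear_mult[OF a(1), symmetric] mult.assoc)
 then show ?thesis using \<Lambda> by blast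
 qed
 qed
 qed
qed

definition lagrange :: "real set => real => complex poly" where
 "lagrange \<Lambda> \<kappa> = smult (inverse (\<Prod>\<mu>\<in>\<Lambda> - {\<kappa>}. complex_of_real \<kappa> - complex_of_real \<mu>)) (lin_prod (\<Lambda> - {\<kappa>}))"

lemma degree_lin_prod: "finite \<Lambda> ==> degree (lin_prod \<Lambda>) = card \<Lambda>"
 unfolding lin_prod_def by (subst degree_prod_eq_sum_degree) auto

lemma poly_lagrange:
 assumes "finite \<Lambda>" "\<mu> : \<Lambda>"
 shows "poly (lagrange \<Lambda> \<kappa>) (complex_of_real \<mu>) = (if \<kappa> = \<mu> then 1 else 0)"
proof (cases "\<kappa> = \<mu>")
 case True
 then show ?thesis using assms by (simp add: lagrange_def lin_prod_def poly_prod)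
next
 case False
 then have "(\<Prod>\<kappa>\<in>\<Lambda> - {\<kappa>}. poly [:- complex_of_real \<kappa>, 1:] (complex_of_real \<mu>)) = 0"
 using assms by (intro prod_zero) auto
 then show ?thesis using False by (simp add: lagrange_def lin_prod_def poly_prod)
qed

lemma sum_lagrange:
 assumes "finite \<Lambda>" "\<Lambda> ~= {}"
 shows "(\<Sum>\<kappa>\<in>\<Lambda>. lagrange \<Lambda> \<kappa>) = 1"
proof (rule ccontr)
 let ?p = "(\<Sum>\<kappa>\<in>\<Lambda>. lagrange \<Lambda> \<kappa>) - 1"
 assume "(\<Sum>\<kappa>\<in>\<Lambda>. lagrange \<Lambda> \<kappa>) ~= 1"
 then have "?p ~= 0" by simp
 have "card \<Lambda> = card (complex_of_real ` \<Lambda>)"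
 by (rule card_image[symmetric]) (auto simp: inj_on_def)
 also have "... \<le> card {x. poly ?p x = 0}"
 using assms by (intro card_mono poly_roots_finite \<open>?p ~= 0\<close>) (auto simp: poly_sum poly_lagrange)
 also have "... \<le> degree ?p"
 using \<open>?p ~= 0\<close> by (rule card_poly_roots_bound)
 also have "... \<le> card \<Lambda> - 1"
 proof (rule degree_diff_le)
 show "degree (\<Sum>\<kappa>\<in>\<Lambda>. lagrange \<Lambda> \<kappa>) \<le> card \<Lambda> - 1"
 proof (rule degree_sum_le[OF assms(1)])
 fix \<kappa> assume "\<kappa> : \<Lambda>"
 have "degree (lagrange \<Lambda> \<kappa>) \<le> degree (lin_prod (\<Lambda> - {\<kappa>}))"
 unfolding lagrange_def by (rule degree_smult_le)
 then show "degree (lagrange \<Lambda> \<kappa>) \<le> card \<Lambda> - 1"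
 using assms \<open>\<kappa> : \<Lambda>\<close> by (simp add: degree_lin_prod)
 qed
 qed simp
 also have "... < card \<Lambda>"
 using assms by (simp add: card_gt_0_iff)
 finally show False by simp
qed

text \<open>The Lagrange polynomials of the roots of an annihilating polynomial with simple real roots, evaluated at \<open>a\<close>, are
the spectral projections.\<close>

theorem spectral_theorem:
 assumes a: "a : ops n n" "hermitian a"
 obtains \<Lambda> :: "real set" and P where "finite \<Lambda>" "(\<Sum>\<kappa>\<in>\<Lambda>. P \<kappa>) = pr n"
 "!!\<kappa>. \<kappa> : \<Lambda> ==> P \<kappa> : ops n n & P \<kappa> ~= 0 & ad (P \<kappa>) = P \<kappa> & P \<kappa> * P \<kappa> = P \<kappa>
 & a * P \<kappa> = scl (complex_of_real \<kappa>) (P \<kappa>)"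
 "!!\<kappa> \<mu>. \<kappa> : \<Lambda> ==> \<mu> : \<Lambda> ==> \<kappa> ~= \<mu> ==> P \<kappa> * P \<mu> = 0"
 "!!C \<kappa>. alg_closed n a C ==> P \<kappa> : C"
proof -
 obtain p where p: "p ~= 0" "peval n a (p * 1) = 0"
 using exists_annihilator[OF a(1)] by auto
 then obtain \<Lambda>' where "finite \<Lambda>'" "peval n a (lin_prod \<Lambda>' * 1) = 0"
 using hermitian_annihilator[OF a] by blast
 then have \<Lambda>': "finite \<Lambda>'" "peval n a (lin_prod \<Lambda>') = 0" by simp_all
 define P where "P \<kappa> = peval n a (lagrange \<Lambda>' \<kappa>)" for \<kappa>
 define \<Lambda> where "\<Lambda> = {\<kappa> : \<Lambda>'. P \<kappa> ~= 0}"
 have ops: "P \<kappa> : ops n n" for \<kappa> by (simp add: P_def peval_ops a)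
 have one: "peval n a 1 = pr n" by (simp add: one_pCons)
 have sum': "(\<Sum>\<kappa>\<in>\<Lambda>'. P \<kappa>) = pr n"
 proof (cases "\<Lambda>' = {}")
 case True
 then show ?thesis using \<Lambda>'(2) by (simp add: lin_prod_def one)
 next
 case False
 then show ?thesis
 using \<Lambda>'(1) unfolding P_def by (simp add: sum_lagrange one flip: peval_sum)
 qed
 have sum: "(\<Sum>\<kappa>\<in>\<Lambda>. P \<kappa>) = pr n"
 unfolding sum'[symmetric] \<Lambda>_def using \<Lambda>'(1) by (intro sum.mono_neutral_left) auto
 have eig: "a * P \<kappa> = scl (complex_of_real \<kappa>) (P \<kappa>)" if "\<kappa> : \<Lambda>'" for \<kappa>
 proof -
 have "lin_prod \<Lambda>' = [:- complex_of_real \<kappa>, 1:] * lin_prod (\<Lambda>' - {\<kappa>})"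
 unfolding lin_prod_def by (rule prod.remove[OF \<Lambda>'(1) that])
 then have "(a - scl (complex_of_real \<kappa>) 1) * peval n a (lin_prod (\<Lambda>' - {\<kappa>})) = 0"
 using \<Lambda>'(2) by (simp only: peval_linear_mult[OF a(1), symmetric])
 then have "(a - scl (complex_of_real \<kappa>) 1) * P \<kappa> = 0"
 by (simp add: P_def lagrange_def peval_smult)
 then show ?thesis by (simp add: algebra_simps)
 qed
 have orth: "ad (P \<kappa>) * P \<mu> = 0" if "\<kappa> : \<Lambda>'" "\<mu> : \<Lambda>'" "\<kappa> ~= \<mu>" for \<kappa> \<mu>
 proof -
 have "scl (complex_of_real \<kappa>) (ad (P \<kappa>) * P \<mu>) = ad (a * P \<kappa>) * P \<mu>"
 by (simp add: eig[OF that(1)])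
 also have "... = ad (P \<kappa>) * (a * P \<mu>)"
 using a(2) by (simp add: hermitian_def mult.assoc)
 also have "... = scl (complex_of_real \<mu>) (ad (P \<kappa>) * P \<mu>)"
 by (simp add: eig[OF that(2)])
 finally have "scl (complex_of_real \<kappa> - complex_of_real \<mu>) (ad (P \<kappa>) * P \<mu>) = 0"
 by (simp add: scl.scale_left_diff_distrib)
 then show ?thesis using that(3) by simp
 qed
 have self: "ad (P \<kappa>) = ad (P \<kappa>) * P \<kappa>" if "\<kappa> : \<Lambda>'" for \<kappa>
 proof -
 have "ad (P \<kappa>) = ad (P \<kappa>) * (\<Sum>\<mu>\<in>\<Lambda>'. P \<mu>)"
 unfolding sum' using ops_ad[OF ops[of \<kappa>]] by (simp add: opsD(2))
 also have "... = (\<Sum>\<mu>\<in>\<Lambda>'. if \<mu> = \<kappa> then ad (P \<kappa>) * P \<kappa> else 0)"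
 unfolding sum_distrib_left using orth that by (intro sum.cong) auto
 finally show ?thesis using that \<Lambda>'(1) by simp
 qed
 have herm: "ad (P \<kappa>) = P \<kappa>" if "\<kappa> : \<Lambda>'" for \<kappa>
 using self[OF that] by (metis ad_simps(1,8))
 show ?thesis
 proof (rule that[of \<Lambda> P])
 show "finite \<Lambda>" using \<Lambda>'(1) by (simp add: \<Lambda>_def)
 show "P \<kappa> : ops n n & P \<kappa> ~= 0 & ad (P \<kappa>) = P \<kappa> & P \<kappa> * P \<kappa> = P \<kappa>
 & a * P \<kappa> = scl (complex_of_real \<kappa>) (P \<kappa>)" if "\<kappa> : \<Lambda>" for \<kappa>
 using that self[of \<kappa>] herm[of \<kappa>] eig[of \<kappa>] ops by (auto simp: \<Lambda>_def)
 show "P \<kappa> * P \<mu> = 0" if "\<kappa> : \<Lambda>" "\<mu> : \<Lambda>" "\<kappa> ~= \<mu>" for \<kappa> \<mu>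
 using that orth[of \<kappa> \<mu>] herm[of \<kappa>] by (auto simp: \<Lambda>_def)
 show "P \<kappa> : C" if "alg_closed n a C" for C \<kappa>
 unfolding P_def by (rule peval_in[OF that])
 qed (fact sum)
qed

lemma spectral_expand:
 assumes "a : ops n n" "(\<Sum>\<kappa>\<in>\<Lambda>. P \<kappa>) = pr n"
 "!!\<kappa>. \<kappa> : \<Lambda> ==> a * P \<kappa> = scl (complex_of_real \<kappa>) (P \<kappa>)"
 shows "a = (\<Sum>\<kappa>\<in>\<Lambda>. scl (complex_of_real \<kappa>) (P \<kappa>))"
proof -
 have "a = a * (\<Sum>\<kappa>\<in>\<Lambda>. P \<kappa>)" using assms(1,2) by (simp add: opsD)
 then show ?thesis using assms(3) by (simp add: sum_distrib_left)
qed

lemma positive_projection: "ad P = P ==> P * P = P ==> positive P"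
 by (metis positive_ad_mult)

lemma positive_one_minus_pr: "positive (1 - pr n)"
 by (rule positive_projection) (auto simp: algebra_simps)

lemma spectral_calculus_mult:
 assumes "finite \<Lambda>" "!!\<kappa>. \<kappa> : \<Lambda> ==> P \<kappa> * P \<kappa> = P \<kappa>"
 "!!\<kappa> \<mu>. \<kappa> : \<Lambda> ==> \<mu> : \<Lambda> ==> \<kappa> ~= \<mu> ==> P \<kappa> * P \<mu> = 0"
 shows "(\<Sum>\<kappa>\<in>\<Lambda>. scl (f \<kappa>) (P \<kappa>)) * (\<Sum>\<kappa>\<in>\<Lambda>. scl (g \<kappa>) (P \<kappa>)) = (\<Sum>\<kappa>\<in>\<Lambda>. scl (f \<kappa> * g \<kappa>) (P \<kappa>))"
proof -
 have "(\<Sum>\<kappa>\<in>\<Lambda>. scl (f \<kappa>) (P \<kappa>)) * (\<Sum>\<kappa>\<in>\<Lambda>. scl (g \<kappa>) (P \<kappa>))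
 = (\<Sum>\<kappa>\<in>\<Lambda>. \<Sum>\<mu>\<in>\<Lambda>. scl (f \<kappa> * g \<mu>) (P \<kappa> * P \<mu>))"
 by (simp add: sum_product mult.commute)
 also have "... = (\<Sum>\<kappa>\<in>\<Lambda>. \<Sum>\<mu>\<in>\<Lambda>. if \<mu> = \<kappa> then scl (f \<kappa> * g \<kappa>) (P \<kappa>) else 0)"
 using assms(2,3) by (intro sum.cong) auto
 finally show ?thesis using assms(1) by simp
qed

text \<open>Square root \<open>h\<close>, inverse square root \<open>g\<close> on the support, and support projection \<open>Q\<close> of a positive operator.\<close>

lemma positive_calculus:
 assumes k: "k : ops n n" "positive k"
 obtains g h Q where "g : ops n n" "h : ops n n" "Q : ops n n"
 "ad g = g" "ad h = h" "ad Q = Q" "Q * Q = Q" "k * Q = k" "Q * k = k" "g * k * g = Q" "h * h = k"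
 "g * h = Q" "h * g = Q" "k * g = h" "g * k = h"
 "!!C. alg_closed n k C ==> g : C & h : C & Q : C"
proof -
 obtain \<Lambda> P where sp: "finite \<Lambda>" "(\<Sum>\<kappa>\<in>\<Lambda>. P \<kappa>) = pr n"
 "!!\<kappa>. \<kappa> : \<Lambda> ==> P \<kappa> : ops n n & P \<kappa> ~= 0 & ad (P \<kappa>) = P \<kappa> & P \<kappa> * P \<kappa> = P \<kappa>
 & k * P \<kappa> = scl (complex_of_real \<kappa>) (P \<kappa>)"
 "!!\<kappa> \<mu>. \<kappa> : \<Lambda> ==> \<mu> : \<Lambda> ==> \<kappa> ~= \<mu> ==> P \<kappa> * P \<mu> = 0"
 "!!C \<kappa>. alg_closed n k C ==> P \<kappa> : C"
 using spectral_theorem[OF k(1) positive_hermitian[OF k(2)]] by metis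
 define F where "F f = (\<Sum>\<kappa>\<in>\<Lambda>. scl (complex_of_real (f \<kappa>)) (P \<kappa>))" for f
 have kF: "k = F (%x. x)"
 unfolding F_def by (rule spectral_expand[OF k(1) sp(2)]) (use sp(3) in blast)
 have mult: "F f * F g = F (%x. f x * g x)" for f g
 unfolding F_def of_real_mult by (rule spectral_calculus_mult) (use sp in auto)
 have cong: "F f = F g" if "!!x. x : \<Lambda> ==> f x = g x" for f g
 unfolding F_def using that by (intro sum.cong) auto
 have F_ops: "F f : ops n n" for f
 unfolding F_def using sp(3) by (intro ops_sum ops_scl) blast
 have F_ad: "ad (F f) = F f" for f
 unfolding F_def ad_sum using sp(3) by (intro sum.cong) auto
 have F_in: "F f : C" if "alg_closed n k C" for f C
 unfolding F_def using that sp(5) by (intro scl.subspace_sum scl.subspace_scale) (auto simp: alg_closed_def)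
 have nonneg: "0 \<le> \<kappa>" if "\<kappa> : \<Lambda>" for \<kappa>
 proof -
 obtain \<xi> where \<xi>: "P \<kappa> \<rhd> \<xi> ~= 0" using sp(3)[OF \<open>\<kappa> : \<Lambda>\<close>] by (metis aop_eqI ap_simps(5))
 have "k \<rhd> P \<kappa> \<rhd> \<xi> = smult (complex_of_real \<kappa>) (P \<kappa> \<rhd> \<xi>)"
 using sp(3)[OF that] by (metis ap_scl ap_simps(1))
 then have "0 \<le> complex_of_real \<kappa> * ip (P \<kappa> \<rhd> \<xi>) (P \<kappa> \<rhd> \<xi>)"
 using k(2) unfolding positive_def by (metis ip_smult_right)
 then have "0 \<le> \<kappa> * sqn (P \<kappa> \<rhd> \<xi>)"
 by (simp add: ip_self complex_nonneg_iff)
 then show ?thesis using sqn_pos[OF \<xi>] by (simp add: zero_le_mult_iff)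
 qed
 define g where "g = F (%x. if x = 0 then 0 else 1 / sqrt x)"
 define h where "h = F sqrt"
 define Q where "Q = F (%x. if x = 0 then 0 else 1)"
 show ?thesis
 proof
 show "g : ops n n" "h : ops n n" "Q : ops n n" by (simp_all add: g_def h_def Q_def F_ops)
 show "ad g = g" "ad h = h" "ad Q = Q" by (simp_all add: g_def h_def Q_def F_ad)
 show "Q * Q = Q" "k * Q = k" "Q * k = k" "g * k * g = Q" "h * h = k" "g * h = Q" "h * g = Q"
 "k * g = h" "g * k = h"
 unfolding kF g_def h_def Q_def mult by (rule cong; use nonneg in \<open>simp add: real_div_sqrt field_simps\<close>)+
 show "g : C & h : C & Q : C" if "alg_closed n k C" for C
 using F_in[OF that] by (simp add: g_def h_def Q_def)
 qed
qed

text \<open>The least eigenvalue is described by an operator inequality instead of the spectral decomposition, because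
that is what the eigenspace argument for fixed operators uses.\<close>

lemma min_eigenvalue:
 assumes a: "a : ops n n" "hermitian a" "\<not> positive a"
 obtains \<kappa> \<xi> where "\<kappa> < 0" "positive (a - scl (complex_of_real \<kappa>) 1)" "\<xi> ~= 0"
 "a \<rhd> \<xi> = smult (complex_of_real \<kappa>) \<xi>"
proof -
 obtain \<Lambda> P where sp: "finite \<Lambda>" "(\<Sum>\<kappa>\<in>\<Lambda>. P \<kappa>) = pr n"
 "!!\<kappa>. \<kappa> : \<Lambda> ==> P \<kappa> : ops n n & P \<kappa> ~= 0 & ad (P \<kappa>) = P \<kappa> & P \<kappa> * P \<kappa> = P \<kappa>
 & a * P \<kappa> = scl (complex_of_real \<kappa>) (P \<kappa>)"
 using spectral_theorem[OF a(1,2)] by metis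
 have aS: "a = (\<Sum>\<kappa>\<in>\<Lambda>. scl (complex_of_real \<kappa>) (P \<kappa>))"
 by (rule spectral_expand[OF a(1) sp(2)]) (use sp(3) in blast)
 have P_pos: "positive (P \<kappa>)" if "\<kappa> : \<Lambda>" for \<kappa>
 using sp(3)[OF that] by (auto intro: positive_projection)
 have "\<exists>\<kappa>\<in>\<Lambda>. \<kappa> < 0"
 proof (rule ccontr)
 assume "\<not> ?thesis"
 then have "positive a" unfolding aS using P_pos
 by (intro positive_sum positive_scl) (auto simp: not_less)
 with a(3) show False by simp
 qed
 then obtain \<mu> where "\<mu> : \<Lambda>" "\<mu> < 0" by blast
 then have ne: "\<Lambda> ~= {}" and neg: "Min \<Lambda> < 0"
 using Min_le[OF sp(1), of \<mu>] by auto
 let ?m = "Min \<Lambda>"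
 have m: "?m : \<Lambda>" using ne sp(1) by simp
 obtain \<zeta> where \<zeta>: "P ?m \<rhd> \<zeta> ~= 0" using sp(3)[OF m] by (metis aop_eqI ap_simps(5))
 show ?thesis
 proof
 show "?m < 0" by (fact neg)
 have "a - scl (complex_of_real ?m) 1
 = (\<Sum>\<kappa>\<in>\<Lambda>. scl (complex_of_real (\<kappa> - ?m)) (P \<kappa>)) + scl (complex_of_real (- ?m)) (1 - pr n)"
 proof -
 have "(\<Sum>\<kappa>\<in>\<Lambda>. scl (complex_of_real (\<kappa> - ?m)) (P \<kappa>)) = a - scl (complex_of_real ?m) (pr n)"
 by (subst aS, subst sp(2)[symmetric])
 (simp add: scl.scale_left_diff_distrib sum_subtractf scl.scale_sum_right)
 then show ?thesis by (simp add: scl.scale_right_diff_distrib)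
 qed
 also have "positive ..."
 using P_pos neg sp(1) by (intro positive_add positive_sum positive_scl positive_one_minus_pr) auto
 finally show "positive (a - scl (complex_of_real ?m) 1)" .
 show "P ?m \<rhd> \<zeta> ~= 0" by (fact \<zeta>)
 show "a \<rhd> P ?m \<rhd> \<zeta> = smult (complex_of_real ?m) (P ?m \<rhd> \<zeta>)"
 using sp(3)[OF m] by (metis ap_scl ap_simps(1))
 qed
qed

lemma hermitian_bounded:
 assumes a: "a : ops n n" "hermitian a"
 obtains c where "0 \<le> c" "positive (scl (complex_of_real c) (pr n) - a)"
proof (cases "positive (- a)")
 case True
 then show ?thesis using that[of 0] by simp
next
 case False
 have "- a : ops n n" "hermitian (- a)" using a by (auto simp: hermitian_def)
 then obtain \<kappa> \<xi> where \<kappa>: "\<kappa> < 0" "positive (- a - scl (complex_of_real \<kappa>) 1)"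
 using min_eigenvalue[OF _ _ False] by metis
 have "positive (ad (pr n) * (- a - scl (complex_of_real \<kappa>) 1) * pr n)"
 by (rule positive_ad_mult_mult) (fact \<kappa>)
 also have "ad (pr n) * (- a - scl (complex_of_real \<kappa>) 1) * pr n = scl (complex_of_real (- \<kappa>)) (pr n) - a"
 using a(1) by (simp add: algebra_simps opsD ops_mult_pr)
 finally show ?thesis using that[of "- \<kappa>"] \<kappa>(1) by simp
qed

section \<open>Completely positive maps on operator systems\<close>

text \<open>Positivity of an operator matrix with an arbitrary finite index set; the indices of Kraus families are pairs and
triples.\<close>

definition bpos :: "'i set => ('i => 'i => aop) => bool" where
 "bpos K s \<longleftrightarrow> (\<forall>\<xi>. 0 \<le> (\<Sum>i\<in>K. \<Sum>j\<in>K. ip (\<xi> i) (s i j \<rhd> \<xi> j)))"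

definition opsys :: "nat => aop set => bool" where
 "opsys n S \<longleftrightarrow> S \<subseteq> ops n n & scl.subspace S & pr n : S & (\<forall>x\<in>S. ad x : S)"

definition linear_on :: "aop set => (aop => aop) => bool" where
 "linear_on S f \<longleftrightarrow> (\<forall>x\<in>S. \<forall>y\<in>S. f (x + y) = f x + f y) & (\<forall>c. \<forall>x\<in>S. f (scl c x) = scl c (f x))"

definition functional_on :: "aop set => (aop => complex) => bool" where
 "functional_on S f \<longleftrightarrow> (\<forall>x\<in>S. \<forall>y\<in>S. f (x + y) = f x + f y) & (\<forall>c. \<forall>x\<in>S. f (scl c x) = c * f x)"

lemma opsysD:
 assumes "opsys n S"
 shows "S \<subseteq> ops n n" "scl.subspace S" "pr n : S" "x : S ==> ad x : S" "x : S ==> x : ops n n"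
 "0 : S" "x : S ==> y : S ==> x + y : S" "x : S ==> y : S ==> x - y : S" "x : S ==> scl c x : S"
 "(!!a. a : A ==> f a : S) ==> sum f A : S"
 using assms scl.subspace_diff[of S] unfolding opsys_def
 by (auto simp: scl.subspace_0 scl.subspace_add scl.subspace_scale intro: scl.subspace_sum)

lemma bpos_cong:
 assumes "!!i j. i : K ==> j : K ==> s i j = t i j"
 shows "bpos K s \<longleftrightarrow> bpos K t"
proof -
 have "(\<Sum>i\<in>K. \<Sum>j\<in>K. ip (\<xi> i) (s i j \<rhd> \<xi> j)) = (\<Sum>i\<in>K. \<Sum>j\<in>K. ip (\<xi> i) (t i j \<rhd> \<xi> j))" for \<xi>
 by (intro sum.cong refl) (simp add: assms)
 then show ?thesis by (simp add: bpos_def)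
qed

lemma bpos_reindex:
 assumes "bij_betw e K K'"
 shows "bpos K' s \<longleftrightarrow> bpos K (%i j. s (e i) (e j))"
proof -
 have eq: "(\<Sum>i\<in>K'. \<Sum>j\<in>K'. ip (\<xi> i) (s i j \<rhd> \<xi> j))
 = (\<Sum>i\<in>K. \<Sum>j\<in>K. ip (\<xi> (e i)) (s (e i) (e j) \<rhd> \<xi> (e j)))" for \<xi>
 by (simp add: sum.reindex_bij_betw[OF assms, symmetric])
 show ?thesis
 proof
 assume *: "bpos K (%i j. s (e i) (e j))"
 show "bpos K' s"
 unfolding bpos_def eq using * unfolding bpos_def by (auto dest: spec[of _ "%i. _ (e i)"])
 next
 assume *: "bpos K' s"
 show "bpos K (%i j. s (e i) (e j))"
 unfolding bpos_def
 proof
 fix \<xi>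
 have inv: "inv_into K e (e i) = i" if "i : K" for i
 using that assms by (simp add: bij_betw_def)
 have "0 \<le> (\<Sum>i\<in>K. \<Sum>j\<in>K. ip (\<xi> (inv_into K e (e i))) (s (e i) (e j) \<rhd> \<xi> (inv_into K e (e j))))"
 using *[unfolded bpos_def, THEN spec, of "%i. \<xi> (inv_into K e i)"] unfolding eq .
 then show "0 \<le> (\<Sum>i\<in>K. \<Sum>j\<in>K. ip (\<xi> i) (s (e i) (e j) \<rhd> \<xi> j))"
 by (simp add: inv)
 qed
 qed
qed

text \<open>The isometry of \<open>\<complex>\<^sup>m\<close> onto the \<open>i\<close>-th summand of \<open>\<complex>\<^sup>D \<otimes> \<complex>\<^sup>m\<close>.\<close>

definition blk :: "nat => nat => aop" where
 "blk m i = (\<Sum>k<m. rk (bvec (i * m + k)) (bvec k))"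

lemma coeff_blk: "coeff (blk m i \<rhd> \<xi>) j = (if m > 0 & j div m = i then coeff \<xi> (j mod m) else 0)"
proof -
 have "coeff (blk m i \<rhd> \<xi>) j = (\<Sum>k<m. if i * m + k = j then coeff \<xi> k else 0)"
 by (auto simp: blk_def ap_sum_left coeff_sum coeff_bvec intro!: sum.cong)
 also have "... = (if m > 0 & j div m = i then coeff \<xi> (j mod m) else 0)"
 proof (cases "m > 0 & j div m = i")
 case True
 then have "(\<Sum>k<m. if i * m + k = j then coeff \<xi> k else 0) = (\<Sum>k<m. if k = j mod m then coeff \<xi> k else 0)"
 by (intro sum.cong refl if_cong) (use True in \<open>metis div_mult_mod_eq add_left_cancel\<close>)
 then show ?thesis using True by simp
 next
 case False
 then have "i * m + k ~= j" if "k < m" for k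
 using that by auto
 then show ?thesis using False by (auto intro!: sum.neutral)
 qed
 finally show ?thesis .
qed

lemma coeff_ad_blk: "coeff (ad (blk m i) \<rhd> \<xi>) k = (if k < m then coeff \<xi> (i * m + k) else 0)"
 by (auto simp: blk_def ad_sum ap_sum_left coeff_sum coeff_bvec if_distrib cong: if_cong)

lemma blk_ops [simp, intro]: "i < D ==> blk m i : ops (D * m) m"
 unfolding blk_def
proof (intro ops_sum ops_rk)
 fix k assume "i < D" "k : {..<m}"
 then have "i * m + k < Suc i * m" by simp
 also have "... \<le> D * m" using \<open>i < D\<close> by (intro mult_right_mono) auto
 finally show "bvec (i * m + k) : spc (D * m)" by simp
qed auto

lemma ad_blk_blk: "ad (blk m i) * blk m j = (if i = j then pr m else 0)"
 by (intro aop_eqI poly_eqI) (auto simp: coeff_ad_blk coeff_blk)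

lemma ad_blk_blk_mult: "ad (blk m i) * (blk m j * x) = (if i = j then pr m * x else 0)"
 by (simp add: ad_blk_blk flip: mult.assoc)

lemma sum_blk_ad_blk: "(\<Sum>i<D. blk m i * ad (blk m i)) = pr (D * m)"
proof (intro aop_eqI poly_eqI)
 fix \<xi> j
 have "coeff ((\<Sum>i<D. blk m i * ad (blk m i)) \<rhd> \<xi>) j
 = (\<Sum>i<D. if i = j div m then (if m > 0 then coeff \<xi> j else 0) else 0)"
 by (auto simp: ap_sum_left coeff_sum coeff_blk coeff_ad_blk intro!: sum.cong)
 also have "... = coeff (pr (D * m) \<rhd> \<xi>) j"
 by (auto simp: less_mult_imp_div_less div_less_iff_less_mult)
 finally show "coeff ((\<Sum>i<D. blk m i * ad (blk m i)) \<rhd> \<xi>) j = coeff (pr (D * m) \<rhd> \<xi>) j" .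
qed

definition bop :: "nat => nat => (nat => nat => aop) => aop" where
 "bop m D s = (\<Sum>i<D. \<Sum>j<D. blk m i * s i j * ad (blk m j))"

lemma ip_bop: "ip \<xi> (bop m D s \<rhd> \<eta>)
 = (\<Sum>i<D. \<Sum>j<D. ip (ad (blk m i) \<rhd> \<xi>) (s i j \<rhd> ad (blk m j) \<rhd> \<eta>))"
 by (simp add: bop_def ap_sum_left ip_sum_right ip_ad_left)

lemma bop_ops: "(!!i j. i < D ==> j < D ==> s i j : ops m m) ==> bop m D s : ops (D * m) (D * m)"
 unfolding bop_def by (intro ops_sum ops_mult[where k = m] ops_ad) auto

lemma ad_bop: "ad (bop m D s) = bop m D (%i j. ad (s j i))"
 unfolding bop_def by (simp add: ad_sum mult.assoc) (rule sum.swap)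

lemma positive_bop_iff:
 assumes "!!i j. i < D ==> j < D ==> s i j : ops m m"
 shows "positive (bop m D s) \<longleftrightarrow> bpos {..<D} s"
proof
 assume "bpos {..<D} s"
 then show "positive (bop m D s)"
 unfolding positive_def ip_bop bpos_def by (metis (no_types))
next
 assume pos: "positive (bop m D s)"
 show "bpos {..<D} s"
 unfolding bpos_def
 proof
 fix \<xi>
 let ?X = "\<Sum>i<D. blk m i \<rhd> \<xi> i"
 have X: "ad (blk m i) \<rhd> ?X = pr m \<rhd> \<xi> i" if "i < D" for i
 proof -
 have "ad (blk m i) \<rhd> ?X = (\<Sum>j<D. if j = i then pr m \<rhd> \<xi> i else 0)"
 unfolding ap_sum_right ap_simps(1)[symmetric] by (intro sum.cong) (auto simp: ad_blk_blk)
 then show ?thesis using that by simp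
 qed
 have "0 \<le> ip ?X (bop m D s \<rhd> ?X)" using pos by (auto simp: positive_def)
 also have "... = (\<Sum>i<D. \<Sum>j<D. ip (pr m \<rhd> \<xi> i) (s i j \<rhd> pr m \<rhd> \<xi> j))"
 unfolding ip_bop by (intro sum.cong refl) (simp only: X lessThan_iff)
 also have "... = (\<Sum>i<D. \<Sum>j<D. ip (\<xi> i) (s i j \<rhd> \<xi> j))"
 proof (intro sum.cong refl)
 fix i j assume "i : {..<D}" "j : {..<D}"
 then have s: "s i j : ops m m" using assms by simp
 have "ip (pr m \<rhd> \<xi> i) (s i j \<rhd> pr m \<rhd> \<xi> j) = ip (\<xi> i) (pr m \<rhd> s i j \<rhd> pr m \<rhd> \<xi> j)"
 using ip_ad_left[of "pr m"] by simp
 also have "... = ip (\<xi> i) ((pr m * s i j * pr m) \<rhd> \<xi> j)" by simp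
 also have "... = ip (\<xi> i) (s i j \<rhd> \<xi> j)" using opsD[OF s] by (simp only:)
 finally show "ip (pr m \<rhd> \<xi> i) (s i j \<rhd> pr m \<rhd> \<xi> j) = ip (\<xi> i) (s i j \<rhd> \<xi> j)" .
 qed
 finally show "0 \<le> (\<Sum>i<D. \<Sum>j<D. ip (\<xi> i) (s i j \<rhd> \<xi> j))" .
 qed
qed

definition posfun :: "aop set => (aop => complex) => bool" where
 "posfun W f \<longleftrightarrow> functional_on W f & (\<forall>x\<in>W. positive x --> 0 \<le> f x)"

lemma posfun_mono:
 assumes "opsys N W" "posfun W f" "x : W" "y : W" "positive (y - x)"
 shows "0 \<le> f y - f x"
proof -
 have "f y = f (x + (y - x))" by simp
 also have "... = f x + f (y - x)"
 using assms opsysD(8)[OF assms(1)] unfolding posfun_def functional_on_def by blast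
 finally show ?thesis
 using assms opsysD(8)[OF assms(1)] unfolding posfun_def by force
qed

text \<open>The extension theorem of M. Riesz in one step: the value at \<open>b\<close> may be any number between the suprema and
infima that monotonicity imposes, and these are finite because the unit dominates all hermitian elements.\<close>

lemma posfun_extend_step:
 assumes W: "opsys N W" and f: "posfun W f" and b: "b : ops N N" "hermitian b"
 shows "\<exists>W' f'. opsys N W' & posfun W' f' & W \<subseteq> W' & b : W' & (\<forall>x\<in>W. f' x = f x)"
proof (cases "b : W")
 case True
 then show ?thesis using W f by blast
next
 case False
 note sub = opsysD(2)[OF W]
 have lin: "f (x + y) = f x + f y" if "x : W" "y : W" for x y
 using f that by (simp add: posfun_def functional_on_def)
 have scal: "f (scl c x) = c * f x" if "x : W" for c x
 using f that by (simp add: posfun_def functional_on_def)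
 have pos: "0 \<le> f x" if "x : W" "positive x" for x
 using f that by (simp add: posfun_def)
 obtain c1 where c1: "positive (scl (complex_of_real c1) (pr N) - b)"
 using hermitian_bounded[OF b] by blast
 have "- b : ops N N" "hermitian (- b)" using b by (auto simp: hermitian_def)
 then obtain c2 where c2: "positive (scl (complex_of_real c2) (pr N) - (- b))"
 using hermitian_bounded by blast
 define L where "L = {Re (f w) | w. w : W & positive (b - w)}"
 have below: "Re (f w) \<le> Re (f w')" if "w : W" "w' : W" "positive (b - w)" "positive (w' - b)" for w w'
 proof -
 have "positive (w' - w)" using positive_add[OF that(3,4)] by simp
 from posfun_mono[OF W f that(1,2) this] show ?thesis by (simp add: complex_nonneg_iff)
 qed
 have sclW: "scl c (pr N) : W" for c using opsysD(3,9)[OF W] by blast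
 have "positive (b - scl (complex_of_real (- c2)) (pr N))" using c2 by (simp add: add.commute)
 then have neL: "L ~= {}" using sclW unfolding L_def by blast
 have bdd: "bdd_above L"
 unfolding L_def by (rule bdd_aboveI[of _ "Re (f (scl (complex_of_real c1) (pr N)))"])
 (use below sclW c1 in blast)
 define \<gamma> where "\<gamma> = Sup L"
 have lo: "Re (f w) \<le> \<gamma>" if "w : W" "positive (b - w)" for w
 unfolding \<gamma>_def using bdd that by (intro cSup_upper) (auto simp: L_def)
 have up: "\<gamma> \<le> Re (f w)" if "w : W" "positive (w - b)" for w
 unfolding \<gamma>_def using neL below that by (intro cSup_least) (auto simp: L_def)
 define W' where "W' = {w + scl c b | w c. w : W}"
 have uniq: "w = w' & c = c'" if "w : W" "w' : W" "w + scl c b = w' + scl c' b" for w w' c c'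
 proof -
 have eq: "scl (c' - c) b = w - w'"
 using that(3) by (simp add: scl.scale_left_diff_distrib algebra_simps)
 have "c = c'"
 proof (rule ccontr)
 assume "c ~= c'"
 then have "b = scl (inverse (c' - c)) (scl (c' - c) b)" by simp
 also have "... : W" unfolding eq using that opsysD(8,9)[OF W] by blast
 finally show False using False by simp
 qed
 then show ?thesis using that(3) by simp
 qed
 define f' where "f' x = (THE y. \<exists>w c. w : W & x = w + scl c b & y = f w + c * complex_of_real \<gamma>)" for x
 have f': "f' (w + scl c b) = f w + c * complex_of_real \<gamma>" if "w : W" for w c
 unfolding f'_def by (rule the_equality) (use uniq that in blast)+
 have W'I: "w + scl c b : W'" if "w : W" for w c unfolding W'_def using that by blast
 have add: "(w + scl c b) + (w' + scl c' b) = (w + w') + scl (c + c') b" for w c w' c'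
 by (simp add: scl.scale_left_distrib algebra_simps)
 have scale: "scl d (w + scl c b) = scl d w + scl (d * c) b" for w c d
 by (simp add: scl.scale_right_distrib)
 have "opsys N W'"
 unfolding opsys_def
 proof (intro conjI ballI)
 show "W' \<subseteq> ops N N" using opsysD(1)[OF W] b(1) by (auto simp: W'_def)
 show "scl.subspace W'"
 unfolding scl.subspace_def
 proof (intro conjI ballI allI)
 show "0 : W'" using W'I[of 0 0] opsysD(6)[OF W] by simp
 fix x assume "x : W'"
 then obtain w c where x: "w : W" "x = w + scl c b" by (auto simp: W'_def)
 show "scl d x : W'" for d
 unfolding x scale using x opsysD(9)[OF W] by (intro W'I)
 fix y assume "y : W'"
 then obtain w' c' where y: "w' : W" "y = w' + scl c' b" by (auto simp: W'_def)
 show "x + y : W'" unfolding x y add using x y opsysD(7)[OF W] by (intro W'I)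
 qed
 show "pr N : W'" using W'I[of "pr N" 0] opsysD(3)[OF W] by simp
 fix x assume "x : W'"
 then obtain w c where x: "w : W" "x = w + scl c b" by (auto simp: W'_def)
 then have "ad x = ad w + scl (cnj c) b" using b(2) by (simp add: hermitian_def)
 then show "ad x : W'" using W'I opsysD(4)[OF W] x(1) by auto
 qed
 moreover have "posfun W' f'"
 unfolding posfun_def functional_on_def
 proof (intro conjI ballI allI impI)
 fix x assume "x : W'"
 then obtain w c where x: "w : W" "x = w + scl c b" by (auto simp: W'_def)
 show "f' (scl d x) = d * f' x" for d
 unfolding x scale using x opsysD(9)[OF W] by (simp add: f' scal algebra_simps)
 show "f' (x + y) = f' x + f' y" if "y : W'" for y
 proof -
 obtain w' c' where y: "w' : W" "y = w' + scl c' b" using \<open>y : W'\<close> by (auto simp: W'_def)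
 show ?thesis
 unfolding x y add using f'[OF opsysD(7)[OF W x(1) y(1)]] x y by (simp add: f' lin algebra_simps del: scl.scale_left_distrib)
 qed
 assume xpos: "positive x"
 have "ad x = x" using positive_hermitian[OF xpos] by (simp add: hermitian_def)
 then have "ad w + scl (cnj c) b = w + scl c b" using b(2) x(2) by (simp add: hermitian_def)
 then have w: "ad w = w" and c: "cnj c = c" using uniq[of "ad w" w] opsysD(4)[OF W] x(1) by auto
 then obtain r where r: "c = complex_of_real r" by (metis Reals_cases Reals_cnj_iff)
 have fw_real: "f w = complex_of_real (Re (f w))"
 proof -
 obtain k where k: "0 \<le> k" "positive (scl (complex_of_real k) (pr N) - w)"
 using hermitian_bounded[of w N] w x(1) opsysD(5)[OF W] by (auto simp: hermitian_def)
 have prpos: "positive (scl (complex_of_real k) (pr N))"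
 using k(1) by (intro positive_scl positive_projection) auto
 have "0 \<le> f (scl (complex_of_real k) (pr N)) - f w"
 by (rule posfun_mono[OF W f x(1) sclW k(2)])
 moreover have "0 \<le> f (scl (complex_of_real k) (pr N))"
 by (rule pos[OF sclW prpos])
 ultimately show ?thesis by (simp add: complex_nonneg_iff complex_eq_iff)
 qed
 have resc: "positive (scl (complex_of_real (1 / d)) x)" if "d > 0" for d
 using that xpos by (intro positive_scl) auto
 have Rs: "Re (f (scl (complex_of_real d) w)) = d * Re (f w)" for d
 using scal[OF x(1), of "complex_of_real d"] by simp
 have "0 \<le> Re (f w) + r * \<gamma>"
 proof (cases r "0 :: real" rule: linorder_cases)
 case equal
 then have "positive w" using xpos x r by simp
 then have "0 \<le> f w" using pos x(1) by blast
 then show ?thesis using equal by (simp add: complex_nonneg_iff)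
 next
 case greater
 have e: "b - scl (complex_of_real (- (1 / r))) w = scl (complex_of_real (1 / r)) x"
 using greater by (simp add: x r scl.scale_right_distrib add.commute flip: of_real_mult)
 have "Re (f (scl (complex_of_real (- (1 / r))) w)) \<le> \<gamma>"
 by (rule lo[OF opsysD(9)[OF W x(1)] resc[OF greater, folded e]])
 then have "- (1 / r) * Re (f w) \<le> \<gamma>" unfolding Rs .
 then show ?thesis using greater by (simp add: field_simps)
 next
 case less
 then have e: "scl (complex_of_real (1 / - r)) w - b = scl (complex_of_real (1 / - r)) x"
 by (simp add: x r scl.scale_right_distrib flip: of_real_mult)
 have "\<gamma> \<le> Re (f (scl (complex_of_real (1 / - r)) w))"
 by (rule up[OF opsysD(9)[OF W x(1)] resc[of "- r", folded e]]) (use less in simp)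
 then have "\<gamma> \<le> 1 / - r * Re (f w)" unfolding Rs .
 then show ?thesis using less by (simp add: field_simps)
 qed
 then have "0 \<le> complex_of_real (Re (f w) + r * \<gamma>)" by (simp add: complex_nonneg_iff)
 also have "... = f' x"
 unfolding x(2) f'[OF x(1)] r of_real_add of_real_mult fw_real[symmetric] by simp
 finally show "0 \<le> f' x" .
 qed
 moreover have "W \<subseteq> W'" using W'I[of _ 0] by auto
 moreover have "b : W'" using W'I[of 0 1] opsysD(6)[OF W] by simp
 moreover have "f' x = f x" if "x : W" for x using f'[OF that, of 0] by simp
 ultimately show ?thesis by blast
qed

lemma posfun_extend:
 assumes "finite B" "!!b. b : B ==> b : ops N N & hermitian b" "opsys N W" "posfun W f"
 shows "\<exists>W' f'. opsys N W' & posfun W' f' & W \<subseteq> W' & B \<subseteq> W' & (\<forall>x\<in>W. f' x = f x)"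
 using assms(1,2)
proof (induction B rule: finite_induct)
 case empty
 then show ?case using assms(3,4) by blast
next
 case (insert b B)
 then obtain W1 f1 where 1: "opsys N W1" "posfun W1 f1" "W \<subseteq> W1" "B \<subseteq> W1" "\<forall>x\<in>W. f1 x = f x"
 by auto
 obtain W2 f2 where 2: "opsys N W2" "posfun W2 f2" "W1 \<subseteq> W2" "b : W2" "\<forall>x\<in>W1. f2 x = f1 x"
 using posfun_extend_step[OF 1(1,2), of b] insert.prems by auto
 show ?case using 1 2 by (intro exI[of _ W2] exI[of _ f2]) auto
qed

lemma functional_on_sum:
 assumes "functional_on W f" "scl.subspace W" "!!a. a : A ==> g a : W"
 shows "f (sum g A) = (\<Sum>a\<in>A. f (g a))"
proof -
 have f0: "f 0 = 0"
 using assms(1) scl.subspace_0[OF assms(2)] unfolding functional_on_def by (metis mult_zero_left scl.scale_zero_left)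
 show ?thesis
 using assms(3)
 proof (induction A rule: infinite_finite_induct)
 case (insert a A)
 then have "sum g A : W" by (intro scl.subspace_sum[OF assms(2)]) auto
 then have "f (g a + sum g A) = f (g a) + f (sum g A)"
 using assms(1) insert.prems by (simp add: functional_on_def)
 then show ?case using insert by simp
 qed (simp_all add: f0)
qed

text \<open>A positive functional on a full matrix algebra has a density matrix, whose spectral decomposition gives the
vectors \<open>\<zeta>\<close>.\<close>

lemma posfun_form:
 assumes "posfun (ops N N) f"
 obtains \<zeta> where "!!X. X : ops N N ==> f X = (\<Sum>a<N. ip (\<zeta> a) (X \<rhd> \<zeta> a))"
proof -
 have fl: "functional_on (ops N N) f" using assms by (simp add: posfun_def)
 define R where "R = (\<Sum>i<N. \<Sum>j<N. scl (f (rk (bvec i) (bvec j))) (rk (bvec j) (bvec i)))"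
 have R_ops: "R : ops N N" unfolding R_def by (intro ops_sum ops_scl ops_rk) auto
 have f_sum: "f (\<Sum>i<N. \<Sum>j<N. scl (c i j) (rk (bvec i) (bvec j)))
 = (\<Sum>i<N. \<Sum>j<N. c i j * f (rk (bvec i) (bvec j)))" for c
 proof -
 have sc: "f (scl (c i j) (rk (bvec i) (bvec j))) = c i j * f (rk (bvec i) (bvec j))" if "i < N" "j < N" for i j
 using fl ops_rk[of "bvec i" N "bvec j" N] that unfolding functional_on_def by blast
 have "f (\<Sum>i<N. \<Sum>j<N. scl (c i j) (rk (bvec i) (bvec j)))
 = (\<Sum>i<N. f (\<Sum>j<N. scl (c i j) (rk (bvec i) (bvec j))))"
 by (intro functional_on_sum[OF fl ops_subspace] ops_sum ops_scl ops_rk) auto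
 also have "... = (\<Sum>i<N. \<Sum>j<N. f (scl (c i j) (rk (bvec i) (bvec j))))"
 by (intro sum.cong refl functional_on_sum[OF fl ops_subspace] ops_scl ops_rk) auto
 also have "... = (\<Sum>i<N. \<Sum>j<N. c i j * f (rk (bvec i) (bvec j)))"
 by (intro sum.cong refl sc) auto
 finally show ?thesis .
 qed
 have "positive R"
 unfolding positive_def
 proof
 fix \<xi>
 let ?\<xi> = "pr N \<rhd> \<xi>"
 have ops: "rk ?\<xi> ?\<xi> : ops N N" by (intro ops_rk) auto
 have "positive (rk ?\<xi> ?\<xi>)"
 unfolding positive_def
 proof
 fix \<zeta>
 have "ip \<zeta> (rk ?\<xi> ?\<xi> \<rhd> \<zeta>) = ip ?\<xi> \<zeta> * cnj (ip ?\<xi> \<zeta>)"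
 by (simp add: ip_commute[of \<zeta>])
 also have "... = complex_of_real ((cmod (ip ?\<xi> \<zeta>))\<^sup>2)" by (rule complex_norm_square[symmetric])
 finally show "0 \<le> ip \<zeta> (rk ?\<xi> ?\<xi> \<rhd> \<zeta>)" by (simp add: complex_nonneg_iff)
 qed
 then have "0 \<le> f (rk ?\<xi> ?\<xi>)" using assms ops by (simp add: posfun_def)
 also have "rk ?\<xi> ?\<xi> = (\<Sum>i<N. \<Sum>j<N. scl (coeff \<xi> i * cnj (coeff \<xi> j)) (rk (bvec i) (bvec j)))"
 by (subst ops_expand[OF ops]) (intro sum.cong refl, simp add: mult.commute)
 also have "f ... = (\<Sum>i<N. \<Sum>j<N. (coeff \<xi> i * cnj (coeff \<xi> j)) * f (rk (bvec i) (bvec j)))"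
 by (rule f_sum)
 also have "... = ip \<xi> (R \<rhd> \<xi>)"
 unfolding R_def by (simp add: ap_sum_left ip_sum_right mult_ac)
 finally show "0 \<le> ip \<xi> (R \<rhd> \<xi>)" .
 qed
 then obtain h where h: "h : ops N N" "ad h = h" "h * h = R"
 using positive_calculus[OF R_ops] by metis
 show ?thesis
 proof
 fix X assume X: "X : ops N N"
 have frk: "f (rk (bvec i) (bvec j)) = coeff (R \<rhd> bvec i) j" if ij: "i < N" "j < N" for i j
 proof -
 have "coeff (R \<rhd> bvec i) j
 = (\<Sum>a<N. \<Sum>b<N. f (rk (bvec a) (bvec b)) * ((if i = a then 1 else 0) * (if b = j then 1 else 0)))"
 by (simp add: R_def ap_sum_left coeff_sum coeff_bvec) (intro sum.cong refl, auto)
 also have "... = (\<Sum>a<N. if a = i then f (rk (bvec i) (bvec j)) else 0)"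
 proof (intro sum.cong refl)
 fix a
 have "(\<Sum>b<N. f (rk (bvec a) (bvec b)) * ((if i = a then 1 else 0) * (if b = j then 1 else 0)))
 = (\<Sum>b<N. if b = j then (if a = i then f (rk (bvec i) (bvec j)) else 0) else 0)"
 by (intro sum.cong) auto
 then show "(\<Sum>b<N. f (rk (bvec a) (bvec b)) * ((if i = a then 1 else 0) * (if b = j then 1 else 0)))
 = (if a = i then f (rk (bvec i) (bvec j)) else 0)"
 using ij by simp
 qed
 finally show ?thesis using ij by simp
 qed
 have "f X = (\<Sum>i<N. \<Sum>j<N. coeff (X \<rhd> bvec j) i * f (rk (bvec i) (bvec j)))"
 by (subst ops_expand[OF X]) (rule f_sum)
 also have "... = (\<Sum>i<N. \<Sum>j<N. coeff (X \<rhd> bvec j) i * coeff (R \<rhd> bvec i) j)"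
 by (intro sum.cong refl) (simp add: frk)
 also have "... = (\<Sum>j<N. \<Sum>i<N. coeff (X \<rhd> bvec j) i * coeff (R \<rhd> bvec i) j)"
 by (rule sum.swap)
 also have "... = (\<Sum>j<N. coeff (R \<rhd> X \<rhd> bvec j) j)"
 proof (intro sum.cong refl)
 fix j
 have "X \<rhd> bvec j : spc N" using X by blast
 then have "R \<rhd> X \<rhd> bvec j = R \<rhd> (\<Sum>i<N. smult (coeff (X \<rhd> bvec j) i) (bvec i))"
 by (subst spc_expand[of "X \<rhd> bvec j" N]) auto
 then show "(\<Sum>i<N. coeff (X \<rhd> bvec j) i * coeff (R \<rhd> bvec i) j) = coeff (R \<rhd> X \<rhd> bvec j) j"
 by (simp add: ap_sum_right coeff_sum)
 qed
 also have "... = (\<Sum>j<N. \<Sum>i<N. coeff (h \<rhd> bvec i) j * coeff (h \<rhd> X \<rhd> bvec j) i)"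
 proof (intro sum.cong refl)
 fix j
 let ?y = "h \<rhd> X \<rhd> bvec j"
 have "?y : spc N" using h(1) by blast
 then have "h \<rhd> ?y = h \<rhd> (\<Sum>i<N. smult (coeff ?y i) (bvec i))"
 by (subst spc_expand[of ?y N]) auto
 then show "coeff (R \<rhd> X \<rhd> bvec j) j = (\<Sum>i<N. coeff (h \<rhd> bvec i) j * coeff ?y i)"
 by (simp add: h(3)[symmetric] ap_sum_right coeff_sum mult.commute)
 qed
 also have "... = (\<Sum>i<N. \<Sum>j<N. coeff (h \<rhd> bvec i) j * coeff (h \<rhd> X \<rhd> bvec j) i)"
 by (rule sum.swap)
 also have "... = (\<Sum>i<N. ip (h \<rhd> bvec i) (X \<rhd> h \<rhd> bvec i))"
 proof (intro sum.cong refl)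
 fix i
 let ?y = "h \<rhd> bvec i"
 have "?y : spc N" using h(1) by blast
 then have "h \<rhd> X \<rhd> ?y = h \<rhd> X \<rhd> (\<Sum>j<N. smult (coeff ?y j) (bvec j))"
 by (subst spc_expand[of ?y N]) auto
 then have "(\<Sum>j<N. coeff ?y j * coeff (h \<rhd> X \<rhd> bvec j) i) = ip (bvec i) (h \<rhd> X \<rhd> ?y)"
 by (simp add: ap_sum_right coeff_sum)
 also have "... = ip (h \<rhd> bvec i) (X \<rhd> ?y)" using ip_ad_right[of "bvec i" h] h(2) by simp
 finally show "(\<Sum>j<N. coeff ?y j * coeff (h \<rhd> X \<rhd> bvec j) i) = ip ?y (X \<rhd> ?y)" .
 qed
 finally show "f X = (\<Sum>a<N. ip (h \<rhd> bvec a) (X \<rhd> h \<rhd> bvec a))" .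
 qed
qed

lemma posfun_state:
 assumes "opsys N W" "posfun W f"
 obtains \<zeta> where "!!X. X : W ==> f X = (\<Sum>a<N. ip (\<zeta> a) (X \<rhd> \<zeta> a))"
proof -
 let ?h1 = "%(i, j). rk (bvec i) (bvec j) + rk (bvec j) (bvec i)"
 let ?h2 = "%(i, j). scl \<i> (rk (bvec i) (bvec j) - rk (bvec j) (bvec i))"
 let ?B = "?h1 ` ({..<N} \<times> {..<N}) \<union> ?h2 ` ({..<N} \<times> {..<N})"
 have "b : ops N N & hermitian b" if "b : ?B" for b
 using that by (auto simp: hermitian_def scl.scale_right_diff_distrib intro!: ops_add ops_scl ops_diff ops_rk)
 then obtain W' f' where W': "opsys N W'" "posfun W' f'" "W \<subseteq> W'" "?B \<subseteq> W'" "\<forall>x\<in>W. f' x = f x"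
 using posfun_extend[OF _ _ assms, of ?B] by auto
 have "rk (bvec i) (bvec j) : W'" if "i < N" "j < N" for i j
 proof -
 have "?h1 (i, j) : W'" "?h2 (i, j) : W'" using W'(4) that by blast+
 then have "scl (1/2) (?h1 (i, j) + scl (- \<i>) (?h2 (i, j))) : W'"
 using opsysD(7,9)[OF W'(1)] by blast
 also have "scl (1/2) (?h1 (i, j) + scl (- \<i>) (?h2 (i, j))) = rk (bvec i) (bvec j)"
 by (rule aop_eqI) (simp add: smult_add_right flip: smult_add_left)
 finally show ?thesis .
 qed
 then have "X : W'" if "X : ops N N" for X
 by (subst ops_expand[OF that]) (intro opsysD(9,10)[OF W'(1)], auto)
 then have "W' = ops N N" using opsysD(1)[OF W'(1)] by blast
 then obtain \<zeta> where "!!X. X : ops N N ==> f' X = (\<Sum>a<N. ip (\<zeta> a) (X \<rhd> \<zeta> a))"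
 using posfun_form W'(2) by metis
 then show ?thesis using that W'(3,5) \<open>W' = ops N N\<close> by (metis subsetD)
qed

lemma posfun_kernel_nat:
 fixes Q :: "nat => nat => aop => complex"
 assumes T: "opsys m T" and lin: "!!i j. i < D ==> j < D ==> functional_on T (Q i j)"
 and pos: "!!t. (!!i j. i < D ==> j < D ==> t i j : T) ==> bpos {..<D} t
 ==> 0 \<le> (\<Sum>i<D. \<Sum>j<D. Q i j (t i j))"
 shows "\<exists>(q :: nat) \<zeta>. (\<forall>a i. \<zeta> a i : spc m) &
 (\<forall>i<D. \<forall>j<D. \<forall>t\<in>T. Q i j t = (\<Sum>a<q. ip (\<zeta> a i) (t \<rhd> \<zeta> a j)))"
proof -
 let ?J = "blk m"
 define W where "W = {X : ops (D * m) (D * m). \<forall>i<D. \<forall>j<D. ad (?J i) * X * ?J j : T}"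
 define f where "f X = (\<Sum>i<D. \<Sum>j<D. Q i j (ad (?J i) * X * ?J j))" for X
 have W: "opsys (D * m) W"
 unfolding opsys_def
 proof (intro conjI ballI)
 show "scl.subspace W"
 unfolding scl.subspace_def W_def using opsysD(6,7,9)[OF T]
 by (auto simp: algebra_simps)
 show "pr (D * m) : W"
 proof -
 have "ad (?J i) * pr (D * m) * ?J j = (if i = j then pr m else 0)" if "i < D" "j < D" for i j
 using that by (simp add: mult.assoc opsD(1)[OF blk_ops] ad_blk_blk)
 then show ?thesis using opsysD(3,6)[OF T] by (simp add: W_def)
 qed
 fix X assume X: "X : W"
 have "ad (ad (?J j) * X * ?J i) : T" if "i < D" "j < D" for i j
 using X that opsysD(4)[OF T] by (simp only: W_def mem_Collect_eq)
 then show "ad X : W" using X by (simp add: W_def ops_ad mult.assoc)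
 qed (auto simp: W_def)
 have "posfun W f"
 unfolding posfun_def functional_on_def
 proof (intro conjI ballI allI impI)
 fix X assume X: "X : W"
 have XT: "ad (?J i) * X * ?J j : T" if "i < D" "j < D" for i j using X that by (simp add: W_def)
 show "f (X + Y) = f X + f Y" if Y: "Y : W" for Y
 proof -
 have "Q i j (ad (?J i) * (X + Y) * ?J j) = Q i j (ad (?J i) * X * ?J j) + Q i j (ad (?J i) * Y * ?J j)"
 if "i < D" "j < D" for i j
 using lin[OF that] XT[OF that] Y that unfolding functional_on_def W_def
 by (simp add: distrib_left distrib_right)
 then show ?thesis by (simp add: f_def sum.distrib)
 qed
 show "f (scl c X) = c * f X" for c
 proof -
 have "Q i j (ad (?J i) * scl c X * ?J j) = c * Q i j (ad (?J i) * X * ?J j)"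
 if "i < D" "j < D" for i j
 using lin[OF that] XT[OF that] unfolding functional_on_def by simp
 then show ?thesis by (simp add: f_def sum_distrib_left)
 qed
 assume Xpos: "positive X"
 have "bpos {..<D} (%i j. ad (?J i) * X * ?J j)"
 unfolding bpos_def
 proof
 fix \<xi> :: "nat => complex poly"
 have "0 \<le> ip (\<Sum>i<D. ?J i \<rhd> \<xi> i) (X \<rhd> (\<Sum>i<D. ?J i \<rhd> \<xi> i))"
 using Xpos by (auto simp: positive_def)
 also have "... = (\<Sum>i<D. \<Sum>j<D. ip (\<xi> i) ((ad (?J i) * X * ?J j) \<rhd> \<xi> j))"
 by (simp add: ap_sum_right ip_sum_left ip_sum_right ip_ad_right) (rule sum.swap)
 finally show "0 \<le> (\<Sum>i<D. \<Sum>j<D. ip (\<xi> i) ((ad (?J i) * X * ?J j) \<rhd> \<xi> j))" .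
 qed
 then show "0 \<le> f X" unfolding f_def using XT by (intro pos)
 qed
 then obtain \<zeta> where \<zeta>: "!!X. X : W ==> f X = (\<Sum>a<D * m. ip (\<zeta> a) (X \<rhd> \<zeta> a))"
 using posfun_state[OF W] by blast
 show ?thesis
 proof (intro exI conjI allI impI ballI)
 show "ad (?J i) \<rhd> \<zeta> a : spc m" for a i
 by (auto simp: spc_iff coeff_ad_blk)
 fix i j t assume ij: "i < D" "j < D" and t: "t : T"
 let ?X = "?J i * t * ad (?J j)"
 have c: "ad (?J k) * ?X * ?J l = (if k = i & l = j then t else 0)" for k l
 using opsD[OF opsysD(5)[OF T t]]
 by (simp add: mult.assoc ad_blk_blk ad_blk_blk_mult)
 have "?X : ops (D * m) (D * m)"
 using ij opsysD(5)[OF T t] by (intro ops_mult[where k = m] ops_ad) auto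
 then have X: "?X : W" using opsysD(6)[OF T] t by (simp add: W_def c)
 have Q0: "Q k l 0 = 0" if "k < D" "l < D" for k l
 using lin[OF that] opsysD(6)[OF T] unfolding functional_on_def by (metis mult_zero_left scl.scale_zero_left)
 have "f ?X = (\<Sum>k<D. \<Sum>l<D. if k = i & l = j then Q i j t else 0)"
 unfolding f_def c by (intro sum.cong refl) (auto simp: Q0)
 also have "... = (\<Sum>k<D. if k = i then Q i j t else 0)"
 using ij by (intro sum.cong refl) auto
 also have "... = Q i j t" using ij by simp
 finally show "Q i j t = (\<Sum>a<D * m. ip (ad (?J i) \<rhd> \<zeta> a) (t \<rhd> ad (?J j) \<rhd> \<zeta> a))"
 using \<zeta>[OF X] by (simp add: ip_ad_left)
 qed
qed

text \<open>A family of maps that is positive on positive matrices defines a positive functional on matrices over \<open>T\<close>; the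
vectors of an extension of this functional to the full matrix algebra represent all members of the family at
once.\<close>

lemma posfun_kernel:
 assumes T: "opsys m T" and K: "finite K"
 and lin: "!!i j. i : K ==> j : K ==> functional_on T (Q i j)"
 and pos: "!!t. (!!i j. i : K ==> j : K ==> t i j : T) ==> bpos K t
 ==> 0 \<le> (\<Sum>i\<in>K. \<Sum>j\<in>K. Q i j (t i j))"
 shows "\<exists>(q :: nat) \<zeta>. (\<forall>a i. \<zeta> a i : spc m) &
 (\<forall>i\<in>K. \<forall>j\<in>K. \<forall>t\<in>T. Q i j t = (\<Sum>a<q. ip (\<zeta> a i) (t \<rhd> \<zeta> a j)))"
proof -
 let ?D = "card K"
 obtain e where e: "bij_betw e {..<?D} K" using ex_bij_betw_nat_finite[OF K] by (auto simp: atLeast0LessThan)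
 let ?i = "inv_into {..<?D} e"
 have eK: "e i : K" if "i < ?D" for i using e that by (auto simp: bij_betw_def)
 have ie: "?i (e i) = i" if "i < ?D" for i using e that by (simp add: bij_betw_def)
 have ei: "e (?i k) = k" "?i k < ?D" if "k : K" for k
 using e that by (auto simp: bij_betw_def f_inv_into_f inv_into_into[of k e "{..<?D}", simplified])
 have "0 \<le> (\<Sum>i<?D. \<Sum>j<?D. Q (e i) (e j) (t i j))"
 if t: "!!i j. i < ?D ==> j < ?D ==> t i j : T" and tp: "bpos {..<?D} t" for t
 proof -
 have "bpos K (%k l. t (?i k) (?i l))"
 unfolding bpos_reindex[OF e] using tp by (subst bpos_cong[of _ _ t]) (auto simp: ie)
 then have "0 \<le> (\<Sum>k\<in>K. \<Sum>l\<in>K. Q k l (t (?i k) (?i l)))"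
 using t ei by (intro pos) auto
 also have "... = (\<Sum>i<?D. \<Sum>j<?D. Q (e i) (e j) (t (?i (e i)) (?i (e j))))"
 by (simp add: sum.reindex_bij_betw[OF e, symmetric])
 also have "... = (\<Sum>i<?D. \<Sum>j<?D. Q (e i) (e j) (t i j))"
 by (intro sum.cong refl) (simp add: ie)
 finally show ?thesis .
 qed
 then obtain q :: nat and \<zeta> where \<zeta>: "\<forall>a i. \<zeta> a i : spc m"
 "\<forall>i<?D. \<forall>j<?D. \<forall>t\<in>T. Q (e i) (e j) t = (\<Sum>a<q. ip (\<zeta> a i) (t \<rhd> \<zeta> a j))"
 using posfun_kernel_nat[OF T, of ?D "%i j. Q (e i) (e j)"] lin eK by blast
 have "Q k l t = (\<Sum>a<q. ip (\<zeta> a (?i k)) (t \<rhd> \<zeta> a (?i l)))" if "k : K" "l : K" "t : T" for k l t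
 using \<zeta>(2)[rule_format, OF ei(2)[OF that(1)] ei(2)[OF that(2)] that(3)] ei(1) that(1,2) by simp
 then show ?thesis
 using \<zeta>(1) by (intro exI[of _ q] exI[of _ "%a k. \<zeta> a (?i k)"]) blast
qed

text \<open>Arveson's extension theorem and the Kraus decomposition for a completely positive matrix of maps \<open>\<pi> i j\<close>. One
family of operators \<open>v a i\<close> serves all entries, which ties the entries together later on.\<close>

theorem kraus_family:
 assumes T: "opsys m T" and I: "finite I"
 and lin: "!!i j. i : I ==> j : I ==> linear_on T (E i j)"
 and ops: "!!i j t. i : I ==> j : I ==> t : T ==> E i j t : ops n n"
 and cp: "!!t. (!!k l. k : I \<times> {..<n} ==> l : I \<times> {..<n} ==> t k l : T) ==> bpos (I \<times> {..<n}) t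
 ==> bpos ((I \<times> {..<n}) \<times> I) (%(k, i) (l, j). E i j (t k l))"
 obtains q :: nat and v where "!!a i. v a i : ops m n"
 "!!i j t. i : I ==> j : I ==> t : T ==> E i j t = (\<Sum>a<q. ad (v a i) * t * v a j)"
proof -
 let ?K = "I \<times> {..<n}"
 define Q where "Q = (%(i, a) (j, b) t. coeff (E i j t \<rhd> bvec b) a)"
 have "\<exists>(q :: nat) \<zeta>. (\<forall>a i. \<zeta> a i : spc m) &
 (\<forall>i\<in>?K. \<forall>j\<in>?K. \<forall>t\<in>T. Q i j t = (\<Sum>a<q. ip (\<zeta> a i) (t \<rhd> \<zeta> a j)))"
 proof (rule posfun_kernel[OF T])
 show "finite ?K" using I by simp
 show "functional_on T (Q k l)" if "k : ?K" "l : ?K" for k l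
 using that lin[of "fst k" "fst l"]
 by (auto simp: Q_def functional_on_def linear_on_def split: prod.splits)
 fix t assume t: "!!k l. k : ?K ==> l : ?K ==> t k l : T" and tp: "bpos ?K t"
 let ?\<xi> = "%(k, i). if fst k = i then bvec (snd k) else 0"
 have "bpos (?K \<times> I) (%(k, i) (l, j). E i j (t k l))" by (rule cp[OF t tp])
 then have "0 \<le> (\<Sum>p\<in>?K \<times> I. \<Sum>p'\<in>?K \<times> I. ip (?\<xi> p) ((%(k, i) (l, j). E i j (t k l)) p p' \<rhd> ?\<xi> p'))"
 unfolding bpos_def by blast
 also have "... = (\<Sum>k\<in>?K. \<Sum>i\<in>I. \<Sum>l\<in>?K. \<Sum>j\<in>I. ip (?\<xi> (k, i)) (E i j (t k l) \<rhd> ?\<xi> (l, j)))"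
 by (simp add: sum.cartesian_product' case_prod_beta)
 also have "... = (\<Sum>k\<in>?K. \<Sum>i\<in>I. if i = fst k then (\<Sum>l\<in>?K. \<Sum>j\<in>I. if j = fst l then Q k l (t k l) else 0) else 0)"
 by (intro sum.cong refl) (auto simp: Q_def intro!: sum.cong)
 also have "... = (\<Sum>k\<in>?K. \<Sum>l\<in>?K. Q k l (t k l))"
 using I by (intro sum.cong refl) (auto intro!: sum.cong)
 finally show "0 \<le> (\<Sum>k\<in>?K. \<Sum>l\<in>?K. Q k l (t k l))" .
 qed
 then obtain q :: nat and \<zeta> where \<zeta>: "!!a k. \<zeta> a k : spc m"
 "!!k l t. k : ?K ==> l : ?K ==> t : T ==> Q k l t = (\<Sum>a<q. ip (\<zeta> a k) (t \<rhd> \<zeta> a l))"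
 by blast
 define v where "v a i = (\<Sum>b<n. rk (\<zeta> a (i, b)) (bvec b))" for a i
 show ?thesis
 proof
 show "v a i : ops m n" for a i
 unfolding v_def using \<zeta>(1) by (intro ops_sum ops_rk) auto
 fix i j t assume ij: "i : I" "j : I" "t : T"
 have rk3: "rk (bvec b) \<alpha> * t * rk \<beta> (bvec c) = scl (ip \<alpha> (t \<rhd> \<beta>)) (rk (bvec b) (bvec c))" for \<alpha> \<beta> b c
 by (rule aop_eqI) (simp add: mult.commute)
 have "(\<Sum>a<q. ad (v a i) * t * v a j)
 = (\<Sum>a<q. \<Sum>b<n. \<Sum>c<n. rk (bvec b) (\<zeta> a (i, b)) * t * rk (\<zeta> a (j, c)) (bvec c))"
 by (simp only: v_def ad_sum ad_rk sum_distrib_left sum_distrib_right)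
 (intro sum.cong refl sum.swap)
 also have "... = (\<Sum>a<q. \<Sum>b<n. \<Sum>c<n. scl (ip (\<zeta> a (i, b)) (t \<rhd> \<zeta> a (j, c))) (rk (bvec b) (bvec c)))"
 by (simp only: rk3)
 also have "... = (\<Sum>b<n. \<Sum>a<q. \<Sum>c<n. scl (ip (\<zeta> a (i, b)) (t \<rhd> \<zeta> a (j, c))) (rk (bvec b) (bvec c)))"
 by (rule sum.swap)
 also have "... = (\<Sum>b<n. \<Sum>c<n. \<Sum>a<q. scl (ip (\<zeta> a (i, b)) (t \<rhd> \<zeta> a (j, c))) (rk (bvec b) (bvec c)))"
 by (intro sum.cong refl sum.swap)
 also have "... = (\<Sum>b<n. \<Sum>c<n. scl (coeff (E i j t \<rhd> bvec c) b) (rk (bvec b) (bvec c)))"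
 using \<zeta>(2)[of "(i, _)" "(j, _)" t, symmetric] ij
 by (intro sum.cong refl) (simp add: Q_def flip: scl.scale_sum_left)
 also have "... = E i j t" by (rule ops_expand[symmetric]) (rule ops[OF ij])
 finally show "E i j t = (\<Sum>a<q. ad (v a i) * t * v a j)" by simp
 qed
qed

lemma cp_all_index:
 assumes cp: "!!(p :: nat) s. (!!i j. i < p ==> j < p ==> s i j : S) ==> bpos {..<p} s ==> bpos {..<p} (%i j. \<pi> (s i j))"
 and "finite K" "!!i j. i : K ==> j : K ==> s i j : S" "bpos K s"
 shows "bpos K (%i j. \<pi> (s i j))"
proof -
 obtain e where e: "bij_betw e {..<card K} K"
 using ex_bij_betw_nat_finite[OF assms(2)] by (auto simp: atLeast0LessThan)
 have "e i : K" if "i < card K" for i using e that by (auto simp: bij_betw_def)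
 then show ?thesis
 using assms(3,4) unfolding bpos_reindex[OF e] by (intro cp) auto
qed

definition cpmap :: "aop set => (aop => aop) => bool" where
 "cpmap S \<pi> \<longleftrightarrow> linear_on S \<pi> &
 (\<forall>(p :: nat) s. (\<forall>i<p. \<forall>j<p. s i j : S) --> bpos {..<p} s --> bpos {..<p} (%i j. \<pi> (s i j)))"

theorem kraus_map:
 assumes S: "opsys m S" and cp: "cpmap S \<pi>" and ops: "!!s. s : S ==> \<pi> s : ops n n"
 obtains q :: nat and v where "!!a. v a : ops m n" "!!s. s : S ==> \<pi> s = (\<Sum>a<q. ad (v a) * s * v a)"
proof -
 have "bpos ((UNIV \<times> {..<n}) \<times> (UNIV :: unit set)) (%(k, i) (l, j). \<pi> (t k l))"
 if "!!k l. k : UNIV \<times> {..<n} ==> l : UNIV \<times> {..<n} ==> t k l : S" "bpos (UNIV \<times> {..<n}) t"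
 for t :: "unit \<times> nat => unit \<times> nat => aop"
 proof -
 have "bpos (UNIV \<times> {..<n}) (%k l. \<pi> (t k l))"
 by (rule cp_all_index[where S = S]) (use cp that in \<open>auto simp: cpmap_def\<close>)
 moreover have "bij_betw fst ((UNIV \<times> {..<n}) \<times> (UNIV :: unit set)) ((UNIV :: unit set) \<times> {..<n})"
 by (auto simp: bij_betw_def inj_on_def)
 ultimately show ?thesis
 by (simp add: bpos_reindex case_prod_beta')
 qed
 note cp' = this
 show ?thesis
 proof (rule kraus_family[OF S, of "UNIV :: unit set" "%_ _. \<pi>" n])
 show "linear_on S \<pi>" using cp by (simp add: cpmap_def)
 fix q :: nat and v
 assume v: "!!a i. v a i : ops m n"
 "!!i j t. i : UNIV ==> j : UNIV ==> t : S ==> \<pi> t = (\<Sum>a<q. ad (v a (i :: unit)) * t * v a j)"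
 show thesis
 by (rule that[of "%a. v a ()" q]) (use v in auto)
 qed (use ops cp' in auto)
qed

section \<open>Rigidity of incompressible operator systems\<close>

definition vsub :: "nat => complex poly set => bool" where
 "vsub n G \<longleftrightarrow> G \<subseteq> spc n & 0 : G & (\<forall>\<xi>\<in>G. \<forall>\<eta>\<in>G. \<xi> + \<eta> : G) & (\<forall>c. \<forall>\<xi>\<in>G. smult c \<xi> : G)"

lemma vsubD:
 assumes "vsub n G"
 shows "\<xi> : G ==> \<xi> : spc n" "0 : G" "\<xi> : G ==> \<eta> : G ==> \<xi> + \<eta> : G"
 "\<xi> : G ==> smult c \<xi> : G" "\<xi> : G ==> \<eta> : G ==> \<xi> - \<eta> : G"
proof -
 show "\<xi> : G ==> \<xi> : spc n" "0 : G" "\<xi> : G ==> \<eta> : G ==> \<xi> + \<eta> : G"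
 "\<xi> : G ==> smult c \<xi> : G"
 using assms by (auto simp: vsub_def)
 assume "\<xi> : G" "\<eta> : G"
 then have "\<xi> + smult (-1) \<eta> : G" using assms unfolding vsub_def by blast
 then show "\<xi> - \<eta> : G" by simp
qed

lemma vsub_sum: "vsub n G ==> (!!a. a : A ==> f a : G) ==> sum f A : G"
 by (induction A rule: infinite_finite_induct) (auto simp: vsubD(2,3))

lemma vsub_spc: "vsub n (spc n)"
 by (simp add: vsub_def)

lemma vsub_zero: "vsub n {0}"
 by (simp add: vsub_def)

lemma vsub_plus:
 assumes "vsub n F" "vsub n G"
 shows "vsub n {f + g | f g. f : F & g : G}"
 unfolding vsub_def
proof (intro conjI ballI allI)
 show "{f + g | f g. f : F & g : G} \<subseteq> spc n" using vsubD(1)[OF assms(1)] vsubD(1)[OF assms(2)] by auto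
 show "0 : {f + g | f g. f : F & g : G}"
 using vsubD(2)[OF assms(1)] vsubD(2)[OF assms(2)] by force
 fix x assume "x : {f + g | f g. f : F & g : G}"
 then obtain f g where x: "x = f + g" "f : F" "g : G" by blast
 show "smult c x : {f + g | f g. f : F & g : G}" for c
 using x vsubD(4)[OF assms(1), of f c] vsubD(4)[OF assms(2), of g c] by (auto simp: smult_add_right)
 fix y assume "y : {f + g | f g. f : F & g : G}"
 then obtain f' g' where y: "y = f' + g'" "f' : F" "g' : G" by blast
 have "x + y = (f + f') + (g + g')" by (simp add: x y)
 then show "x + y : {f + g | f g. f : F & g : G}"
 using x y vsubD(3)[OF assms(1), of f f'] vsubD(3)[OF assms(2), of g g'] by blast
qed

lemma subset_plus_left: "vsub n G ==> F \<subseteq> {f + g | f g. f : F & g : G}"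
proof
 fix f assume "vsub n G" "f : F"
 then have "f = f + 0 & f : F & 0 : G" by (simp add: vsubD(2))
 then show "f : {f + g | f g. f : F & g : G}" by blast
qed

lemma subset_plus_right: "vsub n F ==> G \<subseteq> {f + g | f g. f : F & g : G}"
proof
 fix g assume "vsub n F" "g : G"
 then have "g = 0 + g & 0 : F & g : G" by (simp add: vsubD(2))
 then show "g : {f + g | f g. f : F & g : G}" by blast
qed

lemma vsub_eigen: "X : ops n n ==> c ~= 0 ==> vsub n {\<xi>. X \<rhd> \<xi> = smult c \<xi>}"
 unfolding vsub_def
proof (intro conjI subsetI)
 fix \<xi> assume X: "X : ops n n" "c ~= 0" "\<xi> : {\<xi>. X \<rhd> \<xi> = smult c \<xi>}"
 then have "\<xi> = smult (inverse c) (X \<rhd> \<xi>)" by simp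
 then show "\<xi> : spc n" using X(1) by (metis ops_ap spc_smult)
qed (auto simp: smult_add_right mult.commute)

lemma sqn_spc: "\<xi> : spc n ==> sqn \<xi> = (\<Sum>i<n. (cmod (coeff \<xi> i))\<^sup>2)"
 using ip_eq_sum[of n \<xi> \<xi>] unfolding sqn_def spc_iff
 by (simp add: cmod_power2) (simp add: power2_eq_square sum.distrib)

lemma sqn_bvec [simp]: "sqn (bvec i) = 1"
 by (simp add: sqn_def coeff_bvec)

text \<open>Comparison of traces: the columns of \<open>J\<close> have norm one and the rows norm at most one.\<close>

lemma isometry_le:
 assumes J: "J : ops n d" "ad J * J = pr d"
 shows "d \<le> n"
proof -
 have 1: "sqn (J \<rhd> bvec i) = 1" if "i < d" for i
 proof -
 have "ip (J \<rhd> bvec i) (J \<rhd> bvec i) = ip (bvec i) ((ad J * J) \<rhd> bvec i)" by (simp add: ip_ad_right)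
 then show ?thesis using that by (simp add: J(2) sqn_def coeff_bvec)
 qed
 have 2: "sqn (ad J \<rhd> \<xi>) \<le> sqn \<xi>" for \<xi>
 proof -
 have "ip (J \<rhd> ad J \<rhd> \<xi>) (J \<rhd> ad J \<rhd> \<xi>) = ip (ad J \<rhd> \<xi>) ((ad J * J) \<rhd> ad J \<rhd> \<xi>)"
 by (simp add: ip_ad_right)
 also have "... = ip (ad J \<rhd> \<xi>) (ad J \<rhd> \<xi>)"
 using ops_ap[OF ops_ad[OF J(1)]] by (simp add: J(2) spc_def)
 finally have "sqn (\<xi> - J \<rhd> ad J \<rhd> \<xi>) = sqn \<xi> - sqn (ad J \<rhd> \<xi>)"
 by (simp add: sqn_def ip_ad_left ip_ad_right[symmetric])
 then show ?thesis using sqn_nonneg[of "\<xi> - J \<rhd> ad J \<rhd> \<xi>"] by simp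
 qed
 have c: "cmod (coeff (J \<rhd> bvec i) j) = cmod (coeff (ad J \<rhd> bvec j) i)" for i j
 proof -
 have "coeff (J \<rhd> bvec i) j = cnj (coeff (ad J \<rhd> bvec j) i)"
 using ip_ad_left[of J "bvec j" "bvec i"] by simp
 then show ?thesis by simp
 qed
 have "real d = (\<Sum>i<d. sqn (J \<rhd> bvec i))" by (simp add: 1)
 also have "... = (\<Sum>i<d. \<Sum>j<n. (cmod (coeff (J \<rhd> bvec i) j))\<^sup>2)"
 by (intro sum.cong refl sqn_spc) (rule ops_ap[OF J(1)])
 also have "... = (\<Sum>j<n. \<Sum>i<d. (cmod (coeff (ad J \<rhd> bvec j) i))\<^sup>2)"
 unfolding c by (rule sum.swap)
 also have "... = (\<Sum>j<n. sqn (ad J \<rhd> bvec j))"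
 by (intro sum.cong refl sqn_spc[symmetric]) (rule ops_ap[OF ops_ad[OF J(1)]])
 also have "... \<le> (\<Sum>j<n. 1)" by (intro sum_mono) (metis 2 sqn_bvec)
 finally show ?thesis by simp
qed

definition isoin :: "nat => complex poly set => nat => bool" where
 "isoin n G d \<longleftrightarrow> (\<exists>J. J : ops n d & ad J * J = pr d & (\<forall>\<xi>. J \<rhd> \<xi> : G))"

text \<open>Dimension, defined by the isometries into the subspace.\<close>

definition vdim :: "nat => complex poly set => nat" where
 "vdim n G = (GREATEST d. isoin n G d)"

lemma isoin_le: "isoin n G d ==> d \<le> n"
 unfolding isoin_def using isometry_le by blast

lemma isoin_vdim: "vsub n G ==> isoin n G (vdim n G)"
 unfolding vdim_def
proof (rule GreatestI_nat)
 assume "vsub n G"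
 then show "isoin n G 0"
 unfolding isoin_def by (intro exI[of _ 0]) (simp add: vsubD(2))
qed (rule isoin_le)

lemma le_vdim: "isoin n G d ==> d \<le> vdim n G"
 unfolding vdim_def by (rule Greatest_le_nat[where b = n]) (auto dest: isoin_le)

lemma pr_Suc: "pr (Suc d) = pr d + rk (bvec d) (bvec d)"
 by (simp add: pr_def)

lemma isoin_extend:
 assumes G: "vsub n G" and J: "J : ops n d" "ad J * J = pr d" "!!\<xi>. J \<rhd> \<xi> : G"
 and \<xi>: "\<xi> : G" "J \<rhd> ad J \<rhd> \<xi> ~= \<xi>"
 shows "isoin n G (Suc d)"
proof -
 define \<eta>' where "\<eta>' = \<xi> - J \<rhd> ad J \<rhd> \<xi>"
 define \<eta> where "\<eta> = smult (complex_of_real (1 / sqrt (sqn \<eta>'))) \<eta>'"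
 have "\<eta>' ~= 0" using \<xi>(2) by (simp add: \<eta>'_def)
 then have \<eta>1: "ip \<eta> \<eta> = 1"
 using sqn_pos[of \<eta>'] by (simp add: \<eta>_def ip_self norm_divide power_divide)
 have "\<eta>' : G" unfolding \<eta>'_def using \<xi>(1) J(3) vsubD(5)[OF G] by blast
 then have \<eta>G: "\<eta> : G" unfolding \<eta>_def by (rule vsubD(4)[OF G])
 have "ad J \<rhd> \<eta>' = 0"
 proof -
 have "ad J \<rhd> J \<rhd> ad J \<rhd> \<xi> = (ad J * J) \<rhd> ad J \<rhd> \<xi>" by simp
 also have "... = ad J \<rhd> \<xi>" using ops_ap[OF ops_ad[OF J(1)]] by (simp add: J(2) spc_def)
 finally show ?thesis by (simp add: \<eta>'_def)
 qed
 then have J\<eta>: "ad J \<rhd> \<eta> = 0" by (simp add: \<eta>_def)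
 have Jd: "J \<rhd> bvec d = 0"
 using ops_ap_pr[OF J(1), of "bvec d"] by (metis ap_0_right coeff_bvec coeff_pr coeff_0 poly_eqI less_irrefl)
 let ?J = "J + rk \<eta> (bvec d)"
 show ?thesis
 unfolding isoin_def
 proof (intro exI conjI allI)
 have J': "J : ops n (Suc d)"
 proof -
 have "J * pr (Suc d) = J"
 using opsD(2)[OF J(1)] by (simp add: pr_Suc distrib_left mult_rk Jd) (metis aop_eqI ap_rk ap_simps(5) smult_0_right)
 then show ?thesis using opsD(1)[OF J(1)] by (simp add: ops_def)
 qed
 then show "?J : ops n (Suc d)"
 using vsubD(1)[OF G \<eta>G] by (intro ops_add ops_rk) auto
 have z: "rk 0 \<alpha> = 0" "rk \<alpha> 0 = 0" for \<alpha> by (rule aop_eqI; simp)+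
 have "ad J * rk \<eta> (bvec d) = 0" by (simp add: mult_rk J\<eta> z)
 moreover have "rk (bvec d) \<eta> * J = 0" by (simp add: rk_mult J\<eta> z)
 moreover have "rk (bvec d) \<eta> * rk \<eta> (bvec d) = rk (bvec d) (bvec d)" by (simp add: rk_mult_rk \<eta>1)
 ultimately show "ad ?J * ?J = pr (Suc d)"
 by (simp add: algebra_simps J(2) pr_Suc)
 show "?J \<rhd> \<zeta> : G" for \<zeta>
 using J(3) \<eta>G vsubD(3,4)[OF G] by simp
 qed
qed

lemma vdim_strict_mono:
 assumes "vsub n G" "vsub n G'" "G \<subseteq> G'" "\<xi> : G'" "\<xi> \<notin> G"
 shows "vdim n G < vdim n G'"
proof -
 obtain J where J: "J : ops n (vdim n G)" "ad J * J = pr (vdim n G)" "!!\<xi>. J \<rhd> \<xi> : G"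
 using isoin_vdim[OF assms(1)] by (auto simp: isoin_def)
 have "isoin n G' (Suc (vdim n G))"
 proof (rule isoin_extend[OF assms(2) J(1,2) _ assms(4)])
 show "J \<rhd> \<xi> : G'" for \<xi> using J(3) assms(3) by blast
 show "J \<rhd> ad J \<rhd> \<xi> ~= \<xi>" using J(3)[of "ad J \<rhd> \<xi>"] assms(5) by metis
 qed
 then show ?thesis using le_vdim by force
qed

lemma isometry_onto:
 assumes "vsub n G"
 obtains J where "J : ops n (vdim n G)" "ad J * J = pr (vdim n G)" "!!\<xi>. J \<rhd> \<xi> : G"
 "!!\<xi>. \<xi> : G ==> J \<rhd> ad J \<rhd> \<xi> = \<xi>"
proof -
 obtain J where J: "J : ops n (vdim n G)" "ad J * J = pr (vdim n G)" "!!\<xi>. J \<rhd> \<xi> : G"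
 using isoin_vdim[OF assms(1)] by (auto simp: isoin_def)
 moreover have "J \<rhd> ad J \<rhd> \<xi> = \<xi>" if "\<xi> : G" for \<xi>
 using isoin_extend[OF assms J that] le_vdim[of n G "Suc (vdim n G)"] by fastforce
 ultimately show ?thesis using that by blast
qed

lemma vdim_le: "vsub n G ==> vdim n G \<le> n"
 using isoin_vdim isoin_le by blast

lemma vdim_less: "vsub n G ==> G ~= spc n ==> vdim n G < n"
proof -
 assume G: "vsub n G" "G ~= spc n"
 then obtain \<xi> where "\<xi> : spc n" "\<xi> \<notin> G" using vsubD(1) by blast
 then have "vdim n G < vdim n (spc n)"
 using vdim_strict_mono[OF G(1) vsub_spc] vsubD(1)[OF G(1)] by blast
 then show ?thesis using vdim_le[OF vsub_spc] by (meson less_le_trans)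
qed

text \<open>Replaces Zorn's lemma in finite dimension.\<close>

lemma max_vdim:
 assumes "good G0" "!!G. good G ==> vsub n G"
 shows "\<exists>G. good G & (\<forall>G'. good G' --> vdim n G' \<le> vdim n G)"
proof (rule ex_has_greatest_nat[of good, OF assms(1)])
 show "\<forall>G. good G --> vdim n G < Suc n"
 using assms(2) vdim_le by (simp add: less_Suc_eq_le)
qed

text \<open>No compression to a space of smaller dimension is a complete order embedding.\<close>

definition incompressible :: "nat => aop set => bool" where
 "incompressible n S \<longleftrightarrow> (\<forall>d J. J : ops n d & ad J * J = pr d &
 (\<forall>(p :: nat) s. (\<forall>i<p. \<forall>j<p. s i j : S & ad (s i j) = s j i) &
 bpos {..<p} (%i j. ad J * s i j * J) --> bpos {..<p} s) --> n \<le> d)"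

text \<open>If \<open>c\<close> is the least eigenvalue of \<open>X\<close> and \<open>\<xi>\<close> an eigenvector, the vectors \<open>z a \<rhd> \<xi>\<close> must all attain the minimum
of the form of \<open>X\<close>.\<close>

lemma eigenspace_invariant:
 assumes "finite A" "(\<Sum>a\<in>A. ip (z a \<rhd> \<xi>) (X \<rhd> z a \<rhd> \<xi>)) = ip \<xi> (X \<rhd> \<xi>)"
 "(\<Sum>a\<in>A. ip (z a \<rhd> \<xi>) (z a \<rhd> \<xi>)) = ip \<xi> \<xi>" "X \<rhd> \<xi> = smult c \<xi>"
 "positive (X - scl c 1)" "a : A"
 shows "X \<rhd> z a \<rhd> \<xi> = smult c (z a \<rhd> \<xi>)"
proof -
 let ?Y = "X - scl c 1"
 have "(\<Sum>a\<in>A. ip (z a \<rhd> \<xi>) (?Y \<rhd> z a \<rhd> \<xi>)) = 0"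
 using assms(2-4) by (simp add: sum_subtractf flip: sum_distrib_left)
 moreover have "0 \<le> ip (z a \<rhd> \<xi>) (?Y \<rhd> z a \<rhd> \<xi>)" for a
 using assms(5) unfolding positive_def by blast
 ultimately have "ip (z a \<rhd> \<xi>) (?Y \<rhd> z a \<rhd> \<xi>) = 0"
 using assms(1,6) by (subst (asm) sum_nonneg_eq_0_iff) auto
 then have "?Y \<rhd> z a \<rhd> \<xi> = 0" by (rule positive_kernel[OF assms(5)])
 then show ?thesis by simp
qed

lemma sum_ip_eq:
 "(\<Sum>a\<in>A. ip (z a \<rhd> \<xi>) (X \<rhd> z a \<rhd> \<eta>)) = ip \<xi> ((\<Sum>a\<in>A. ad (z a) * X * z a) \<rhd> \<eta>)"
 by (simp add: ap_sum_left ip_sum_right ip_ad_right)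

lemma sum_ip_eq1:
 "(\<Sum>a\<in>A. ip (z a \<rhd> \<xi>) (z a \<rhd> \<eta>)) = ip \<xi> ((\<Sum>a\<in>A. ad (z a) * z a) \<rhd> \<eta>)"
 by (simp add: ap_sum_left ip_sum_right ip_ad_right)

definition invariant :: "nat => 'a set => ('a => aop) => complex poly set => bool" where
 "invariant n A z G \<longleftrightarrow> vsub n G & (\<forall>a\<in>A. \<forall>\<xi>\<in>G. z a \<rhd> \<xi> : G)"

lemma invariant_plus:
 assumes "invariant n A z F" "invariant n A z G"
 shows "invariant n A z {f + g | f g. f : F & g : G}"
 using assms vsub_plus[of n F G] unfolding invariant_def by fastforce

lemma bop_mult_diag:
 assumes "!!i j. i < p ==> j < p ==> s i j : ops m m" "z : ops m m"
 shows "ad (bop m p (%i j. if i = j then z else 0)) * bop m p s * bop m p (%i j. if i = j then z else 0)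
 = bop m p (%i j. ad z * s i j * z)"
 and "k < p ==> ad (blk m k) * bop m p (%i j. if i = j then z else 0) = z * ad (blk m k)"
proof -
 have diag: "bop m p (%i j. if i = j then z else 0) = (\<Sum>i<p. blk m i * z * ad (blk m i))"
 unfolding bop_def by (intro sum.cong refl) (auto simp: if_distrib if_distribR cong: if_cong)
 show comm: "ad (blk m k) * bop m p (%i j. if i = j then z else 0) = z * ad (blk m k)" if "k < p" for k
 proof -
 have "ad (blk m k) * bop m p (%i j. if i = j then z else 0) = (\<Sum>i<p. if i = k then z * ad (blk m k) else 0)"
 unfolding diag sum_distrib_left
 by (intro sum.cong refl) (auto simp: mult.assoc ad_blk_blk_mult ops_mult_pr[OF assms(2)])
 then show ?thesis using that by simp
 qed
 have comm': "ad (bop m p (%i j. if i = j then z else 0)) * blk m k = blk m k * ad z" if "k < p" for k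
 using comm[OF that] by (metis ad_simps(1,8))
 show "ad (bop m p (%i j. if i = j then z else 0)) * bop m p s * bop m p (%i j. if i = j then z else 0)
 = bop m p (%i j. ad z * s i j * z)" (is "ad ?Z * _ * _ = _")
 proof -
 have "ad ?Z * bop m p s * ?Z = (\<Sum>i<p. \<Sum>j<p. ad ?Z * blk m i * s i j * (ad (blk m j) * ?Z))"
 by (simp add: bop_def[of m p s] sum_distrib_left sum_distrib_right mult.assoc)
 also have "... = (\<Sum>i<p. \<Sum>j<p. blk m i * (ad z * s i j * z) * ad (blk m j))"
 by (intro sum.cong refl) (simp add: comm comm' mult.assoc)
 finally show ?thesis by (simp add: bop_def[of m p "%i j. ad z * s i j * z"])
 qed
qed

text \<open>\<open>S\<close> is fixed by the unital completely positive map with Kraus operators \<open>z a\<close>.\<close>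

locale fixed_operators =
 fixes n :: nat and S :: "aop set" and A :: "'a set" and z :: "'a => aop"
 assumes S: "opsys n S" and inc: "incompressible n S" and A: "finite A"
 and z: "!!a. a : A ==> z a : ops n n"
 and fixed: "!!s. s : S ==> (\<Sum>a\<in>A. ad (z a) * s * z a) = s"
begin

abbreviation "zinv \<equiv> invariant n A z"

lemma inv_vsub: "zinv G ==> vsub n G" by (simp add: invariant_def)

lemma sum_z: "(\<Sum>a\<in>A. ad (z a) * z a) = pr n"
proof -
 have "(\<Sum>a\<in>A. ad (z a) * z a) = (\<Sum>a\<in>A. ad (z a) * pr n * z a)"
 by (intro sum.cong refl) (simp add: opsD(1)[OF z] mult.assoc)
 then show ?thesis using fixed[of "pr n"] opsysD(3)[OF S] by simp
qed

text \<open>As \<open>S\<close> cannot be compressed to \<open>G\<close>, some matrix over \<open>S\<close> is positive on \<open>G\<close> but not positive. Its eigenspace for the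
least eigenvalue is invariant under the Kraus operators and meets the copies of \<open>G\<close> trivially. A coordinate
of suitable vectors of this eigenspace produces the required subspace.\<close>

lemma transversal:
 assumes G: "zinv G" "G ~= spc n"
 obtains L where "zinv L" "L ~= {0}" "L \<inter> G = {0}"
proof -
 note vG = inv_vsub[OF G(1)]
 obtain J where J: "J : ops n (vdim n G)" "ad J * J = pr (vdim n G)" "!!\<xi>. J \<rhd> \<xi> : G"
 "!!\<xi>. \<xi> : G ==> J \<rhd> ad J \<rhd> \<xi> = \<xi>"
 by (rule isometry_onto[OF vG]) (rule that; assumption)
 have "\<not> n \<le> vdim n G" using vdim_less[OF vG G(2)] by simp
 then obtain p :: nat and s where s: "!!i j. i < p ==> j < p ==> s i j : S"
 "!!i j. i < p ==> j < p ==> ad (s i j) = s j i"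
 and sJ: "bpos {..<p} (%i j. ad J * s i j * J)" and s_neg: "\<not> bpos {..<p} s"
 using inc J(1,2) unfolding incompressible_def by metis
 have s_ops: "s i j : ops n n" if "i < p" "j < p" for i j
 using s(1)[OF that] opsysD(1)[OF S] by blast
 define X where "X = bop n p s"
 define Z where "Z a = bop n p (%i j. if i = j then z a else 0)" for a
 have X_ops: "X : ops (p * n) (p * n)" unfolding X_def by (rule bop_ops[OF s_ops])
 have "hermitian X"
 unfolding hermitian_def X_def ad_bop unfolding bop_def by (intro sum.cong refl) (simp add: s(2))
 moreover have "\<not> positive X" unfolding X_def using s_neg by (simp add: positive_bop_iff[OF s_ops])
 ultimately obtain l \<xi>0 where l: "l < 0" "positive (X - scl (complex_of_real l) 1)" "\<xi>0 ~= 0"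
 "X \<rhd> \<xi>0 = smult (complex_of_real l) \<xi>0"
 using min_eigenvalue[OF X_ops] by blast
 define F where "F = {\<xi>. X \<rhd> \<xi> = smult (complex_of_real l) \<xi>}"
 have vF: "vsub (p * n) F" unfolding F_def by (rule vsub_eigen[OF X_ops]) (use l in simp)
 have ZX: "(\<Sum>a\<in>A. ad (Z a) * X * Z a) = X"
 proof -
 have "(\<Sum>a\<in>A. ad (Z a) * X * Z a) = (\<Sum>a\<in>A. bop n p (%i j. ad (z a) * s i j * z a))"
 unfolding Z_def X_def by (intro sum.cong refl bop_mult_diag(1) s_ops z)
 also have "... = (\<Sum>i<p. \<Sum>j<p. \<Sum>a\<in>A. blk n i * (ad (z a) * s i j * z a) * ad (blk n j))"
 unfolding bop_def by (subst sum.swap, intro sum.cong refl, rule sum.swap)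
 also have "... = (\<Sum>i<p. \<Sum>j<p. blk n i * (\<Sum>a\<in>A. ad (z a) * s i j * z a) * ad (blk n j))"
 by (simp only: sum_distrib_left sum_distrib_right)
 also have "... = X" unfolding X_def bop_def by (intro sum.cong refl) (simp add: fixed s(1))
 finally show ?thesis .
 qed
 have blkZ: "ad (blk n k) \<rhd> Z a \<rhd> \<zeta> = z a \<rhd> ad (blk n k) \<rhd> \<zeta>" if "k < p" "a : A" for k a \<zeta>
 using bop_mult_diag(2)[of p s n "z a" k, OF s_ops z[OF that(2)] that(1)]
 by (metis Z_def ap_simps(1))
 have spcp: "ip \<zeta> \<eta> = (\<Sum>k<p. ip (ad (blk n k) \<rhd> \<zeta>) (ad (blk n k) \<rhd> \<eta>))" if "\<eta> : spc (p * n)" for \<zeta> \<eta>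
 proof -
 have "ip \<zeta> ((\<Sum>k<p. blk n k * ad (blk n k)) \<rhd> \<eta>) = (\<Sum>k<p. ip (ad (blk n k) \<rhd> \<zeta>) (ad (blk n k) \<rhd> \<eta>))"
 by (simp add: ap_sum_left ip_sum_right ip_ad_left)
 then show ?thesis using that by (simp add: sum_blk_ad_blk spc_def)
 qed
 have Zspc: "Z a \<rhd> \<zeta> : spc (p * n)" if "a : A" for a \<zeta>
 unfolding Z_def by (rule ops_ap[of _ _ "p * n"], rule bop_ops) (use z[OF that] in auto)
 have FZ: "Z a \<rhd> \<zeta> : F" if "\<zeta> : F" "a : A" for a \<zeta>
 proof -
 have \<zeta>: "\<zeta> : spc (p * n)" "X \<rhd> \<zeta> = smult (complex_of_real l) \<zeta>"
 using that vsubD(1)[OF vF] by (auto simp: F_def)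
 have "(\<Sum>a\<in>A. ip (Z a \<rhd> \<zeta>) (Z a \<rhd> \<zeta>)) = (\<Sum>a\<in>A. \<Sum>k<p. ip (z a \<rhd> ad (blk n k) \<rhd> \<zeta>) (z a \<rhd> ad (blk n k) \<rhd> \<zeta>))"
 by (intro sum.cong refl) (simp add: spcp[OF Zspc] blkZ)
 also have "... = (\<Sum>k<p. \<Sum>a\<in>A. ip (z a \<rhd> ad (blk n k) \<rhd> \<zeta>) (z a \<rhd> ad (blk n k) \<rhd> \<zeta>))"
 by (rule sum.swap)
 also have "... = (\<Sum>k<p. ip (ad (blk n k) \<rhd> \<zeta>) (ad (blk n k) \<rhd> \<zeta>))"
 proof (intro sum.cong refl)
 fix k assume "k : {..<p}"
 then have "ad (blk n k) \<rhd> \<zeta> : spc n" by auto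
 then show "(\<Sum>a\<in>A. ip (z a \<rhd> ad (blk n k) \<rhd> \<zeta>) (z a \<rhd> ad (blk n k) \<rhd> \<zeta>)) = ip (ad (blk n k) \<rhd> \<zeta>) (ad (blk n k) \<rhd> \<zeta>)"
 unfolding sum_ip_eq1 sum_z by (simp add: spc_def)
 qed
 also have "... = ip \<zeta> \<zeta>" by (rule spcp[OF \<zeta>(1), symmetric])
 finally have "X \<rhd> Z a \<rhd> \<zeta> = smult (complex_of_real l) (Z a \<rhd> \<zeta>)"
 using A that(2) \<zeta>(2) l(2) ZX by (intro eigenspace_invariant[where A = A]) (auto simp: sum_ip_eq)
 then show ?thesis by (simp add: F_def)
 qed
 define good where "good F' \<longleftrightarrow> vsub (p * n) F' & F' \<subseteq> F & F' ~= {0} & (\<forall>a\<in>A. \<forall>\<zeta>\<in>F'. Z a \<rhd> \<zeta> : F')" for F'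
 have "good F" unfolding good_def using vF l FZ by (auto simp: F_def)
 from ex_has_least_nat[of good F "vdim (p * n)", OF this]
 obtain F' where F': "good F'" "!!F''. good F'' ==> vdim (p * n) F' \<le> vdim (p * n) F''"
 by (elim exE conjE) simp
 have vF': "vsub (p * n) F'" and F'F: "F' \<subseteq> F" and F'0: "F' ~= {0}"
 and F'Z: "!!a \<zeta>. a : A ==> \<zeta> : F' ==> Z a \<rhd> \<zeta> : F'"
 using F'(1) by (auto simp: good_def)
 obtain \<zeta>0 where \<zeta>0: "\<zeta>0 : F'" "\<zeta>0 ~= 0" using F'0 vsubD(2)[OF vF'] by blast
 have "\<exists>k<p. ad (blk n k) \<rhd> \<zeta>0 \<notin> G"
 proof (rule ccontr)
 assume "\<not> ?thesis"
 then have inG: "ad (blk n k) \<rhd> \<zeta>0 = J \<rhd> ad J \<rhd> ad (blk n k) \<rhd> \<zeta>0" if "k < p" for k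
 using J(4) that by simp
 have "0 \<le> (\<Sum>i<p. \<Sum>j<p. ip (ad J \<rhd> ad (blk n i) \<rhd> \<zeta>0) ((ad J * s i j * J) \<rhd> ad J \<rhd> ad (blk n j) \<rhd> \<zeta>0))"
 using sJ[unfolded bpos_def, rule_format, of "%i. ad J \<rhd> ad (blk n i) \<rhd> \<zeta>0"] .
 also have "... = ip \<zeta>0 (X \<rhd> \<zeta>0)"
 unfolding X_def ip_bop by (intro sum.cong refl) (simp add: ip_ad_right inG[symmetric])
 also have "... = complex_of_real (l * sqn \<zeta>0)"
 using \<zeta>0 F'F by (auto simp: F_def ip_self)
 finally show False using l(1) sqn_pos[OF \<zeta>0(2)] by (simp add: complex_nonneg_iff mult_less_0_iff zero_le_mult_iff)
 qed
 then obtain k where k: "k < p" "ad (blk n k) \<rhd> \<zeta>0 \<notin> G" by blast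
 define F'' where "F'' = {\<zeta> : F'. ad (blk n k) \<rhd> \<zeta> : G}"
 have vF'': "vsub (p * n) F''"
 unfolding vsub_def F''_def using vsubD[OF vF'] vsubD[OF vG] by auto
 have F''0: "F'' = {0}"
 proof (rule ccontr)
 assume "F'' ~= {0}"
 moreover have "Z a \<rhd> \<zeta> : F''" if "a : A" "\<zeta> : F''" for a \<zeta>
 using that F'Z G(1) k(1) by (auto simp: F''_def blkZ invariant_def)
 ultimately have "good F''" unfolding good_def using vF'' F'F by (auto simp: F''_def)
 then have "vdim (p * n) F' \<le> vdim (p * n) F''" by (rule F'(2))
 moreover have "vdim (p * n) F'' < vdim (p * n) F'"
 by (rule vdim_strict_mono[OF vF'' vF' _ \<zeta>0(1)]) (use k in \<open>auto simp: F''_def\<close>)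
 ultimately show False by simp
 qed
 define L where "L = (%\<zeta>. ad (blk n k) \<rhd> \<zeta>) ` F'"
 show ?thesis
 proof (rule that)
 have "vsub n L"
 unfolding vsub_def L_def
 proof (intro conjI ballI allI)
 show "(%\<zeta>. ad (blk n k) \<rhd> \<zeta>) ` F' \<subseteq> spc n" using k(1) by auto
 show "0 : (%\<zeta>. ad (blk n k) \<rhd> \<zeta>) ` F'"
 using vsubD(2)[OF vF'] by (metis ap_0_right imageI)
 fix x assume x: "x : (%\<zeta>. ad (blk n k) \<rhd> \<zeta>) ` F'"
 show "smult c x : (%\<zeta>. ad (blk n k) \<rhd> \<zeta>) ` F'" for c
 using x vsubD(4)[OF vF'] by (auto simp flip: ap_smult_right)
 fix y assume "y : (%\<zeta>. ad (blk n k) \<rhd> \<zeta>) ` F'"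
 then show "x + y : (%\<zeta>. ad (blk n k) \<rhd> \<zeta>) ` F'"
 using x vsubD(3)[OF vF'] by (auto simp flip: ap_add_right)
 qed
 then show "zinv L"
 unfolding invariant_def L_def using F'Z k(1) by (auto simp flip: blkZ)
 have "ad (blk n k) \<rhd> \<zeta>0 ~= 0" using k(2) vsubD(2)[OF vG] by metis
 then show "L ~= {0}" unfolding L_def using \<zeta>0(1) by blast
 show "L \<inter> G = {0}"
 proof
 show "L \<inter> G \<subseteq> {0}"
 proof
 fix x assume "x : L \<inter> G"
 then obtain \<zeta> where "\<zeta> : F''" "x = ad (blk n k) \<rhd> \<zeta>" by (auto simp: L_def F''_def)
 then show "x : {0}" using F''0 by simp
 qed
 show "{0} \<subseteq> L \<inter> G" using vsubD(2)[OF vF'] vsubD(2)[OF vG] unfolding L_def by force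
 qed
 qed
qed

text \<open>A maximal invariant \<open>G\<close> with \<open>F \<inter> G = 0\<close> is a complement: otherwise \<open>F + G\<close> has a transversal invariant subspace by
which \<open>G\<close> could be enlarged.\<close>

lemma complement:
 assumes F: "zinv F"
 obtains G where "zinv G" "F \<inter> G = {0}" "spc n = {f + g | f g. f : F & g : G}"
proof -
 define good where "good G \<longleftrightarrow> zinv G & F \<inter> G = {0}" for G
 have "good {0}" unfolding good_def invariant_def using vsub_zero vsubD(2)[OF inv_vsub[OF F]] by auto
 moreover have "vsub n G" if "good G" for G using that by (simp add: good_def invariant_def)
 ultimately have "\<exists>G. good G & (\<forall>G'. good G' --> vdim n G' \<le> vdim n G)"
 by (rule max_vdim[of good "{0}" n])
 then obtain G where G: "good G" "!!G'. good G' ==> vdim n G' \<le> vdim n G"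
 by blast
 let ?H = "{f + g | f g. f : F & g : G}"
 have iG: "zinv G" and FG: "F \<inter> G = {0}" using G(1) by (auto simp: good_def)
 note vF = inv_vsub[OF F] and vG = inv_vsub[OF iG]
 have iH: "zinv ?H" by (rule invariant_plus[OF F iG])
 note vH = inv_vsub[OF iH]
 have "?H = spc n"
 proof (rule ccontr)
 assume "?H ~= spc n"
 then obtain L where L: "zinv L" "L ~= {0}" "L \<inter> ?H = {0}" by (rule transversal[OF iH]) (rule that; assumption)
 note vL = inv_vsub[OF L(1)]
 let ?G' = "{g + l | g l. g : G & l : L}"
 have "F \<inter> ?G' \<subseteq> {0}"
 proof
 fix x assume "x : F \<inter> ?G'"
 then obtain g l where x: "x : F" "x = g + l" "g : G" "l : L" by auto
 then have "l = x + smult (-1) g" by simp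
 then have "l : ?H" using x(1) vsubD(4)[OF vG x(3)] by blast
 then have "l : L \<inter> ?H" using x(4) by blast
 then have "l = 0" unfolding L(3) by simp
 then have "x : F \<inter> G" using x by simp
 then show "x : {0}" unfolding FG .
 qed
 then have "F \<inter> ?G' = {0}"
 using vsubD(2)[OF vF] vsubD(2)[OF inv_vsub[OF invariant_plus[OF iG L(1)]]] by blast
 then have "good ?G'" using invariant_plus[OF iG L(1)] by (simp add: good_def)
 then have le: "vdim n ?G' \<le> vdim n G" by (rule G(2))
 obtain l where l: "l : L" "l ~= 0" using L(2) vsubD(2)[OF vL] by blast
 have "l \<notin> G"
 proof
 assume "l : G"
 then have "0 + l : ?H" using vsubD(2)[OF vF] by blast
 then show False using l L(3) by auto
 qed
 moreover have "G \<subseteq> ?G'" by (rule subset_plus_left[OF vL])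
 moreover have "l : ?G'" by (rule subsetD[OF subset_plus_right[OF vG] l(1)])
 ultimately have "vdim n G < vdim n ?G'"
 by (intro vdim_strict_mono[OF vG inv_vsub[OF invariant_plus[OF iG L(1)]]])
 then show False using le by simp
 qed
 then show ?thesis by (intro that[OF iG FG]) (rule sym)
qed

end

lemma oblique_projection:
 assumes H: "vsub n H" and C: "vsub n C" and HC: "H \<inter> C = {0}" "spc n = {h + c | h c. h : H & c : C}"
 obtains T where "T : ops n n" "!!h. h : H ==> T \<rhd> h = 0" "!!c. c : C ==> T \<rhd> c = c"
proof -
 have "\<exists>c. c : C & bvec j - c : H" if "j < n" for j
 proof -
 have "bvec j : spc n" using that by simp
 then obtain h c where "bvec j = h + c" "h : H" "c : C" unfolding HC(2) by blast
 then show ?thesis by (intro exI[of _ c]) simp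
 qed
 then obtain c where c: "!!j. j < n ==> c j : C & bvec j - c j : H" by metis
 define T where "T = (\<Sum>j<n. rk (c j) (bvec j))"
 have T: "T \<rhd> \<xi> : C" "\<xi> - T \<rhd> \<xi> : H" if "\<xi> : spc n" for \<xi>
 proof -
 have T\<xi>: "T \<rhd> \<xi> = (\<Sum>j<n. smult (coeff \<xi> j) (c j))" by (simp add: T_def ap_sum_left)
 show "T \<rhd> \<xi> : C" unfolding T\<xi> using c by (intro vsub_sum[OF C] vsubD(4)[OF C]) auto
 have "\<xi> - T \<rhd> \<xi> = (\<Sum>j<n. smult (coeff \<xi> j) (bvec j - c j))"
 unfolding T\<xi> by (subst spc_expand[OF that]) (simp add: smult_diff_right sum_subtractf)
 also have "... : H" using c by (intro vsub_sum[OF H] vsubD(4)[OF H]) auto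
 finally show "\<xi> - T \<rhd> \<xi> : H" .
 qed
 show ?thesis
 proof
 show "T : ops n n" unfolding T_def using c vsubD(1)[OF C] by (intro ops_sum ops_rk) auto
 show "T \<rhd> h = 0" if h: "h : H" for h
 proof -
 have "h - (h - T \<rhd> h) : H" by (rule vsubD(5)[OF H h T(2)[OF vsubD(1)[OF H h]]])
 moreover have "h - (h - T \<rhd> h) = T \<rhd> h" by simp
 ultimately have "T \<rhd> h : H \<inter> C" using T(1)[OF vsubD(1)[OF H h]] by (simp only: Int_iff)
 then show ?thesis unfolding HC(1) by simp
 qed
 show "T \<rhd> x = x" if x: "x : C" for x
 proof -
 have "x - T \<rhd> x : C" by (rule vsubD(5)[OF C x T(1)[OF vsubD(1)[OF C x]]])
 then have "x - T \<rhd> x : H \<inter> C" using T(2)[OF vsubD(1)[OF C x]] by (intro IntI)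
 then show ?thesis unfolding HC(1) by simp
 qed
 qed
qed

definition perp :: "nat => complex poly set => complex poly set" where
 "perp n F = {\<xi> : spc n. \<forall>f\<in>F. ip f \<xi> = 0}"

lemma vsub_perp: "vsub n (perp n F)"
 by (auto simp: vsub_def perp_def)

context fixed_operators
begin

text \<open>Choose a maximal invariant subspace \<open>G\<close> of the orthogonal complement of \<open>F\<close>. Invariant complements produce
projections along which fixed eigenvectors can be found, and maximality forces \<open>G\<close> to be everything.\<close>

lemma perp_invariant:
 assumes F: "zinv F"
 shows "zinv (perp n F)"
proof -
 note vF = inv_vsub[OF F]
 define good where "good G \<longleftrightarrow> zinv G & G \<subseteq> perp n F" for G
 have "good {0}" unfolding good_def invariant_def using vsub_zero by (auto simp: perp_def)
 moreover have "vsub n G" if "good G" for G using that by (simp add: good_def invariant_def)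
 ultimately have "\<exists>G. good G & (\<forall>G'. good G' --> vdim n G' \<le> vdim n G)"
 by (rule max_vdim[of good "{0}" n])
 then obtain G where G: "good G" "!!G'. good G' ==> vdim n G' \<le> vdim n G"
 by blast
 have iG: "zinv G" and GF: "G \<subseteq> perp n F" using G(1) by (auto simp: good_def)
 note vG = inv_vsub[OF iG]
 have "perp n F = G"
 proof (rule ccontr)
 assume ne: "perp n F ~= G"
 let ?H = "{f + g | f g. f : F & g : G}"
 have iH: "zinv ?H" by (rule invariant_plus[OF F iG])
 note vH = inv_vsub[OF iH]
 have FH: "F \<subseteq> ?H" by (rule subset_plus_left[OF vG])
 have GH: "G \<subseteq> ?H" by (rule subset_plus_right[OF vF])
 have "?H ~= spc n"
 proof
 assume H: "?H = spc n"
 obtain \<xi> where \<xi>: "\<xi> : perp n F" "\<xi> \<notin> G" using ne GF by blast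
 then have "\<xi> : ?H" using H by (auto simp: perp_def)
 then obtain f g where fg: "\<xi> = f + g" "f : F" "g : G" by blast
 have "\<xi> - g : perp n F" using \<xi>(1) GF fg(3) by (intro vsubD(5)[OF vsub_perp]) auto
 then have "f = 0" using fg by (auto simp: perp_def)
 then show False using fg \<xi> by simp
 qed
 obtain C where C: "zinv C" "?H \<inter> C = {0}" "spc n = {h + c | h c. h : ?H & c : C}"
 by (rule complement[OF iH]) (rule that; assumption)
 note vC = inv_vsub[OF C(1)]
 obtain T where T: "T : ops n n" "!!h. h : ?H ==> T \<rhd> h = 0" "!!c. c : C ==> T \<rhd> c = c"
 by (rule oblique_projection[OF vH vC C(2,3)]) (rule that; assumption)
 have Tz: "T * z a = z a * T" if a: "a : A" for a
 proof (rule ops_eqI[of _ n n])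
 show "T * z a : ops n n" "z a * T : ops n n" using T(1) z[OF a] by blast+
 fix j assume "j < n"
 then have "bvec j : spc n" by simp
 then obtain h c where hc: "bvec j = h + c" "h : ?H" "c : C" unfolding C(3) by blast
 have "z a \<rhd> h : ?H" "z a \<rhd> c : C" using hc(2,3) iH C(1) a unfolding invariant_def by blast+
 then show "(T * z a) \<rhd> bvec j = (z a * T) \<rhd> bvec j"
 unfolding hc(1) using hc(2,3) T(2,3) by simp
 qed
 define k where "k = ad T * T"
 have k_ops: "k : ops n n" unfolding k_def using T(1) by blast
 have "k ~= 0"
 proof
 assume "k = 0"
 then have "T = 0" unfolding k_def by (rule ad_mult_eq_0)
 then have c0: "c = 0" if "c : C" for c using T(3)[OF that] by simp
 have "spc n \<subseteq> ?H"
 proof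
 fix x assume "x : spc n"
 then obtain h' c' where x: "x = h' + c'" "h' : ?H" "c' : C" unfolding C(3) by blast
 then have "x = h'" using c0[OF x(3)] by simp
 then show "x : ?H" using x(2) by simp
 qed
 then show False using \<open>?H ~= spc n\<close> vsubD(1)[OF vH] by blast
 qed
 have "\<not> positive (- k)"
 proof
 assume neg: "positive (- k)"
 have "ip \<xi> (k \<rhd> \<xi>) = 0" for \<xi>
 proof -
 have "0 \<le> ip \<xi> (k \<rhd> \<xi>)" unfolding k_def using positive_ad_mult by (auto simp: positive_def)
 moreover have "0 \<le> - ip \<xi> (k \<rhd> \<xi>)" using neg by (auto simp: positive_def)
 ultimately show ?thesis by (simp add: complex_nonneg_iff complex_eq_iff)
 qed
 then have "k = 0" by (rule aop_polarize)
 with \<open>k ~= 0\<close> show False by simp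
 qed
 moreover have "hermitian (- k)" by (simp add: hermitian_def k_def)
 ultimately obtain l \<zeta> where l: "l < 0" "positive (- k - scl (complex_of_real l) 1)" "\<zeta> ~= 0"
 "(- k) \<rhd> \<zeta> = smult (complex_of_real l) \<zeta>"
 using min_eigenvalue[OF ops_minus[OF k_ops]] by blast
 define E where "E = {\<xi>. (- k) \<rhd> \<xi> = smult (complex_of_real l) \<xi>}"
 have vE: "vsub n E" unfolding E_def by (rule vsub_eigen[OF ops_minus[OF k_ops]]) (use l in simp)
 have kfix: "(\<Sum>a\<in>A. ad (z a) * (- k) * z a) = - k"
 proof -
 have "(\<Sum>a\<in>A. ad (z a) * k * z a) = (\<Sum>a\<in>A. ad T * (ad (z a) * z a) * T)"
 proof (intro sum.cong refl)
 fix a assume a: "a : A"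
 have "ad (z a) * k * z a = ad (T * z a) * (T * z a)" by (simp add: k_def mult.assoc)
 also have "... = ad T * (ad (z a) * z a) * T" unfolding Tz[OF a] by (simp add: mult.assoc)
 finally show "ad (z a) * k * z a = ad T * (ad (z a) * z a) * T" .
 qed
 also have "... = ad T * (\<Sum>a\<in>A. ad (z a) * z a) * T" by (simp add: sum_distrib_left sum_distrib_right)
 also have "... = k" by (simp add: sum_z k_def mult.assoc opsD(1)[OF T(1)])
 finally show ?thesis by (simp add: sum_negf)
 qed
 have iE: "zinv E"
 unfolding invariant_def
 proof (intro conjI ballI vE)
 fix a \<xi> assume a: "a : A" and \<xi>: "\<xi> : E"
 have "\<xi> : spc n" using \<xi> by (rule vsubD(1)[OF vE])
 then show "z a \<rhd> \<xi> : E"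
 using \<xi> unfolding E_def mem_Collect_eq
 by (intro eigenspace_invariant[OF A _ _ _ l(2) a]) (simp_all only: sum_ip_eq sum_ip_eq1 kfix sum_z spc_def mem_Collect_eq)
 qed
 have EH: "ip h \<xi> = 0" if "h : ?H" "\<xi> : E" for h \<xi>
 proof -
 have "complex_of_real l * ip h \<xi> = ip h ((- k) \<rhd> \<xi>)" using that(2) by (simp add: E_def)
 also have "... = - ip (T \<rhd> h) (T \<rhd> \<xi>)" by (simp add: k_def ip_ad_right)
 also have "... = 0" using T(2)[OF that(1)] by simp
 finally show ?thesis using l(1) by simp
 qed
 let ?G' = "{g + e | g e. g : G & e : E}"
 have iG': "zinv ?G'" by (rule invariant_plus[OF iG iE])
 have "E \<subseteq> perp n F" unfolding perp_def using vsubD(1)[OF vE] EH FH by blast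
 then have "?G' \<subseteq> perp n F" using GF vsubD(3)[OF vsub_perp] by blast
 then have "good ?G'" using iG' by (simp add: good_def)
 then have le: "vdim n ?G' \<le> vdim n G" by (rule G(2))
 have \<zeta>E: "\<zeta> : E" using l by (simp add: E_def)
 have "\<zeta> \<notin> G"
 proof
 assume "\<zeta> : G"
 then have "ip \<zeta> \<zeta> = 0" by (intro EH[OF _ \<zeta>E] subsetD[OF GH])
 then show False using l(3) by simp
 qed
 moreover have "G \<subseteq> ?G'" by (rule subset_plus_left[OF vE])
 moreover have "\<zeta> : ?G'" by (rule subsetD[OF subset_plus_right[OF vG] \<zeta>E])
 ultimately have "vdim n G < vdim n ?G'" by (intro vdim_strict_mono[OF vG inv_vsub[OF iG']])
 then show False using le by simp
 qed
 then show ?thesis using iG by simp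
qed

text \<open>On a maximal invariant subspace \<open>C\<close> where \<open>X\<close> commutes with all \<open>z a\<close>, the orthogonal complement is again invariant
under \<open>z\<close> and \<open>X\<close>. The eigenspace for the least eigenvalue of \<open>X\<close> on it is invariant too, and there \<open>X\<close> is scalar,
so \<open>C\<close> could be enlarged.\<close>

lemma fixed_hermitian_commutes:
 assumes X: "X : ops n n" "hermitian X" "(\<Sum>a\<in>A. ad (z a) * X * z a) = X" and a: "a : A"
 shows "z a * X = X * z a"
proof -
 define good where "good C \<longleftrightarrow> zinv C & (\<forall>\<xi>\<in>C. X \<rhd> \<xi> : C & (\<forall>a\<in>A. X \<rhd> z a \<rhd> \<xi> = z a \<rhd> X \<rhd> \<xi>))" for C
 have "good {0}" unfolding good_def invariant_def using vsub_zero by auto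
 moreover have "vsub n G" if "good G" for G using that by (simp add: good_def invariant_def)
 ultimately have "\<exists>G. good G & (\<forall>G'. good G' --> vdim n G' \<le> vdim n G)"
 by (rule max_vdim[of good "{0}" n])
 then obtain C where C: "good C" "!!G'. good G' ==> vdim n G' \<le> vdim n C"
 by blast
 have iC: "zinv C" using C(1) by (auto simp: good_def)
 note vC = inv_vsub[OF iC]
 have XC: "X \<rhd> \<xi> : C" "a : A ==> X \<rhd> z a \<rhd> \<xi> = z a \<rhd> X \<rhd> \<xi>" if "\<xi> : C" for \<xi> a
 using C(1) that by (auto simp: good_def)
 have ipX: "ip (X \<rhd> \<xi>) \<eta> = ip \<xi> (X \<rhd> \<eta>)" for \<xi> \<eta>
 using X(2) ip_ad_left[of X \<xi> \<eta>] by (simp add: hermitian_def)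
 have "C = spc n"
 proof (rule ccontr)
 assume ne: "C ~= spc n"
 let ?D = "perp n C"
 have iD: "zinv ?D" by (rule perp_invariant[OF iC])
 have vD: "vsub n ?D" by (rule vsub_perp)
 have XD: "X \<rhd> \<xi> : ?D" if "\<xi> : ?D" for \<xi>
 using that X(1) XC(1) by (auto simp: perp_def simp flip: ipX)
 define d where "d = vdim n ?D"
 obtain J where J: "J : ops n d" "ad J * J = pr d" "!!\<xi>. J \<rhd> \<xi> : ?D"
 "!!\<xi>. \<xi> : ?D ==> J \<rhd> ad J \<rhd> \<xi> = \<xi>"
 by (rule isometry_onto[OF vD, folded d_def]) (rule that; assumption)
 define Y where "Y = ad J * X * J"
 have Y: "Y : ops d d" "hermitian Y"
 using J(1) X(1,2) by (auto simp: Y_def hermitian_def mult.assoc intro!: ops_mult)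
 have "d ~= 0"
 proof
 assume "d = 0"
 then have D0: "?D = {0}"
 using J(1,4) vsubD(2)[OF vD] opsD(2)[OF J(1)] by fastforce
 obtain K where K: "K : ops n (vdim n C)" "ad K * K = pr (vdim n C)" "!!\<xi>. K \<rhd> \<xi> : C"
 "!!\<xi>. \<xi> : C ==> K \<rhd> ad K \<rhd> \<xi> = \<xi>"
 by (rule isometry_onto[OF vC]) (rule that; assumption)
 have "\<xi> : C" if \<xi>: "\<xi> : spc n" for \<xi>
 proof -
 have "ip c (\<xi> - K \<rhd> ad K \<rhd> \<xi>) = 0" if "c : C" for c
 proof -
 have "ip c (K \<rhd> ad K \<rhd> \<xi>) = ip (K \<rhd> ad K \<rhd> c) \<xi>" by (simp add: ip_ad_right flip: ip_ad_left)
 then show ?thesis using K(4)[OF that] by simp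
 qed
 moreover have "\<xi> - K \<rhd> ad K \<rhd> \<xi> : spc n" using \<xi> K(1) by auto
 ultimately have "\<xi> - K \<rhd> ad K \<rhd> \<xi> : ?D" by (auto simp: perp_def)
 then have "K \<rhd> ad K \<rhd> \<xi> = \<xi>" using D0 by simp
 then show ?thesis using K(3)[of "ad K \<rhd> \<xi>"] by simp
 qed
 then show False using ne vsubD(1)[OF vC] by blast
 qed
 obtain c where c: "0 \<le> c" "positive (scl (complex_of_real c) (pr d) - Y)"
 using hermitian_bounded[OF Y] by blast
 \<comment> \<open>The shift by \<open>c + 1\<close> makes \<open>W\<close> negative, so that the least eigenvalue of \<open>Y\<close> is found as a negative one of \<open>W\<close>.\<close>
 define W where "W = Y - scl (complex_of_real (c + 1)) (pr d)"
 have "\<not> positive W"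
 proof
 assume W: "positive W"
 have "positive (W + (scl (complex_of_real c) (pr d) - Y))" by (rule positive_add[OF W c(2)])
 also have "W + (scl (complex_of_real c) (pr d) - Y) = - pr d"
 by (simp add: W_def scl.scale_left_distrib)
 finally have "0 \<le> ip (bvec 0) ((- pr d) \<rhd> bvec 0)" unfolding positive_def by blast
 then show False using \<open>d ~= 0\<close> by (simp add: complex_nonneg_iff coeff_bvec)
 qed
 moreover have "W : ops d d" "hermitian W"
 using Y by (auto simp: W_def hermitian_def)
 ultimately obtain l \<zeta> where l: "l < 0" "positive (W - scl (complex_of_real l) 1)" "\<zeta> ~= 0"
 "W \<rhd> \<zeta> = smult (complex_of_real l) \<zeta>"
 using min_eigenvalue[of W d] by blast
 have \<zeta>: "\<zeta> : spc d" using vsub_eigen[OF \<open>W : ops d d\<close>, of "complex_of_real l"] l by (auto dest: vsubD(1))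
 define \<mu> where "\<mu> = complex_of_real (l + c + 1)"
 have WY: "(W - scl (complex_of_real l) 1) \<rhd> \<eta> = Y \<rhd> \<eta> - smult \<mu> \<eta>" if "\<eta> : spc d" for \<eta>
 using that by (simp add: W_def \<mu>_def spc_def smult_add_left)
 have low: "0 \<le> ip \<eta> (X \<rhd> \<eta> - smult \<mu> \<eta>)" and eq: "ip \<eta> (X \<rhd> \<eta> - smult \<mu> \<eta>) = 0 ==> X \<rhd> \<eta> = smult \<mu> \<eta>"
 if \<eta>: "\<eta> : ?D" for \<eta>
 proof -
 have s: "ad J \<rhd> \<eta> : spc d" using J(1) by blast
 have iso: "ip (ad J \<rhd> \<eta>) (ad J \<rhd> \<theta>) = ip \<eta> \<theta>" if "\<theta> : ?D" for \<theta>
 using J(4)[OF that] by (simp add: ip_ad_left)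
 have YJ: "Y \<rhd> ad J \<rhd> \<eta> = ad J \<rhd> X \<rhd> \<eta>" using J(4)[OF \<eta>] by (simp add: Y_def)
 have e: "ip (ad J \<rhd> \<eta>) ((W - scl (complex_of_real l) 1) \<rhd> ad J \<rhd> \<eta>) = ip \<eta> (X \<rhd> \<eta> - smult \<mu> \<eta>)"
 unfolding WY[OF s] YJ using iso[OF XD[OF \<eta>]] iso[OF \<eta>] by simp
 show "0 \<le> ip \<eta> (X \<rhd> \<eta> - smult \<mu> \<eta>)" unfolding e[symmetric] using l(2) by (auto simp: positive_def)
 assume "ip \<eta> (X \<rhd> \<eta> - smult \<mu> \<eta>) = 0"
 then have "(W - scl (complex_of_real l) 1) \<rhd> ad J \<rhd> \<eta> = 0"
 using positive_kernel[OF l(2)] e by simp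
 then have "ad J \<rhd> X \<rhd> \<eta> = ad J \<rhd> smult \<mu> \<eta>" unfolding WY[OF s] YJ by simp
 then have "J \<rhd> ad J \<rhd> X \<rhd> \<eta> = J \<rhd> ad J \<rhd> smult \<mu> \<eta>" by simp
 then show "X \<rhd> \<eta> = smult \<mu> \<eta>" using J(4)[OF XD[OF \<eta>]] J(4)[OF \<eta>] by simp
 qed
 define E where "E = {\<xi> : ?D. X \<rhd> \<xi> = smult \<mu> \<xi>}"
 have vE: "vsub n E"
 using vD by (auto simp: vsub_def E_def smult_add_right mult.commute)
 have zE: "z a \<rhd> \<xi> : E" if \<xi>: "\<xi> : E" and a: "a : A" for \<xi> a
 proof -
 have zD: "z a \<rhd> \<xi> : ?D" if "a : A" for a
 using iD that \<xi> unfolding invariant_def E_def by blast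
 have "\<xi> : spc n" using \<xi> vsubD(1)[OF vE] by blast
 then have "(\<Sum>a\<in>A. ip (z a \<rhd> \<xi>) (X \<rhd> z a \<rhd> \<xi>)) = ip \<xi> (X \<rhd> \<xi>)"
 "(\<Sum>a\<in>A. ip (z a \<rhd> \<xi>) (z a \<rhd> \<xi>)) = ip \<xi> \<xi>"
 unfolding sum_ip_eq sum_ip_eq1 X(3) sum_z by (simp_all add: spc_def)
 then have "(\<Sum>a\<in>A. ip (z a \<rhd> \<xi>) (X \<rhd> z a \<rhd> \<xi> - smult \<mu> (z a \<rhd> \<xi>))) = 0"
 using \<xi> by (simp add: sum_subtractf E_def flip: sum_distrib_left)
 then have "ip (z a \<rhd> \<xi>) (X \<rhd> z a \<rhd> \<xi> - smult \<mu> (z a \<rhd> \<xi>)) = 0"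
 using A a low[OF zD] by (subst (asm) sum_nonneg_eq_0_iff) auto
 then show ?thesis using eq[OF zD[OF a]] zD[OF a] by (simp add: E_def)
 qed
 have iE: "zinv E" using vE zE by (simp add: invariant_def)
 have JE: "J \<rhd> \<zeta> : E"
 proof -
 have "Y \<rhd> \<zeta> - smult \<mu> \<zeta> = 0" using WY[OF \<zeta>] l(4) by simp
 then have "J \<rhd> Y \<rhd> \<zeta> = smult \<mu> (J \<rhd> \<zeta>)" by simp
 moreover have "J \<rhd> Y \<rhd> \<zeta> = X \<rhd> J \<rhd> \<zeta>" using J(4)[OF XD[OF J(3)]] by (simp add: Y_def)
 ultimately show ?thesis using J(3) by (simp add: E_def)
 qed
 have J0: "J \<rhd> \<zeta> ~= 0"
 proof
 assume "J \<rhd> \<zeta> = 0"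
 then have "(ad J * J) \<rhd> \<zeta> = 0" by simp
 then show False using \<zeta> l(3) by (simp add: J(2) spc_def)
 qed
 let ?G = "{f + e | f e. f : C & e : E}"
 have iG: "zinv ?G" by (rule invariant_plus[OF iC iE])
 have "good ?G"
 unfolding good_def
 proof (intro conjI ballI iG)
 fix \<xi> assume "\<xi> : ?G"
 then obtain f e where fe: "\<xi> = f + e" "f : C" "e : E" by blast
 have Xe: "X \<rhd> e = smult \<mu> e" using fe(3) by (simp add: E_def)
 have "X \<rhd> \<xi> = X \<rhd> f + smult \<mu> e" by (simp add: fe(1) Xe)
 then show "X \<rhd> \<xi> : ?G" using XC(1)[OF fe(2)] vsubD(4)[OF vE fe(3)] by blast
 fix a assume a: "a : A"
 have "X \<rhd> z a \<rhd> e = smult \<mu> (z a \<rhd> e)" using zE[OF fe(3) a] by (simp add: E_def)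
 then show "X \<rhd> z a \<rhd> \<xi> = z a \<rhd> X \<rhd> \<xi>"
 using XC(2)[OF fe(2) a] Xe by (simp add: fe(1))
 qed
 then have le: "vdim n ?G \<le> vdim n C" by (rule C(2))
 have "J \<rhd> \<zeta> \<notin> C"
 proof
 assume "J \<rhd> \<zeta> : C"
 then have "ip (J \<rhd> \<zeta>) (J \<rhd> \<zeta>) = 0" using J(3)[of \<zeta>] unfolding perp_def by blast
 then show False using J0 by simp
 qed
 moreover have "C \<subseteq> ?G" by (rule subset_plus_left[OF vE])
 moreover have "J \<rhd> \<zeta> : ?G" by (rule subsetD[OF subset_plus_right[OF vC] JE])
 ultimately have "vdim n C < vdim n ?G" by (intro vdim_strict_mono[OF vC inv_vsub[OF iG]])
 then show False using le by simp
 qed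
 then show ?thesis
 using XC(2) a X(1) z[OF a] by (intro ops_eqI[of _ n n]) auto
qed

text \<open>Hermitian and skew-hermitian parts are fixed as well, because \<open>S\<close> is selfadjoint.\<close>

theorem rigidity:
 assumes s: "s : S" and a: "a : A"
 shows "z a * s = s * z a"
proof -
 have herm: "z a * x = x * z a" if "x : S" "ad x = x" for x
 using that fixed opsysD(5)[OF S] a by (intro fixed_hermitian_commutes) (auto simp: hermitian_def)
 have "z a * (s + ad s) = (s + ad s) * z a"
 using s opsysD(4,7)[OF S] by (intro herm) (auto simp: add.commute)
 moreover have "z a * (scl \<i> (s - ad s)) = (scl \<i> (s - ad s)) * z a"
 using s opsysD(4,8,9)[OF S] by (intro herm) (auto simp: scl.scale_right_diff_distrib)
 then have "scl \<i> (z a * (s - ad s)) = scl \<i> ((s - ad s) * z a)" by simp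
 then have "z a * (s - ad s) = (s - ad s) * z a" by (metis complex_i_not_zero scl.scale_left_imp_eq)
 ultimately have "z a * (s + ad s) + z a * (s - ad s) = (s + ad s) * z a + (s - ad s) * z a" by simp
 then have "scl 2 (z a * s) = scl 2 (s * z a)"
 by (simp add: algebra_simps scl.scale_left_distrib[of 1 1, simplified])
 then show ?thesis by simp
qed

end

section \<open>Irreducible operator systems are incompressible\<close>

definition commutant :: "nat => aop set => aop set" where
 "commutant n S = {y : ops n n. \<forall>s\<in>S. y * s = s * y}"

lemma commutantD: "y : commutant n S ==> y : ops n n" "y : commutant n S ==> s : S ==> y * s = s * y"
 by (auto simp: commutant_def)

lemma commutant_mult: "x : commutant n S ==> y : commutant n S ==> x * y : commutant n S"
 unfolding commutant_def by (auto simp: mult.assoc) (metis mult.assoc)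

lemma commutant_add: "x : commutant n S ==> y : commutant n S ==> x + y : commutant n S"
 unfolding commutant_def by (auto simp: algebra_simps)

lemma commutant_diff: "x : commutant n S ==> y : commutant n S ==> x - y : commutant n S"
 unfolding commutant_def by (auto simp: algebra_simps)

lemma commutant_scl: "x : commutant n S ==> scl c x : commutant n S"
 unfolding commutant_def by auto

lemma commutant_pr: "opsys n S ==> pr n : commutant n S"
 unfolding commutant_def
proof (intro CollectI conjI ballI)
 fix s assume "opsys n S" "s : S"
 then have "s : ops n n" by (rule opsysD(5))
 then show "pr n * s = s * pr n" by (simp add: opsD)
qed simp

lemma commutant_ad: "opsys n S ==> x : commutant n S ==> ad x : commutant n S"
 unfolding commutant_def
proof (intro CollectI conjI ballI)
 fix s assume "opsys n S" "x : {y : ops n n. \<forall>s\<in>S. y * s = s * y}" "s : S"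
 then have "x * ad s = ad s * x" using opsysD(4) by blast
 then have "ad (x * ad s) = ad (ad s * x)" by simp
 then show "ad x * s = s * ad x" by simp
qed auto

lemma alg_closed_commutant: "opsys n S ==> k : commutant n S ==> alg_closed n k (commutant n S)"
 unfolding alg_closed_def scl.subspace_def
 by (auto intro: commutant_mult commutant_add commutant_scl commutant_pr) (simp add: commutant_def)

lemma alg_closed_centralizer:
 assumes "k * x = x * k" "x : ops n n"
 shows "alg_closed n k {y. y * x = x * y}"
 unfolding alg_closed_def scl.subspace_def
 using assms by (auto simp: opsD algebra_simps) (metis mult.assoc)

text \<open>If the corner \<open>(1 - P) y P\<close> were nonzero, its polar decomposition would give a partial isometry \<open>u\<close> in the commutant
with initial projection \<open>Q \<le> P\<close> and range in \<open>1 - P\<close>. Then \<open>s\<close> is determined by its compression to the range of \<open>1 - Q\<close>,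
in an order preserving way, against incompressibility.\<close>

lemma commutant_projection:
 assumes S: "opsys n S" and inc: "incompressible n S"
 and P: "P : commutant n S" "ad P = P" "P * P = P" and y: "y : commutant n S"
 shows "(pr n - P) * y * P = 0"
proof (rule ccontr)
 assume ne: "(pr n - P) * y * P ~= 0"
 define y1 where "y1 = (pr n - P) * y * P"
 have y1: "y1 : commutant n S"
 unfolding y1_def using P(1) y commutant_pr[OF S] by (intro commutant_mult commutant_diff)
 define k where "k = ad y1 * y1"
 have k: "k : commutant n S" unfolding k_def by (intro commutant_mult commutant_ad[OF S] y1)
 have "positive k" unfolding k_def by (rule positive_ad_mult)
 then obtain g h Q where g: "g : ops n n" "ad g = g" "ad Q = Q" "Q * Q = Q" "k * Q = k" "g * k * g = Q"
 and gh: "Q : ops n n"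
 and alg: "!!C. alg_closed n k C ==> g : C & h : C & Q : C"
 using positive_calculus[OF commutantD(1)[OF k]] by metis
 have gQ: "g : commutant n S" "Q : commutant n S" using alg[OF alg_closed_commutant[OF S k]] by auto
 define u where "u = y1 * g"
 have u: "u : commutant n S" unfolding u_def by (intro commutant_mult y1 gQ)
 have uu: "ad u * u = Q" using g by (simp add: u_def k_def mult.assoc)
 have y1P: "y1 * P = y1" using P by (simp add: y1_def mult.assoc)
 have Py1: "P * y1 = 0" using P opsD(2)[OF commutantD(1)[OF P(1)]] by (simp add: y1_def algebra_simps flip: mult.assoc)
 have kP: "k * P = k" using y1P by (simp add: k_def mult.assoc)
 have Pk: "P * k = k" using kP P(2) by (metis ad_simps(1) k_def ad_simps(8))
 have "g * P = P * g"
 using alg[OF alg_closed_centralizer[OF _ commutantD(1)[OF P(1)]]] kP Pk by auto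
 then have QP: "Q * P = Q" using g(6) kP by (metis mult.assoc)
 have Qu: "Q * u = 0" using QP Py1 by (metis mult.assoc mult_zero_left mult_zero_right u_def)
 have Q0: "Q ~= 0" using g(5) ne by (metis ad_mult_eq_0 k_def mult_zero_right y1_def)
 define G where "G = {\<xi> : spc n. Q \<rhd> \<xi> = 0}"
 have vG: "vsub n G" by (auto simp: vsub_def G_def)
 obtain J where J: "J : ops n (vdim n G)" "ad J * J = pr (vdim n G)" "!!\<xi>. J \<rhd> \<xi> : G"
 "!!\<xi>. \<xi> : G ==> J \<rhd> ad J \<rhd> \<xi> = \<xi>"
 by (rule isometry_onto[OF vG]) (rule that; assumption)
 define R where "R = pr n - Q"
 have QJ: "Q * J = 0" using J(3) by (intro aop_eqI) (auto simp: G_def)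
 have RJ: "J * ad J = R"
 proof -
 have "R \<rhd> \<zeta> : G" for \<zeta>
 proof -
 have "Q * R = 0" using g(4) opsD(2)[OF gh] by (simp add: R_def algebra_simps)
 then have "Q \<rhd> R \<rhd> \<zeta> = 0" by (metis ap_simps(1,5))
 then show ?thesis using gh by (auto simp: G_def R_def)
 qed
 then have "J * ad J * R = R" using J(4) by (intro aop_eqI) simp
 moreover have "R * J = J" using QJ opsD(1)[OF J(1)] by (simp add: R_def algebra_simps)
 then have "ad J * R = ad J" using g(3) by (metis R_def ad_pr ad_simps(1,3))
 ultimately show ?thesis by (simp add: mult.assoc)
 qed
 have Ru: "J * (ad J * u) = u"
 proof -
 have "J * (ad J * u) = R * u" by (simp add: RJ[symmetric] mult.assoc)
 then show ?thesis using Qu opsD(1)[OF commutantD(1)[OF u]] by (simp add: R_def algebra_simps)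
 qed
 have split: "s = ad (ad J * u) * (ad J * s * J) * (ad J * u) + ad (ad J) * (ad J * s * J) * ad J" if s: "s : S" for s
 proof -
 have cs: "Q * s = s * Q" "ad u * s = s * ad u"
 using commutantD(2)[OF _ s] gQ(2) commutant_ad[OF S u] by auto
 have "R * s * R = s - s * Q"
 using cs(1) g(4) opsD[OF opsysD(5)[OF S s]] opsD[OF gh]
 by (simp add: R_def algebra_simps)
 moreover have "ad u * s * u = s * Q"
 using cs(2) uu by (simp add: mult.assoc)
 ultimately have "s = ad u * s * u + R * s * R" by simp
 also have "ad u * s * u = ad (J * (ad J * u)) * s * (J * (ad J * u))" by (simp only: Ru)
 also have "R * s * R = (J * ad J) * s * (J * ad J)" by (simp only: RJ)
 finally show ?thesis by (simp add: mult.assoc)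
 qed
 have "bpos {..<p} s" if s: "!!i j. i < p ==> j < p ==> s i j : S"
 and pos: "bpos {..<p} (%i j. ad J * s i j * J)" for p :: nat and s
 unfolding bpos_def
 proof
 fix \<xi>
 let ?t = "%i j. ad J * s i j * J"
 have "0 \<le> (\<Sum>i<p. \<Sum>j<p. ip ((ad J * u) \<rhd> \<xi> i) (?t i j \<rhd> (ad J * u) \<rhd> \<xi> j))
 + (\<Sum>i<p. \<Sum>j<p. ip (ad J \<rhd> \<xi> i) (?t i j \<rhd> ad J \<rhd> \<xi> j))"
 by (rule add_nonneg_nonneg)
 (use pos[unfolded bpos_def, rule_format, of "%i. (ad J * u) \<rhd> \<xi> i"]
 pos[unfolded bpos_def, rule_format, of "%i. ad J \<rhd> \<xi> i"] in \<open>simp_all only:\<close>)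
 also have "... = (\<Sum>i<p. \<Sum>j<p. ip (\<xi> i) (s i j \<rhd> \<xi> j))"
 unfolding sum.distrib[symmetric]
 proof (intro sum.cong refl)
 fix i j assume "i : {..<p}" "j : {..<p}"
 then have "s i j \<rhd> \<xi> j = (ad (ad J * u) * ?t i j * (ad J * u) + ad (ad J) * ?t i j * ad J) \<rhd> \<xi> j"
 using split[OF s[of i j]] by simp
 then have "s i j \<rhd> \<xi> j = ad (ad J * u) \<rhd> ?t i j \<rhd> (ad J * u) \<rhd> \<xi> j + ad (ad J) \<rhd> ?t i j \<rhd> ad J \<rhd> \<xi> j"
 by (simp only: ap_simps)
 then show "ip ((ad J * u) \<rhd> \<xi> i) (?t i j \<rhd> (ad J * u) \<rhd> \<xi> j) + ip (ad J \<rhd> \<xi> i) (?t i j \<rhd> ad J \<rhd> \<xi> j)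
 = ip (\<xi> i) (s i j \<rhd> \<xi> j)"
 by (simp only: ip_add_right ip_ad_right)
 qed
 finally show "0 \<le> (\<Sum>i<p. \<Sum>j<p. ip (\<xi> i) (s i j \<rhd> \<xi> j))" .
 qed
 then have "\<forall>(p :: nat) s. (\<forall>i<p. \<forall>j<p. s i j : S & ad (s i j) = s j i) &
 bpos {..<p} (%i j. ad J * s i j * J) --> bpos {..<p} s" by simp
 then have "n \<le> vdim n G"
 using inc[unfolded incompressible_def, THEN spec, THEN spec, of J "vdim n G"] J(1,2) by simp
 moreover have "G ~= spc n"
 proof
 assume "G = spc n"
 then have "Q \<rhd> pr n \<rhd> \<xi> = 0" for \<xi> using pr_ap_spc[of n \<xi>] by (auto simp: G_def)
 then have "Q = 0" using ops_ap_pr[OF gh] by (intro aop_eqI) simp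
 with Q0 show False by simp
 qed
 ultimately show False using vdim_less[OF vG] by simp
qed

theorem commutant_commutative:
 assumes S: "opsys n S" and inc: "incompressible n S"
 and x: "x : commutant n S" and y: "y : commutant n S"
 shows "x * y = y * x"
proof -
 have herm: "x * y = y * x" if x: "x : commutant n S" "ad x = x" for x
 proof -
 have xo: "x : ops n n" using x(1) by (rule commutantD(1))
 obtain \<Lambda> P where sp: "finite \<Lambda>" "(\<Sum>l\<in>\<Lambda>. P l) = pr n"
 "!!l. l : \<Lambda> ==> P l : ops n n & P l ~= 0 & ad (P l) = P l & P l * P l = P l
 & x * P l = scl (complex_of_real l) (P l)"
 "!!C l. alg_closed n x C ==> P l : C"
 using spectral_theorem[OF xo] x(2) unfolding hermitian_def by metis
 have "P l * y = y * P l" if l: "l : \<Lambda>" for l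
 proof -
 have Pc: "P l : commutant n S" by (rule sp(4)[OF alg_closed_commutant[OF S x(1)]])
 have half: "w * P l = P l * (w * P l)" if w: "w : commutant n S" for w
 proof -
 have "(pr n - P l) * w * P l = 0"
 using sp(3)[OF l] by (intro commutant_projection[OF S inc Pc _ _ w]) auto
 then have "pr n * (w * P l) = P l * (w * P l)" by (simp add: algebra_simps)
 then show ?thesis using ops_mult_pr(1)[OF commutantD(1)[OF w]] by metis
 qed
 have "ad (ad y * P l) = ad (P l * (ad y * P l))" using half[OF commutant_ad[OF S y]] by simp
 then have "P l * y = P l * y * P l" using sp(3)[OF l] by (simp add: mult.assoc)
 then show ?thesis using half[OF y] by (simp add: mult.assoc)
 qed
 moreover have xs: "x = (\<Sum>l\<in>\<Lambda>. scl (complex_of_real l) (P l))"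
 by (rule spectral_expand[OF xo sp(2)]) (use sp(3) in blast)
 ultimately show ?thesis
 by (subst (1 2) xs) (simp add: sum_distrib_left sum_distrib_right)
 qed
 have 1: "(x + ad x) * y = y * (x + ad x)"
 using x commutant_ad[OF S x] by (intro herm commutant_add) (auto simp: add.commute)
 have "(scl \<i> (x - ad x)) * y = y * scl \<i> (x - ad x)"
 using x commutant_ad[OF S x] by (intro herm commutant_diff commutant_scl) (auto simp: scl.scale_right_diff_distrib)
 then have "scl \<i> ((x - ad x) * y) = scl \<i> (y * (x - ad x))" by simp
 then have 2: "(x - ad x) * y = y * (x - ad x)" by (metis complex_i_not_zero scl.scale_left_imp_eq)
 have "(x + ad x) * y + (x - ad x) * y = y * (x + ad x) + y * (x - ad x)" using 1 2 by simp
 then have "scl 2 (x * y) = scl 2 (y * x)"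
 by (simp add: algebra_simps scl.scale_left_distrib[of 1 1, simplified])
 then show ?thesis by simp
qed

text \<open>Order version of irreducible action: the restriction to a reducing subspace is required to be a complete order
embedding.\<close>

definition irreducible :: "nat => aop set => bool" where
 "irreducible n S \<longleftrightarrow> (\<forall>L. vsub n L & (\<forall>s\<in>S. \<forall>\<xi>\<in>L. s \<rhd> \<xi> : L) &
 (\<forall>(p :: nat) s. (\<forall>i<p. \<forall>j<p. s i j : S & ad (s i j) = s j i) &
 (\<forall>\<xi>. (\<forall>i. \<xi> i : L) --> 0 \<le> (\<Sum>i<p. \<Sum>j<p. ip (\<xi> i) (s i j \<rhd> \<xi> j))) --> bpos {..<p} s) -->
 L = {0} \<or> L = spc n)"

definition order_embedding :: "nat => aop set => nat => (aop => aop) => bool" where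
 "order_embedding n S d \<pi> \<longleftrightarrow> linear_on S \<pi> & (\<forall>s\<in>S. \<pi> s : ops d d & \<pi> (ad s) = ad (\<pi> s)) & \<pi> (pr n) = pr d &
 (\<forall>(p :: nat) s. (\<forall>i<p. \<forall>j<p. s i j : S & ad (s i j) = s j i) -->
 (bpos {..<p} (%i j. \<pi> (s i j)) \<longleftrightarrow> bpos {..<p} s))"

lemma order_embeddingD:
 assumes "order_embedding n S d \<pi>"
 shows "s : S ==> \<pi> s : ops d d" "s : S ==> \<pi> (ad s) = ad (\<pi> s)" "\<pi> (pr n) = pr d"
 "s : S ==> t : S ==> \<pi> (s + t) = \<pi> s + \<pi> t" "s : S ==> \<pi> (scl c s) = scl c (\<pi> s)" "linear_on S \<pi>"
 "(!!i j. i < p ==> j < p ==> f i j : S & ad (f i j) = f j i) ==>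
 bpos {..<p :: nat} (%i j. \<pi> (f i j)) \<longleftrightarrow> bpos {..<p} f"
proof -
 note E = assms[unfolded order_embedding_def]
 show "s : S ==> \<pi> s : ops d d" "s : S ==> \<pi> (ad s) = ad (\<pi> s)" "\<pi> (pr n) = pr d" "linear_on S \<pi>"
 using E by simp_all
 then show "s : S ==> t : S ==> \<pi> (s + t) = \<pi> s + \<pi> t" "s : S ==> \<pi> (scl c s) = scl c (\<pi> s)"
 unfolding linear_on_def by simp_all
 assume "!!i j. i < p ==> j < p ==> f i j : S & ad (f i j) = f j i"
 then have "\<forall>i<p. \<forall>j<p. f i j : S & ad (f i j) = f j i" by simp
 then show "bpos {..<p :: nat} (%i j. \<pi> (f i j)) \<longleftrightarrow> bpos {..<p} f"
 using E[THEN conjunct2, THEN conjunct2, THEN conjunct2, rule_format, of p f] by simp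
qed

lemma bpos_hermitian:
 fixes p :: nat
 assumes "bpos {..<p} s" "!!i j. i < p ==> j < p ==> s i j : ops n n" "i < p" "j < p"
 shows "ad (s i j) = s j i"
proof -
 have "positive (bop n p s)" using assms(1,2) by (simp add: positive_bop_iff)
 then have "ad (bop n p s) = bop n p s" by (auto dest: positive_hermitian simp: hermitian_def)
 then have e: "bop n p (%i j. ad (s j i)) = bop n p s" by (simp add: ad_bop)
 have entry: "ad (blk n k) * bop n p t * blk n l = t k l"
 if "!!i j. i < p ==> j < p ==> t i j : ops n n" "k < p" "l < p" for t k l
 proof -
 have "ad (blk n k) * bop n p t * blk n l = (\<Sum>i<p. \<Sum>j<p. if j = l then if i = k then t k l else 0 else 0)"
 unfolding bop_def sum_distrib_left sum_distrib_right
 using opsD[OF that(1)] that(2,3)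
 by (intro sum.cong refl) (auto simp: mult.assoc ad_blk_blk ad_blk_blk_mult)
 then show ?thesis using that(2,3) by simp
 qed
 have "ad (s i j) = ad (blk n j) * bop n p (%i j. ad (s j i)) * blk n i"
 using assms by (subst entry) auto
 also have "... = s j i" unfolding e using assms by (subst entry) auto
 finally show ?thesis .
qed

lemma order_embedding_inj:
 assumes S: "opsys n S" and \<pi>: "order_embedding n S d \<pi>"
 shows "inj_on \<pi> S"
proof -
 note E = order_embeddingD[OF \<pi>]
 have minus: "\<pi> (- s) = - \<pi> s" if "s : S" for s using E(5)[OF that, of "-1"] by (simp add: scl_minus_one)
 have herm0: "x = 0" if x: "x : S" "ad x = x" "\<pi> x = 0" for x
 proof -
 have "positive y" if "y : S" "ad y = y" "\<pi> y = 0" for y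
 proof -
 have "bpos {..<1 :: nat} (%_ _. \<pi> y)" by (simp add: that(3) bpos_def)
 then have "bpos {..<1 :: nat} (%_ _. y)" using E(7)[of "1 :: nat" "%_ _. y"] that by simp
 then show ?thesis unfolding bpos_def positive_def by (auto dest: spec[of _ "%_. _"])
 qed
 from this[of x] this[of "- x"] have p: "positive x" "positive (- x)"
 using x opsysD(6,8)[OF S] minus[OF x(1)] by (auto dest: opsysD(8)[OF S, of 0 x])
 have "ip \<xi> (x \<rhd> \<xi>) = 0" for \<xi>
 proof -
 have "0 \<le> ip \<xi> (x \<rhd> \<xi>)" "0 \<le> - ip \<xi> (x \<rhd> \<xi>)" using p by (auto simp: positive_def)
 then show ?thesis by (simp add: complex_nonneg_iff complex_eq_iff)
 qed
 then show ?thesis by (rule aop_polarize)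
 qed
 have zero: "x = 0" if x: "x : S" "\<pi> x = 0" for x
 proof -
 have a: "\<pi> (ad x) = 0" using x E(2) by simp
 note ax = opsysD(4)[OF S x(1)]
 have "x + ad x = 0"
 proof (rule herm0)
 show "x + ad x : S" using opsysD(7)[OF S x(1) ax] .
 show "ad (x + ad x) = x + ad x" by (simp add: add.commute)
 show "\<pi> (x + ad x) = 0" using E(4)[OF x(1) ax] x(2) a by simp
 qed
 moreover have "scl \<i> (x - ad x) = 0"
 proof (rule herm0)
 have "\<pi> (x - ad x) = 0" using E(4)[OF x(1), of "- ad x"] minus[OF ax] x a ax opsysD(9)[OF S ax, of "-1"] by (simp add: scl_minus_one)
 then show "\<pi> (scl \<i> (x - ad x)) = 0" using E(5) opsysD(8)[OF S x(1) ax] by simp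
 qed (use x ax opsysD(8,9)[OF S] in \<open>auto simp: scl.scale_right_diff_distrib\<close>)
 then have "x - ad x = 0" by simp
 ultimately have "scl 2 x = 0" by (metis add_diff_cancel_left' diff_add_cancel scl.scale_left_distrib scl.scale_one one_add_one add.commute add_0 diff_0_right eq_iff_diff_eq_0)
 then show ?thesis by simp
 qed
 show ?thesis
 proof (rule inj_onI)
 fix x y assume xy: "x : S" "y : S" "\<pi> x = \<pi> y"
 have "\<pi> (x - y) = 0"
 using E(4)[OF xy(1), of "- y"] minus[OF xy(2)] xy opsysD(9)[OF S xy(2), of "-1"] by (simp add: scl_minus_one)
 then have "x - y = 0" using zero opsysD(8)[OF S xy(1,2)] by blast
 then show "x = y" by simp
 qed
qed

text \<open>Let \<open>\<pi>\<close> be a complete order embedding of \<open>S\<close> into operators on a space of least dimension \<open>d\<close>. Its image is incompressible,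
and \<open>\<pi>\<close> and its inverse have Kraus operators \<open>w a\<close> and \<open>v b\<close>. Rigidity for the products \<open>v b * w a\<close> shows that the \<open>w a\<close>
intertwine \<open>\<pi>\<close> and the identity. They combine to an injective intertwiner, since the commutant is commutative. Its range is
a reducing subspace on which \<open>S\<close> is completely order embedded, so it is all of \<open>\<complex>\<^sup>n\<close> and \<open>n = d\<close>.\<close>

theorem irreducible_incompressible:
 assumes S: "opsys n S" and irr: "irreducible n S"
 shows "incompressible n S"
 unfolding incompressible_def
proof (intro allI impI, elim conjE)
 fix d' J'
 assume J': "J' : ops n d'" "ad J' * J' = pr d'"
 and emb: "\<forall>(p :: nat) s. (\<forall>i<p. \<forall>j<p. s i j : S & ad (s i j) = s j i) &
 bpos {..<p} (%i j. ad J' * s i j * J') --> bpos {..<p} s"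
 have compress: "bpos {..<p} (%i j. ad J * s i j * J)" if "bpos {..<p} s" for p :: nat and J s
 unfolding bpos_def using that[unfolded bpos_def, rule_format, of "%i. J \<rhd> _ i"]
 by (simp add: ip_ad_right)
 have "order_embedding n S d' (%s. ad J' * s * J')"
 unfolding order_embedding_def
 proof (intro conjI ballI allI impI)
 show "linear_on S (%s. ad J' * s * J')" by (simp add: linear_on_def algebra_simps)
 show "ad J' * s * J' : ops d' d'" "ad J' * ad s * J' = ad (ad J' * s * J')" if "s : S" for s
 using opsysD(5)[OF S that] J'(1) by (auto simp: mult.assoc)
 show "ad J' * pr n * J' = pr d'" using J' opsD(1)[OF J'(1)] by (simp add: mult.assoc)
 qed (use emb compress in blast)
 then have ex: "\<exists>d \<pi>. order_embedding n S d \<pi>" by blast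
 define d where "d = (LEAST d. \<exists>\<pi>. order_embedding n S d \<pi>)"
 obtain \<pi> where \<pi>: "order_embedding n S d \<pi>"
 unfolding d_def using LeastI_ex[OF ex] by blast
 have least: "d \<le> e" if "order_embedding n S e \<sigma>" for e \<sigma>
 unfolding d_def using that by (intro Least_le) blast
 have "d \<le> d'" by (rule least) fact
 note E = order_embeddingD[OF \<pi>]
 have inj: "inj_on \<pi> S" by (rule order_embedding_inj[OF S \<pi>])
 define S1 where "S1 = \<pi> ` S"
 have S1: "opsys d S1"
 unfolding opsys_def
 proof (intro conjI ballI)
 show "S1 \<subseteq> ops d d" using E(1) by (auto simp: S1_def)
 show "scl.subspace S1"
 unfolding scl.subspace_def S1_def
 proof (intro conjI ballI allI)
 show "0 : \<pi> ` S" using E(5)[OF opsysD(6)[OF S], of 0] opsysD(6)[OF S] by (metis image_eqI scl.scale_zero_left)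
 fix x assume "x : \<pi> ` S"
 then obtain s where s: "s : S" "x = \<pi> s" by blast
 show "scl c x : \<pi> ` S" for c using s E(5) opsysD(9)[OF S] by (metis image_eqI)
 fix y assume "y : \<pi> ` S"
 then obtain t where t: "t : S" "y = \<pi> t" by blast
 show "x + y : \<pi> ` S" using E(4)[OF s(1) t(1)] opsysD(7)[OF S s(1) t(1)] s(2) t(2) by (metis image_eqI)
 qed
 show "pr d : S1" unfolding S1_def E(3)[symmetric] using opsysD(3)[OF S] by blast
 show "ad x : S1" if "x : S1" for x
 proof -
 from that obtain s where s: "s : S" "x = \<pi> s" by (auto simp: S1_def)
 then have "ad x = \<pi> (ad s)" by (simp add: E(2))
 then show ?thesis unfolding S1_def using opsysD(4)[OF S s(1)] by blast
 qed
 qed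
 define \<rho> where "\<rho> = inv_into S \<pi>"
 have \<rho>: "\<rho> (\<pi> s) = s" if "s : S" for s using inj that by (simp add: \<rho>_def)
 have \<rho>S: "\<rho> x : S" "\<pi> (\<rho> x) = x" if "x : S1" for x using that \<rho> by (auto simp: S1_def)
 have hfam: "ad (\<rho> x) = \<rho> y" if "x : S1" "y : S1" "ad x = y" for x y
 using \<rho>S[OF that(1)] \<rho>S[OF that(2)] that(3) E(2) opsysD(4)[OF S] \<rho> by metis
 have inc1: "incompressible d S1"
 unfolding incompressible_def
 proof (intro allI impI, elim conjE)
 fix e J
 assume J: "J : ops d e" "ad J * J = pr e"
 and em: "\<forall>(p :: nat) s. (\<forall>i<p. \<forall>j<p. s i j : S1 & ad (s i j) = s j i) &
 bpos {..<p} (%i j. ad J * s i j * J) --> bpos {..<p} s"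
 have "order_embedding n S e (%s. ad J * \<pi> s * J)"
 unfolding order_embedding_def
 proof (intro conjI ballI allI impI)
 show "linear_on S (%s. ad J * \<pi> s * J)" using E(4,5) by (simp add: linear_on_def algebra_simps)
 show "ad J * \<pi> s * J : ops e e" "ad J * \<pi> (ad s) * J = ad (ad J * \<pi> s * J)" if "s : S" for s
 using E(1,2)[OF that] J(1) by (auto simp: mult.assoc)
 show "ad J * \<pi> (pr n) * J = pr e" using J opsD(1)[OF J(1)] by (simp add: mult.assoc E(3))
 fix p :: nat and s assume s: "\<forall>i<p. \<forall>j<p. s i j : S & ad (s i j) = s j i"
 have iff: "bpos {..<p} (%i j. \<pi> (s i j)) \<longleftrightarrow> bpos {..<p} s" using s by (intro E(7)) auto
 have "bpos {..<p} (%i j. ad J * \<pi> (s i j) * J) --> bpos {..<p} (%i j. \<pi> (s i j))"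
 proof -
 have "\<pi> (s i j) : S1 & ad (\<pi> (s i j)) = \<pi> (s j i)" if "i < p" "j < p" for i j
 using s that E(2) by (metis S1_def imageI)
 then show ?thesis using em[rule_format, of p "%i j. \<pi> (s i j)"] by blast
 qed
 then show "bpos {..<p} (%i j. ad J * \<pi> (s i j) * J) \<longleftrightarrow> bpos {..<p} s"
 using compress iff by blast
 qed
 then show "d \<le> e" by (rule least)
 qed
 have cp: "cpmap S \<pi>"
 unfolding cpmap_def
 proof (intro conjI allI impI E(6))
 fix p :: nat and s assume s: "\<forall>i<p. \<forall>j<p. s i j : S" "bpos {..<p} s"
 have "ad (s i j) = s j i" if "i < p" "j < p" for i j
 using s opsysD(5)[OF S] that by (intro bpos_hermitian[OF s(2)]) auto
 then show "bpos {..<p} (%i j. \<pi> (s i j))" using s E(7)[of p s] by blast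
 qed
 have cp\<rho>: "cpmap S1 \<rho>"
 unfolding cpmap_def linear_on_def
 proof (intro conjI allI impI ballI)
 fix x y assume "x : S1" "y : S1"
 then have "\<pi> (\<rho> x + \<rho> y) = x + y" "\<rho> x + \<rho> y : S"
 using \<rho>S E(4) opsysD(7)[OF S] by simp_all
 with \<rho>[of "\<rho> x + \<rho> y"] show "\<rho> (x + y) = \<rho> x + \<rho> y" by simp
 next
 fix c x assume "x : S1"
 then have "\<pi> (scl c (\<rho> x)) = scl c x" "scl c (\<rho> x) : S"
 using \<rho>S E(5) opsysD(9)[OF S] by simp_all
 with \<rho>[of "scl c (\<rho> x)"] show "\<rho> (scl c x) = scl c (\<rho> x)" by simp
 next
 fix p :: nat and s assume s: "\<forall>i<p. \<forall>j<p. s i j : S1" "bpos {..<p} s"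
 have h: "ad (s i j) = s j i" if "i < p" "j < p" for i j
 using s opsysD(5)[OF S1] that by (intro bpos_hermitian[OF s(2)]) auto
 have h': "\<rho> (s i j) : S & ad (\<rho> (s i j)) = \<rho> (s j i)" if "i < p" "j < p" for i j
 proof -
 have "s i j : S1" "s j i : S1" using s(1) that by simp_all
 then show ?thesis using \<rho>S(1) hfam h[OF that] by simp
 qed
 have "bpos {..<p} (%i j. \<pi> (\<rho> (s i j))) \<longleftrightarrow> bpos {..<p} s"
 by (rule bpos_cong) (use s(1) \<rho>S(2) in simp)
 moreover have "bpos {..<p} (%i j. \<pi> (\<rho> (s i j))) \<longleftrightarrow> bpos {..<p} (%i j. \<rho> (s i j))"
 by (rule E(7)) (use h' in simp)
 ultimately show "bpos {..<p} (%i j. \<rho> (s i j))" using s(2) by simp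
 qed
 obtain q :: nat and w where w: "!!a. w a : ops n d" "!!s. s : S ==> \<pi> s = (\<Sum>a<q. ad (w a) * s * w a)"
 by (rule kraus_map[OF S cp E(1)]) (assumption, (rule that; assumption))
 obtain r :: nat and v where v: "!!b. v b : ops d n" "!!x. x : S1 ==> \<rho> x = (\<Sum>b<r. ad (v b) * x * v b)"
 by (rule kraus_map[OF S1 cp\<rho> opsysD(5)[OF S \<rho>S(1)]]) (assumption, (rule that; assumption))
 have v': "(\<Sum>b<r. ad (v b) * \<pi> s * v b) = s" if "s : S" for s
 using v(2)[of "\<pi> s"] \<rho> that by (simp add: S1_def)
 interpret fo: fixed_operators d S1 "{..<r} \<times> {..<q}" "%(b, a). v b * w a"
 proof
 fix x assume "x : S1"
 then obtain s where s: "s : S" "x = \<pi> s" by (auto simp: S1_def)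
 have "(\<Sum>c\<in>{..<r} \<times> {..<q}. ad (case c of (b, a) => v b * w a) * x * (case c of (b, a) => v b * w a))
 = (\<Sum>b<r. \<Sum>a<q. ad (w a) * (ad (v b) * x * v b) * w a)"
 by (simp add: sum.cartesian_product' mult.assoc)
 also have "... = (\<Sum>a<q. \<Sum>b<r. ad (w a) * (ad (v b) * x * v b) * w a)" by (rule sum.swap)
 also have "... = (\<Sum>a<q. ad (w a) * (\<Sum>b<r. ad (v b) * x * v b) * w a)"
 by (simp add: sum_distrib_left sum_distrib_right)
 also have "... = x" using v'[OF s(1)] w(2)[OF s(1)] by (simp add: s(2))
 finally show "(\<Sum>c\<in>{..<r} \<times> {..<q}. ad (case c of (b, a) => v b * w a) * x * (case c of (b, a) => v b * w a)) = x" .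
 qed (use S1 inc1 w(1) v(1) in auto)
 have inter: "w a * \<pi> s = s * w a" if a: "a < q" and s: "s : S" for a s
 proof -
 have c: "v b * w a * \<pi> s = \<pi> s * (v b * w a)" if "b < r" for b
 using fo.rigidity[of "\<pi> s" "(b, a)"] a s that by (auto simp: S1_def)
 have one: "(\<Sum>b<r. ad (v b) * v b) = pr n"
 using v'[OF opsysD(3)[OF S]] by (simp add: E(3) mult.assoc opsD(1)[OF v(1)])
 have "w a * \<pi> s = pr n * w a * \<pi> s" by (simp add: opsD(1)[OF w(1)])
 also have "... = (\<Sum>b<r. ad (v b) * (v b * w a * \<pi> s))"
 by (simp add: one[symmetric] sum_distrib_right mult.assoc)
 also have "... = (\<Sum>b<r. ad (v b) * \<pi> s * v b * w a)"
 by (intro sum.cong refl) (simp add: c[unfolded mult.assoc] mult.assoc)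
 also have "... = s * w a" by (simp add: v'[OF s] flip: sum_distrib_right)
 finally show ?thesis .
 qed
 have sumw: "(\<Sum>a<q. ad (w a) * w a) = pr d"
 using w(2)[OF opsysD(3)[OF S]] by (simp add: E(3) mult.assoc opsD(1)[OF w(1)])
 have adinter: "ad x * s = \<pi> s * ad x" if "!!s. s : S ==> x * \<pi> s = s * x" "s : S" for x s
 proof -
 have "ad (x * \<pi> (ad s)) = ad (ad s * x)" using that opsysD(4)[OF S] by simp
 then show ?thesis using E(2)[OF that(2)] by simp
 qed
 have comm: "ad x * y : commutant d S1"
 if "x : ops n d" "y : ops n d" "!!s. s : S ==> x * \<pi> s = s * x" "!!s. s : S ==> y * \<pi> s = s * y" for x y
 unfolding commutant_def S1_def
 proof (intro CollectI conjI ballI)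
 show "ad x * y : ops d d" using that by blast
 fix t assume "t : \<pi> ` S"
 then obtain s where s: "s : S" "t = \<pi> s" by blast
 show "ad x * y * t = t * (ad x * y)"
 using that(4)[OF s(1)] adinter[OF that(3) s(1)] s(2) by (metis mult.assoc)
 qed
 have step: "\<exists>x. x : ops n d & (\<forall>s\<in>S. x * \<pi> s = s * x) & (\<forall>\<xi>\<in>spc d. x \<rhd> \<xi> = 0 --> (\<forall>a<k. w a \<rhd> \<xi> = 0))"
 if "k \<le> q" for k
 using that
 proof (induction k)
 case 0
 then show ?case by (intro exI[of _ 0]) auto
 next
 case (Suc k)
 then obtain x where x: "x : ops n d" "!!s. s : S ==> x * \<pi> s = s * x"
 "!!\<xi>. \<xi> : spc d ==> x \<rhd> \<xi> = 0 ==> \<forall>a<k. w a \<rhd> \<xi> = 0" by auto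
 define K where "K = ad x * x"
 have K: "K : commutant d S1" "positive K" unfolding K_def using x by (auto intro: comm positive_ad_mult)
 obtain g h Q where Q: "Q : ops d d" "ad Q = Q" "Q * Q = Q" "K * Q = K" "g * h = Q" "g * K = h"
 "!!C. alg_closed d K C ==> g : C & h : C & Q : C"
 using positive_calculus[OF commutantD(1)[OF K(1)] K(2)] by metis
 define N where "N = pr d - Q"
 have N: "N : commutant d S1"
 unfolding N_def using Q(7)[OF alg_closed_commutant[OF S1 K(1)]] commutant_pr[OF S1] by (intro commutant_diff) auto
 have adN: "ad N = N" using Q(2) by (simp add: N_def)
 have KN: "K * N = 0" using Q(4) opsD(2)[OF commutantD(1)[OF K(1)]] by (simp add: N_def algebra_simps)
 have xN: "x * N = 0"
 proof (rule ad_mult_eq_0)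
 show "ad (x * N) * (x * N) = 0" using KN by (simp add: K_def mult.assoc)
 qed
 have wk: "w k : ops n d" "!!s. s : S ==> w k * \<pi> s = s * w k" using w(1) inter Suc.prems by auto
 define y where "y = ad x * w k"
 have y: "y : commutant d S1" unfolding y_def by (intro comm x(1,2) wk)
 have NN: "N * N = N" using Q(3) opsD[OF Q(1)] by (simp add: N_def algebra_simps)
 have "y * N = y * N * N" by (simp add: NN mult.assoc)
 also have "... = N * y * N" using commutant_commutative[OF S1 inc1 y N] by simp
 also have "N * y = ad (x * N) * w k" by (simp add: y_def adN mult.assoc)
 finally have yN: "y * N = 0" using xN by simp
 let ?x = "x + w k * N"
 show ?case
 proof (intro exI[of _ ?x] conjI ballI impI)
 show "?x : ops n d" using x(1) wk(1) commutantD(1)[OF N] by blast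
 show "?x * \<pi> s = s * ?x" if "s : S" for s
 proof -
 have "N * \<pi> s = \<pi> s * N" using commutantD(2)[OF N] that by (auto simp: S1_def)
 then have "w k * N * \<pi> s = (w k * \<pi> s) * N" by (simp add: mult.assoc)
 also have "... = s * (w k * N)" by (simp add: wk(2)[OF that] mult.assoc)
 finally show ?thesis by (simp add: distrib_left distrib_right x(2)[OF that])
 qed
 fix \<xi> assume \<xi>: "\<xi> : spc d" "?x \<rhd> \<xi> = 0"
 have "(ad x * ?x) \<rhd> \<xi> = 0" using \<xi>(2) by (simp del: ap_simps(2))
 then have "(K + y * N) \<rhd> \<xi> = 0" by (simp add: K_def y_def algebra_simps)
 then have "K \<rhd> \<xi> = 0" by (simp add: yN)
 then have "Q \<rhd> \<xi> = 0" using Q(5,6) by (metis ap_0_right ap_simps(1))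
 then have N\<xi>: "N \<rhd> \<xi> = \<xi>" using \<xi>(1) by (simp add: N_def spc_def)
 have "x \<rhd> \<xi> = 0" using xN N\<xi> by (metis ap_simps(1,5))
 moreover from this have "w k \<rhd> \<xi> = 0" using \<xi>(2) N\<xi> by simp
 ultimately show "\<forall>a<Suc k. w a \<rhd> \<xi> = 0" using x(3)[OF \<xi>(1)] by (auto simp: less_Suc_eq)
 qed
 qed
 obtain x where x': "x : ops n d & (\<forall>s\<in>S. x * \<pi> s = s * x) & (\<forall>\<xi>\<in>spc d. x \<rhd> \<xi> = 0 --> (\<forall>a<q. w a \<rhd> \<xi> = 0))"
 using step[OF order_refl] by (elim exE) (rule that; assumption)
 have x: "x : ops n d" "!!s. s : S ==> x * \<pi> s = s * x"
 "!!\<xi>. \<xi> : spc d ==> x \<rhd> \<xi> = 0 ==> \<forall>a<q. w a \<rhd> \<xi> = 0" using x' by simp_all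
 have x_inj: "\<xi> = 0" if "\<xi> : spc d" "x \<rhd> \<xi> = 0" for \<xi>
 proof -
 have "\<xi> = (\<Sum>a<q. ad (w a) * w a) \<rhd> \<xi>" unfolding sumw using that(1) by (simp add: spc_def)
 also have "... = 0" using x(3)[OF that] by (simp add: ap_sum_left)
 finally show ?thesis .
 qed
 define K where "K = ad x * x"
 have K: "K : commutant d S1" "positive K" unfolding K_def using x by (auto intro: comm positive_ad_mult)
 obtain g h Q where g: "g : ops d d" "h : ops d d" "Q : ops d d" "ad g = g" "K * Q = K" "g * K * g = Q" "g * h = Q"
 "!!C. alg_closed d K C ==> g : C & h : C & Q : C"
 using positive_calculus[OF commutantD(1)[OF K(1)] K(2)] by metis
 have gc: "g : commutant d S1" using g(8)[OF alg_closed_commutant[OF S1 K(1)]] by simp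
 have Qd: "Q = pr d"
 proof (rule ops_eqI[OF g(3) ops_pr])
 fix j assume "j < d"
 then have s: "bvec j - Q \<rhd> bvec j : spc d" using g(3) by auto
 have "K \<rhd> (bvec j - Q \<rhd> bvec j) = 0" using g(5) by (metis ap_diff_right ap_simps(1) cancel_comm_monoid_add_class.diff_cancel)
 then have "ip (x \<rhd> (bvec j - Q \<rhd> bvec j)) (x \<rhd> (bvec j - Q \<rhd> bvec j)) = 0"
 by (metis K_def ap_simps(1) ip_0(2) ip_ad_right)
 then have "bvec j - Q \<rhd> bvec j = 0" by (intro x_inj[OF s]) (simp only: ip_self_eq_0)
 then show "Q \<rhd> bvec j = pr d \<rhd> bvec j" using \<open>j < d\<close> by simp
 qed
 define L where "L = (%\<xi>. x \<rhd> \<xi>) ` spc d"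
 have vL: "vsub n L"
 unfolding vsub_def L_def
 proof (intro conjI ballI allI)
 show "(%\<xi>. x \<rhd> \<xi>) ` spc d \<subseteq> spc n" using x(1) by auto
 show "0 : (%\<xi>. x \<rhd> \<xi>) ` spc d" by (rule image_eqI[of _ _ 0]) auto
 fix \<xi> assume \<xi>: "\<xi> : (%\<xi>. x \<rhd> \<xi>) ` spc d"
 show "smult c \<xi> : (%\<xi>. x \<rhd> \<xi>) ` spc d" for c using \<xi> by (auto simp flip: ap_smult_right)
 fix \<eta> assume "\<eta> : (%\<xi>. x \<rhd> \<xi>) ` spc d"
 then show "\<xi> + \<eta> : (%\<xi>. x \<rhd> \<xi>) ` spc d" using \<xi> by (auto simp flip: ap_add_right)
 qed
 have "L = {0} \<or> L = spc n"
 proof (rule irr[unfolded irreducible_def, rule_format], intro conjI vL ballI allI impI)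
 fix s \<xi> assume s: "s : S" and "\<xi> : L"
 then obtain \<zeta> where \<zeta>: "\<zeta> : spc d" "\<xi> = x \<rhd> \<zeta>" by (auto simp: L_def)
 have "s \<rhd> \<xi> = x \<rhd> \<pi> s \<rhd> \<zeta>" using x(2)[OF s] \<zeta>(2) by (metis ap_simps(1))
 then show "s \<rhd> \<xi> : L" using E(1)[OF s] by (auto simp: L_def)
 next
 fix p :: nat and s
 assume as: "(\<forall>i<p. \<forall>j<p. s i j : S & ad (s i j) = s j i) &
 (\<forall>\<xi>. (\<forall>i. \<xi> i : L) --> 0 \<le> (\<Sum>i<p. \<Sum>j<p. ip (\<xi> i) (s i j \<rhd> \<xi> j)))"
 have "bpos {..<p} (%i j. \<pi> (s i j))"
 unfolding bpos_def
 proof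
 fix \<xi>
 have "0 \<le> (\<Sum>i<p. \<Sum>j<p. ip (x \<rhd> g \<rhd> \<xi> i) (s i j \<rhd> x \<rhd> g \<rhd> \<xi> j))"
 using as g(1) by (auto simp: L_def)
 also have "... = (\<Sum>i<p. \<Sum>j<p. ip (\<xi> i) (\<pi> (s i j) \<rhd> \<xi> j))"
 proof (intro sum.cong refl)
 fix i j assume "i : {..<p}" "j : {..<p}"
 then have s: "s i j : S" using as by auto
 have "ad (x * g) * s i j * (x * g) = g * (ad x * s i j) * x * g" by (simp add: g(4) mult.assoc)
 also have "... = g * \<pi> (s i j) * K * g" by (simp add: adinter[OF x(2) s] K_def mult.assoc)
 also have "... = \<pi> (s i j) * (g * K * g)"
 using commutantD(2)[OF gc, of "\<pi> (s i j)"] s by (simp add: S1_def mult.assoc[symmetric])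
 also have "... = \<pi> (s i j)" using E(1)[OF s] by (simp add: g(6) Qd opsD)
 finally show "ip (x \<rhd> g \<rhd> \<xi> i) (s i j \<rhd> x \<rhd> g \<rhd> \<xi> j) = ip (\<xi> i) (\<pi> (s i j) \<rhd> \<xi> j)"
 by (metis ap_simps(1) ip_ad_right)
 qed
 finally show "0 \<le> (\<Sum>i<p. \<Sum>j<p. ip (\<xi> i) (\<pi> (s i j) \<rhd> \<xi> j))" .
 qed
 then show "bpos {..<p} s" using E(7)[of p s] as by blast
 qed
 then have "n \<le> d"
 proof
 assume L0: "L = {0}"
 have "d = 0"
 proof (rule ccontr)
 assume "d ~= 0"
 then have "bvec 0 : spc d" by simp
 then have "bvec 0 = 0" using x_inj L0 by (auto simp: L_def)
 then show False by (simp add: bvec_def monom_eq_0_iff)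
 qed
 then have "\<pi> (pr n) = \<pi> 0" using E(3) E(5)[OF opsysD(6)[OF S], of 0] by simp
 then have "pr n = 0" using inj opsysD(3,6)[OF S] by (auto dest: inj_onD)
 then have "n = 0" by (metis ap_simps(5) bvec_def monom_eq_0_iff neq0_conv pr_bvec zero_neq_one)
 then show ?thesis by simp
 next
 assume Ln: "L = spc n"
 define u where "u = x * g"
 have u: "u : ops n d" unfolding u_def using x(1) g(1) by blast
 have uu: "ad u * u = pr d" using g(6) by (simp add: u_def g(4) K_def Qd mult.assoc)
 have "u * ad u = pr n"
 proof (rule ops_eqI[of _ n n])
 show "u * ad u : ops n n" using u by blast
 fix j assume "j < n"
 then have "bvec j : L" by (simp add: Ln)
 then obtain \<zeta> where \<zeta>: "\<zeta> : spc d" "bvec j = x \<rhd> \<zeta>" by (auto simp: L_def)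
 have "x \<rhd> \<zeta> = u \<rhd> h \<rhd> \<zeta>"
 using g(7) \<zeta>(1) by (simp add: u_def spc_def Qd flip: ap_simps(1)) (simp add: g(7) Qd spc_def mult.assoc)
 moreover have "(u * ad u) \<rhd> u \<rhd> h \<rhd> \<zeta> = u \<rhd> (ad u * u) \<rhd> h \<rhd> \<zeta>" by simp
 moreover have "... = u \<rhd> h \<rhd> \<zeta>" using ops_ap[OF g(2)] by (simp add: uu spc_def)
 ultimately have "(u * ad u) \<rhd> bvec j = bvec j" by (simp only: \<zeta>(2))
 then show "(u * ad u) \<rhd> bvec j = pr n \<rhd> bvec j" using \<open>j < n\<close> by simp
 qed auto
 then show ?thesis using isometry_le[of "ad u" d n] u by auto
 qed
 then show "n \<le> d'" using \<open>d \<le> d'\<close> by simp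
qed

section \<open>Pullbacks\<close>

definition opullback :: "nat => aop set => nat => aop set => bool" where
 "opullback n S m T \<longleftrightarrow> (\<exists>(r :: nat) x. (\<forall>i<r. x i : ops m n) & (\<Sum>i<r. ad (x i) * x i) = pr n &
 S = scl.span {ad (x i) * t * x j | i j t. i < r & j < r & t : T})"

lemma calculus_injective:
 assumes k: "k : ops n n" "positive k" and inj: "!!\<xi>. \<xi> : spc n ==> k \<rhd> \<xi> = 0 ==> \<xi> = 0"
 obtains g h where "g : ops n n" "h : ops n n" "ad g = g" "ad h = h" "g * k * g = pr n"
 "g * h = pr n" "h * g = pr n" "!!C. alg_closed n k C ==> g : C & h : C"
proof -
 obtain g h Q where g: "g : ops n n" "h : ops n n" "Q : ops n n" "ad g = g" "ad h = h" "k * Q = k"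
 "g * k * g = Q" "g * h = Q" "h * g = Q"
 "!!C. alg_closed n k C ==> g : C & h : C & Q : C"
 using positive_calculus[OF k] by metis
 have "Q = pr n"
 proof (rule ops_eqI[OF g(3) ops_pr])
 fix j assume "j < n"
 then have s: "bvec j - Q \<rhd> bvec j : spc n" using ops_ap[OF g(3)] by simp
 have "k \<rhd> Q \<rhd> bvec j = k \<rhd> bvec j" using g(6) by (metis ap_simps(1))
 then have "k \<rhd> (bvec j - Q \<rhd> bvec j) = 0" by simp
 then have "bvec j - Q \<rhd> bvec j = 0" using inj[OF s] by blast
 then show "Q \<rhd> bvec j = pr n \<rhd> bvec j" using \<open>j < n\<close> by simp
 qed
 then show ?thesis using that g by metis
qed

text \<open>The sum \<open>a\<close> of the \<open>x\<^sub>i\<^sup>* x\<^sub>i\<close> is injective by \<open>unit\<close> and multiplies \<open>S\<close> into itself by \<open>module\<close>, hence so do the powers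
\<open>g = a\<^sup>-\<^sup>1\<^sup>/\<^sup>2\<close> and \<open>h = a\<^sup>1\<^sup>/\<^sup>2\<close>. Replacing \<open>x\<^sub>i\<close> by \<open>x\<^sub>i g\<close> normalises the family without leaving \<open>S\<close>.\<close>

lemma pullback_normalise:
 assumes S: "opsys n S" and T: "opsys m T" and I: "finite I"
 and x: "!!i. i : I ==> x i : ops m n"
 and closed: "!!i j t. i : I ==> j : I ==> t : T ==> ad (x i) * t * x j : S"
 and module: "!!i s. i : I ==> s : S ==> ad (x i) * x i * s : S"
 and unit: "(\<Sum>k<N :: nat. ad (x (p k)) * x (q k)) = pr n" "!!k. k < N ==> q k : I"
 and span: "S \<subseteq> scl.span {ad (x i) * t * x j | i j t. i : I & j : I & t : T}"
 shows "opullback n S m T"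
proof -
 define a where "a = (\<Sum>i\<in>I. ad (x i) * x i)"
 have a: "a : ops n n" "positive a"
 unfolding a_def using x by (auto intro!: positive_sum positive_ad_mult)
 have inj: "\<xi> = 0" if "\<xi> : spc n" "a \<rhd> \<xi> = 0" for \<xi>
 proof -
 have "(\<Sum>i\<in>I. ip (x i \<rhd> \<xi>) (x i \<rhd> \<xi>)) = ip \<xi> (a \<rhd> \<xi>)"
 unfolding a_def by (rule sum_ip_eq1)
 also have "... = 0" using that(2) by simp
 finally have "ip (x i \<rhd> \<xi>) (x i \<rhd> \<xi>) = 0" if "i : I" for i
 using that I by (subst (asm) sum_nonneg_eq_0_iff) auto
 then have x0: "x i \<rhd> \<xi> = 0" if "i : I" for i using that by simp
 have "\<xi> = (\<Sum>k<N. ad (x (p k)) * x (q k)) \<rhd> \<xi>" unfolding unit(1) using that(1) by (simp add: spc_def)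
 also have "... = 0" using x0 unit(2) by (simp add: ap_sum_left)
 finally show ?thesis .
 qed
 obtain g h where g: "g : ops n n" "h : ops n n" "ad g = g" "ad h = h" "g * a * g = pr n"
 "g * h = pr n" "h * g = pr n" "!!C. alg_closed n a C ==> g : C & h : C"
 using calculus_injective[OF a inj] by metis
 have "alg_closed n a {y. \<forall>s\<in>S. y * s : S}"
 unfolding alg_closed_def scl.subspace_def
 proof (intro conjI ballI allI)
 show "pr n : {y. \<forall>s\<in>S. y * s : S}" by (intro CollectI ballI) (simp add: opsD(1)[OF opsysD(5)[OF S]])
 fix y assume y: "y : {y. \<forall>s\<in>S. y * s : S}"
 show "a * y : {y. \<forall>s\<in>S. y * s : S}"
 proof (intro CollectI ballI)
 fix s assume "s : S"
 then have "ad (x i) * x i * (y * s) : S" if "i : I" for i using module[OF that] y by blast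
 then have "(\<Sum>i\<in>I. ad (x i) * x i * (y * s)) : S" by (rule opsysD(10)[OF S])
 then show "a * y * s : S" by (simp add: a_def sum_distrib_right mult.assoc)
 qed
 qed (use opsysD(6,7,9)[OF S] in \<open>auto simp: distrib_right\<close>)
 then have gl: "g * s : S" "h * s : S" if "s : S" for s using g(8) that by blast+
 have gr: "s * g : S" "s * h : S" if "s : S" for s
 proof -
 have "ad (g * ad s) : S" "ad (h * ad s) : S" using gl opsysD(4)[OF S] that by blast+
 then show "s * g : S" "s * h : S" by (simp_all add: g(3,4))
 qed
 obtain e where e: "bij_betw e {..<card I} I"
 using ex_bij_betw_nat_finite[OF I] by (auto simp: atLeast0LessThan)
 have eI: "e i : I" if "i < card I" for i using e that by (auto simp: bij_betw_def)
 define X where "X i = x (e i) * g" for i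
 let ?G = "{ad (x i) * t * x j | i j t. i : I & j : I & t : T}"
 let ?G' = "{ad (X i) * t * X j | i j t. i < card I & j < card I & t : T}"
 have "(\<Sum>i<card I. ad (X i) * X i) = pr n"
 proof -
 have "(\<Sum>i<card I. ad (X i) * X i) = (\<Sum>i\<in>I. g * (ad (x i) * x i) * g)"
 unfolding X_def using sum.reindex_bij_betw[OF e, of "%i. g * (ad (x i) * x i) * g"]
 by (simp add: g(3) mult.assoc)
 also have "... = g * a * g" by (simp add: a_def sum_distrib_left sum_distrib_right)
 finally show ?thesis by (simp add: g(5))
 qed
 moreover have "S = scl.span ?G'"
 proof
 show "scl.span ?G' \<subseteq> S"
 proof (rule scl.span_minimal[OF _ opsysD(2)[OF S]])
 show "?G' \<subseteq> S"
 proof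
 fix y assume "y : ?G'"
 then obtain i j t where y: "i < card I" "j < card I" "t : T" "y = ad (X i) * t * X j" by blast
 have "g * (ad (x (e i)) * t * x (e j)) * g : S" using closed eI y gl gr by blast
 then show "y : S" by (simp add: y X_def g(3) mult.assoc)
 qed
 qed
 have "scl.span ?G \<subseteq> {y. g * y * g : scl.span ?G'}"
 proof (rule scl.span_minimal)
 show "?G \<subseteq> {y. g * y * g : scl.span ?G'}"
 proof
 fix y assume "y : ?G"
 then obtain i j t where y: "i : I" "j : I" "t : T" "y = ad (x i) * t * x j" by blast
 obtain i' j' where ij: "i' < card I" "j' < card I" "i = e i'" "j = e j'"
 using y e unfolding bij_betw_def by (metis imageE lessThan_iff)
 have "g * y * g = ad (X i') * t * X j'" by (simp add: y ij X_def g(3) mult.assoc)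
 then show "y : {y. g * y * g : scl.span ?G'}" using y ij by (auto intro!: scl.span_base)
 qed
 show "scl.subspace {y. g * y * g : scl.span ?G'}"
 by (auto simp: scl.subspace_def distrib_left distrib_right scl.span_zero scl.span_add scl.span_scale)
 qed
 then show "S \<subseteq> scl.span ?G'"
 proof -
 have "s : scl.span ?G'" if s: "s : S" for s
 proof -
 have "h * s * h : {y. g * y * g : scl.span ?G'}"
 using \<open>scl.span ?G \<subseteq> _\<close> span gl(2) gr(2) s by blast
 moreover have "g * (h * s * h) * g = s"
 using opsD[OF opsysD(5)[OF S s]] g(6,7) by (metis mult.assoc)
 ultimately show ?thesis by simp
 qed
 then show ?thesis by blast
 qed
 qed
 moreover have "X i : ops m n" if "i < card I" for i unfolding X_def using x eI that g(1) by blast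
 ultimately show ?thesis unfolding opullback_def by blast
qed

section \<open>Equivalence of incompressible operator systems\<close>

lemma cinner_add_left: "cinner (x + y) z = cinner x z + cinner y (z :: 'a :: chilbert_space)"
 by (metis cinner_add_right cinner_commute complex_cnj_add)

lemma cinner_zero_right [simp]: "cinner x (0 :: 'a :: chilbert_space) = 0"
 using cinner_add_right[of x 0 0] by simp

lemma cinner_zero_left [simp]: "cinner (0 :: 'a :: chilbert_space) x = 0"
 using cinner_add_left[of 0 0 x] by simp

lemma cinner_sum_right: "cinner x (sum f A) = (\<Sum>a\<in>A. cinner x (f a :: 'a :: chilbert_space))"
 by (induction A rule: infinite_finite_induct) (auto simp: cinner_add_right)

lemma cinner_sum_left: "cinner (sum f A) x = (\<Sum>a\<in>A. cinner (f a :: 'a :: chilbert_space) x)"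
 by (induction A rule: infinite_finite_induct) (auto simp: cinner_add_left)

definition obpos :: "'i set => ('i => 'i => 'a :: chilbert_space \<Rightarrow>\<^sub>L 'a) => bool" where
 "obpos K x \<longleftrightarrow> (\<forall>\<xi>. 0 \<le> (\<Sum>i\<in>K. \<Sum>j\<in>K. cinner (\<xi> i) (blinfun_apply (x i j) (\<xi> j))))"

lemma obpos_reindex:
 assumes "bij_betw e K K'"
 shows "obpos K' s \<longleftrightarrow> obpos K (%i j. s (e i) (e j))"
proof -
 have eq: "(\<Sum>i\<in>K'. \<Sum>j\<in>K'. cinner (\<xi> i) (blinfun_apply (s i j) (\<xi> j)))
 = (\<Sum>i\<in>K. \<Sum>j\<in>K. cinner (\<xi> (e i)) (blinfun_apply (s (e i) (e j)) (\<xi> (e j))))" for \<xi>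
 by (simp add: sum.reindex_bij_betw[OF assms, symmetric])
 show ?thesis
 proof
 assume *: "obpos K (%i j. s (e i) (e j))"
 show "obpos K' s"
 unfolding obpos_def eq using * unfolding obpos_def by (auto dest: spec[of _ "%i. _ (e i)"])
 next
 assume *: "obpos K' s"
 show "obpos K (%i j. s (e i) (e j))"
 unfolding obpos_def
 proof
 fix \<xi>
 have inv: "inv_into K e (e i) = i" if "i : K" for i
 using that assms by (simp add: bij_betw_def)
 have "0 \<le> (\<Sum>i\<in>K. \<Sum>j\<in>K. cinner (\<xi> (inv_into K e (e i))) (blinfun_apply (s (e i) (e j)) (\<xi> (inv_into K e (e j)))))"
 using *[unfolded obpos_def, THEN spec, of "%i. \<xi> (inv_into K e i)"] unfolding eq .
 then show "0 \<le> (\<Sum>i\<in>K. \<Sum>j\<in>K. cinner (\<xi> i) (blinfun_apply (s (e i) (e j)) (\<xi> j)))"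
 by (simp add: inv)
 qed
 qed
qed

definition ucoe :: "nat => aop set => (aop => 'a :: chilbert_space \<Rightarrow>\<^sub>L 'a) => bool" where
 "ucoe n S \<phi> \<longleftrightarrow> (\<forall>x\<in>S. \<forall>y\<in>S. \<phi> (x + y) = \<phi> x + \<phi> y) &
 (\<forall>a. \<forall>x\<in>S. \<phi> (scl a x) = scaleC_blinfun a (\<phi> x)) & \<phi> (pr n) = id_blinfun &
 (\<forall>(p :: nat) x. (\<forall>i<p. \<forall>j<p. x i j : S) --> (bpos {..<p} x \<longleftrightarrow> obpos {..<p} (%i j. \<phi> (x i j))))"

lemma ucoe_index:
 assumes "ucoe n S \<phi>" "finite K" "!!i j. i : K ==> j : K ==> x i j : S"
 shows "bpos K x \<longleftrightarrow> obpos K (%i j. \<phi> (x i j))"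
proof -
 obtain e where e: "bij_betw e {..<card K} K"
 using ex_bij_betw_nat_finite[OF assms(2)] by (auto simp: atLeast0LessThan)
 have "e i : K" if "i < card K" for i using e that by (auto simp: bij_betw_def)
 then show ?thesis
 using assms(1,3) unfolding bpos_reindex[OF e] obpos_reindex[OF e] ucoe_def by simp
qed

lemma scaleC_blinfun_zero: "scaleC_blinfun 0 x = 0"
proof (rule blinfun_eqI)
 fix \<xi>
 have "scaleC 0 (blinfun_apply x \<xi>) = scaleC 0 (blinfun_apply x \<xi>) + scaleC 0 (blinfun_apply x \<xi>)"
 by (metis add_0 scaleC_add_left)
 then show "blinfun_apply (scaleC_blinfun 0 x) \<xi> = blinfun_apply 0 \<xi>"
 by (simp add: scaleC_blinfun.rep_eq)
qed

lemma ucoe_inj: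
 assumes S: "opsys n S" and \<phi>: "ucoe n S \<phi>"
 shows "inj_on \<phi> S"
proof (rule inj_onI)
 fix x y assume xy: "x : S" "y : S" "\<phi> x = \<phi> y"
 have d: "z : S & \<phi> z = 0" if z: "z = x - y \<or> z = y - x" for z
 proof -
 have "\<phi> (a - b) = 0" if "a : S" "b : S" "\<phi> a = \<phi> b" for a b
 proof -
 have "\<phi> a = \<phi> ((a - b) + b)" by simp
 also have "... = \<phi> (a - b) + \<phi> b"
 using \<phi> that opsysD(8)[OF S] unfolding ucoe_def by blast
 finally show ?thesis using that(3) by simp
 qed
 then show ?thesis using z xy opsysD(8)[OF S] by metis
 qed
 have "positive z" if z: "z = x - y \<or> z = y - x" for z
 proof -
 have "obpos {..<1 :: nat} (%_ _. \<phi> z)" using d[OF z] by (simp add: obpos_def)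
 moreover have "bpos {..<1 :: nat} (%_ _. z) \<longleftrightarrow> obpos {..<1 :: nat} (%_ _. \<phi> z)"
 by (rule ucoe_index[OF \<phi>]) (use d[OF z] in auto)
 ultimately have "bpos {..<1 :: nat} (%_ _. z)" by (simp only:)
 then show ?thesis unfolding bpos_def positive_def by (auto dest: spec[of _ "%_. _"])
 qed
 then have p: "positive (x - y)" "positive (y - x)" by auto
 have "ip \<xi> ((x - y) \<rhd> \<xi>) = 0" for \<xi>
 proof -
 have 1: "0 \<le> ip \<xi> ((x - y) \<rhd> \<xi>)" "0 \<le> ip \<xi> ((y - x) \<rhd> \<xi>)" using p unfolding positive_def by blast+
 have "ip \<xi> ((y - x) \<rhd> \<xi>) = - ip \<xi> ((x - y) \<rhd> \<xi>)" by simp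
 with 1 show ?thesis unfolding complex_nonneg_iff by (simp add: complex_eq_iff)
 qed
 then have "x - y = 0" by (rule aop_polarize)
 then show "x = y" by simp
qed

lemmas bc_add = bounded_bilinear.add_left[OF bounded_bilinear_blinfun_compose]
 bounded_bilinear.add_right[OF bounded_bilinear_blinfun_compose]

lemmas bc_sum = bounded_bilinear.sum_left[OF bounded_bilinear_blinfun_compose]
 bounded_bilinear.sum_right[OF bounded_bilinear_blinfun_compose]

lemma bc_assoc: "(x o\<^sub>L y) o\<^sub>L z = x o\<^sub>L (y o\<^sub>L z)"
 by (rule blinfun_eqI) simp

lemma bc_id: "id_blinfun o\<^sub>L x = x" "x o\<^sub>L id_blinfun = x"
 by (rule blinfun_eqI, simp)+

text \<open>The TRO enters only through finitely many of its elements \<open>g i\<close>, their adjoints \<open>h i\<close>, and the two resolutions of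
the identity by products of them. The hypotheses are symmetric in \<open>S\<close> and \<open>T\<close>, see \<open>swap\<close>.\<close>

locale delta_data =
 fixes n m :: nat and S T :: "aop set"
 and \<phi> :: "aop => 'h::chilbert_space \<Rightarrow>\<^sub>L 'h" and \<psi> :: "aop => 'k::chilbert_space \<Rightarrow>\<^sub>L 'k"
 and I :: "'i set" and g :: "'i => 'h \<Rightarrow>\<^sub>L 'k" and h :: "'i => 'k \<Rightarrow>\<^sub>L 'h"
 and N :: nat and p q :: "nat => 'i" and N' :: nat and p' q' :: "nat => 'i"
 assumes S: "opsys n S" and T: "opsys m T" and \<phi>: "ucoe n S \<phi>" and \<psi>: "ucoe m T \<psi>"
 and I: "finite I"
 and adj: "!!i \<xi> \<eta>. i : I ==> cinner (blinfun_apply (h i) \<eta>) \<xi> = cinner \<eta> (blinfun_apply (g i) \<xi>)"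
 and gcl: "!!i. i : I ==> g i : bounded_ops" and hcl: "!!i. i : I ==> h i : bounded_ops"
 and TS: "!!i j t. i : I ==> j : I ==> t : T ==> h i o\<^sub>L (\<psi> t o\<^sub>L g j) : \<phi> ` S"
 and ST: "!!i j s. i : I ==> j : I ==> s : S ==> g i o\<^sub>L (\<phi> s o\<^sub>L h j) : \<psi> ` T"
 and pq: "!!k. k < N ==> p k : I & q k : I" and pq': "!!k. k < N' ==> p' k : I & q' k : I"
 and unit: "(\<Sum>k<N. h (p k) o\<^sub>L g (q k)) = id_blinfun" "(\<Sum>k<N. h (q k) o\<^sub>L g (p k)) = id_blinfun"
 and unit': "(\<Sum>k<N'. g (p' k) o\<^sub>L h (q' k)) = id_blinfun" "(\<Sum>k<N'. g (q' k) o\<^sub>L h (p' k)) = id_blinfun"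
begin

lemma adj': "i : I ==> cinner \<xi> (blinfun_apply (h i) \<eta>) = cinner (blinfun_apply (g i) \<xi>) \<eta>"
 by (metis adj cinner_commute)

definition E :: "'i => 'i => aop => aop" where
 "E i j t = inv_into S \<phi> (h i o\<^sub>L (\<psi> t o\<^sub>L g j))"

definition F :: "'i => 'i => aop => aop" where
 "F i j s = inv_into T \<psi> (g i o\<^sub>L (\<phi> s o\<^sub>L h j))"

lemma ES: "i : I ==> j : I ==> t : T ==> E i j t : S"
 unfolding E_def by (rule inv_into_into[OF TS])

lemma \<phi>E: "i : I ==> j : I ==> t : T ==> \<phi> (E i j t) = h i o\<^sub>L (\<psi> t o\<^sub>L g j)"
 unfolding E_def by (rule f_inv_into_f[OF TS])

lemma FT: "i : I ==> j : I ==> s : S ==> F i j s : T"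
 unfolding F_def by (rule inv_into_into[OF ST])

lemma \<psi>F: "i : I ==> j : I ==> s : S ==> \<psi> (F i j s) = g i o\<^sub>L (\<phi> s o\<^sub>L h j)"
 unfolding F_def by (rule f_inv_into_f[OF ST])

lemma swap: "delta_data m n T S \<psi> \<phi> I h g N' p' q' N p q"
 by standard (use S T \<phi> \<psi> I adj' gcl hcl TS ST pq pq' unit unit' in auto)

lemma \<phi>_inj: "x : S ==> y : S ==> \<phi> x = \<phi> y ==> x = y"
 using ucoe_inj[OF S \<phi>] by (rule inj_onD)

lemma \<phi>_add: "x : S ==> y : S ==> \<phi> (x + y) = \<phi> x + \<phi> y"
 using \<phi> by (simp add: ucoe_def)

lemma \<phi>_scl: "x : S ==> \<phi> (scl c x) = scaleC_blinfun c (\<phi> x)"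
 using \<phi> by (simp add: ucoe_def)

lemma \<phi>_sum: "(!!a. a : A ==> f a : S) ==> \<phi> (sum f A) = (\<Sum>a\<in>A. \<phi> (f a))"
proof (induction A rule: infinite_finite_induct)
 case (insert a A)
 then show ?case using opsysD(10)[OF S, of A f] by (simp add: \<phi>_add)
qed (use \<phi>_scl[OF opsysD(6)[OF S], of 0] in \<open>simp_all add: scaleC_blinfun_zero\<close>)

lemma units:
 "(\<Sum>k<N. h (q k) o\<^sub>L (g (p k) o\<^sub>L X)) = X" "(\<Sum>k<N. Y o\<^sub>L (h (p k) o\<^sub>L g (q k))) = Y"
proof -
 have "(\<Sum>k<N. h (q k) o\<^sub>L (g (p k) o\<^sub>L X)) = (\<Sum>k<N. h (q k) o\<^sub>L g (p k)) o\<^sub>L X"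
 by (simp add: bc_sum bc_assoc)
 then show "(\<Sum>k<N. h (q k) o\<^sub>L (g (p k) o\<^sub>L X)) = X" by (simp add: unit bc_id)
 have "(\<Sum>k<N. Y o\<^sub>L (h (p k) o\<^sub>L g (q k))) = Y o\<^sub>L (\<Sum>k<N. h (p k) o\<^sub>L g (q k))"
 by (simp add: bc_sum bc_assoc)
 then show "(\<Sum>k<N. Y o\<^sub>L (h (p k) o\<^sub>L g (q k))) = Y" by (simp add: unit bc_id)
qed

lemma EF_unit:
 assumes s: "s : S"
 shows "(\<Sum>k<N. \<Sum>l<N. E (q k) (q l) (F (p k) (p l) s)) = s"
proof (rule \<phi>_inj)
 have e: "\<phi> (E (q k) (q l) (F (p k) (p l) s)) = h (q k) o\<^sub>L (g (p k) o\<^sub>L (\<phi> s o\<^sub>L (h (p l) o\<^sub>L g (q l))))"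
 "E (q k) (q l) (F (p k) (p l) s) : S" if "k < N" "l < N" for k l
 using pq that s by (simp_all add: \<phi>E \<psi>F FT ES bc_assoc)
 show "(\<Sum>k<N. \<Sum>l<N. E (q k) (q l) (F (p k) (p l) s)) : S"
 using e(2) by (intro opsysD(10)[OF S]) auto
 have "\<phi> (\<Sum>k<N. \<Sum>l<N. E (q k) (q l) (F (p k) (p l) s))
 = (\<Sum>k<N. \<phi> (\<Sum>l<N. E (q k) (q l) (F (p k) (p l) s)))"
 using e(2) by (intro \<phi>_sum opsysD(10)[OF S]) auto
 also have "... = (\<Sum>k<N. \<Sum>l<N. \<phi> (E (q k) (q l) (F (p k) (p l) s)))"
 using e(2) by (intro sum.cong refl \<phi>_sum) auto
 also have "... = (\<Sum>k<N. \<Sum>l<N. h (q k) o\<^sub>L (g (p k) o\<^sub>L (\<phi> s o\<^sub>L (h (p l) o\<^sub>L g (q l)))))"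
 by (intro sum.cong refl) (simp add: e(1))
 also have "... = \<phi> s" by (simp add: units unit bc_id flip: bc_sum)
 finally show "\<phi> (\<Sum>k<N. \<Sum>l<N. E (q k) (q l) (F (p k) (p l) s)) = \<phi> s" .
qed (fact s)

text \<open>For positive \<open>(t k l)\<close> the matrix with entries \<open>h i (\<psi> (t k l)) g j\<close> is again positive, being a compression.\<close>

lemma kraus_E:
 obtains r :: nat and v where "!!a i. v a i : ops m n"
 "!!i j t. i : I ==> j : I ==> t : T ==> E i j t = (\<Sum>a<r. ad (v a i) * t * v a j)"
proof (rule kraus_family[OF T I, of E n])
 interpret sw: delta_data m n T S \<psi> \<phi> I h g N' p' q' N p q by (rule swap)
 fix i j assume ij: "i : I" "j : I"
 show "linear_on T (E i j)"
 unfolding linear_on_def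
 proof (intro conjI ballI allI)
 fix x y assume xy: "x : T" "y : T"
 show "E i j (x + y) = E i j x + E i j y"
 using ij xy ES opsysD(7)[OF S] opsysD(7)[OF T]
 by (intro \<phi>_inj) (simp_all add: \<phi>_add \<phi>E sw.\<phi>_add bc_add)
 next
 fix c x assume x: "x : T"
 have lin: "blinfun_apply (h i) (scaleC c \<eta>) = scaleC c (blinfun_apply (h i) \<eta>)" for \<eta>
 using hcl[OF ij(1)] by (simp add: bounded_ops_def)
 show "E i j (scl c x) = scl c (E i j x)"
 proof (rule \<phi>_inj)
 show "E i j (scl c x) : S" "scl c (E i j x) : S"
 using ij x ES opsysD(9)[OF S] opsysD(9)[OF T] by simp_all
 show "\<phi> (E i j (scl c x)) = \<phi> (scl c (E i j x))"
 using ij x ES opsysD(9)[OF T]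
 by (simp add: \<phi>_scl \<phi>E sw.\<phi>_scl) (rule blinfun_eqI, simp add: scaleC_blinfun.rep_eq lin)
 qed
 qed
 show "E i j t : ops n n" if "t : T" for t using ES[OF ij that] opsysD(5)[OF S] by blast
next
 fix t :: "'i \<times> nat => 'i \<times> nat => aop"
 let ?K = "I \<times> {..<n}"
 assume t: "!!k l. k : ?K ==> l : ?K ==> t k l : T" and pos: "bpos ?K t"
 have fin: "finite ?K" using I by simp
 have opos: "obpos ?K (%k l. \<psi> (t k l))" using ucoe_index[OF \<psi> fin, of t] t pos by blast
 have "obpos (?K \<times> I) (%x y. \<phi> ((%(k, i) (l, j). E i j (t k l)) x y))"
 unfolding obpos_def
 proof
 fix \<xi> :: "('i \<times> nat) \<times> 'i => 'h"
 define \<eta> where "\<eta> k = (\<Sum>i\<in>I. blinfun_apply (g i) (\<xi> (k, i)))" for k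
 have "(\<Sum>x\<in>?K \<times> I. \<Sum>y\<in>?K \<times> I. cinner (\<xi> x) (blinfun_apply (\<phi> ((%(k, i) (l, j). E i j (t k l)) x y)) (\<xi> y)))
 = (\<Sum>k\<in>?K. \<Sum>i\<in>I. \<Sum>l\<in>?K. \<Sum>j\<in>I. cinner (\<xi> (k, i)) (blinfun_apply (\<phi> (E i j (t k l))) (\<xi> (l, j))))"
 by (simp add: sum.cartesian_product' case_prod_beta)
 also have "... = (\<Sum>k\<in>?K. \<Sum>i\<in>I. \<Sum>l\<in>?K. \<Sum>j\<in>I.
 cinner (blinfun_apply (g i) (\<xi> (k, i))) (blinfun_apply (\<psi> (t k l)) (blinfun_apply (g j) (\<xi> (l, j)))))"
 by (intro sum.cong refl) (simp add: \<phi>E[OF _ _ t] adj')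
 also have "... = (\<Sum>k\<in>?K. \<Sum>l\<in>?K. \<Sum>i\<in>I. \<Sum>j\<in>I.
 cinner (blinfun_apply (g i) (\<xi> (k, i))) (blinfun_apply (\<psi> (t k l)) (blinfun_apply (g j) (\<xi> (l, j)))))"
 by (intro sum.cong refl sum.swap)
 also have "... = (\<Sum>k\<in>?K. \<Sum>l\<in>?K. cinner (\<eta> k) (blinfun_apply (\<psi> (t k l)) (\<eta> l)))"
 proof -
 have "(\<Sum>i\<in>I. \<Sum>j\<in>I. cinner (blinfun_apply (g i) (\<xi> (k, i))) (blinfun_apply (\<psi> (t k l)) (blinfun_apply (g j) (\<xi> (l, j)))))
 = cinner (\<eta> k) (blinfun_apply (\<psi> (t k l)) (\<eta> l))" for k l
 unfolding \<eta>_def blinfun.sum_right cinner_sum_right cinner_sum_left by (rule sum.swap)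
 then show ?thesis by simp
 qed
 also have "0 \<le> ..." using opos unfolding obpos_def by blast
 finally show "0 \<le> (\<Sum>x\<in>?K \<times> I. \<Sum>y\<in>?K \<times> I. cinner (\<xi> x) (blinfun_apply (\<phi> ((%(k, i) (l, j). E i j (t k l)) x y)) (\<xi> y)))" .
 qed
 moreover have "(%(k, i) (l, j). E i j (t k l)) x y : S" if "x : ?K \<times> I" "y : ?K \<times> I" for x y
 using that t ES by auto
 ultimately show "bpos (?K \<times> I) (%(k, i) (l, j). E i j (t k l))"
 using ucoe_index[OF \<phi>, of "?K \<times> I" "%(k, i) (l, j). E i j (t k l)"] fin I by blast
qed (rule that)

end

locale delta_kraus = delta_data n m S T \<phi> \<psi> I g h N p q N' p' q'
 for n m S T and \<phi> :: "aop => 'h::chilbert_space \<Rightarrow>\<^sub>L 'h" and \<psi> :: "aop => 'k::chilbert_space \<Rightarrow>\<^sub>L 'k"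
 and I :: "'i set" and g h N p q N' p' q' +
 fixes r1 r2 :: nat and v u :: "nat => 'i => aop"
 assumes incS: "incompressible n S" and incT: "incompressible m T"
 and v: "!!a i. v a i : ops m n"
 and Ev: "!!i j t. i : I ==> j : I ==> t : T ==> E i j t = (\<Sum>a<r1. ad (v a i) * t * v a j)"
 and u: "!!b i. u b i : ops n m"
 and Fu: "!!i j s. i : I ==> j : I ==> s : S ==> F i j s = (\<Sum>b<r2. ad (u b i) * s * u b j)"
begin

lemma swap_E: "delta_data.E T \<psi> \<phi> h g = F"
 by (intro ext) (simp add: delta_data.E_def[OF swap] F_def)

lemma swap_F: "delta_data.F S \<psi> \<phi> h g = E"
 by (intro ext) (simp add: delta_data.F_def[OF swap] E_def)

lemma swap_kraus: "delta_kraus m n T S \<psi> \<phi> I h g N' p' q' N p q r2 r1 u v"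
 by (intro delta_kraus.intro swap delta_kraus_axioms.intro)
 (use incS incT v u Ev Fu in \<open>simp_all add: swap_E swap_F\<close>)

lemma EF_kraus:
 assumes "i : I" "j : I" "k : I" "l : I" "s : S"
 shows "E i j (F k l s) = (\<Sum>a<r1. \<Sum>b<r2. ad (v a i) * (ad (u b k) * s * u b l) * v a j)"
proof -
 have "E i j (F k l s) = (\<Sum>a<r1. ad (v a i) * F k l s * v a j)" by (rule Ev[OF assms(1,2) FT[OF assms(3-5)]])
 then show ?thesis by (simp add: Fu[OF assms(3-5)] sum_distrib_left sum_distrib_right)
qed

text \<open>Kraus operators of \<open>s \<mapsto> \<Sum> E (q k) (q l) (F (p k) (p l) s)\<close>, which is the identity of \<open>S\<close>.\<close>

definition z :: "nat => nat => aop" where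
 "z b a = (\<Sum>k<N. u b (p k) * v a (q k))"

lemma z_ops: "z b a : ops n n"
 unfolding z_def using u v by (intro ops_sum ops_mult[where k = m]) auto

lemma sum_z_left:
 assumes "i : I" "k : I" "s : S"
 shows "(\<Sum>a<r1. \<Sum>b<r2. ad (u b k * v a i) * s * z b a) = (\<Sum>l<N. E i (q l) (F k (p l) s))"
proof -
 have "(\<Sum>a<r1. \<Sum>b<r2. ad (u b k * v a i) * s * z b a)
 = (\<Sum>a<r1. \<Sum>b<r2. \<Sum>l<N. ad (v a i) * (ad (u b k) * s * u b (p l)) * v a (q l))"
 by (simp add: z_def sum_distrib_left mult.assoc)
 also have "... = (\<Sum>a<r1. \<Sum>l<N. \<Sum>b<r2. ad (v a i) * (ad (u b k) * s * u b (p l)) * v a (q l))"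
 by (intro sum.cong refl sum.swap)
 also have "... = (\<Sum>l<N. \<Sum>a<r1. \<Sum>b<r2. ad (v a i) * (ad (u b k) * s * u b (p l)) * v a (q l))"
 by (rule sum.swap)
 also have "... = (\<Sum>l<N. E i (q l) (F k (p l) s))"
 using assms pq by (intro sum.cong refl EF_kraus[symmetric]) auto
 finally show ?thesis .
qed

lemma z_fixed:
 assumes s: "s : S"
 shows "(\<Sum>c\<in>{..<r1} \<times> {..<r2}. ad (z (snd c) (fst c)) * s * z (snd c) (fst c)) = s"
proof -
 have "(\<Sum>c\<in>{..<r1} \<times> {..<r2}. ad (z (snd c) (fst c)) * s * z (snd c) (fst c))
 = (\<Sum>a<r1. \<Sum>b<r2. \<Sum>k<N. ad (u b (p k) * v a (q k)) * s * z b a)"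
 by (simp add: sum.cartesian_product') (simp add: z_def ad_sum sum_distrib_right)
 also have "... = (\<Sum>a<r1. \<Sum>k<N. \<Sum>b<r2. ad (u b (p k) * v a (q k)) * s * z b a)"
 by (intro sum.cong refl sum.swap)
 also have "... = (\<Sum>k<N. \<Sum>a<r1. \<Sum>b<r2. ad (u b (p k) * v a (q k)) * s * z b a)"
 by (rule sum.swap)
 also have "... = (\<Sum>k<N. \<Sum>l<N. E (q k) (q l) (F (p k) (p l) s))"
 by (rule sum.cong[OF refl], rule sum_z_left) (use pq s in auto)
 also have "... = s" by (rule EF_unit[OF s])
 finally show ?thesis .
qed

lemma z_commutant:
 assumes "a < r1" "b < r2"
 shows "z b a : commutant n S"
proof -
 interpret fo: fixed_operators n S "{..<r1} \<times> {..<r2}" "%c. z (snd c) (fst c)"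
 by standard (use S incS z_ops z_fixed in auto)
 show ?thesis
 unfolding commutant_def using fo.rigidity[of _ "(a, b)"] assms z_ops by auto
qed

definition e :: "'i => 'i => aop" where
 "e i j = E i j (pr m)"

lemma eS: "i : I ==> j : I ==> e i j : S"
 unfolding e_def using ES opsysD(3)[OF T] by blast

lemma \<phi>e: "i : I ==> j : I ==> \<phi> (e i j) = h i o\<^sub>L g j"
 unfolding e_def using \<phi>E[OF _ _ opsysD(3)[OF T]] \<psi> by (simp add: ucoe_def bc_id)

lemma e_kraus: "i : I ==> j : I ==> e i j = (\<Sum>a<r1. ad (v a i) * v a j)"
 unfolding e_def by (simp add: Ev opsysD(3)[OF T] mult.assoc opsD(1)[OF v])

lemma ad_e: "i : I ==> j : I ==> ad (e i j) = e j i"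
 by (simp add: e_kraus ad_sum)

lemma ad_E: "i : I ==> j : I ==> t : T ==> ad (E i j t) = E j i (ad t)"
 by (simp add: Ev opsysD(4)[OF T] ad_sum mult.assoc)

lemma ad_F: "i : I ==> j : I ==> s : S ==> ad (F i j s) = F j i (ad s)"
 by (simp add: Fu opsysD(4)[OF S] ad_sum mult.assoc)

lemma sum_e: "(\<Sum>k<N. e (p k) (q k)) = pr n"
proof (rule \<phi>_inj)
 show "(\<Sum>k<N. e (p k) (q k)) : S" using eS pq by (intro opsysD(10)[OF S]) auto
 have "\<phi> (\<Sum>k<N. e (p k) (q k)) = (\<Sum>k<N. \<phi> (e (p k) (q k)))" using eS pq by (intro \<phi>_sum) auto
 also have "... = (\<Sum>k<N. h (p k) o\<^sub>L g (q k))" using pq by (intro sum.cong refl) (simp add: \<phi>e)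
 finally show "\<phi> (\<Sum>k<N. e (p k) (q k)) = \<phi> (pr n)" using \<phi> by (simp add: unit ucoe_def)
qed (rule opsysD(3)[OF S])

text \<open>Since the \<open>z b a\<close> commute with \<open>S\<close>, multiplication by \<open>e i k\<close> can be read off from the Kraus operators. It
corresponds under \<open>\<phi>\<close> to the product \<open>h i g k\<close> in the Hilbert space, although \<open>\<phi>\<close> is not multiplicative.\<close>

lemma e_mult:
 assumes i: "i : I" and k: "k : I" and s: "s : S"
 shows "e i k * s = (\<Sum>l<N. E i (q l) (F k (p l) s))" "e i k * s : S"
 "\<phi> (e i k * s) = h i o\<^sub>L (g k o\<^sub>L \<phi> s)"
proof -
 define M where "M s = (\<Sum>l<N. E i (q l) (F k (p l) s))" for s
 have MS: "M s : S" if "s : S" for s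
 unfolding M_def using pq i k that FT ES by (intro opsysD(10)[OF S]) auto
 have \<phi>M: "\<phi> (M s) = h i o\<^sub>L (g k o\<^sub>L \<phi> s)" if s: "s : S" for s
 proof -
 have "\<phi> (M s) = (\<Sum>l<N. \<phi> (E i (q l) (F k (p l) s)))"
 unfolding M_def using pq i k s FT ES by (intro \<phi>_sum) auto
 also have "... = (\<Sum>l<N. (h i o\<^sub>L (g k o\<^sub>L \<phi> s)) o\<^sub>L (h (p l) o\<^sub>L g (q l)))"
 using pq i k s FT by (intro sum.cong refl) (simp add: \<phi>E \<psi>F bc_assoc)
 finally show ?thesis by (simp only: units)
 qed
 have pn: "pr n : S" by (rule opsysD(3)[OF S])
 have "M (pr n) = e i k"
 using \<phi>M[OF pn] \<phi>e[OF i k] \<phi> MS[OF pn] eS[OF i k] by (intro \<phi>_inj) (simp_all add: ucoe_def bc_id)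
 moreover have "M (pr n) * s = M s"
 proof -
 have "M (pr n) * s = (\<Sum>a<r1. \<Sum>b<r2. ad (u b k * v a i) * pr n * z b a * s)"
 unfolding M_def sum_z_left[OF i k pn, symmetric] by (simp add: sum_distrib_right)
 also have "... = (\<Sum>a<r1. \<Sum>b<r2. ad (u b k * v a i) * s * z b a)"
 proof (intro sum.cong refl)
 fix a b assume "a : {..<r1}" "b : {..<r2}"
 then have "z b a * s = s * z b a" using commutantD(2)[OF z_commutant s] by simp
 then have "ad (u b k * v a i) * pr n * z b a * s = ad (u b k * v a i) * (pr n * (s * z b a))"
 by (simp add: mult.assoc)
 then show "ad (u b k * v a i) * pr n * z b a * s = ad (u b k * v a i) * s * z b a"
 using ops_mult_pr(1)[OF opsysD(5)[OF S s]] by (simp add: mult.assoc)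
 qed
 also have "... = M s" unfolding M_def by (rule sum_z_left[OF i k s])
 finally show ?thesis .
 qed
 ultimately have eM: "e i k * s = M s" by simp
 show "e i k * s = (\<Sum>l<N. E i (q l) (F k (p l) s))" using eM by (simp add: M_def)
 show "e i k * s : S" "\<phi> (e i k * s) = h i o\<^sub>L (g k o\<^sub>L \<phi> s)" unfolding eM using MS \<phi>M s by auto
qed

lemma mult_e:
 assumes x: "x : I" and y: "y : I" and s: "s : S"
 shows "s * e x y : S" "\<phi> (s * e x y) = \<phi> s o\<^sub>L (h x o\<^sub>L g y)"
proof -
 note ads = opsysD(4)[OF S s]
 have "s * e x y = ad (e y x * ad s)" using ad_e[OF y x] by simp
 also have "... = (\<Sum>l<N. E (q l) y (F (p l) x s))"
 unfolding e_mult(1)[OF y x ads] ad_sum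
 proof (intro sum.cong refl)
 fix l assume "l : {..<N}"
 then show "ad (E y (q l) (F x (p l) (ad s))) = E (q l) y (F (p l) x s)"
 using pq x y s ads FT by (simp add: ad_E ad_F)
 qed
 finally have eq: "s * e x y = (\<Sum>l<N. E (q l) y (F (p l) x s))" .
 have mem: "E (q l) y (F (p l) x s) : S" if "l < N" for l using pq that x y s FT ES by simp
 show "s * e x y : S" unfolding eq using mem by (intro opsysD(10)[OF S]) auto
 have "\<phi> (s * e x y) = (\<Sum>l<N. \<phi> (E (q l) y (F (p l) x s)))"
 unfolding eq using mem by (intro \<phi>_sum) auto
 also have "... = (\<Sum>l<N. h (q l) o\<^sub>L (g (p l) o\<^sub>L (\<phi> s o\<^sub>L (h x o\<^sub>L g y))))"
 using pq x y s FT by (intro sum.cong refl) (simp add: \<phi>E \<psi>F bc_assoc)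
 finally show "\<phi> (s * e x y) = \<phi> s o\<^sub>L (h x o\<^sub>L g y)" by (simp only: units)
qed

lemma E_F:
 assumes "k : I" "y : I" "x : I" "x' : I" "s : S"
 shows "E k y (F x x' s) = e k x * (s * e x' y)"
 using assms mult_e[of x' y s] e_mult[of k x "s * e x' y"]
 by (intro \<phi>_inj) (simp_all add: ES FT \<phi>E \<psi>F bc_assoc)

text \<open>The sum of \<open>D\<^sup>* D\<close> over the differences \<open>D\<close> of the two sides expands into values of \<open>F\<close> that cancel.\<close>

lemma sum_e_u:
 assumes i: "i : I" and b: "b < r2"
 shows "(\<Sum>k<N'. e i (p' k) * u b (q' k)) = u b i"
proof -
 interpret sw: delta_data m n T S \<psi> \<phi> I h g N' p' q' N p q by (rule swap)
 define D where "D b = (\<Sum>k<N'. e i (p' k) * u b (q' k)) - u b i" for b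
 define G where "G = F i i (pr n)"
 note pn = opsysD(3)[OF S]
 have GT: "G : T" unfolding G_def by (rule FT[OF i i pn])
 have \<psi>G: "\<psi> G = g i o\<^sub>L h i" unfolding G_def using \<psi>F[OF i i pn] \<phi> by (simp add: ucoe_def bc_id)
 have un: "(\<Sum>k<N'. g (q' k) o\<^sub>L (h (p' k) o\<^sub>L X)) = X" "(\<Sum>k<N'. Y o\<^sub>L (g (p' k) o\<^sub>L h (q' k))) = Y" for X Y
 by (rule sw.units)+
 have 1: "(\<Sum>k<N'. F (q' k) i (e (p' k) i)) = G"
 proof (rule sw.\<phi>_inj[OF _ GT])
 have mem: "F (q' k) i (e (p' k) i) : T" if "k < N'" for k using pq' that i eS FT by simp
 then show "(\<Sum>k<N'. F (q' k) i (e (p' k) i)) : T" by (intro opsysD(10)[OF T]) auto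
 have "\<psi> (\<Sum>k<N'. F (q' k) i (e (p' k) i)) = (\<Sum>k<N'. \<psi> (F (q' k) i (e (p' k) i)))"
 using mem by (intro sw.\<phi>_sum) auto
 also have "... = (\<Sum>k<N'. g (q' k) o\<^sub>L (h (p' k) o\<^sub>L (g i o\<^sub>L h i)))"
 using pq' i eS by (intro sum.cong refl) (simp add: \<psi>F \<phi>e bc_assoc)
 finally show "\<psi> (\<Sum>k<N'. F (q' k) i (e (p' k) i)) = \<psi> G" by (simp add: un \<psi>G)
 qed
 have 2: "(\<Sum>k<N'. F i (q' k) (e i (p' k))) = G"
 proof -
 have "(\<Sum>k<N'. F i (q' k) (e i (p' k))) = ad (\<Sum>k<N'. F (q' k) i (e (p' k) i))"
 unfolding ad_sum using pq' i eS by (intro sum.cong refl) (simp add: ad_F ad_e)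
 also have "... = G" unfolding 1 G_def using ad_F[OF i i pn] by simp
 finally show ?thesis .
 qed
 have 3: "(\<Sum>k<N'. \<Sum>l<N'. F (q' k) (q' l) (e (p' k) i * e i (p' l))) = G"
 proof (rule sw.\<phi>_inj[OF _ GT])
 have mem: "F (q' k) (q' l) (e (p' k) i * e i (p' l)) : T" if "k < N'" "l < N'" for k l
 using pq' that i eS e_mult(2) FT by simp
 then show "(\<Sum>k<N'. \<Sum>l<N'. F (q' k) (q' l) (e (p' k) i * e i (p' l))) : T"
 by (intro opsysD(10)[OF T]) auto
 have "\<psi> (\<Sum>k<N'. \<Sum>l<N'. F (q' k) (q' l) (e (p' k) i * e i (p' l)))
 = (\<Sum>k<N'. \<psi> (\<Sum>l<N'. F (q' k) (q' l) (e (p' k) i * e i (p' l))))"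
 using mem by (intro sw.\<phi>_sum opsysD(10)[OF T]) auto
 also have "... = (\<Sum>k<N'. \<Sum>l<N'. \<psi> (F (q' k) (q' l) (e (p' k) i * e i (p' l))))"
 using mem by (intro sum.cong refl sw.\<phi>_sum) auto
 also have "... = (\<Sum>k<N'. \<Sum>l<N'. g (q' k) o\<^sub>L (h (p' k) o\<^sub>L ((g i o\<^sub>L h i) o\<^sub>L (g (p' l) o\<^sub>L h (q' l)))))"
 using pq' i eS e_mult(2,3) by (intro sum.cong refl) (simp add: \<psi>F \<phi>e bc_assoc)
 also have "... = (\<Sum>k<N'. g (q' k) o\<^sub>L (h (p' k) o\<^sub>L (\<Sum>l<N'. (g i o\<^sub>L h i) o\<^sub>L (g (p' l) o\<^sub>L h (q' l)))))"
 by (simp only: bc_sum)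
 finally show "\<psi> (\<Sum>k<N'. \<Sum>l<N'. F (q' k) (q' l) (e (p' k) i * e i (p' l))) = \<psi> G"
 by (simp only: un \<psi>G)
 qed
 have "(\<Sum>b<r2. ad (D b) * D b)
 = (\<Sum>b<r2. (\<Sum>k<N'. \<Sum>l<N'. ad (u b (q' k)) * (e (p' k) i * e i (p' l)) * u b (q' l)))
 - (\<Sum>b<r2. \<Sum>k<N'. ad (u b (q' k)) * e (p' k) i * u b i)
 - ((\<Sum>b<r2. \<Sum>k<N'. ad (u b i) * e i (p' k) * u b (q' k)) - (\<Sum>b<r2. ad (u b i) * pr n * u b i))"
 proof -
 have "ad (D b) * D b = (\<Sum>k<N'. \<Sum>l<N'. ad (u b (q' k)) * (e (p' k) i * e i (p' l)) * u b (q' l))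
 - (\<Sum>k<N'. ad (u b (q' k)) * e (p' k) i * u b i)
 - ((\<Sum>k<N'. ad (u b i) * e i (p' k) * u b (q' k)) - ad (u b i) * pr n * u b i)" for b
 proof -
 define A B where "A = (\<Sum>k<N'. ad (u b (q' k)) * e (p' k) i)" and "B = (\<Sum>k<N'. e i (p' k) * u b (q' k))"
 have a: "ad B = A"
 unfolding A_def B_def ad_sum using pq' i by (intro sum.cong refl) (simp add: ad_e)
 have pu: "ad (u b i) * pr n = ad (u b i)" using ops_ad[OF u] by (rule opsD(2))
 have "ad (D b) * D b = A * B - A * u b i - (ad (u b i) * B - ad (u b i) * u b i)"
 unfolding D_def B_def[symmetric] ad_simps a by (simp add: algebra_simps)
 moreover have "A * B = (\<Sum>k<N'. \<Sum>l<N'. ad (u b (q' k)) * (e (p' k) i * e i (p' l)) * u b (q' l))"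
 unfolding A_def B_def by (simp add: sum_product mult.assoc)
 moreover have "A * u b i = (\<Sum>k<N'. ad (u b (q' k)) * e (p' k) i * u b i)"
 unfolding A_def by (simp add: sum_distrib_right)
 moreover have "ad (u b i) * B = (\<Sum>k<N'. ad (u b i) * e i (p' k) * u b (q' k))"
 unfolding B_def by (simp add: sum_distrib_left mult.assoc)
 ultimately show ?thesis by (simp only: pu)
 qed
 then show ?thesis by (simp only: sum_subtractf)
 qed
 also have "(\<Sum>b<r2. (\<Sum>k<N'. \<Sum>l<N'. ad (u b (q' k)) * (e (p' k) i * e i (p' l)) * u b (q' l)))
 = (\<Sum>k<N'. \<Sum>b<r2. \<Sum>l<N'. ad (u b (q' k)) * (e (p' k) i * e i (p' l)) * u b (q' l))"
 by (rule sum.swap)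
 also have "... = (\<Sum>k<N'. \<Sum>l<N'. \<Sum>b<r2. ad (u b (q' k)) * (e (p' k) i * e i (p' l)) * u b (q' l))"
 by (intro sum.cong refl sum.swap)
 also have "... = (\<Sum>k<N'. \<Sum>l<N'. F (q' k) (q' l) (e (p' k) i * e i (p' l)))"
 using pq' i eS e_mult(2) by (intro sum.cong refl) (simp add: Fu)
 also have "(\<Sum>b<r2. \<Sum>k<N'. ad (u b (q' k)) * e (p' k) i * u b i) = (\<Sum>k<N'. F (q' k) i (e (p' k) i))"
 using pq' i eS by (subst sum.swap, intro sum.cong refl) (simp add: Fu)
 also have "(\<Sum>b<r2. \<Sum>k<N'. ad (u b i) * e i (p' k) * u b (q' k)) = (\<Sum>k<N'. F i (q' k) (e i (p' k)))"
 using pq' i eS by (subst sum.swap, intro sum.cong refl) (simp add: Fu)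
 also have "(\<Sum>b<r2. ad (u b i) * pr n * u b i) = G"
 unfolding G_def using i pn by (simp add: Fu)
 finally have "(\<Sum>b<r2. ad (D b) * D b) = 0" unfolding 1 2 3 by simp
 then have "D b = 0" using b by (intro sum_ad_mult_eq_0[of "{..<r2}" D b]) auto
 then show ?thesis by (simp add: D_def)
qed

text \<open>Operators that behave under \<open>F\<close> like the adjoints of the elements of the TRO.\<close>

definition family :: "('i => aop) => bool" where
 "family w \<longleftrightarrow> (\<forall>i\<in>I. w i : ops n m) &
 (\<forall>k\<in>I. \<forall>x\<in>I. \<forall>x'\<in>I. \<forall>s\<in>S. w k * F x x' s = e k x * s * w x')"

lemma family_u:
 assumes b: "b < r2"
 shows "family (u b)"
 unfolding family_def
proof (intro conjI ballI u)
 fix k x x' s assume as: "k : I" "x : I" "x' : I" "s : S"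
 interpret sw: delta_kraus m n T S \<psi> \<phi> I h g N' p' q' N p q r2 r1 u v by (rule swap_kraus)
 let ?t = "F x x' s"
 have t: "?t : T" by (rule FT[OF as(2-4)])
 have z': "sw.z a b * ?t = ?t * sw.z a b" if "a < r1" for a
 using commutantD(2)[OF sw.z_commutant[OF b that] t] .
 have "u b k * ?t = (\<Sum>i<N'. e k (p' i) * u b (q' i)) * ?t" using sum_e_u[OF as(1) b] by simp
 also have "... = (\<Sum>i<N'. \<Sum>a<r1. ad (v a k) * v a (p' i) * u b (q' i) * ?t)"
 using pq' as(1) by (simp add: e_kraus sum_distrib_right)
 also have "... = (\<Sum>a<r1. \<Sum>i<N'. ad (v a k) * v a (p' i) * u b (q' i) * ?t)" by (rule sum.swap)
 also have "... = (\<Sum>a<r1. ad (v a k) * (sw.z a b * ?t))"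
 by (simp add: sw.z_def sum_distrib_left sum_distrib_right mult.assoc)
 also have "... = (\<Sum>a<r1. ad (v a k) * (?t * sw.z a b))" by (intro sum.cong refl) (simp add: z')
 also have "... = (\<Sum>a<r1. \<Sum>i<N'. ad (v a k) * ?t * v a (p' i) * u b (q' i))"
 by (simp add: sw.z_def sum_distrib_left mult.assoc)
 also have "... = (\<Sum>i<N'. \<Sum>a<r1. ad (v a k) * ?t * v a (p' i) * u b (q' i))" by (rule sum.swap)
 also have "... = (\<Sum>i<N'. E k (p' i) ?t * u b (q' i))"
 using pq' as(1) t by (intro sum.cong refl) (simp add: Ev sum_distrib_right)
 also have "... = (\<Sum>i<N'. e k x * s * (e x' (p' i) * u b (q' i)))"
 using pq' as by (intro sum.cong refl) (simp add: E_F mult.assoc)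
 also have "... = e k x * s * u b x'"
 unfolding sum_distrib_left[symmetric] sum_e_u[OF as(3) b] ..
 finally show "u b k * ?t = e k x * s * u b x'" .
qed

lemma familyD:
 assumes "family w"
 shows "i : I ==> w i : ops n m"
 "k : I ==> x : I ==> x' : I ==> s : S ==> w k * F x x' s = e k x * s * w x'"
 using assms by (auto simp: family_def)

lemma family_add: "family w ==> family w' ==> family (%i. w i + w' i)"
 by (simp add: family_def distrib_left distrib_right)

lemma family_zero: "family (%i. 0)"
 by (simp add: family_def)

lemma family_left:
 assumes y: "y : commutant n S" and w: "family w"
 shows "family (%i. y * w i)"
 unfolding family_def
proof (intro conjI ballI)
 show "y * w i : ops n m" if "i : I" for i using commutantD(1)[OF y] familyD(1)[OF w that] by blast
 fix k x x' s assume as: "k : I" "x : I" "x' : I" "s : S"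
 have "y * w k * F x x' s = y * (e k x * s) * w x'" by (simp add: mult.assoc familyD(2)[OF w as])
 also have "y * (e k x * s) = e k x * s * y" by (rule commutantD(2)[OF y e_mult(2)[OF as(1,2,4)]])
 finally show "y * w k * F x x' s = e k x * s * (y * w x')" by (simp add: mult.assoc)
qed

text \<open>The coefficient by which products of two families differ from the products \<open>e x y\<close>, see \<open>mult_ad_family\<close>.\<close>

definition cc :: "('i => aop) => ('i => aop) => aop" where
 "cc w w' = (\<Sum>k<N. w (p k) * ad (w' (q k)))"

lemma cc_raw:
 assumes w: "family w" and w': "family w'" and xy: "x : I" "y : I" and s: "s : S"
 shows "s * (w x * ad (w' y)) = cc w w' * s * e x y"
proof -
 have st: "e k x0 * s * (w x * ad (w' y)) = w k * ad (w' x0) * (s * e x y)" if k: "k : I" "x0 : I" for k x0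
 proof -
 have "e k x0 * s * (w x * ad (w' y)) = w k * F x0 x s * ad (w' y)"
 using familyD(2)[OF w k(1,2) xy(1) s] by (simp add: mult.assoc)
 also have "... = w k * ad (w' y * F x x0 (ad s))"
 using ad_F[OF xy(1) k(2) opsysD(4)[OF S s]] by (simp add: mult.assoc)
 also have "... = w k * ad (e y x * ad s * w' x0)"
 using familyD(2)[OF w' xy(2,1) k(2) opsysD(4)[OF S s]] by simp
 finally show ?thesis using ad_e[OF xy(2,1)] by (simp add: mult.assoc)
 qed
 have "s * (w x * ad (w' y)) = (\<Sum>k<N. e (p k) (q k)) * s * (w x * ad (w' y))"
 unfolding sum_e using opsD(1)[OF opsysD(5)[OF S s]] by simp
 also have "... = (\<Sum>k<N. w (p k) * ad (w' (q k)) * (s * e x y))"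
 unfolding sum_distrib_right using pq by (intro sum.cong refl st) auto
 also have "... = cc w w' * s * e x y" by (simp add: cc_def sum_distrib_right mult.assoc)
 finally show ?thesis .
qed

lemma cc_ops: "family w ==> family w' ==> cc w w' : ops n n"
 unfolding cc_def using pq familyD(1) by (intro ops_sum ops_mult[where k = m] ops_ad) auto

lemma mult_ad_family:
 assumes w: "family w" and w': "family w'" and xy: "x : I" "y : I"
 shows "w x * ad (w' y) = cc w w' * e x y"
 using cc_raw[OF assms opsysD(3)[OF S]] ops_mult_pr(1)[OF familyD(1)[OF w xy(1)]] opsD(2)[OF cc_ops[OF w w']]
 by simp

lemma cc_commutant:
 assumes w: "family w" and w': "family w'"
 shows "cc w w' : commutant n S"
 unfolding commutant_def
proof (intro CollectI conjI ballI cc_ops assms)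
 fix s assume s: "s : S"
 have "s * (cc w w' * e (p k) (q k)) = cc w w' * s * e (p k) (q k)" if "k < N" for k
 using cc_raw[OF w w' _ _ s] mult_ad_family[OF w w'] pq[OF that] by simp
 then have "(\<Sum>k<N. s * (cc w w' * e (p k) (q k))) = (\<Sum>k<N. cc w w' * s * e (p k) (q k))"
 by (intro sum.cong refl) auto
 then have "s * (cc w w' * pr n) = cc w w' * s * pr n"
 by (simp only: sum_distrib_left[symmetric] sum_e)
 then show "cc w w' * s = s * cc w w'"
 using opsD(2)[OF cc_ops[OF w w']] opsD(2)[OF opsysD(5)[OF S s]] by (simp add: mult.assoc)
qed

lemma family_sandwich:
 assumes w: "family w" and w': "family w'" and ky: "k : I" "y : I" and t: "t : T"
 shows "w k * t * ad (w' y) = E k y t * cc w w'"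
proof -
 interpret sw: delta_data m n T S \<psi> \<phi> I h g N' p' q' N p q by (rule swap)
 have FE: "(\<Sum>i<N'. \<Sum>j<N'. F (q' i) (q' j) (E (p' i) (p' j) t)) = t"
 using sw.EF_unit[OF t] unfolding swap_E swap_F .
 have one: "w k * F x x' s * ad (w' y) = E k y (F x x' s) * cc w w'" if as: "x : I" "x' : I" "s : S" for x x' s
 proof -
 have "w k * F x x' s * ad (w' y) = e k x * s * (w x' * ad (w' y))"
 using familyD(2)[OF w ky(1) as] by (simp add: mult.assoc)
 also have "... = e k x * s * (cc w w' * e x' y)" by (simp add: mult_ad_family[OF w w' as(2) ky(2)])
 also have "cc w w' * e x' y = e x' y * cc w w'"
 by (rule commutantD(2)[OF cc_commutant[OF w w'] eS[OF as(2) ky(2)]])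
 finally show ?thesis by (simp add: E_F[OF ky as] mult.assoc)
 qed
 have mem: "F (q' i) (q' j) (E (p' i) (p' j) t) : T" if "i < N'" "j < N'" for i j
 using pq' that t ES FT by simp
 have Elin: "E k y (\<Sum>i<N'. \<Sum>j<N'. f i j) = (\<Sum>i<N'. \<Sum>j<N'. E k y (f i j))"
 if f: "!!i j. i < N' ==> j < N' ==> f i j : T" for f
 proof -
 have "E k y (\<Sum>i<N'. \<Sum>j<N'. f i j) = (\<Sum>a<r1. \<Sum>i<N'. \<Sum>j<N'. ad (v a k) * f i j * v a y)"
 using f by (subst Ev[OF ky]) (auto intro!: opsysD(10)[OF T] simp: sum_distrib_left sum_distrib_right)
 also have "... = (\<Sum>i<N'. \<Sum>a<r1. \<Sum>j<N'. ad (v a k) * f i j * v a y)" by (rule sum.swap)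
 also have "... = (\<Sum>i<N'. \<Sum>j<N'. \<Sum>a<r1. ad (v a k) * f i j * v a y)"
 by (intro sum.cong refl sum.swap)
 also have "... = (\<Sum>i<N'. \<Sum>j<N'. E k y (f i j))"
 using f by (intro sum.cong refl) (simp add: Ev[OF ky])
 finally show ?thesis .
 qed
 have "w k * t * ad (w' y) = (\<Sum>i<N'. \<Sum>j<N'. w k * F (q' i) (q' j) (E (p' i) (p' j) t) * ad (w' y))"
 by (subst FE[symmetric]) (simp add: sum_distrib_left sum_distrib_right)
 also have "... = (\<Sum>i<N'. \<Sum>j<N'. E k y (F (q' i) (q' j) (E (p' i) (p' j) t)) * cc w w')"
 using pq' t ES by (intro sum.cong refl one) auto
 also have "... = E k y (\<Sum>i<N'. \<Sum>j<N'. F (q' i) (q' j) (E (p' i) (p' j) t)) * cc w w'"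
 using mem by (simp add: Elin sum_distrib_right)
 finally show ?thesis unfolding FE .
qed

lemma cc_positive:
 assumes w: "family w"
 shows "positive (cc w w)"
proof -
 define a where "a = (\<Sum>i\<in>I. e i i)"
 have aS: "a : S" unfolding a_def using eS by (intro opsysD(10)[OF S]) auto
 have ak: "a = (\<Sum>i\<in>I. \<Sum>b<r1. ad (v b i) * v b i)" unfolding a_def by (intro sum.cong refl e_kraus)
 have a: "a : ops n n" "positive a"
 using opsysD(5)[OF S aS] unfolding ak by (auto intro!: positive_sum positive_ad_mult)
 have inj: "\<xi> = 0" if \<xi>: "\<xi> : spc n" "a \<rhd> \<xi> = 0" for \<xi>
 proof -
 have "(\<Sum>i\<in>I. \<Sum>b<r1. ip (v b i \<rhd> \<xi>) (v b i \<rhd> \<xi>)) = ip \<xi> (a \<rhd> \<xi>)"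
 unfolding ak by (simp add: ap_sum_left ip_sum_right ip_ad_right)
 also have "... = 0" using \<xi>(2) by simp
 finally have "(\<Sum>b<r1. ip (v b i \<rhd> \<xi>) (v b i \<rhd> \<xi>)) = 0" if "i : I" for i
 using that I by (subst (asm) sum_nonneg_eq_0_iff) (auto intro: sum_nonneg)
 then have "ip (v b i \<rhd> \<xi>) (v b i \<rhd> \<xi>) = 0" if "i : I" "b < r1" for i b
 using that by (subst (asm) sum_nonneg_eq_0_iff) auto
 then have v0: "v b i \<rhd> \<xi> = 0" if "i : I" "b < r1" for i b using that by simp
 have "\<xi> = (\<Sum>k<N. e (p k) (q k)) \<rhd> \<xi>" unfolding sum_e using \<xi>(1) by (simp add: spc_def)
 also have "... = 0" using pq v0 by (simp add: ap_sum_left e_kraus)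
 finally show ?thesis .
 qed
 obtain f h where f: "f : ops n n" "ad f = f" "f * a * f = pr n" "!!C. alg_closed n a C ==> f : C & h : C"
 using calculus_injective[OF a inj] by metis
 note c = cc_commutant[OF w w] and co = cc_ops[OF w w]
 have "a * cc w w = cc w w * a" using commutantD(2)[OF c aS] by simp
 then have fc: "f * cc w w = cc w w * f" using f(4)[OF alg_closed_centralizer[OF _ co]] by simp
 have "(\<Sum>i\<in>I. (f * w i) * ad (f * w i)) = f * (\<Sum>i\<in>I. w i * ad (w i)) * f"
 by (simp add: sum_distrib_left sum_distrib_right f(2) mult.assoc)
 also have "(\<Sum>i\<in>I. w i * ad (w i)) = cc w w * a"
 unfolding a_def sum_distrib_left by (intro sum.cong refl mult_ad_family[OF w w])
 also have "f * (cc w w * a) * f = cc w w * (f * a * f)"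
 using fc by (simp add: mult.assoc[symmetric])
 also have "... = cc w w" using opsD(2)[OF co] by (simp add: f(3))
 finally have "cc w w = (\<Sum>i\<in>I. (f * w i) * ad (f * w i))" by simp
 then show ?thesis by (auto intro!: positive_sum positive_mult_ad simp del: ad_simps)
qed

text \<open>The next family is added on the kernel of the coefficient of the previous sum. All coefficients lie in the
commutative commutant of \<open>S\<close>, which makes the mixed terms vanish.\<close>

lemma combined_family:
 "k \<le> r2 ==> \<exists>w. family w & (\<forall>\<xi>\<in>spc n. cc w w \<rhd> \<xi> = 0 --> (\<forall>b<k. cc (u b) (u b) \<rhd> \<xi> = 0))"
proof (induction k)
 case 0
 then show ?case using family_zero by auto
next
 case (Suc k)
 then obtain w where w: "family w" "!!\<xi>. \<xi> : spc n ==> cc w w \<rhd> \<xi> = 0 ==> \<forall>b<k. cc (u b) (u b) \<rhd> \<xi> = 0"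
 by auto
 have uk: "family (u k)" by (rule family_u) (use Suc.prems in simp)
 define c where "c = cc w w"
 have c: "c : commutant n S" "c : ops n n" "positive c"
 unfolding c_def using cc_commutant cc_ops cc_positive w(1) by auto
 obtain f d Q where Q: "Q : ops n n" "ad Q = Q" "Q * Q = Q" "c * Q = c" "Q * c = c" "f * d = Q" "f * c = d"
 "!!C. alg_closed n c C ==> f : C & d : C & Q : C"
 using positive_calculus[OF c(2,3)] by metis
 define K where "K = pr n - Q"
 have K: "K : commutant n S"
 unfolding K_def using Q(8)[OF alg_closed_commutant[OF S c(1)]] commutant_pr[OF S] by (intro commutant_diff) auto
 have adK: "ad K = K" using Q(2) by (simp add: K_def)
 have KK: "K * K = K" using Q(3) opsD[OF Q(1)] by (simp add: K_def algebra_simps)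
 have Kc: "K * c = 0" using Q(5) opsD(1)[OF c(2)] by (simp add: K_def algebra_simps)
 have Kw: "K * w i = 0" if i: "i : I" for i
 proof -
 have "ad (ad (K * w i)) * ad (K * w i) = K * (w i * ad (w i)) * K" by (simp add: adK mult.assoc)
 also have "... = 0" using Kc by (simp add: mult_ad_family[OF w(1) w(1) i i] c_def[symmetric] flip: mult.assoc)
 finally have "ad (K * w i) = 0" by (rule ad_mult_eq_0)
 then show ?thesis by (simp only: ad_eq_0)
 qed
 let ?w = "%i. w i + K * u k i"
 have w': "family ?w" by (intro family_add family_left K w uk)
 have Kcomm: "K * cc a b = cc a b * K" if "family a" "family b" for a b
 by (rule commutant_commutative[OF S incS K cc_commutant[OF that]])
 have "cc ?w ?w = c + cc w (u k) * K + K * cc (u k) w + K * cc (u k) (u k) * K"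
 by (simp add: cc_def c_def sum_distrib_left sum_distrib_right distrib_left distrib_right sum.distrib adK mult.assoc add.assoc)
 also have "cc w (u k) * K = 0"
 proof -
 have "cc w (u k) * K = K * cc w (u k)" using Kcomm[OF w(1) uk] by simp
 also have "... = (\<Sum>j<N. K * w (p j) * ad (u k (q j)))" by (simp add: cc_def sum_distrib_left mult.assoc)
 also have "... = 0" using Kw pq by (intro sum.neutral) simp
 finally show ?thesis .
 qed
 also have "K * cc (u k) w = 0"
 proof -
 have "K * cc (u k) w = (\<Sum>j<N. u k (p j) * ad (K * w (q j)))"
 unfolding Kcomm[OF uk w(1)] by (simp add: cc_def sum_distrib_right adK mult.assoc)
 also have "... = 0" using Kw pq by (intro sum.neutral) (simp del: ad_simps add: ad_simps(5))
 finally show ?thesis .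
 qed
 finally have cw: "cc ?w ?w = c + K * cc (u k) (u k) * K" by simp
 show ?case
 proof (intro exI[of _ ?w] conjI ballI impI w')
 fix \<xi> assume \<xi>: "\<xi> : spc n" "cc ?w ?w \<rhd> \<xi> = 0"
 have "K * cc ?w ?w = K * cc (u k) (u k) * K" unfolding cw by (simp add: distrib_left Kc KK flip: mult.assoc)
 then have "(K * cc (u k) (u k) * K) \<rhd> \<xi> = (K * cc ?w ?w) \<rhd> \<xi>" by simp
 also have "... = 0" using \<xi>(2) by simp
 finally have 1: "(K * cc (u k) (u k) * K) \<rhd> \<xi> = 0" .
 then have c0: "c \<rhd> \<xi> = 0" using \<xi>(2) unfolding cw ap_simps(2) by simp
 then have "Q \<rhd> \<xi> = 0" using Q(6,7) by (metis ap_0_right ap_simps(1))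
 then have K\<xi>: "K \<rhd> \<xi> = \<xi>" using \<xi>(1) by (simp add: K_def spc_def)
 have "(K * cc (u k) (u k) * K) = cc (u k) (u k) * K"
 using Kcomm[OF uk uk] KK by (metis mult.assoc)
 then have "cc (u k) (u k) \<rhd> \<xi> = 0" using 1 K\<xi> by simp
 then show "\<forall>b<Suc k. cc (u b) (u b) \<rhd> \<xi> = 0"
 using w(2)[OF \<xi>(1)] c0 by (auto simp: less_Suc_eq c_def)
 qed
qed

lemma cc_u_kernel:
 assumes \<xi>: "\<xi> : spc n" and zero: "!!b. b < r2 ==> cc (u b) (u b) \<rhd> \<xi> = 0"
 shows "\<xi> = 0"
proof -
 have u0: "ad (u b i) \<rhd> \<xi> = 0" if b: "b < r2" and i: "i : I" for b i
 proof -
 note ub = family_u[OF b]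
 have "u b i * ad (u b i) = e i i * cc (u b) (u b)"
 using mult_ad_family[OF ub ub i i] commutantD(2)[OF cc_commutant[OF ub ub] eS[OF i i]] by simp
 then have "(u b i * ad (u b i)) \<rhd> \<xi> = 0" using zero[OF b] by simp
 then have "ip (ad (u b i) \<rhd> \<xi>) (ad (u b i) \<rhd> \<xi>) = 0" by (simp add: ip_ad_left)
 then show ?thesis by simp
 qed
 have z0: "z b a \<rhd> \<xi> = 0" if "a < r1" "b < r2" for a b
 proof -
 note zc = z_commutant[OF that]
 have "ad (z b a) \<rhd> \<xi> = 0"
 using pq u0[OF that(2)] by (simp add: z_def ad_sum ap_sum_left)
 then have "(z b a * ad (z b a)) \<rhd> \<xi> = 0" by simp
 then have "(ad (z b a) * z b a) \<rhd> \<xi> = 0"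
 using commutant_commutative[OF S incS zc commutant_ad[OF S zc]] by simp
 then have "ip (z b a \<rhd> \<xi>) (z b a \<rhd> \<xi>) = 0" by (metis ap_simps(1) ip_0(2) ip_ad_right)
 then show ?thesis by simp
 qed
 have "\<xi> = (\<Sum>c\<in>{..<r1} \<times> {..<r2}. ad (z (snd c) (fst c)) * pr n * z (snd c) (fst c)) \<rhd> \<xi>"
 unfolding z_fixed[OF opsysD(3)[OF S]] using \<xi> by (simp add: spc_def)
 also have "... = 0" unfolding ap_sum_left by (rule sum.neutral) (auto simp: z0)
 finally show ?thesis .
qed

theorem opullback: "opullback n S m T"
proof -
 obtain w where w: "family w" "!!\<xi>. \<xi> : spc n ==> cc w w \<rhd> \<xi> = 0 ==> \<forall>b<r2. cc (u b) (u b) \<rhd> \<xi> = 0"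
 using combined_family[of r2] by auto
 define c where "c = cc w w"
 have c: "c : commutant n S" "c : ops n n" "positive c"
 unfolding c_def using cc_commutant cc_ops cc_positive w(1) by auto
 have "\<xi> = 0" if "\<xi> : spc n" "c \<rhd> \<xi> = 0" for \<xi>
 using cc_u_kernel[OF that(1)] w(2)[OF that(1)] that(2) by (simp add: c_def)
 then obtain f d where f: "f : ops n n" "ad f = f" "f * c * f = pr n"
 "!!C. alg_closed n c C ==> f : C & d : C"
 using calculus_injective[OF c(2,3)] by metis
 have fc: "f : commutant n S" using f(4)[OF alg_closed_commutant[OF S c(1)]] by simp
 define x where "x i = ad (w i) * f" for i
 have x: "x i : ops m n" if "i : I" for i unfolding x_def using familyD(1)[OF w(1) that] f(1) by blast
 have xE: "ad (x i) * t * x j = E i j t" if ij: "i : I" "j : I" and t: "t : T" for i j t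
 proof -
 have "ad (x i) * t * x j = f * (w i * t * ad (w j)) * f" by (simp add: x_def f(2) mult.assoc)
 also have "... = (f * E i j t) * c * f"
 unfolding family_sandwich[OF w(1) w(1) ij t] by (simp add: c_def mult.assoc)
 also have "... = E i j t * (f * c * f)"
 using commutantD(2)[OF fc ES[OF ij t]] by (simp add: mult.assoc)
 also have "... = E i j t" using opsD(2)[OF opsysD(5)[OF S ES[OF ij t]]] by (simp add: f(3))
 finally show ?thesis .
 qed
 have xe: "ad (x i) * x j = e i j" if ij: "i : I" "j : I" for i j
 using xE[OF ij opsysD(3)[OF T]] opsD(1)[OF x[OF ij(2)]] by (simp add: e_def mult.assoc)
 show ?thesis
 proof (rule pullback_normalise[OF S T I x, where N = N and p = p and q = q])
 show "ad (x i) * t * x j : S" if "i : I" "j : I" "t : T" for i j t using that xE ES by simp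
 show "ad (x i) * x i * s : S" if "i : I" "s : S" for i s using that xe e_mult(2) by simp
 show "(\<Sum>k<N. ad (x (p k)) * x (q k)) = pr n"
 unfolding sum_e[symmetric] using pq xe by (intro sum.cong refl) simp
 show "S \<subseteq> scl.span {ad (x i) * t * x j | i j t. i : I & j : I & t : T}" (is "_ \<subseteq> scl.span ?G")
 proof
 fix s assume s: "s : S"
 have "(\<Sum>k<N. \<Sum>l<N. E (q k) (q l) (F (p k) (p l) s)) : scl.span ?G"
 proof (intro scl.span_sum scl.span_base)
 fix k l assume "k : {..<N}" "l : {..<N}"
 then have kl: "p k : I" "q k : I" "p l : I" "q l : I" using pq by auto
 show "E (q k) (q l) (F (p k) (p l) s) : ?G"
 using xE[OF kl(2,4) FT[OF kl(1,3) s]] kl FT[OF kl(1,3) s] by force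
 qed
 then show "s : scl.span ?G" unfolding EF_unit[OF s] .
 qed
 qed (use pq in auto)
qed

end

theorem (in delta_data) incompressible_pullback:
 assumes incS: "incompressible n S" and incT: "incompressible m T"
 shows "opullback n S m T"
proof -
 obtain r1 :: nat and v where v: "!!a i. v a i : ops m n"
 "!!i j t. i : I ==> j : I ==> t : T ==> E i j t = (\<Sum>a<r1. ad (v a i) * t * v a j)"
 by (rule kraus_E) (rule that; assumption)
 interpret sw: delta_data m n T S \<psi> \<phi> I h g N' p' q' N p q by (rule swap)
 have swE: "sw.E = F" by (intro ext) (simp add: sw.E_def F_def)
 obtain r2 :: nat and u where u: "!!a i. u a i : ops n m"
 "!!i j s. i : I ==> j : I ==> s : S ==> F i j s = (\<Sum>b<r2. ad (u b i) * s * u b j)"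
 by (rule sw.kraus_E[unfolded swE]) (rule that; assumption)
 interpret delta_kraus n m S T \<phi> \<psi> I g h N p q N' p' q' r1 r2 v u
 by standard (use incS incT v u in auto)
 show ?thesis by (rule opullback)
qed

section \<open>Matrices as adjointable operators\<close>

definition emb :: "complex mat => aop" where
 "emb x = (\<Sum>i<dim_row x. \<Sum>j<dim_col x. scl (x $$ (i, j)) (rk (bvec i) (bvec j)))"

definition unemb :: "nat => nat => aop => complex mat" where
 "unemb r c X = mat r c (%(i, j). coeff (X \<rhd> bvec j) i)"

definition vemb :: "complex vec => complex poly" where
 "vemb v = (\<Sum>i<dim_vec v. smult (v $ i) (bvec i))"

definition unvemb :: "nat => complex poly => complex vec" where
 "unvemb n \<xi> = vec n (coeff \<xi>)"

lemma emb_ops: "x : carrier_mat r c ==> emb x : ops r c"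
 unfolding emb_def by (intro ops_sum ops_scl ops_rk) auto

lemma coeff_emb:
 assumes "x : carrier_mat r c" "i < r" "j < c"
 shows "coeff (emb x \<rhd> bvec j) i = x $$ (i, j)"
proof -
 have "coeff (emb x \<rhd> bvec j) i = (\<Sum>a<r. \<Sum>b<c. if a = i & b = j then x $$ (i, j) else 0)"
 using assms(1) by (auto simp: emb_def ap_sum_left coeff_sum coeff_bvec intro!: sum.cong)
 also have "... = (\<Sum>a<r. if a = i then x $$ (i, j) else 0)"
 using assms(3) by (intro sum.cong refl) auto
 finally show ?thesis using assms(2) by simp
qed

lemma unemb_carrier [simp]: "unemb r c X : carrier_mat r c"
 by (simp add: unemb_def)

lemma unemb_emb: "x : carrier_mat r c ==> unemb r c (emb x) = x"
 by (intro eq_matI) (auto simp: unemb_def coeff_emb)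

lemma ops_eqI_coeff:
 assumes "X : ops r c" "Y : ops r c"
 and "!!i j. i < r ==> j < c ==> coeff (X \<rhd> bvec j) i = coeff (Y \<rhd> bvec j) i"
 shows "X = Y"
proof (rule ops_eqI[OF assms(1,2)])
 fix j assume "j < c"
 have "X \<rhd> bvec j : spc r" "Y \<rhd> bvec j : spc r" using assms(1,2) by auto
 then show "X \<rhd> bvec j = Y \<rhd> bvec j"
 using assms(3) \<open>j < c\<close> unfolding spc_iff by (intro poly_eqI) (metis not_le)
qed

lemma emb_unemb:
 assumes "X : ops r c"
 shows "emb (unemb r c X) = X"
proof (rule ops_eqI_coeff[of _ r c])
 show "coeff (emb (unemb r c X) \<rhd> bvec j) i = coeff (X \<rhd> bvec j) i" if "i < r" "j < c" for i j
 by (subst coeff_emb[OF unemb_carrier that]) (use that in \<open>simp add: unemb_def\<close>)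
qed (use assms in \<open>auto intro: emb_ops\<close>)

lemma emb_inj: "x : carrier_mat r c ==> y : carrier_mat r c ==> emb x = emb y ==> x = y"
 by (metis unemb_emb)

lemma emb_add:
 assumes "x : carrier_mat r c" "y : carrier_mat r c"
 shows "emb (x + y) = emb x + emb y"
 by (rule ops_eqI_coeff[of _ r c])
 (use assms in \<open>auto intro!: emb_ops simp: coeff_emb[of _ r c]\<close>)

lemma emb_smult:
 assumes "x : carrier_mat r c"
 shows "emb (a \<cdot>\<^sub>m x) = scl a (emb x)"
 by (rule ops_eqI_coeff[of _ r c])
 (use assms in \<open>auto intro!: emb_ops simp: coeff_emb[of _ r c]\<close>)

lemma emb_zero [simp]: "emb (0\<^sub>m r c) = 0"
 by (rule ops_eqI_coeff[of _ r c]) (auto intro!: emb_ops simp: coeff_emb[of _ r c])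

lemma emb_one [simp]: "emb (1\<^sub>m n) = pr n"
 by (rule ops_eqI_coeff[of _ n n]) (auto intro!: emb_ops simp: coeff_emb[of _ n n] coeff_bvec)

lemma vemb_spc: "v : carrier_vec n ==> vemb v : spc n"
 by (auto simp: vemb_def spc_iff coeff_sum coeff_bvec)

lemma coeff_vemb: "v : carrier_vec n ==> coeff (vemb v) i = (if i < n then v $ i else 0)"
 by (simp add: vemb_def coeff_sum coeff_bvec if_distrib cong: if_cong)

lemma unvemb_carrier [simp]: "unvemb n \<xi> : carrier_vec n"
 by (simp add: unvemb_def)

lemma vemb_unvemb: "\<xi> : spc n ==> vemb (unvemb n \<xi>) = \<xi>"
 by (rule poly_eqI) (auto simp: coeff_vemb[of _ n] unvemb_def spc_iff)

lemma unvemb_vemb: "v : carrier_vec n ==> unvemb n (vemb v) = v"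
 by (rule eq_vecI) (auto simp: unvemb_def coeff_vemb[of v n])

lemma vemb_add: "v : carrier_vec n ==> w : carrier_vec n ==> vemb (v + w) = vemb v + vemb w"
 by (rule poly_eqI) (simp add: coeff_vemb[of _ n])

lemma vemb_smult: "v : carrier_vec n ==> vemb (a \<cdot>\<^sub>v v) = smult a (vemb v)"
 by (rule poly_eqI) (simp add: coeff_vemb[of _ n])

lemma vemb_zero [simp]: "vemb (0\<^sub>v n) = 0"
 by (rule poly_eqI) (simp add: coeff_vemb[of _ n])

lemma emb_mult_vec:
 assumes x: "x : carrier_mat r c" and v: "v : carrier_vec c"
 shows "emb x \<rhd> vemb v = vemb (x *\<^sub>v v)"
proof (rule poly_eqI)
 fix i
 have xv: "x *\<^sub>v v : carrier_vec r" by (rule mult_mat_vec_carrier[OF x v])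
 have s: "emb x \<rhd> vemb v : spc r" by (rule ops_ap[OF emb_ops[OF x]])
 show "coeff (emb x \<rhd> vemb v) i = coeff (vemb (x *\<^sub>v v)) i"
 proof (cases "i < r")
 case True
 have "coeff (emb x \<rhd> vemb v) i = (\<Sum>j<c. v $ j * x $$ (i, j))"
 using v True by (simp add: vemb_def ap_sum_right coeff_sum coeff_emb[OF x])
 also have "... = (x *\<^sub>v v) $ i"
 using x v True by (auto simp: scalar_prod_def atLeast0LessThan mult.commute intro!: sum.cong)
 finally show ?thesis using True by (simp add: coeff_vemb[OF xv])
 qed (use s in \<open>simp add: coeff_vemb[OF xv] spc_iff\<close>)
qed

lemma emb_col: "x : carrier_mat r c ==> j < c ==> emb x \<rhd> bvec j = vemb (col x j)"
proof (rule poly_eqI)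
 fix i assume x: "x : carrier_mat r c" and j: "j < c"
 have c: "col x j : carrier_vec r" using x by auto
 have s: "emb x \<rhd> bvec j : spc r" by (rule ops_ap[OF emb_ops[OF x]])
 show "coeff (emb x \<rhd> bvec j) i = coeff (vemb (col x j)) i"
 proof (cases "i < r")
 case True
 then show ?thesis using x j by (simp add: coeff_vemb[OF c] coeff_emb[OF x])
 qed (use s in \<open>simp add: coeff_vemb[OF c] spc_iff\<close>)
qed

lemma emb_mult:
 assumes x: "x : carrier_mat r k" and y: "y : carrier_mat k c"
 shows "emb (x * y) = emb x * emb y"
proof (rule ops_eqI[of _ r c])
 show "emb (x * y) : ops r c" by (rule emb_ops) (use x y in auto)
 show "emb x * emb y : ops r c" using emb_ops[OF x] emb_ops[OF y] by blast
 fix j assume j: "j < c"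
 have "(emb x * emb y) \<rhd> bvec j = vemb (x *\<^sub>v col y j)"
 using y j by (simp add: emb_col[OF y j] emb_mult_vec[OF x])
 also have "x *\<^sub>v col y j = col (x * y) j" using x y j by auto
 finally show "emb (x * y) \<rhd> bvec j = (emb x * emb y) \<rhd> bvec j"
 using x y j by (subst emb_col[of _ r c]) auto
qed

lemma mat_adjoint_carrier [simp]: "x : carrier_mat r c ==> mat_adjoint x : carrier_mat c r"
 by (auto simp: mat_adjoint_def mat_of_rows_def)

lemma mat_adjoint_index: "x : carrier_mat r c ==> i < c ==> j < r ==> mat_adjoint x $$ (i, j) = cnj (x $$ (j, i))"
 by (auto simp: mat_adjoint_def mat_of_rows_index)

lemma emb_adjoint:
 assumes x: "x : carrier_mat r c"
 shows "emb (mat_adjoint x) = ad (emb x)"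
proof (rule ops_eqI_coeff[of _ c r])
 show "emb (mat_adjoint x) : ops c r" "ad (emb x) : ops c r" using x by (auto intro: emb_ops)
 fix i j assume ij: "i < c" "j < r"
 have "coeff (ad (emb x) \<rhd> bvec j) i = cnj (coeff (emb x \<rhd> bvec i) j)"
 using ip_ad_right[of "bvec i" "emb x" "bvec j"] by simp
 then show "coeff (emb (mat_adjoint x) \<rhd> bvec j) i = coeff (ad (emb x) \<rhd> bvec j) i"
 using x ij by (simp add: coeff_emb[of _ c r] coeff_emb[OF x] mat_adjoint_index[OF x])
qed

lemma mat_sum_carrier [simp]: "mat_sum r c x I : carrier_mat r c"
 by (simp add: mat_sum_def)

lemma emb_mat_sum:
 assumes "!!i. i : I ==> x i : carrier_mat r c"
 shows "emb (mat_sum r c x I) = (\<Sum>i\<in>I. emb (x i))"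
proof (rule ops_eqI_coeff[of _ r c])
 show "(\<Sum>i\<in>I. emb (x i)) : ops r c" by (rule ops_sum) (rule emb_ops[OF assms])
 fix a b assume ab: "a < r" "b < c"
 have "coeff ((\<Sum>i\<in>I. emb (x i)) \<rhd> bvec b) a = (\<Sum>i\<in>I. coeff (emb (x i) \<rhd> bvec b) a)"
 by (simp add: ap_sum_left coeff_sum)
 also have "... = (\<Sum>i\<in>I. x i $$ (a, b))"
 by (intro sum.cong refl coeff_emb[OF _ ab] assms)
 finally show "coeff (emb (mat_sum r c x I) \<rhd> bvec b) a = coeff ((\<Sum>i\<in>I. emb (x i)) \<rhd> bvec b) a"
 using ab by (simp add: coeff_emb[of _ r c] mat_sum_def)
qed (auto intro: emb_ops)

lemma subspace_emb:
 assumes "mat_subspace r c V"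
 shows "scl.subspace (emb ` V)"
proof -
 have V: "V \<subseteq> carrier_mat r c" "0\<^sub>m r c : V" "!!x y. x : V ==> y : V ==> x + y : V" "!!z x. x : V ==> z \<cdot>\<^sub>m x : V"
 using assms by (auto simp: mat_subspace_def)
 show ?thesis
 unfolding scl.subspace_def
 proof (intro conjI ballI allI)
 show "0 : emb ` V" using V(2) by (metis emb_zero image_eqI)
 fix X assume "X : emb ` V"
 then obtain x where x: "x : V" "X = emb x" by blast
 show "scl a X : emb ` V" for a
 using emb_smult[of x r c a] V(1,4) x by (metis image_eqI subsetD)
 fix Y assume "Y : emb ` V"
 then obtain y where y: "y : V" "Y = emb y" by blast
 show "X + Y : emb ` V"
 using emb_add[of x r c y] V(1,3) x y by (metis image_eqI subsetD)
 qed
qed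

lemma mat_subspace_vimage:
 assumes "scl.subspace W"
 shows "mat_subspace r c {x : carrier_mat r c. emb x : W}"
 unfolding mat_subspace_def
 using scl.subspace_0[OF assms] scl.subspace_add[OF assms] scl.subspace_scale[OF assms]
 by (auto simp: emb_add[of _ r c] emb_smult[of _ r c])

text \<open>Spans of matrices are computed in the vector space of adjointable operators.\<close>

lemma mat_span_eq:
 assumes X: "X \<subseteq> carrier_mat r c"
 shows "mat_span r c X = {x : carrier_mat r c. emb x : scl.span (emb ` X)}"
proof
 show "mat_span r c X \<subseteq> {x : carrier_mat r c. emb x : scl.span (emb ` X)}"
 unfolding mat_span_def
 by (rule hull_minimal) (use X in \<open>auto intro: mat_subspace_vimage scl.span_base\<close>)
 show "{x : carrier_mat r c. emb x : scl.span (emb ` X)} \<subseteq> mat_span r c X"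
 unfolding mat_span_def hull_def
 proof (intro subsetI InterI)
 fix x V assume x: "x : {x : carrier_mat r c. emb x : scl.span (emb ` X)}"
 and "V : {t. mat_subspace r c t & X \<subseteq> t}"
 then have V: "mat_subspace r c V" "X \<subseteq> V" by auto
 have "scl.span (emb ` X) \<subseteq> emb ` V"
 using V by (intro scl.span_minimal subspace_emb[of r c]) auto
 then obtain y where "y : V" "emb x = emb y" using x by blast
 then show "x : V" using emb_inj[of x r c y] x V(1) unfolding mat_subspace_def by auto
 qed
qed

lemma mat_span_subset: "X \<subseteq> carrier_mat r c ==> mat_span r c X \<subseteq> carrier_mat r c"
 unfolding mat_span_eq by blast

lemma emb_mat_span:
 assumes X: "X \<subseteq> carrier_mat r c"
 shows "emb ` mat_span r c X = scl.span (emb ` X)"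
proof
 show "emb ` mat_span r c X \<subseteq> scl.span (emb ` X)" unfolding mat_span_eq[OF X] by auto
 show "scl.span (emb ` X) \<subseteq> emb ` mat_span r c X"
 proof
 fix Y assume Y: "Y : scl.span (emb ` X)"
 have "scl.span (emb ` X) \<subseteq> ops r c"
 using X by (intro scl.span_minimal ops_subspace) (auto intro: emb_ops)
 then have "Y = emb (unemb r c Y)" using Y emb_unemb by force
 then show "Y : emb ` mat_span r c X" unfolding mat_span_eq[OF X] using Y by (metis (mono_tags, lifting) image_eqI mem_Collect_eq unemb_carrier)
 qed
qed

lemma opsys_emb:
 assumes "operator_system n S"
 shows "opsys n (emb ` S)"
proof -
 have S: "mat_subspace n n S" "1\<^sub>m n : S" "!!x. x : S ==> mat_adjoint x : S" "S \<subseteq> carrier_mat n n"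
 using assms by (auto simp: operator_system_def mat_subspace_def)
 show ?thesis
 unfolding opsys_def
 proof (intro conjI ballI)
 show "emb ` S \<subseteq> ops n n" using S(4) by (auto intro: emb_ops)
 show "scl.subspace (emb ` S)" by (rule subspace_emb[OF S(1)])
 show "pr n : emb ` S" using S(2) by (metis emb_one image_eqI)
 fix X assume "X : emb ` S"
 then obtain x where x: "x : S" "X = emb x" by blast
 then have "ad X = emb (mat_adjoint x)" using S(4) emb_adjoint[of x n n] by auto
 then show "ad X : emb ` S" using S(3)[OF x(1)] by blast
 qed
qed

lemma cip_vemb:
 assumes "v : carrier_vec n" "w : carrier_vec n"
 shows "cip v w = ip (vemb v) (vemb w)"
proof -
 have "ip (vemb v) (vemb w) = (\<Sum>i<n. cnj (coeff (vemb v) i) * coeff (vemb w) i)"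
 by (rule ip_eq_sum) (simp add: coeff_vemb[OF assms(1)])
 then show ?thesis
 using assms by (auto simp: cip_def scalar_prod_def atLeast0LessThan coeff_vemb[OF assms(1)] coeff_vemb[OF assms(2)] mult.commute intro!: sum.cong)
qed

lemma ip_ops_pr:
 assumes "X : ops n n"
 shows "ip \<xi> (X \<rhd> \<eta>) = ip (pr n \<rhd> \<xi>) (X \<rhd> pr n \<rhd> \<eta>)"
proof -
 have "ip (pr n \<rhd> \<xi>) (X \<rhd> pr n \<rhd> \<eta>) = ip \<xi> ((pr n * X * pr n) \<rhd> \<eta>)"
 using ip_ad_left[of "pr n"] by simp
 then show ?thesis using opsD[OF assms] by (simp only:)
qed

lemma block_psd_iff:
 fixes x :: "nat => nat => complex mat"
 assumes "!!i j. i < p ==> j < p ==> x i j : carrier_mat n n"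
 shows "block_psd n p x \<longleftrightarrow> bpos {..<p} (%i j. emb (x i j))"
proof
 assume b: "block_psd n p x"
 show "bpos {..<p} (%i j. emb (x i j))"
 unfolding bpos_def
 proof
 fix \<xi> :: "nat => complex poly"
 let ?v = "%i. unvemb n (pr n \<rhd> \<xi> i)"
 have "0 \<le> (\<Sum>i<p. \<Sum>j<p. cip (?v i) (x i j *\<^sub>v ?v j))" using b unfolding block_psd_def by simp
 also have "... = (\<Sum>i<p. \<Sum>j<p. ip (\<xi> i) (emb (x i j) \<rhd> \<xi> j))"
 proof (intro sum.cong refl)
 fix i j assume "i : {..<p}" "j : {..<p}"
 then have x: "x i j : carrier_mat n n" using assms by simp
 show "cip (?v i) (x i j *\<^sub>v ?v j) = ip (\<xi> i) (emb (x i j) \<rhd> \<xi> j)"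
 using x by (subst cip_vemb[of _ n])
 (auto simp: emb_mult_vec[OF x, symmetric] vemb_unvemb ip_ops_pr[OF emb_ops[OF x], of "\<xi> i"])
 qed
 finally show "0 \<le> (\<Sum>i<p. \<Sum>j<p. ip (\<xi> i) (emb (x i j) \<rhd> \<xi> j))" .
 qed
next
 assume b: "bpos {..<p} (%i j. emb (x i j))"
 show "block_psd n p x"
 unfolding block_psd_def
 proof (intro allI impI)
 fix v :: "nat => complex vec" assume v: "\<forall>i<p. v i : carrier_vec n"
 have "0 \<le> (\<Sum>i<p. \<Sum>j<p. ip (vemb (v i)) (emb (x i j) \<rhd> vemb (v j)))"
 using b[unfolded bpos_def, rule_format, of "%i. vemb (v i)"] .
 also have "... = (\<Sum>i<p. \<Sum>j<p. cip (v i) (x i j *\<^sub>v v j))"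
 proof (intro sum.cong refl)
 fix i j assume ij: "i : {..<p}" "j : {..<p}"
 then have x: "x i j : carrier_mat n n" using assms by simp
 show "ip (vemb (v i)) (emb (x i j) \<rhd> vemb (v j)) = cip (v i) (x i j *\<^sub>v v j)"
 using x v ij by (subst cip_vemb[of _ n]) (auto simp: emb_mult_vec[OF x])
 qed
 finally show "0 \<le> (\<Sum>i<p. \<Sum>j<p. cip (v i) (x i j *\<^sub>v v j))" .
 qed
qed

lemma emb_sandwich:
 assumes "x : carrier_mat m n" "y : carrier_mat m n" "t : carrier_mat m m"
 shows "emb (mat_adjoint x * t * y) = ad (emb x) * emb t * emb y"
proof -
 have "mat_adjoint x * t : carrier_mat n m" using assms by (intro mult_carrier_mat) auto
 then show ?thesis using assms by (simp add: emb_mult[of _ n m _ n] emb_mult[of _ n m _ m] emb_adjoint)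
qed

lemma emb_sandwich_right:
 assumes "x : carrier_mat m n" "y : carrier_mat m n" "c : carrier_mat n n"
 shows "emb (x * c * mat_adjoint y) = emb x * emb c * ad (emb y)"
proof -
 have "x * c : carrier_mat m n" using assms by (intro mult_carrier_mat) auto
 then show ?thesis using assms by (simp add: emb_mult[of _ m n _ m] emb_mult[of _ m n _ n] emb_adjoint)
qed

lemma emb_adjoint_mult:
 assumes "x : carrier_mat m n" "y : carrier_mat m n"
 shows "emb (mat_adjoint x * y) = ad (emb x) * emb y"
 using assms by (simp add: emb_mult[of _ n m _ n] emb_adjoint)

lemma pullback_span:
 assumes T: "T \<subseteq> carrier_mat m m" and x: "!!i. i < r ==> x i : carrier_mat m n"
 shows "emb ` mat_span n n {mat_adjoint (x i) * t * x j | i j t. i < r & j < r & t : T}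
 = scl.span {ad (emb (x i)) * t * emb (x j) | i j t. i < r & j < r & t : emb ` T}"
proof -
 let ?X = "{mat_adjoint (x i) * t * x j | i j t. i < r & j < r & t : T}"
 let ?Y = "{ad (emb (x i)) * t * emb (x j) | i j t. i < r & j < r & t : emb ` T}"
 have X: "?X \<subseteq> carrier_mat n n"
 proof
 fix y assume "y : ?X"
 then obtain i j t where y: "i < r" "j < r" "t : T" "y = mat_adjoint (x i) * t * x j" by blast
 show "y : carrier_mat n n" unfolding y(4) using x[OF y(1)] x[OF y(2)] T y(3) by (intro mult_carrier_mat[of _ n m]) auto
 qed
 have e: "emb (mat_adjoint (x i) * t * x j) = ad (emb (x i)) * emb t * emb (x j)" if "i < r" "j < r" "t : T" for i j t
 using x that T by (intro emb_sandwich[OF x x]) auto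
 have "emb ` ?X = ?Y"
 proof (intro equalityI subsetI)
 fix y assume "y : emb ` ?X"
 then obtain i j t where y: "i < r" "j < r" "t : T" "y = emb (mat_adjoint (x i) * t * x j)" by blast
 then show "y : ?Y" using e[OF y(1-3)] by blast
 next
 fix y assume "y : ?Y"
 then obtain i j t where y: "i < r" "j < r" "t : T" "y = ad (emb (x i)) * emb t * emb (x j)" by blast
 then have "y = emb (mat_adjoint (x i) * t * x j)" using e[OF y(1-3)] by simp
 then show "y : emb ` ?X" using y by blast
 qed
 then show ?thesis unfolding emb_mat_span[OF X] by simp
qed

lemma emb_image_subset: "A \<subseteq> carrier_mat r c ==> B \<subseteq> carrier_mat r c ==> emb ` A \<subseteq> emb ` B ==> A \<subseteq> B"
proof
 fix a assume A: "A \<subseteq> carrier_mat r c" "B \<subseteq> carrier_mat r c" "emb ` A \<subseteq> emb ` B" and a: "a : A"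
 then obtain b where b: "b : B" "emb a = emb b" by blast
 then have "a = b" using A(1,2) a by (intro emb_inj[of a r c b]) auto
 then show "a : B" using b(1) by simp
qed

section \<open>TRO-equivalent operator systems\<close>

definition pullback :: "nat => complex mat set => nat => complex mat set => bool" where
 "pullback n S m T \<longleftrightarrow> (\<exists>(r :: nat) x. (\<forall>i<r. x i : carrier_mat m n) &
 mat_sum n n (%i. mat_adjoint (x i) * x i) {..<r} = 1\<^sub>m n &
 S = mat_span n n {mat_adjoint (x i) * t * x j | i j t. i < r & j < r & t : T})"

lemma pullback_of_opullback:
 assumes S: "operator_system n S" and T: "operator_system m T" and "opullback n (emb ` S) m (emb ` T)"
 shows "pullback n S m T"
proof -
 obtain r :: nat and X where X: "!!i. i < r ==> X i : ops m n" "(\<Sum>i<r. ad (X i) * X i) = pr n"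
 "emb ` S = scl.span {ad (X i) * t * X j | i j t. i < r & j < r & t : emb ` T}"
 using assms(3) unfolding opullback_def by blast
 define x where "x i = unemb m n (X i)" for i
 have xc: "x i : carrier_mat m n" for i by (simp add: x_def)
 have ex: "emb (x i) = X i" if "i < r" for i using X(1)[OF that] by (simp add: x_def emb_unemb)
 have Tc: "T \<subseteq> carrier_mat m m" and Sc: "S \<subseteq> carrier_mat n n"
 using S T by (auto simp: operator_system_def mat_subspace_def)
 have ac: "mat_adjoint (x i) : carrier_mat n m" for i using xc by simp
 have one: "mat_sum n n (%i. mat_adjoint (x i) * x i) {..<r} = 1\<^sub>m n"
 proof (rule emb_inj[of _ n n])
 have "emb (mat_sum n n (%i. mat_adjoint (x i) * x i) {..<r}) = (\<Sum>i<r. emb (mat_adjoint (x i) * x i))"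
 by (intro emb_mat_sum mult_carrier_mat[OF ac xc])
 also have "... = (\<Sum>i<r. ad (X i) * X i)"
 by (intro sum.cong refl) (simp add: emb_mult[OF ac xc] emb_adjoint[OF xc] ex)
 finally show "emb (mat_sum n n (%i. mat_adjoint (x i) * x i) {..<r}) = emb (1\<^sub>m n)" by (simp add: X(2))
 qed auto
 let ?G = "{mat_adjoint (x i) * t * x j | i j t. i < r & j < r & t : T}"
 have eG: "emb ` mat_span n n ?G = emb ` S"
 proof -
 have "{ad (emb (x i)) * t * emb (x j) | i j t. i < r & j < r & t : emb ` T}
 = {ad (X i) * t * X j | i j t. i < r & j < r & t : emb ` T}"
 by (intro Collect_cong ex_cong1) (auto simp: ex)
 then show ?thesis unfolding X(3) pullback_span[OF Tc xc] by (rule arg_cong)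
 qed
 have "mat_span n n ?G \<subseteq> carrier_mat n n"
 proof (rule mat_span_subset, rule subsetI)
 fix y assume "y : ?G"
 then obtain i j t where y: "t : T" "y = mat_adjoint (x i) * t * x j" by blast
 show "y : carrier_mat n n" unfolding y(2) using Tc y(1) by (intro mult_carrier_mat[OF mult_carrier_mat[OF ac] xc]) auto
 qed
 then have "S = mat_span n n ?G" using emb_image_subset[OF Sc] emb_image_subset[OF _ Sc] eG by (intro equalityI) auto
 then show ?thesis unfolding pullback_def using xc one by blast
qed

text \<open>Scalars are absorbed into the second factors.\<close>

lemma span_products:
 assumes M: "!!c x. x : M ==> scl c x : M" and X: "X : scl.span {ad x * y | x y. x : M & y : M}"
 obtains N :: nat and f g where "!!k. k < N ==> f k : M & g k : M" "X = (\<Sum>k<N. ad (f k) * g k)"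
proof -
 define W where "W = {sum_list (map (%(x, y). ad x * y) L) | L. set L \<subseteq> M \<times> M}"
 have "scl.span {ad x * y | x y. x : M & y : M} \<subseteq> W"
 proof (rule scl.span_minimal)
 show "{ad x * y | x y. x : M & y : M} \<subseteq> W"
 proof
 fix Y assume "Y : {ad x * y | x y. x : M & y : M}"
 then obtain x y where "x : M" "y : M" "Y = ad x * y" by blast
 then show "Y : W" unfolding W_def by (intro CollectI exI[of _ "[(x, y)]"]) simp
 qed
 show "scl.subspace W"
 unfolding scl.subspace_def
 proof (intro conjI ballI allI)
 show "0 : W" unfolding W_def by (intro CollectI exI[of _ "[]"]) simp
 fix Y assume "Y : W"
 then obtain L where L: "set L \<subseteq> M \<times> M" "Y = sum_list (map (%(x, y). ad x * y) L)" unfolding W_def by blast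
 show "scl c Y : W" for c
 proof -
 have "scl c (sum_list (map (%(x, y). ad x * y) L)) = sum_list (map (%(x, y). ad x * y) (map (%(x, y). (scl (cnj c) x, y)) L))"
 by (induction L) (auto simp: scl.scale_right_distrib)
 moreover have "set (map (%(x, y). (scl (cnj c) x, y)) L) \<subseteq> M \<times> M" using L(1) M by auto
 ultimately show ?thesis unfolding W_def L(2) by blast
 qed
 fix Z assume "Z : W"
 then obtain L' where L': "set L' \<subseteq> M \<times> M" "Z = sum_list (map (%(x, y). ad x * y) L')" unfolding W_def by blast
 show "Y + Z : W" unfolding W_def L(2) L'(2) using L(1) L'(1)
 by (intro CollectI exI[of _ "L @ L'"]) simp
 qed
 qed
 then obtain L where L: "set L \<subseteq> M \<times> M" "X = sum_list (map (%(x, y). ad x * y) L)" using X unfolding W_def by blast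
 show ?thesis
 proof (rule that[of "length L" "%k. fst (L ! k)" "%k. snd (L ! k)"])
 show "fst (L ! k) : M & snd (L ! k) : M" if "k < length L" for k
 using nth_mem[OF that] L(1) by (auto simp: mem_Times_iff)
 show "X = (\<Sum>k<length L. ad (fst (L ! k)) * snd (L ! k))"
 unfolding L(2) sum_list_sum_nth by (simp add: atLeast0LessThan case_prod_beta)
 qed
qed

text \<open>For \<open>1 = \<Sum> f\<^sub>k\<^sup>* g\<^sub>k\<close>, sandwiching \<open>s\<close> between two copies of this identity writes it as a sum of elements \<open>x\<^sup>* t y\<close>.\<close>

lemma tro_opullback:
 assumes S: "opsys n S" and T: "opsys m T" and M: "M \<subseteq> ops m n" "!!c x. x : M ==> scl c x : M"
 and unit: "pr n : scl.span {ad x * y | x y. x : M & y : M}"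
 and TS: "!!x y t. x : M ==> y : M ==> t : T ==> ad x * t * y : S"
 and ST: "!!x y s. x : M ==> y : M ==> s : S ==> x * s * ad y : T"
 shows "opullback n S m T"
proof -
 obtain N :: nat and f g where fg: "!!k. k < N ==> f k : M & g k : M" "pr n = (\<Sum>k<N. ad (f k) * g k)"
 using span_products[OF M(2) unit] by metis
 have "ad (pr n) = (\<Sum>k<N. ad (g k) * f k)" unfolding fg(2) ad_sum by simp
 then have gf: "pr n = (\<Sum>k<N. ad (g k) * f k)" by simp
 define I where "I = f ` {..<N} \<union> g ` {..<N}"
 have IM: "I \<subseteq> M" unfolding I_def using fg(1) by auto
 show ?thesis
 proof (rule pullback_normalise[OF S T, of I "%x. x", where N = N and p = f and q = g])
 show "finite I" by (simp add: I_def)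
 show "x : ops m n" if "x : I" for x using that IM M(1) by blast
 show "ad x * t * y : S" if "x : I" "y : I" "t : T" for x y t using that IM TS by blast
 show "ad x * x * s : S" if x: "x : I" and s: "s : S" for x s
 proof -
 have "s = s * (\<Sum>k<N. ad (f k) * g k)" using opsD(2)[OF opsysD(5)[OF S s]] by (simp add: fg(2))
 then have "ad x * x * s = (\<Sum>k<N. ad x * (x * s * ad (f k)) * g k)"
 by (metis (no_types, lifting) mult.assoc sum.cong sum_distrib_left)
 also have "... : S" using x s IM fg(1) TS ST by (intro opsysD(10)[OF S]) auto
 finally show ?thesis .
 qed
 show "S \<subseteq> scl.span {ad x * t * y | x y t. x : I & y : I & t : T}" (is "_ \<subseteq> scl.span ?G")
 proof
 fix s assume s: "s : S"
 have "s = (\<Sum>k<N. ad (g k) * f k) * s * (\<Sum>l<N. ad (f l) * g l)"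
 using opsD[OF opsysD(5)[OF S s]] by (simp add: fg(2)[symmetric] gf[symmetric])
 also have "... = (\<Sum>k<N. \<Sum>l<N. ad (g k) * (f k * s * ad (f l)) * g l)"
 unfolding sum_distrib_right unfolding sum_distrib_left by (simp add: mult.assoc)
 also have "... : scl.span ?G"
 proof (intro scl.span_sum scl.span_base)
 fix k l assume "k : {..<N}" "l : {..<N}"
 then have "g k : I" "g l : I" "f k * s * ad (f l) : T"
 using fg(1) ST s by (auto simp: I_def)
 then show "ad (g k) * (f k * s * ad (f l)) * g l : ?G" by blast
 qed
 finally show "s : scl.span ?G" .
 qed
 qed (use fg in \<open>auto simp: I_def\<close>)
qed

theorem tro_pullback:
 assumes S: "operator_system n S" and T: "operator_system m T" and tro: "mat_tro_equivalent n S m T"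
 shows "pullback n S m T" "pullback m T n S"
proof -
 obtain M where M: "mat_tro n m M" "mat_nondegenerate n m M"
 "!!x y t. x : M ==> y : M ==> t : T ==> mat_adjoint x * t * y : S"
 "!!x y s. x : M ==> y : M ==> s : S ==> x * s * mat_adjoint y : T"
 using tro unfolding mat_tro_equivalent_def by blast
 have Ms: "mat_subspace m n M" and Mc: "M \<subseteq> carrier_mat m n"
 using M(1) by (auto simp: mat_tro_def mat_subspace_def)
 have Tc: "T \<subseteq> carrier_mat m m" and Sc: "S \<subseteq> carrier_mat n n"
 using S T by (auto simp: operator_system_def mat_subspace_def)
 let ?M = "emb ` M"
 let ?M' = "ad ` ?M"
 have sM: "scl.subspace ?M" by (rule subspace_emb[OF Ms])
 have Mo: "?M \<subseteq> ops m n" "?M' \<subseteq> ops n m" using Mc by (auto intro: emb_ops)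
 have eTS: "ad x * t * y : emb ` S" if xyt: "x : ?M" "y : ?M" "t : emb ` T" for x y t
 proof -
 obtain x' y' t' where e: "x' : M" "y' : M" "t' : T" "x = emb x'" "y = emb y'" "t = emb t'" using xyt by blast
 then have c: "x' : carrier_mat m n" "y' : carrier_mat m n" "t' : carrier_mat m m" using Mc Tc by auto
 have "ad x * t * y = emb (mat_adjoint x' * t' * y')"
 unfolding e(4-6) by (rule emb_sandwich[OF c, symmetric])
 then show ?thesis using M(3)[OF e(1-3)] by blast
 qed
 have eST: "x * s * ad y : emb ` T" if xys: "x : ?M" "y : ?M" "s : emb ` S" for x y s
 proof -
 obtain x' y' s' where e: "x' : M" "y' : M" "s' : S" "x = emb x'" "y = emb y'" "s = emb s'" using xys by blast
 then have c: "x' : carrier_mat m n" "y' : carrier_mat m n" "s' : carrier_mat n n" using Mc Sc by auto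
 have "x * s * ad y = emb (x' * s' * mat_adjoint y')"
 unfolding e(4-6) by (rule emb_sandwich_right[OF c, symmetric])
 then show ?thesis using M(4)[OF e(1-3)] by blast
 qed
 have u1: "pr n : scl.span {ad x * y | x y. x : ?M & y : ?M}"
 proof -
 let ?X = "{mat_adjoint x * y | x y. x : M & y : M}"
 have X: "?X \<subseteq> carrier_mat n n"
 proof
 fix z assume "z : ?X"
 then obtain x y where z: "x : M" "y : M" "z = mat_adjoint x * y" by blast
 show "z : carrier_mat n n" unfolding z(3) using Mc z(1,2) by (intro mult_carrier_mat[of _ n m]) auto
 qed
 have "1\<^sub>m n : mat_span n n ?X" using M(2) by (simp add: mat_nondegenerate_def)
 then have "emb (1\<^sub>m n) : scl.span (emb ` ?X)" unfolding mat_span_eq[OF X] by simp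
 moreover have "emb ` ?X \<subseteq> {ad x * y | x y. x : ?M & y : ?M}"
 proof
 fix Z assume "Z : emb ` ?X"
 then obtain x y where xy: "x : M" "y : M" "Z = emb (mat_adjoint x * y)" by blast
 then have c: "x : carrier_mat m n" "y : carrier_mat m n" using Mc by auto
 have "Z = ad (emb x) * emb y" unfolding xy(3) using c by (simp add: emb_mult[of _ n m _ n] emb_adjoint[OF c(1)])
 then show "Z : {ad x * y | x y. x : ?M & y : ?M}" using xy by blast
 qed
 ultimately show ?thesis unfolding emb_one by (rule rev_subsetD[OF _ scl.span_mono])
 qed
 have u2: "pr m : scl.span {ad x * y | x y. x : ?M' & y : ?M'}"
 proof -
 let ?X = "{x * mat_adjoint y | x y. x : M & y : M}"
 have X: "?X \<subseteq> carrier_mat m m"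
 proof
 fix z assume "z : ?X"
 then obtain x y where z: "x : M" "y : M" "z = x * mat_adjoint y" by blast
 show "z : carrier_mat m m" unfolding z(3) using Mc z(1,2) by (intro mult_carrier_mat[of _ m n]) auto
 qed
 have "1\<^sub>m m : mat_span m m ?X" using M(2) by (simp add: mat_nondegenerate_def)
 then have "emb (1\<^sub>m m) : scl.span (emb ` ?X)" unfolding mat_span_eq[OF X] by simp
 moreover have "emb ` ?X \<subseteq> {ad x * y | x y. x : ?M' & y : ?M'}"
 proof
 fix Z assume "Z : emb ` ?X"
 then obtain x y where xy: "x : M" "y : M" "Z = emb (x * mat_adjoint y)" by blast
 then have c: "x : carrier_mat m n" "y : carrier_mat m n" using Mc by auto
 have "Z = ad (ad (emb x)) * ad (emb y)" unfolding xy(3) using c by (simp add: emb_mult[of _ m n _ m] emb_adjoint[OF c(2)])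
 then show "Z : {ad x * y | x y. x : ?M' & y : ?M'}" using xy by blast
 qed
 ultimately show ?thesis unfolding emb_one by (rule rev_subsetD[OF _ scl.span_mono])
 qed
 have "opullback n (emb ` S) m (emb ` T)"
 by (rule tro_opullback[OF opsys_emb[OF S] opsys_emb[OF T] Mo(1) _ u1 eTS eST])
 (rule scl.subspace_scale[OF sM])
 then show "pullback n S m T" by (rule pullback_of_opullback[OF S T])
 have "opullback m (emb ` T) n (emb ` S)"
 proof (rule tro_opullback[OF opsys_emb[OF T] opsys_emb[OF S] Mo(2) _ u2])
 show "scl c x : ?M'" if "x : ?M'" for c x
 proof -
 from that obtain y where y: "y : ?M" "x = ad y" by blast
 then have "scl c x = ad (scl (cnj c) y)" by simp
 then show ?thesis using scl.subspace_scale[OF sM y(1)] by blast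
 qed
 show "ad x * s * y : emb ` T" if xy: "x : ?M'" "y : ?M'" "s : emb ` S" for x y s
 proof -
 obtain a b where ab: "a : ?M" "b : ?M" "x = ad a" "y = ad b" using xy by blast
 show ?thesis using eST[OF ab(1,2) xy(3)] by (simp add: ab(3,4))
 qed
 show "x * t * ad y : emb ` S" if xy: "x : ?M'" "y : ?M'" "t : emb ` T" for x y t
 proof -
 obtain a b where ab: "a : ?M" "b : ?M" "x = ad a" "y = ad b" using xy by blast
 show ?thesis using eTS[OF ab(1,2) xy(3)] by (simp add: ab(3,4))
 qed
 qed
 then show "pullback m T n S" by (rule pullback_of_opullback[OF T S])
qed

section \<open>Complete isometries and complete order embeddings\<close>

lemma sqn_0 [simp]: "sqn 0 = 0"
 by (simp only: sqn_eq_0)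

lemma sum_lessThan_add: "(\<Sum>i<p + (q :: nat). f i) = (\<Sum>i<p. f i) + (\<Sum>i<q. f (p + i))"
 by (induction q) (simp_all add: add.assoc)

definition rowsq :: "nat => (nat => nat => aop) => (nat => complex poly) => real" where
 "rowsq p x \<eta> = (\<Sum>i<p. sqn (\<Sum>j<p. x i j \<rhd> \<eta> j))"

lemma rowsq_nonneg [simp]: "0 \<le> rowsq p x \<eta>"
 by (simp add: rowsq_def sum_nonneg)

lemma sqn_ad_le_bounded:
 assumes "X : ops r c"
 obtains C where "0 \<le> C" "!!\<xi>. sqn (X \<rhd> \<xi>) \<le> C * sqn \<xi>"
proof -
 have a: "ad X * X : ops c c" "hermitian (ad X * X)" using assms by (auto simp: hermitian_def)
 obtain C where C: "0 \<le> C" "positive (scl (complex_of_real C) (pr c) - ad X * X)"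
 using hermitian_bounded[OF a] by blast
 have "positive (scl (complex_of_real C) (1 - pr c))"
 using C(1) by (intro positive_scl positive_one_minus_pr)
 from positive_add[OF C(2) this] have p: "positive (scl (complex_of_real C) 1 - ad X * X)"
 by (simp add: scl.scale_right_diff_distrib)
 have "sqn (X \<rhd> \<xi>) \<le> C * sqn \<xi>" for \<xi>
 proof -
 have "0 \<le> ip \<xi> ((scl (complex_of_real C) 1 - ad X * X) \<rhd> \<xi>)" using p unfolding positive_def by blast
 also have "... = complex_of_real (C * sqn \<xi> - sqn (X \<rhd> \<xi>))" by (simp add: ip_ad_right ip_self)
 finally show ?thesis by (simp add: complex_nonneg_iff)
 qed
 with C(1) show ?thesis using that by blast
qed

lemma rowsq_bounded:
 assumes x: "!!i j. i < p ==> j < p ==> x i j : ops n n"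
 obtains C where "0 \<le> C" "!!\<eta>. (!!j. j < p ==> \<eta> j : spc n) ==> rowsq p x \<eta> \<le> C * (\<Sum>j<p. sqn (\<eta> j))"
proof -
 have X: "bop n p x : ops (p * n) (p * n)" by (rule bop_ops[OF x])
 obtain C where C: "0 \<le> C" "!!\<xi>. sqn (bop n p x \<rhd> \<xi>) \<le> C * sqn \<xi>"
 using sqn_ad_le_bounded[OF X] by blast
 have "rowsq p x \<eta> \<le> C * (\<Sum>j<p. sqn (\<eta> j))" if \<eta>: "!!j. j < p ==> \<eta> j : spc n" for \<eta>
 proof -
 define emb_blk where "emb_blk \<theta> = (\<Sum>i<p. blk n i \<rhd> \<theta> i)" for \<theta>
 have ad_emb: "ad (blk n i) \<rhd> emb_blk \<theta> = \<theta> i" if "i < p" "!!j. j < p ==> \<theta> j : spc n" for i \<theta>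
 proof -
 have "ad (blk n i) \<rhd> emb_blk \<theta> = (\<Sum>j<p. if j = i then \<theta> i else 0)"
 unfolding emb_blk_def ap_sum_right ap_simps(1)[symmetric] ad_blk_blk
 using that by (intro sum.cong) (auto simp: spc_def)
 then show ?thesis using that by simp
 qed
 have sq: "sqn (emb_blk \<theta>) = (\<Sum>i<p. sqn (\<theta> i))" if "!!j. j < p ==> \<theta> j : spc n" for \<theta>
 proof -
 have "ip (emb_blk \<theta>) (emb_blk \<theta>) = (\<Sum>i<p. ip (\<theta> i) (ad (blk n i) \<rhd> emb_blk \<theta>))"
 by (simp add: emb_blk_def[of \<theta>] ip_sum_left ip_ad_right)
 also have "... = (\<Sum>i<p. ip (\<theta> i) (\<theta> i))" using that by (intro sum.cong refl) (simp add: ad_emb)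
 finally show ?thesis by (simp add: sqn_def)
 qed
 let ?\<gamma> = "%i. \<Sum>j<p. x i j \<rhd> \<eta> j"
 have "bop n p x \<rhd> emb_blk \<eta> = emb_blk ?\<gamma>"
 unfolding bop_def emb_blk_def[of ?\<gamma>] ap_sum_left ap_sum_right ap_simps(1)
 using \<eta> by (intro sum.cong refl) (simp add: ad_emb)
 moreover have "?\<gamma> i : spc n" if "i < p" for i
 using that x by (intro vsub_sum[OF vsub_spc]) auto
 ultimately show ?thesis using C(2)[of "emb_blk \<eta>"] sq[OF \<eta>] by (simp add: sq rowsq_def)
 qed
 then show ?thesis using that C(1) by blast
qed

definition norm_set :: "nat => (nat => nat => aop) => complex poly set => real set" where
 "norm_set p x L = {sqrt (rowsq p x \<eta>) | \<eta>. (\<forall>j. \<eta> j : L) & (\<Sum>j<p. sqn (\<eta> j)) \<le> 1}"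

lemma norm_set_bdd:
 assumes "!!i j. i < p ==> j < p ==> x i j : ops n n" "L \<subseteq> spc n"
 shows "bdd_above (norm_set p x L)"
proof (rule rowsq_bounded[where p = p and x = x and n = n])
 show "x i j : ops n n" if "i < p" "j < p" for i j using assms(1)[OF that] .
 fix C assume C: "0 \<le> C" "!!\<eta>. (!!j. j < p ==> \<eta> j : spc n) ==> rowsq p x \<eta> \<le> C * (\<Sum>j<p. sqn (\<eta> j))"
 show "bdd_above (norm_set p x L)"
 proof (rule bdd_aboveI)
 fix r assume "r : norm_set p x L"
 then obtain \<eta> where \<eta>: "r = sqrt (rowsq p x \<eta>)" "!!j. \<eta> j : L" "(\<Sum>j<p. sqn (\<eta> j)) \<le> 1"
 by (auto simp: norm_set_def)
 have "rowsq p x \<eta> \<le> C * (\<Sum>j<p. sqn (\<eta> j))" using \<eta>(2) assms(2) by (intro C(2)) auto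
 also have "... \<le> C * 1" using \<eta>(3) C(1) by (rule mult_left_mono)
 finally show "r \<le> sqrt C" by (simp add: \<eta>(1))
 qed
qed

lemma rowsq_le_norm:
 assumes L: "vsub n L" and x: "!!i j. i < p ==> j < p ==> x i j : ops n n" and \<eta>: "!!j. \<eta> j : L"
 shows "rowsq p x \<eta> \<le> (Sup (norm_set p x L))\<^sup>2 * (\<Sum>j<p. sqn (\<eta> j))"
proof -
 let ?c = "Sup (norm_set p x L)" and ?s = "\<Sum>j<p. sqn (\<eta> j)"
 have bdd: "bdd_above (norm_set p x L)" using L x by (intro norm_set_bdd) (auto simp: vsub_def)
 show ?thesis
 proof (cases "?s = 0")
 case True
 then have "\<eta> j = 0" if "j < p" for j using that by (subst (asm) sum_nonneg_eq_0_iff) auto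
 then have "(\<Sum>j<p. x i j \<rhd> \<eta> j) = 0" for i by (intro sum.neutral) auto
 then show ?thesis by (simp add: rowsq_def True)
 next
 case False
 then have s: "0 < ?s" using sum_nonneg[of "{..<p}" "%j. sqn (\<eta> j)"] by simp
 define d where "d = complex_of_real (1 / sqrt ?s)"
 have d: "(cmod d)\<^sup>2 = 1 / ?s" using s by (simp add: d_def norm_divide power_divide)
 have "sqrt (rowsq p x (%j. smult d (\<eta> j))) : norm_set p x L"
 unfolding norm_set_def
 proof (intro CollectI exI[of _ "%j. smult d (\<eta> j)"] conjI allI)
 show "sqrt (rowsq p x (%j. smult d (\<eta> j))) = sqrt (rowsq p x (%j. smult d (\<eta> j)))" by (rule refl)
 show "smult d (\<eta> j) : L" for j using \<eta> by (rule vsubD(4)[OF L])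
 have "(\<Sum>j<p. sqn (smult d (\<eta> j))) = (cmod d)\<^sup>2 * ?s" by (simp add: sum_distrib_left)
 also have "... = 1" unfolding d using s by simp
 finally show "(\<Sum>j<p. sqn (smult d (\<eta> j))) \<le> 1" by simp
 qed
 then have "sqrt (rowsq p x (%j. smult d (\<eta> j))) \<le> ?c" by (rule cSup_upper[OF _ bdd])
 then have "rowsq p x (%j. smult d (\<eta> j)) \<le> ?c\<^sup>2" by (rule sqrt_le_D)
 moreover have "rowsq p x (%j. smult d (\<eta> j)) = rowsq p x \<eta> / ?s"
 proof -
 have "(\<Sum>j<p. x i j \<rhd> smult d (\<eta> j)) = smult d (\<Sum>j<p. x i j \<rhd> \<eta> j)" for i
 by (simp add: smult_sum2)
 then show ?thesis by (simp add: rowsq_def d sum_divide_distrib flip: sum_distrib_left)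
 qed
 ultimately show ?thesis using s by (simp add: field_simps)
 qed
qed

text \<open>The two by two block matrix with \<open>c\<close> on the diagonal and \<open>x\<close>, \<open>x\<^sup>*\<close> off the diagonal, which is positive if and only if
\<open>\<parallel>x\<parallel> \<le> c\<close>. It converts norms into positivity.\<close>

definition paulsen :: "nat => nat => real => (nat => nat => aop) => nat => nat => aop" where
 "paulsen n p c x i j =
 (if i < p & j < p \<or> p \<le> i & p \<le> j then (if i = j then scl (complex_of_real c) (pr n) else 0)
 else if i < p then x i (j - p) else ad (x j (i - p)))"

lemma paulsen_form:
 assumes \<xi>: "!!i. i < p + p ==> \<xi> i : spc n"
 shows "(\<Sum>i<p + p. \<Sum>j<p + p. ip (\<xi> i) (paulsen n p c x i j \<rhd> \<xi> j))
 = complex_of_real (c * (\<Sum>i<p. sqn (\<xi> i)) + c * (\<Sum>i<p. sqn (\<xi> (p + i)))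
 + 2 * Re (\<Sum>i<p. ip (\<xi> i) (\<Sum>j<p. x i j \<rhd> \<xi> (p + j))))"
proof -
 define w where "w = (\<Sum>i<p. ip (\<xi> i) (\<Sum>j<p. x i j \<rhd> \<xi> (p + j)))"
 have "(\<Sum>i<p + p. \<Sum>j<p + p. ip (\<xi> i) (paulsen n p c x i j \<rhd> \<xi> j))
 = (\<Sum>i<p. \<Sum>j<p. ip (\<xi> i) (paulsen n p c x i j \<rhd> \<xi> j))
 + (\<Sum>i<p. \<Sum>j<p. ip (\<xi> i) (paulsen n p c x i (p + j) \<rhd> \<xi> (p + j)))
 + ((\<Sum>i<p. \<Sum>j<p. ip (\<xi> (p + i)) (paulsen n p c x (p + i) j \<rhd> \<xi> j))
 + (\<Sum>i<p. \<Sum>j<p. ip (\<xi> (p + i)) (paulsen n p c x (p + i) (p + j) \<rhd> \<xi> (p + j))))"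
 by (simp add: sum_lessThan_add sum.distrib)
 also have "(\<Sum>i<p. \<Sum>j<p. ip (\<xi> i) (paulsen n p c x i j \<rhd> \<xi> j)) = complex_of_real (c * (\<Sum>i<p. sqn (\<xi> i)))"
 proof -
 have "(\<Sum>i<p. \<Sum>j<p. ip (\<xi> i) (paulsen n p c x i j \<rhd> \<xi> j))
 = (\<Sum>i<p. \<Sum>j<p. if j = i then complex_of_real (c * sqn (\<xi> i)) else 0)"
 using \<xi> by (intro sum.cong refl) (auto simp: paulsen_def spc_def ip_self)
 then show ?thesis by (simp add: sum_distrib_left)
 qed
 also have "(\<Sum>i<p. \<Sum>j<p. ip (\<xi> (p + i)) (paulsen n p c x (p + i) (p + j) \<rhd> \<xi> (p + j))) = complex_of_real (c * (\<Sum>i<p. sqn (\<xi> (p + i))))"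
 proof -
 have "(\<Sum>i<p. \<Sum>j<p. ip (\<xi> (p + i)) (paulsen n p c x (p + i) (p + j) \<rhd> \<xi> (p + j)))
 = (\<Sum>i<p. \<Sum>j<p. if j = i then complex_of_real (c * sqn (\<xi> (p + i))) else 0)"
 using \<xi> by (intro sum.cong refl) (auto simp: paulsen_def spc_def ip_self)
 then show ?thesis by (simp add: sum_distrib_left)
 qed
 also have "(\<Sum>i<p. \<Sum>j<p. ip (\<xi> i) (paulsen n p c x i (p + j) \<rhd> \<xi> (p + j))) = w"
 unfolding w_def ip_sum_right by (intro sum.cong refl) (simp add: paulsen_def)
 also have "(\<Sum>i<p. \<Sum>j<p. ip (\<xi> (p + i)) (paulsen n p c x (p + i) j \<rhd> \<xi> j)) = cnj w"
 proof -
 have "(\<Sum>i<p. \<Sum>j<p. ip (\<xi> (p + i)) (paulsen n p c x (p + i) j \<rhd> \<xi> j))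
 = (\<Sum>i<p. \<Sum>j<p. cnj (ip (\<xi> j) (x j i \<rhd> \<xi> (p + i))))"
 proof (intro sum.cong refl)
 fix i j assume "i : {..<p}" "j : {..<p}"
 then have "ip (\<xi> (p + i)) (paulsen n p c x (p + i) j \<rhd> \<xi> j) = ip (x j i \<rhd> \<xi> (p + i)) (\<xi> j)"
 by (simp add: paulsen_def ip_ad_right)
 then show "ip (\<xi> (p + i)) (paulsen n p c x (p + i) j \<rhd> \<xi> j) = cnj (ip (\<xi> j) (x j i \<rhd> \<xi> (p + i)))"
 by (simp add: ip_commute[symmetric])
 qed
 also have "... = (\<Sum>j<p. \<Sum>i<p. cnj (ip (\<xi> j) (x j i \<rhd> \<xi> (p + i))))" by (rule sum.swap)
 also have "... = cnj w" by (simp add: w_def ip_sum_right)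
 finally show ?thesis .
 qed
 finally show ?thesis unfolding w_def[symmetric] by (simp add: complex_eq_iff)
qed

text \<open>The block matrix of \<open>x\<close> with \<open>c\<close> the norm of \<open>x\<close> on \<open>L\<close> is positive on \<open>L\<close>, hence positive everywhere.\<close>

lemma norm_set_Sup_eq:
 assumes S: "opsys n S" and L: "vsub n L"
 and order: "!!(p :: nat) s. (!!i j. i < p ==> j < p ==> s i j : S & ad (s i j) = s j i) ==>
 (!!\<xi>. (!!i. \<xi> i : L) ==> 0 \<le> (\<Sum>i<p. \<Sum>j<p. ip (\<xi> i) (s i j \<rhd> \<xi> j))) ==> bpos {..<p} s"
 and x: "!!i j. i < p ==> j < p ==> x i j : S"
 shows "Sup (norm_set p x L) = Sup (norm_set p x (spc n))"
proof (rule antisym)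
 have xo: "x i j : ops n n" if "i < p" "j < p" for i j using x[OF that] opsysD(5)[OF S] by blast
 have Ls: "L \<subseteq> spc n" using L by (simp add: vsub_def)
 have bdd: "bdd_above (norm_set p x L)" "bdd_above (norm_set p x (spc n))"
 using xo Ls by (auto intro!: norm_set_bdd)
 have zero: "0 : norm_set p x L'" if "0 : L'" for L'
 unfolding norm_set_def by (intro CollectI exI[of _ "%_. 0"]) (use that in \<open>simp add: rowsq_def\<close>)
 have zL: "0 : norm_set p x L" using vsubD(2)[OF L] by (rule zero)
 have "norm_set p x L \<subseteq> norm_set p x (spc n)" unfolding norm_set_def using Ls by blast
 then show "Sup (norm_set p x L) \<le> Sup (norm_set p x (spc n))"
 using zL bdd(2) by (intro cSup_subset_mono) auto
 define c where "c = Sup (norm_set p x L)"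
 have c: "0 \<le> c" unfolding c_def by (rule cSup_upper[OF zL bdd(1)])
 have "bpos {..<p + p} (paulsen n p c x)"
 proof (rule order)
 fix i j assume ij: "i < p + p" "j < p + p"
 have "scl (complex_of_real c) (pr n) : S" "0 : S" using opsysD(3,6,9)[OF S] by blast+
 then show "paulsen n p c x i j : S & ad (paulsen n p c x i j) = paulsen n p c x j i"
 using ij x opsysD(4)[OF S] by (auto simp: paulsen_def not_less)
 next
 fix \<xi> :: "nat => complex poly" assume \<xi>: "!!i. \<xi> i : L"
 let ?\<gamma> = "%i. \<Sum>j<p. x i j \<rhd> \<xi> (p + j)"
 have row: "(\<Sum>i<p. sqn (?\<gamma> i)) \<le> c\<^sup>2 * (\<Sum>j<p. sqn (\<xi> (p + j)))"
 unfolding rowsq_def[symmetric] c_def by (rule rowsq_le_norm[OF L xo \<xi>])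
 have "0 \<le> c * (\<Sum>i<p. sqn (\<xi> i)) + c * (\<Sum>i<p. sqn (\<xi> (p + i))) + 2 * Re (\<Sum>i<p. ip (\<xi> i) (?\<gamma> i))"
 proof (cases "c = 0")
 case True
 then have "(\<Sum>i<p. sqn (?\<gamma> i)) = 0" using row sum_nonneg[of "{..<p}" "%i. sqn (?\<gamma> i)"] by simp
 then have "?\<gamma> i = 0" if "i < p" for i using that by (subst (asm) sum_nonneg_eq_0_iff) auto
 then show ?thesis using True by simp
 next
 case False
 then have c0: "0 < c" using c by simp
 define d where "d = sqrt c"
 have d: "d * d = c" "0 < d" using c0 by (simp_all add: d_def)
 have "0 \<le> (\<Sum>i<p. sqn (smult (complex_of_real d) (\<xi> i) + smult (complex_of_real (1 / d)) (?\<gamma> i)))"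
 by (intro sum_nonneg) simp
 also have "... = (\<Sum>i<p. c * sqn (\<xi> i) + sqn (?\<gamma> i) / c + 2 * Re (ip (\<xi> i) (?\<gamma> i)))"
 proof (intro sum.cong refl)
 fix i
 have "Re (ip (?\<gamma> i) (\<xi> i)) = Re (ip (\<xi> i) (?\<gamma> i))" by (subst ip_commute) simp
 then show "sqn (smult (complex_of_real d) (\<xi> i) + smult (complex_of_real (1 / d)) (?\<gamma> i))
 = c * sqn (\<xi> i) + sqn (?\<gamma> i) / c + 2 * Re (ip (\<xi> i) (?\<gamma> i))"
 using d(2) by (simp add: sqn_def d(1)[symmetric] field_simps flip: of_real_mult of_real_divide)
 qed
 also have "... = c * (\<Sum>i<p. sqn (\<xi> i)) + (\<Sum>i<p. sqn (?\<gamma> i)) / c + 2 * Re (\<Sum>i<p. ip (\<xi> i) (?\<gamma> i))"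
 by (simp add: sum.distrib sum_distrib_left sum_divide_distrib)
 also have "(\<Sum>i<p. sqn (?\<gamma> i)) / c \<le> c * (\<Sum>j<p. sqn (\<xi> (p + j)))"
 using row c0 by (simp add: field_simps power2_eq_square)
 finally show ?thesis by simp
 qed
 then show "0 \<le> (\<Sum>i<p + p. \<Sum>j<p + p. ip (\<xi> i) (paulsen n p c x i j \<rhd> \<xi> j))"
 using \<xi> Ls by (subst paulsen_form) (auto simp: complex_nonneg_iff)
 qed
 then have pos: "0 \<le> c * (\<Sum>i<p. sqn (\<xi> i)) + c * (\<Sum>i<p. sqn (\<xi> (p + i))) + 2 * Re (\<Sum>i<p. ip (\<xi> i) (\<Sum>j<p. x i j \<rhd> \<xi> (p + j)))"
 if "!!i. \<xi> i : spc n" for \<xi> :: "nat => complex poly"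
 proof -
 have "0 \<le> (\<Sum>i<p + p. \<Sum>j<p + p. ip (\<xi> i) (paulsen n p c x i j \<rhd> \<xi> j))"
 using \<open>bpos {..<p + p} (paulsen n p c x)\<close> unfolding bpos_def by blast
 then show ?thesis using that by (subst (asm) paulsen_form) (auto simp: complex_nonneg_iff)
 qed
 have "sqrt (rowsq p x \<eta>) \<le> c" if \<eta>: "!!j. \<eta> j : spc n" "(\<Sum>j<p. sqn (\<eta> j)) \<le> 1" for \<eta>
 proof -
 let ?\<gamma> = "%i. \<Sum>j<p. x i j \<rhd> \<eta> j"
 define R where "R = rowsq p x \<eta>"
 have "?\<gamma> i : spc n" if "i < p" for i using that xo by (intro vsub_sum[OF vsub_spc]) auto
 then have t: "0 \<le> c * (t * t * R) + c * (\<Sum>i<p. sqn (\<eta> i)) - 2 * t * R" for t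
 proof -
 define \<kappa> where "\<kappa> = complex_of_real (- t)"
 have \<kappa>: "(cmod \<kappa>)\<^sup>2 = t * t" "cnj \<kappa> = \<kappa>" by (simp_all add: \<kappa>_def power2_eq_square)
 let ?\<xi> = "%i. if i < p then smult \<kappa> (?\<gamma> i) else \<eta> (i - p)"
 have main: "0 \<le> c * (\<Sum>i<p. sqn (?\<xi> i)) + c * (\<Sum>i<p. sqn (?\<xi> (p + i))) + 2 * Re (\<Sum>i<p. ip (?\<xi> i) (\<Sum>j<p. x i j \<rhd> ?\<xi> (p + j)))"
 using \<eta>(1) \<open>!!i. i < p ==> ?\<gamma> i : spc n\<close> by (intro pos) auto
 have e1: "(\<Sum>i<p. sqn (?\<xi> i)) = t * t * R"
 by (simp add: R_def rowsq_def sum_distrib_left \<kappa>(1))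
 have e2: "(\<Sum>i<p. sqn (?\<xi> (p + i))) = (\<Sum>i<p. sqn (\<eta> i))" by simp
 have "(\<Sum>i<p. ip (?\<xi> i) (\<Sum>j<p. x i j \<rhd> ?\<xi> (p + j))) = \<kappa> * complex_of_real R"
 by (simp add: R_def rowsq_def ip_self sum_distrib_left \<kappa>(2))
 then have e3: "(\<Sum>i<p. ip (?\<xi> i) (\<Sum>j<p. x i j \<rhd> ?\<xi> (p + j))) = complex_of_real (- t * R)"
 by (simp only: \<kappa>_def of_real_mult)
 show ?thesis using main unfolding e1 e2 e3 by simp
 qed
 have "R \<le> c\<^sup>2"
 proof (cases "c = 0")
 case True
 then show ?thesis using t[of 1] by simp
 next
 case False
 then have c0: "0 < c" using c by simp
 \<comment> \<open>The quadratic polynomial in \<open>t\<close> has its minimum at \<open>1 / c\<close>.\<close>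
 have "R / c \<le> c * (\<Sum>i<p. sqn (\<eta> i))" using t[of "1 / c"] c0 by (simp add: field_simps)
 also have "... \<le> c * 1" using \<eta>(2) c by (rule mult_left_mono)
 finally show ?thesis using c0 by (simp add: field_simps power2_eq_square)
 qed
 then show ?thesis unfolding R_def using c by (rule real_le_lsqrt[rotated])
 qed
 then show "Sup (norm_set p x (spc n)) \<le> Sup (norm_set p x L)"
 unfolding c_def[symmetric] using zero[of "spc n"] by (intro cSup_least) (auto simp: norm_set_def)
qed

lemma vnorm_vemb: "v : carrier_vec n ==> (vnorm v)\<^sup>2 = sqn (vemb v)"
 using sqn_nonneg[of "vemb v"] by (simp add: vnorm_def cip_vemb[of v n v] sqn_def)

lemma finsum_vec_vemb:
 assumes "finite J" "!!j. j : J ==> f j : carrier_vec n"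
 shows "finsum_vec TYPE(complex) n f J : carrier_vec n & vemb (finsum_vec TYPE(complex) n f J) = (\<Sum>j\<in>J. vemb (f j))"
 using assms
proof (induction J rule: finite_induct)
 case empty
 then show ?case by (simp add: finsum_vec_empty)
next
 case (insert a J)
 then have "finsum_vec TYPE(complex) n f (insert a J) = f a + finsum_vec TYPE(complex) n f J"
 by (intro finsum_vec_insert) auto
 then show ?case using insert by (simp add: vemb_add[of _ n])
qed

lemma block_norm_on_eq:
 assumes x: "!!i j. i < p ==> j < p ==> x i j : carrier_mat n n" and L: "L \<subseteq> spc n" "0 : L"
 shows "block_norm_on n {v : carrier_vec n. vemb v : L} p x = Sup (norm_set p (%i j. emb (x i j)) L)"
proof -
 have N: "(\<Sum>i<p. (vnorm (finsum_vec TYPE(complex) n (%j. x i j *\<^sub>v \<xi> j) {..<p}))\<^sup>2) = rowsq p (%i j. emb (x i j)) (%j. vemb (\<xi> j))"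
 if \<xi>: "!!j. j < p ==> \<xi> j : carrier_vec n" for \<xi>
 unfolding rowsq_def
 proof (intro sum.cong refl)
 fix i assume i: "i : {..<p}"
 have f: "finsum_vec TYPE(complex) n (%j. x i j *\<^sub>v \<xi> j) {..<p} : carrier_vec n &
 vemb (finsum_vec TYPE(complex) n (%j. x i j *\<^sub>v \<xi> j) {..<p}) = (\<Sum>j<p. vemb (x i j *\<^sub>v \<xi> j))"
 using x \<xi> i by (intro finsum_vec_vemb) (auto intro: mult_mat_vec_carrier)
 have "(\<Sum>j<p. vemb (x i j *\<^sub>v \<xi> j)) = (\<Sum>j<p. emb (x i j) \<rhd> vemb (\<xi> j))"
 using x \<xi> i by (intro sum.cong refl emb_mult_vec[symmetric]) auto
 then show "(vnorm (finsum_vec TYPE(complex) n (%j. x i j *\<^sub>v \<xi> j) {..<p}))\<^sup>2 = sqn (\<Sum>j<p. emb (x i j) \<rhd> vemb (\<xi> j))"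
 using f vnorm_vemb by metis
 qed
 have "{sqrt (\<Sum>i<p. (vnorm (finsum_vec TYPE(complex) n (%j. x i j *\<^sub>v \<xi> j) {..<p}))\<^sup>2) | \<xi>.
 (\<forall>j<p. \<xi> j : {v : carrier_vec n. vemb v : L}) & (\<Sum>j<p. (vnorm (\<xi> j))\<^sup>2) \<le> 1}
 = norm_set p (%i j. emb (x i j)) L" (is "?A = ?B")
 proof
 show "?A \<subseteq> ?B"
 proof
 fix r assume "r : ?A"
 then obtain \<xi> where \<xi>: "r = sqrt (\<Sum>i<p. (vnorm (finsum_vec TYPE(complex) n (%j. x i j *\<^sub>v \<xi> j) {..<p}))\<^sup>2)"
 "!!j. j < p ==> \<xi> j : carrier_vec n" "!!j. j < p ==> vemb (\<xi> j) : L" "(\<Sum>j<p. (vnorm (\<xi> j))\<^sup>2) \<le> 1" by auto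
 let ?\<eta> = "%j. if j < p then vemb (\<xi> j) else 0"
 have "(\<Sum>i<p. (vnorm (finsum_vec TYPE(complex) n (%j. x i j *\<^sub>v \<xi> j) {..<p}))\<^sup>2)
 = rowsq p (%i j. emb (x i j)) (%j. vemb (\<xi> j))"
 by (rule N) (rule \<xi>(2))
 then have "r = sqrt (rowsq p (%i j. emb (x i j)) ?\<eta>)"
 unfolding \<xi>(1) by (simp add: rowsq_def)
 moreover have "(\<Sum>j<p. sqn (?\<eta> j)) \<le> 1" using \<xi>(4) \<xi>(2) by (simp add: vnorm_vemb[of _ n])
 ultimately show "r : ?B" unfolding norm_set_def using \<xi>(3) L(2)
 by (intro CollectI exI[of _ ?\<eta>]) auto
 qed
 show "?B \<subseteq> ?A"
 proof
 fix r assume "r : ?B"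
 then obtain \<eta> where \<eta>: "r = sqrt (rowsq p (%i j. emb (x i j)) \<eta>)" "!!j. \<eta> j : L" "(\<Sum>j<p. sqn (\<eta> j)) \<le> 1"
 by (auto simp: norm_set_def)
 let ?\<xi> = "%j. unvemb n (\<eta> j)"
 have v: "vemb (?\<xi> j) = \<eta> j" for j using \<eta>(2) L(1) by (intro vemb_unvemb) auto
 have "r = sqrt (\<Sum>i<p. (vnorm (finsum_vec TYPE(complex) n (%j. x i j *\<^sub>v ?\<xi> j) {..<p}))\<^sup>2)"
 unfolding \<eta>(1) by (subst N) (simp_all add: v)
 moreover have "(\<Sum>j<p. (vnorm (?\<xi> j))\<^sup>2) \<le> 1" using \<eta>(3) by (simp add: vnorm_vemb[of _ n] v)
 ultimately show "r : ?A" using \<eta>(2) by (intro CollectI exI[of _ ?\<xi>]) (simp add: v)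
 qed
 qed
 then show ?thesis unfolding block_norm_on_def by simp
qed

lemma irreducible_emb:
 assumes S: "operator_system n S" and irr: "acts_irreducibly n S"
 shows "irreducible n (emb ` S)"
 unfolding irreducible_def
proof (intro allI impI, elim conjE)
 fix L
 assume L: "vsub n L" and inv: "\<forall>s\<in>emb ` S. \<forall>\<xi>\<in>L. s \<rhd> \<xi> : L"
 and order: "\<forall>(p :: nat) s. (\<forall>i<p. \<forall>j<p. s i j : emb ` S & ad (s i j) = s j i) &
 (\<forall>\<xi>. (\<forall>i. \<xi> i : L) --> 0 \<le> (\<Sum>i<p. \<Sum>j<p. ip (\<xi> i) (s i j \<rhd> \<xi> j))) --> bpos {..<p} s"
 have Ls: "L \<subseteq> spc n" using L by (simp add: vsub_def)
 have Sc: "S \<subseteq> carrier_mat n n" and Sad: "!!s. s : S ==> mat_adjoint s : S"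
 using S by (auto simp: operator_system_def mat_subspace_def)
 let ?L = "{v : carrier_vec n. vemb v : L}"
 have act: "s *\<^sub>v \<xi> : ?L" if "s : S" "\<xi> : ?L" for s \<xi>
 proof -
 have s: "s : carrier_mat n n" using that(1) Sc by blast
 have "emb s \<rhd> vemb \<xi> : L" using inv that by blast
 then show ?thesis using s that(2) by (simp add: emb_mult_vec[OF s])
 qed
 have red: "reducing n S ?L"
 unfolding reducing_def using vsubD(2,3,4)[OF L] act Sad
 by (auto simp: vemb_add[of _ n] vemb_smult[of _ n])
 have full: "{v : carrier_vec n. vemb v : spc n} = carrier_vec n" by (auto intro: vemb_spc)
 have "block_norm_on n ?L p x = block_norm_on n (carrier_vec n) p x" if x: "\<forall>i<p. \<forall>j<p. x i j : S" for p x
 proof -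
 have xc: "x i j : carrier_mat n n" if "i < p" "j < p" for i j using x Sc that by blast
 have "block_norm_on n ?L p x = Sup (norm_set p (%i j. emb (x i j)) L)"
 by (rule block_norm_on_eq[OF xc Ls vsubD(2)[OF L]])
 also have "... = Sup (norm_set p (%i j. emb (x i j)) (spc n))"
 proof (rule norm_set_Sup_eq[OF opsys_emb[OF S] L])
 fix p :: nat and s
 assume "!!i j. i < p ==> j < p ==> s i j : emb ` S & ad (s i j) = s j i"
 "!!\<xi>. (!!i. \<xi> i : L) ==> 0 \<le> (\<Sum>i<p. \<Sum>j<p. ip (\<xi> i) (s i j \<rhd> \<xi> j))"
 then show "bpos {..<p} s" by (intro order[THEN spec, THEN spec, THEN mp] conjI allI impI) simp_all
 next
 show "emb (x i j) : emb ` S" if "i < p" "j < p" for i j using x that by simp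
 qed
 also have "... = block_norm_on n {v : carrier_vec n. vemb v : spc n} p x"
 using xc by (intro block_norm_on_eq[symmetric]) auto
 finally show ?thesis unfolding full .
 qed
 then have "?L = {0\<^sub>v n} \<or> ?L = carrier_vec n" using irr red unfolding acts_irreducibly_def by blast
 then show "L = {0} \<or> L = spc n"
 proof
 assume l: "?L = {0\<^sub>v n}"
 have "\<xi> = 0" if "\<xi> : L" for \<xi>
 proof -
 have v: "vemb (unvemb n \<xi>) = \<xi>" using that Ls by (intro vemb_unvemb) auto
 then have "unvemb n \<xi> : ?L" using that by simp
 then have "unvemb n \<xi> = 0\<^sub>v n" using l by simp
 then show ?thesis using v by (metis vemb_zero)
 qed
 then show ?thesis using vsubD(2)[OF L] by blast
 next
 assume l: "?L = carrier_vec n"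
 have "\<xi> : L" if "\<xi> : spc n" for \<xi>
 proof -
 have "unvemb n \<xi> : ?L" unfolding l by simp
 then show ?thesis using vemb_unvemb[OF that] by simp
 qed
 then show ?thesis using Ls by blast
 qed
qed

section \<open>TROs on Hilbert spaces\<close>

text \<open>A minimising sequence of \<open>\<langle>x, x\<rangle> - 2 f x\<close> is Cauchy by the parallelogram identity.\<close>

lemma riesz_representation:
 fixes f :: "'a :: {real_inner, complete_space} => real"
 assumes "bounded_linear f"
 shows "\<exists>y. \<forall>x. f x = inner y x"
proof -
 interpret f: bounded_linear f by (fact assms)
 obtain K where K: "!!x. \<bar>f x\<bar> \<le> norm x * K" using f.bounded by auto
 define Q where "Q x = inner x x - 2 * f x" for x
 have low: "- K\<^sup>2 \<le> Q x" for x
 proof -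
 have "0 \<le> (norm x - K)\<^sup>2" by simp
 also have "... = inner x x - 2 * (norm x * K) + K\<^sup>2" by (simp add: power2_diff power2_norm_eq_inner)
 also have "... \<le> Q x + K\<^sup>2" using K[of x] by (simp add: Q_def abs_le_iff)
 finally show ?thesis by simp
 qed
 define d where "d = (INF x. Q x)"
 have bdd: "bdd_below (range Q)" using low by (intro bdd_belowI) auto
 have dQ: "d \<le> Q x" for x unfolding d_def by (rule cINF_lower[OF bdd]) simp
 have ex: "\<exists>x. Q x < d + e" if "0 < e" for e
 proof (rule ccontr)
 assume "\<not> (\<exists>x. Q x < d + e)"
 then have "d + e \<le> d" unfolding d_def by (intro cINF_greatest) (auto simp: not_less d_def)
 then show False using that by simp
 qed
 have "\<forall>n :: nat. \<exists>x. Q x < d + 1 / real (Suc n)" by (intro allI ex) simp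
 from choice[OF this] obtain X where X: "!!n :: nat. Q (X n) < d + 1 / real (Suc n)" by blast
 have par: "(norm (x - y))\<^sup>2 \<le> 2 * Q x + 2 * Q y - 4 * d" for x y
 proof -
 have "(norm (x - y))\<^sup>2 = 2 * Q x + 2 * Q y - 4 * Q ((1/2) *\<^sub>R (x + y))"
 by (simp add: Q_def power2_norm_eq_inner f.scaleR f.add inner_diff_left inner_diff_right
 inner_add_left inner_add_right inner_commute algebra_simps)
 then show ?thesis using dQ[of "(1/2) *\<^sub>R (x + y)"] by simp
 qed
 have "Cauchy X"
 proof (rule metric_CauchyI)
 fix e :: real assume e: "0 < e"
 obtain M :: nat where M: "4 / e\<^sup>2 < real M" using reals_Archimedean2 by blast
 have "dist (X i) (X j) < e" if "i \<ge> M" "j \<ge> M" for i j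
 proof -
 have small: "1 / real (Suc k) < e\<^sup>2 / 4" if "k \<ge> M" for k
 proof -
 have "4 / e\<^sup>2 < real (Suc k)" using M that by (simp add: less_trans)
 then show ?thesis using e by (simp add: field_simps)
 qed
 have "(norm (X i - X j))\<^sup>2 < e\<^sup>2"
 using par[of "X i" "X j"] X[of i] X[of j] small[OF that(1)] small[OF that(2)] by linarith
 then show ?thesis using e by (simp add: dist_norm power_less_imp_less_base)
 qed
 then show "\<exists>M. \<forall>i\<ge>M. \<forall>j\<ge>M. dist (X i) (X j) < e" by blast
 qed
 then obtain y where y: "X \<longlonglongrightarrow> y" using Cauchy_convergent convergent_def by blast
 have "(%n. Q (X n)) \<longlonglongrightarrow> Q y" unfolding Q_def by (intro tendsto_intros f.tendsto y)
 moreover have "(%n. Q (X n)) \<longlonglongrightarrow> d"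
 proof (rule tendsto_sandwich[where f = "%_. d" and h = "%n. d + 1 / real (Suc n)"])
 show "\<forall>\<^sub>F n in sequentially. d \<le> Q (X n)" using dQ by simp
 show "\<forall>\<^sub>F n in sequentially. Q (X n) \<le> d + 1 / real (Suc n)"
 by (intro always_eventually allI less_imp_le X)
 show "(%_. d) \<longlonglongrightarrow> d" by (rule tendsto_const)
 show "(%n. d + 1 / real (Suc n)) \<longlonglongrightarrow> d"
 using tendsto_add[OF tendsto_const LIMSEQ_inverse_real_of_nat, of d] by (simp add: inverse_eq_divide)
 qed
 ultimately have Qy: "Q y = d" by (rule LIMSEQ_unique)
 have "f x = inner y x" for x
 proof (rule ccontr)
 assume ne: "f x ~= inner y x"
 define b where "b = inner y x - f x"
 define a where "a = inner x x"
 have q: "0 \<le> 2 * t * b + t * t * a" for t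
 proof -
 have "Q (y + t *\<^sub>R x) = Q y + 2 * t * b + t * t * a"
 by (simp add: Q_def a_def b_def f.add f.scaleR inner_add_left inner_add_right inner_commute algebra_simps)
 then show ?thesis using dQ[of "y + t *\<^sub>R x"] Qy by simp
 qed
 have a0: "0 \<le> a" by (simp add: a_def)
 \<comment> \<open>The denominator \<open>a + 1\<close> instead of \<open>a\<close> covers the case \<open>a = 0\<close>.\<close>
 define t where "t = - b / (a + 1)"
 have tb: "t * (a + 1) = - b" using a0 by (simp add: t_def)
 have "0 \<le> (2 * t * b + t * t * a) * ((a + 1) * (a + 1))"
 by (rule mult_nonneg_nonneg[OF q]) (use a0 in simp)
 also have "... = 2 * (t * (a + 1)) * b * (a + 1) + (t * (a + 1)) * (t * (a + 1)) * a" by (simp add: algebra_simps)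
 also have "... = - (b * b * (a + 2))" unfolding tb by (simp add: algebra_simps)
 finally have "b * b * (a + 2) \<le> 0" by simp
 moreover have "b ~= 0" using ne by (simp add: b_def)
 then have "0 < b * b" by (metis not_real_square_gt_zero)
 then have "0 < b * b * (a + 2)" by (rule mult_pos_pos) (use a0 in simp)
 ultimately show False by simp
 qed
 then show ?thesis by blast
qed

lemma cinner_eqI: "(!!z. cinner x z = cinner y z) ==> x = (y :: 'a :: chilbert_space)"
proof -
 assume "!!z. cinner x z = cinner y z"
 then have "inner x z = inner y z" for z by (simp add: inner_eq_Re_cinner)
 then have "inner (x - y) (x - y) = 0" by (simp add: inner_diff_left)
 then show ?thesis by simp
qed

lemma cinner_scaleC_left: "cinner (scaleC a x) y = cnj a * cinner x (y :: 'a :: chilbert_space)"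
 by (metis cinner_commute cinner_scaleC_right complex_cnj_mult)

lemma cadjoint_exists:
 fixes x :: "'a :: chilbert_space \<Rightarrow>\<^sub>L 'b :: chilbert_space"
 assumes x: "x : bounded_ops"
 shows "\<exists>y. \<forall>\<xi> \<eta>. cinner (blinfun_apply y \<eta>) \<xi> = cinner \<eta> (blinfun_apply x \<xi>)"
proof -
 have "\<exists>y. \<forall>\<xi>. inner \<eta> (blinfun_apply x \<xi>) = inner y \<xi>" for \<eta>
 by (rule riesz_representation)
 (intro bounded_linear_compose[OF bounded_linear_inner_right] blinfun.bounded_linear_right)
 then obtain Y where Y: "!!\<eta> \<xi>. inner (Y \<eta>) \<xi> = inner \<eta> (blinfun_apply x \<xi>)" by metis
 have eqI: "u = v" if "!!\<xi>. inner u \<xi> = inner v \<xi>" for u v :: 'a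
 proof -
 have "inner (u - v) (u - v) = 0" using that by (simp add: inner_diff_left)
 then show ?thesis by simp
 qed
 have "bounded_linear Y"
 proof (rule bounded_linear_intro[where K = "norm x"])
 show "Y (u + v) = Y u + Y v" for u v by (rule eqI) (simp add: Y inner_add_left)
 show "Y (r *\<^sub>R u) = r *\<^sub>R Y u" for r u by (rule eqI) (simp add: Y)
 show "norm (Y u) \<le> norm u * norm x" for u
 proof (cases "Y u = 0")
 case False
 have "norm (Y u) * norm (Y u) = inner u (blinfun_apply x (Y u))"
 using Y[of u "Y u"] by (simp add: dot_square_norm power2_eq_square)
 also have "... \<le> norm u * norm (blinfun_apply x (Y u))" by (rule norm_cauchy_schwarz)
 also have "... \<le> norm u * (norm x * norm (Y u))" by (intro mult_left_mono norm_blinfun) simp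
 finally show ?thesis using False by simp
 qed simp
 qed
 then have YA: "blinfun_apply (Blinfun Y) = Y" by (rule bounded_linear_Blinfun_apply)
 have "cinner (Y \<eta>) \<xi> = cinner \<eta> (blinfun_apply x \<xi>)" for \<xi> \<eta>
 proof (rule complex_eqI)
 show "Re (cinner (Y \<eta>) \<xi>) = Re (cinner \<eta> (blinfun_apply x \<xi>))"
 using Y[of \<eta> \<xi>] by (simp add: inner_eq_Re_cinner)
 have "Re (cinner (Y \<eta>) (scaleC \<i> \<xi>)) = Re (cinner \<eta> (blinfun_apply x (scaleC \<i> \<xi>)))"
 using Y[of \<eta> "scaleC \<i> \<xi>"] by (simp add: inner_eq_Re_cinner)
 then show "Im (cinner (Y \<eta>) \<xi>) = Im (cinner \<eta> (blinfun_apply x \<xi>))"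
 using x by (simp add: bounded_ops_def cinner_scaleC_right)
 qed
 then show ?thesis using YA by metis
qed

lemma cadjoint:
 assumes x: "x : bounded_ops"
 shows "cinner (blinfun_apply (cadjoint x) \<eta>) \<xi> = cinner \<eta> (blinfun_apply x \<xi>)"
proof -
 obtain y where y: "\<forall>\<xi> \<eta>. cinner (blinfun_apply y \<eta>) \<xi> = cinner \<eta> (blinfun_apply x \<xi>)"
 using cadjoint_exists[OF x] by blast
 have "cadjoint x = y"
 unfolding cadjoint_def
 proof (rule the_equality)
 show "\<forall>\<xi> \<eta>. cinner (blinfun_apply y \<eta>) \<xi> = cinner \<eta> (blinfun_apply x \<xi>)" by (fact y)
 fix z assume z: "\<forall>\<xi> \<eta>. cinner (blinfun_apply z \<eta>) \<xi> = cinner \<eta> (blinfun_apply x \<xi>)"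
 show "z = y" by (rule blinfun_eqI, rule cinner_eqI) (simp add: y z)
 qed
 then show ?thesis using y by simp
qed

lemma cadjoint_bounded:
 assumes x: "x : bounded_ops"
 shows "cadjoint x : bounded_ops"
 unfolding bounded_ops_def
proof (intro CollectI allI)
 fix a \<eta>
 show "blinfun_apply (cadjoint x) (scaleC a \<eta>) = scaleC a (blinfun_apply (cadjoint x) \<eta>)"
 by (rule cinner_eqI) (simp add: cadjoint[OF x] cinner_scaleC_left)
qed

lemma cadjoint_unique:
 assumes "x : bounded_ops" "!!\<xi> \<eta>. cinner (blinfun_apply y \<eta>) \<xi> = cinner \<eta> (blinfun_apply x \<xi>)"
 shows "cadjoint x = y"
 by (rule blinfun_eqI, rule cinner_eqI) (simp add: cadjoint[OF assms(1)] assms(2))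

lemma cadjoint_right: "x : bounded_ops ==> cinner \<xi> (blinfun_apply (cadjoint x) \<eta>) = cinner (blinfun_apply x \<xi>) \<eta>"
 by (metis cadjoint cinner_commute)

lemma cadjoint_cadjoint: "x : bounded_ops ==> cadjoint (cadjoint x) = x"
 by (rule cadjoint_unique) (auto simp: cadjoint_bounded cadjoint_right)

lemma bounded_ops_compose: "x : bounded_ops ==> y : bounded_ops ==> x o\<^sub>L y : bounded_ops"
 by (simp add: bounded_ops_def)

lemma cadjoint_compose:
 "x : bounded_ops ==> y : bounded_ops ==> cadjoint (x o\<^sub>L y) = cadjoint y o\<^sub>L cadjoint x"
 by (rule cadjoint_unique) (auto simp: bounded_ops_compose cadjoint)

lemma scaleC_commute: "scaleC a (scaleC b x) = scaleC b (scaleC a (x :: 'a :: chilbert_space))"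
 by (simp add: scaleC_scaleC mult.commute)

lemma cadjoint_scaleC: "x : bounded_ops ==> cadjoint (scaleC_blinfun a x) = scaleC_blinfun (cnj a) (cadjoint x)"
 by (rule cadjoint_unique)
 (auto simp: bounded_ops_def scaleC_blinfun.rep_eq scaleC_commute cinner_scaleC_left cinner_scaleC_right cadjoint[unfolded bounded_ops_def])

lemma closed_bounded_ops: "closed bounded_ops"
proof -
 have eq: "bounded_ops = (\<Inter>a. \<Inter>\<xi>. {x :: 'a \<Rightarrow>\<^sub>L 'b. blinfun_apply x (scaleC a \<xi>) = scaleC a (blinfun_apply x \<xi>)})"
 by (auto simp: bounded_ops_def)
 have cl: "closed {x :: 'a \<Rightarrow>\<^sub>L 'b. blinfun_apply x (scaleC a \<xi>) = scaleC a (blinfun_apply x \<xi>)}" for a \<xi>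
 by (intro closed_Collect_eq continuous_intros bounded_linear.continuous_on[OF bounded_linear_scaleC])
 show ?thesis unfolding eq by (intro closed_INT ballI cl)
qed

lemma bounded_linear_scaleC_blinfun: "bounded_linear (scaleC_blinfun a :: ('a::real_normed_vector \<Rightarrow>\<^sub>L 'b::chilbert_space) => _)"
proof (rule bounded_linear_intro[where K = "cmod a"])
 fix x y :: "'a \<Rightarrow>\<^sub>L 'b" and r :: real
 show "scaleC_blinfun a (x + y) = scaleC_blinfun a x + scaleC_blinfun a y"
 by (rule blinfun_eqI) (simp add: scaleC_blinfun.rep_eq blinfun.add_left scaleC_add_right)
 show "scaleC_blinfun a (r *\<^sub>R x) = r *\<^sub>R scaleC_blinfun a x"
 by (rule blinfun_eqI) (simp add: scaleC_blinfun.rep_eq blinfun.scaleR_left linear_cmul[OF bounded_linear.linear[OF bounded_linear_scaleC]])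
 show "norm (scaleC_blinfun a x) \<le> norm x * cmod a"
 proof (rule norm_blinfun_bound)
 fix \<xi>
 have "norm (blinfun_apply (scaleC_blinfun a x) \<xi>) = cmod a * norm (blinfun_apply x \<xi>)"
 by (simp add: scaleC_blinfun.rep_eq norm_scaleC)
 also have "... \<le> cmod a * (norm x * norm \<xi>)" by (intro mult_left_mono norm_blinfun) simp
 finally show "norm (blinfun_apply (scaleC_blinfun a x) \<xi>) \<le> norm x * cmod a * norm \<xi>" by (simp add: mult_ac)
 qed simp
qed

lemma op_subspace_closure:
 assumes "op_subspace V"
 shows "op_subspace (closure V)"
proof -
 have V: "V \<subseteq> bounded_ops" "0 : V" "!!x y. x : V ==> y : V ==> x + y : V" "!!a x. x : V ==> scaleC_blinfun a x : V"
 using assms by (auto simp: op_subspace_def)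
 show ?thesis
 unfolding op_subspace_def
 proof (intro conjI ballI allI)
 show "closure V \<subseteq> bounded_ops" using V(1) closed_bounded_ops by (rule closure_minimal)
 show "0 : closure V" using V(2) closure_subset by blast
 fix x assume "x : closure V"
 then obtain f where f: "!!n. f n : V" "f \<longlonglongrightarrow> x" unfolding closure_sequential by blast
 show "scaleC_blinfun a x : closure V" for a
 unfolding closure_sequential using V(4) f
 by (intro exI[of _ "%n. scaleC_blinfun a (f n)"]) (auto intro: bounded_linear.tendsto[OF bounded_linear_scaleC_blinfun])
 fix y assume "y : closure V"
 then obtain g where g: "!!n. g n : V" "g \<longlonglongrightarrow> y" unfolding closure_sequential by blast
 show "x + y : closure V"
 unfolding closure_sequential using V(3) f g
 by (intro exI[of _ "%n. f n + g n"]) (auto intro: tendsto_add)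
 qed
qed

lemma closed_span_subset:
 assumes "op_subspace V" "X \<subseteq> V"
 shows "closed_span X \<subseteq> closure V"
 unfolding closed_span_def
 by (rule hull_minimal) (use assms closure_subset op_subspace_closure in auto)

text \<open>The linear span of the products \<open>x\<^sup>* y\<close>, written with lists because scalars can be moved into the factors.\<close>

definition products :: "('h::chilbert_space \<Rightarrow>\<^sub>L 'k::chilbert_space) set => ('h \<Rightarrow>\<^sub>L 'h) set" where
 "products M = {sum_list (map (%(x, y). cadjoint x o\<^sub>L y) L) | L. set L \<subseteq> M \<times> M}"

lemma productsI: "x : M ==> y : M ==> cadjoint x o\<^sub>L y : products M"
 unfolding products_def by (intro CollectI exI[of _ "[(x, y)]"]) simp

lemma products_zero: "0 : products M"
 unfolding products_def by (intro CollectI exI[of _ "[]"]) simp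

lemma products_add: "X : products M ==> Y : products M ==> X + Y : products M"
proof -
 assume "X : products M" "Y : products M"
 then obtain L L' where L: "set L \<subseteq> M \<times> M" "X = sum_list (map (%(x, y). cadjoint x o\<^sub>L y) L)"
 "set L' \<subseteq> M \<times> M" "Y = sum_list (map (%(x, y). cadjoint x o\<^sub>L y) L')" unfolding products_def by blast
 then show ?thesis unfolding products_def by (intro CollectI exI[of _ "L @ L'"]) simp
qed

lemma products_induct [consumes 1, case_names zero add]:
 assumes "X : products M" "P 0" "!!x y Y. x : M ==> y : M ==> P Y ==> P ((cadjoint x o\<^sub>L y) + Y)"
 shows "P X"
proof -
 obtain L where L: "set L \<subseteq> M \<times> M" "X = sum_list (map (%(x, y). cadjoint x o\<^sub>L y) L)"
 using assms(1) unfolding products_def by blast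
 have "P (sum_list (map (%(x, y). cadjoint x o\<^sub>L y) L))"
 using L(1)
 proof (induction L)
 case Nil
 then show ?case by (simp add: assms(2))
 next
 case (Cons z L)
 obtain x y where z: "z = (x, y)" by (cases z) auto
 show ?case using Cons z assms(3)[of x y "sum_list (map (%(x, y). cadjoint x o\<^sub>L y) L)"] by simp
 qed
 then show ?thesis using L(2) by simp
qed

lemma scaleC_blinfun_add: "scaleC_blinfun a (x + y) = scaleC_blinfun a x + scaleC_blinfun a (y :: 'a::chilbert_space \<Rightarrow>\<^sub>L 'b::chilbert_space)"
 by (rule linear_add[OF bounded_linear.linear[OF bounded_linear_scaleC_blinfun]])

lemma scaleC_blinfun_0 [simp]: "scaleC_blinfun a (0 :: 'a::chilbert_space \<Rightarrow>\<^sub>L 'b::chilbert_space) = 0"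
 by (rule linear_0[OF bounded_linear.linear[OF bounded_linear_scaleC_blinfun]])

lemma scaleC_blinfun_compose: "scaleC_blinfun a (x o\<^sub>L y) = scaleC_blinfun a x o\<^sub>L y"
 by (rule blinfun_eqI) (simp add: scaleC_blinfun.rep_eq)

lemma products_scale:
 assumes M: "op_subspace M" and X: "X : products M"
 shows "scaleC_blinfun a X : products M"
 using X
proof (induction rule: products_induct)
 case (add x y Y)
 have x: "x : bounded_ops" and ax: "scaleC_blinfun (cnj a) x : M" using M add(1) by (auto simp: op_subspace_def)
 have "scaleC_blinfun a (cadjoint x o\<^sub>L y) = cadjoint (scaleC_blinfun (cnj a) x) o\<^sub>L y"
 by (simp add: cadjoint_scaleC[OF x] scaleC_blinfun_compose)
 then show ?case using productsI[OF ax add(2)] add(3) by (simp add: scaleC_blinfun_add products_add)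
qed (simp add: products_zero)

lemma products_subspace:
 assumes M: "op_subspace M"
 shows "op_subspace (products M)"
 unfolding op_subspace_def
proof (intro conjI ballI allI subsetI)
 have Mb: "x : bounded_ops" if "x : M" for x using M that by (auto simp: op_subspace_def)
 show "X : bounded_ops" if "X : products M" for X
 using that
 proof (induction rule: products_induct)
 case (add x y Y)
 then have "cadjoint x o\<^sub>L y : bounded_ops" by (intro bounded_ops_compose cadjoint_bounded Mb)
 then show ?case using add(3) by (simp add: bounded_ops_def blinfun.add_left scaleC_add_right)
 qed (simp add: bounded_ops_def linear_0[OF bounded_linear.linear[OF bounded_linear_scaleC]])
qed (auto intro: products_zero products_add products_scale M)

lemma products_mult:
 assumes tri: "!!x y z. x : M ==> y : M ==> z : M ==> x o\<^sub>L cadjoint y o\<^sub>L z : M"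
 and X: "X : products M" and Y: "Y : products M"
 shows "X o\<^sub>L Y : products M"
 using X
proof (induction rule: products_induct)
 case (add x y X)
 have "cadjoint x o\<^sub>L y o\<^sub>L Y : products M"
 using Y
 proof (induction rule: products_induct)
 case (add z w Y)
 have "cadjoint x o\<^sub>L y o\<^sub>L (cadjoint z o\<^sub>L w) = cadjoint x o\<^sub>L (y o\<^sub>L cadjoint z o\<^sub>L w)" by (simp add: bc_assoc)
 then show ?case using productsI[OF \<open>x : M\<close> tri[OF \<open>y : M\<close> add(1,2)]] add(3) by (simp add: bc_add products_add)
 qed (simp add: bounded_bilinear.zero_right[OF bounded_bilinear_blinfun_compose] products_zero)
 then show ?case using add(3) by (simp add: bc_add products_add)
qed (simp add: bounded_bilinear.zero_left[OF bounded_bilinear_blinfun_compose] products_zero)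

text \<open>Non-degeneracy gives the identity only as a limit. The products of the TRO form an algebra that lies in the finite-dimensional
space \<open>\<phi>(S)\<close>. An element \<open>e\<close> close to the identity is injective, and the shortest linear relation among its powers
expresses the identity by them.\<close>

lemma id_in_products:
 fixes M :: "('h::chilbert_space \<Rightarrow>\<^sub>L 'k::chilbert_space) set"
 assumes S: "opsys n S" and \<phi>: "ucoe n S \<phi>" and M: "op_subspace M"
 and tri: "!!x y z. x : M ==> y : M ==> z : M ==> x o\<^sub>L cadjoint y o\<^sub>L z : M"
 and MS: "!!x y. x : M ==> y : M ==> cadjoint x o\<^sub>L y : \<phi> ` S"
 and id: "id_blinfun : closed_span {cadjoint x o\<^sub>L y | x y. x : M & y : M}"
 shows "id_blinfun : products M"
proof -
 have "closed_span {cadjoint x o\<^sub>L y | x y. x : M & y : M} \<subseteq> closure (products M)"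
 by (rule closed_span_subset[OF products_subspace[OF M]]) (auto intro: productsI)
 then have "id_blinfun : closure (products M)" using id by blast
 then have near: "\<forall>\<epsilon>>0. \<exists>y\<in>products M. dist y id_blinfun < \<epsilon>" by (simp only: closure_approachable)
 from near[rule_format, of "1/2"] obtain e where e: "e : products M" "dist e id_blinfun < 1/2" by auto
 have e_inj: "X = 0" if "e o\<^sub>L X = 0" for X :: "'h \<Rightarrow>\<^sub>L 'h"
 proof (rule blinfun_eqI)
 fix \<xi>
 let ?\<eta> = "blinfun_apply X \<xi>"
 have "blinfun_apply e ?\<eta> = 0" using that by (metis blinfun_apply_blinfun_compose blinfun.zero_left)
 then have "norm ?\<eta> = norm (blinfun_apply (e - id_blinfun) ?\<eta>)" by (simp add: blinfun.diff_left)
 also have "... \<le> norm (e - id_blinfun) * norm ?\<eta>" by (rule norm_blinfun)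
 also have "... \<le> 1/2 * norm ?\<eta>" using e(2) by (intro mult_right_mono) (auto simp: dist_norm)
 finally show "blinfun_apply X \<xi> = blinfun_apply 0 \<xi>" by simp
 qed
 have PS: "X : \<phi> ` S" if "X : products M" for X
 using that
 proof (induction rule: products_induct)
 case zero
 have "\<phi> 0 = 0" using \<phi> opsysD(6)[OF S] unfolding ucoe_def by (metis scaleC_blinfun_zero scl.scale_zero_left)
 then show ?case using opsysD(6)[OF S] by (metis image_eqI)
 next
 case (add x y Y)
 then obtain s t where "s : S" "t : S" "cadjoint x o\<^sub>L y = \<phi> s" "Y = \<phi> t" using MS by blast
 then have "(cadjoint x o\<^sub>L y) + Y = \<phi> (s + t)" "s + t : S" using \<phi> opsysD(7)[OF S] by (auto simp: ucoe_def)
 then show ?case by blast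
 qed
 \<comment> \<open>\<open>pw k\<close> is the power of \<open>e\<close> with exponent \<open>k + 1\<close>.\<close>
 define pw where "pw k = ((%X. e o\<^sub>L X) ^^ k) e" for k :: nat
 have pw_Suc: "pw (Suc k) = e o\<^sub>L pw k" for k by (simp add: pw_def)
 have pwP: "pw k : products M" for k
 by (induction k) (auto simp: pw_Suc pw_def[of 0] e(1) intro: products_mult[OF tri])
 define s where "s k = inv_into S \<phi> (pw k)" for k
 have s: "s k : S" "\<phi> (s k) = pw k" for k
 using PS[OF pwP[of k]] by (auto simp: s_def inv_into_into f_inv_into_f)
 obtain D a where a: "\<exists>k<D. a k ~= 0" "(\<Sum>k<D. scl (a k) (s k)) = 0"
 using ops_dependent[of s n n] s(1) opsysD(5)[OF S] by metis
 have "(\<Sum>k<D. scaleC_blinfun (a k) (pw k)) = \<phi> (\<Sum>k<D. scl (a k) (s k))"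
 proof -
 have "\<phi> (\<Sum>k\<in>A. scl (a k) (s k)) = (\<Sum>k\<in>A. scaleC_blinfun (a k) (pw k))" if "finite A" for A
 using that
 proof (induction A rule: finite_induct)
 case empty
 then show ?case using \<phi> opsysD(6)[OF S] unfolding ucoe_def by (metis scaleC_blinfun_zero scl.scale_zero_left sum.empty)
 next
 case (insert k A)
 have m: "scl (a k) (s k) : S" for k using opsysD(9)[OF S s(1)] .
 then have "(\<Sum>k\<in>A. scl (a k) (s k)) : S" by (rule opsysD(10)[OF S])
 then show ?case using insert \<phi> s m by (simp add: ucoe_def)
 qed
 then show ?thesis by simp
 qed
 also have "... = 0" unfolding a(2) using \<phi> opsysD(6)[OF S] unfolding ucoe_def by (metis scaleC_blinfun_zero scl.scale_zero_left)
 finally have rel: "(\<Sum>k<D. scaleC_blinfun (a k) (pw k)) = 0" .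
 have "(\<Sum>k<D. scaleC_blinfun (a k) (pw k)) = 0 ==> \<exists>k<D. a k ~= 0 ==> id_blinfun : products M" for a :: "nat => complex" and D
 proof (induction D arbitrary: a)
 case (Suc D)
 let ?Y = "\<Sum>k<D. scaleC_blinfun (a (Suc k)) (pw k)"
 have scr: "scaleC_blinfun b (e o\<^sub>L X) = e o\<^sub>L scaleC_blinfun b X" for b and X :: "'h \<Rightarrow>\<^sub>L 'h"
 proof (rule blinfun_eqI)
 have "e : bounded_ops" using products_subspace[OF M] e(1) by (auto simp: op_subspace_def)
 then show "blinfun_apply (scaleC_blinfun b (e o\<^sub>L X)) \<xi> = blinfun_apply (e o\<^sub>L scaleC_blinfun b X) \<xi>" for \<xi>
 by (simp add: scaleC_blinfun.rep_eq bounded_ops_def)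
 qed
 have pw0: "pw 0 = e o\<^sub>L id_blinfun" by (simp add: pw_def bc_id)
 have "e o\<^sub>L (scaleC_blinfun (a 0) id_blinfun + ?Y) = (\<Sum>k<Suc D. scaleC_blinfun (a k) (pw k))"
 by (simp add: sum.lessThan_Suc_shift bc_add bc_sum scr[symmetric] pw_Suc pw0[symmetric] del: sum.lessThan_Suc)
 also have "... = 0" by (rule Suc.prems(1))
 finally have zero: "scaleC_blinfun (a 0) id_blinfun + ?Y = 0" by (rule e_inj)
 show ?case
 proof (cases "a 0 = 0")
 case True
 then have "?Y = 0" using zero by (simp add: scaleC_blinfun_zero)
 moreover have "\<exists>k<D. a (Suc k) ~= 0" using Suc.prems(2) True by (metis less_Suc_eq_0_disj)
 ultimately show ?thesis by (rule Suc.IH)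
 next
 case False
 have "?Y : products M"
 by (induction D) (auto intro: products_zero products_add products_scale[OF M] pwP)
 then have "scaleC_blinfun (- inverse (a 0)) ?Y : products M" by (rule products_scale[OF M])
 also have "scaleC_blinfun (- inverse (a 0)) ?Y = id_blinfun"
 proof (rule blinfun_eqI)
 fix \<xi>
 have "scaleC (a 0) \<xi> + blinfun_apply ?Y \<xi> = 0"
 using arg_cong[OF zero, of "%X. blinfun_apply X \<xi>"] by (simp add: blinfun.add_left scaleC_blinfun.rep_eq)
 then have y: "blinfun_apply ?Y \<xi> = - scaleC (a 0) \<xi>" by (simp add: eq_neg_iff_add_eq_0 add.commute)
 have m: "- v = scaleC (-1) v" for v :: 'h using scaleC_of_real[of "-1" v] by simp
 have "scaleC (- inverse (a 0)) (blinfun_apply ?Y \<xi>) = scaleC 1 \<xi>"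
 using False by (simp add: y m scaleC_scaleC)
 also have "... = \<xi>" using scaleC_of_real[of 1 \<xi>] by simp
 finally show "blinfun_apply (scaleC_blinfun (- inverse (a 0)) ?Y) \<xi> = blinfun_apply id_blinfun \<xi>"
 by (simp add: scaleC_blinfun.rep_eq)
 qed
 finally show ?thesis .
 qed
 qed simp
 then show ?thesis using rel a(1) by blast
qed

lemma products_sum:
 assumes "X : products M"
 obtains N :: nat and f g where "!!k. k < N ==> f k : M & g k : M" "X = (\<Sum>k<N. cadjoint (f k) o\<^sub>L g k)"
proof -
 obtain L where L: "set L \<subseteq> M \<times> M" "X = sum_list (map (%(x, y). cadjoint x o\<^sub>L y) L)"
 using assms unfolding products_def by blast
 show ?thesis
 proof (rule that[of "length L" "%k. fst (L ! k)" "%k. snd (L ! k)"])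
 show "fst (L ! k) : M & snd (L ! k) : M" if "k < length L" for k
 using nth_mem[OF that] L(1) by (auto simp: mem_Times_iff)
 show "X = (\<Sum>k<length L. cadjoint (fst (L ! k)) o\<^sub>L snd (L ! k))"
 unfolding L(2) sum_list_sum_nth by (simp add: atLeast0LessThan case_prod_beta)
 qed
qed

lemma flip_unit:
 assumes "!!k. k < N ==> f k : bounded_ops & g k : bounded_ops" "(\<Sum>k<N :: nat. cadjoint (f k) o\<^sub>L g k) = id_blinfun"
 shows "(\<Sum>k<N. cadjoint (g k) o\<^sub>L f k) = id_blinfun"
proof (rule blinfun_eqI, rule cinner_eqI)
 fix \<xi> \<eta>
 have "cinner (blinfun_apply (\<Sum>k<N. cadjoint (g k) o\<^sub>L f k) \<xi>) \<eta> = (\<Sum>k<N. cinner (blinfun_apply (f k) \<xi>) (blinfun_apply (g k) \<eta>))"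
 unfolding blinfun.sum_left cinner_sum_left using assms(1) by (intro sum.cong refl) (simp add: cadjoint)
 also have "... = cinner \<xi> (blinfun_apply (\<Sum>k<N. cadjoint (f k) o\<^sub>L g k) \<eta>)"
 unfolding blinfun.sum_left cinner_sum_right using assms(1) by (intro sum.cong refl) (simp add: cadjoint_right)
 finally show "cinner (blinfun_apply (\<Sum>k<N. cadjoint (g k) o\<^sub>L f k) \<xi>) \<eta> = cinner (blinfun_apply id_blinfun \<xi>) \<eta>"
 by (simp add: assms(2))
qed

lemma ucoe_unemb:
 assumes S: "operator_system n S" and \<phi>: "unital_complete_order_embedding n S \<phi>"
 shows "ucoe n (emb ` S) (%X. \<phi> (unemb n n X))"
proof -
 have Sc: "S \<subseteq> carrier_mat n n" and one: "1\<^sub>m n : S" and Ss: "!!x y. x : S ==> y : S ==> x + y : S" "!!a x. x : S ==> a \<cdot>\<^sub>m x : S"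
 using S by (auto simp: operator_system_def mat_subspace_def)
 have un: "unemb n n (emb x) = x" if "x : S" for x using that Sc by (intro unemb_emb) auto
 show ?thesis
 unfolding ucoe_def
 proof (intro conjI ballI allI impI)
 fix X assume "X : emb ` S"
 then obtain x where x: "x : S" "X = emb x" by blast
 have xc: "x : carrier_mat n n" using x Sc by blast
 show "\<phi> (unemb n n (scl a X)) = scaleC_blinfun a (\<phi> (unemb n n X))" for a
 using \<phi> x un[OF x(1)] un[OF Ss(2)[OF x(1)], of a] by (simp add: emb_smult[OF xc] unital_complete_order_embedding_def)
 fix Y assume "Y : emb ` S"
 then obtain y where y: "y : S" "Y = emb y" by blast
 have yc: "y : carrier_mat n n" using y Sc by blast
 show "\<phi> (unemb n n (X + Y)) = \<phi> (unemb n n X) + \<phi> (unemb n n Y)"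
 using \<phi> x y un[OF x(1)] un[OF y(1)] un[OF Ss(1)[OF x(1) y(1)]]
 by (simp add: emb_add[OF xc yc] unital_complete_order_embedding_def)
 next
 show "\<phi> (unemb n n (pr n)) = id_blinfun"
 using \<phi> un[OF one] by (simp add: unital_complete_order_embedding_def)
 next
 fix p :: nat and X assume X: "\<forall>i<p. \<forall>j<p. X i j : emb ` S"
 let ?x = "%i j. unemb n n (X i j)"
 have x: "?x i j : S & emb (?x i j) = X i j" if "i < p" "j < p" for i j
 using X that un by fastforce
 have "bpos {..<p} X \<longleftrightarrow> bpos {..<p} (%i j. emb (?x i j))" using x by (intro bpos_cong) auto
 also have "... \<longleftrightarrow> block_psd n p ?x" by (rule block_psd_iff[symmetric]) simp
 also have "... \<longleftrightarrow> op_block_psd p (%i j. \<phi> (?x i j))"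
 by (rule \<phi>[unfolded unital_complete_order_embedding_def, THEN conjunct2, THEN conjunct2, THEN conjunct2, THEN conjunct2, rule_format])
 (use x in simp)
 finally show "bpos {..<p} X \<longleftrightarrow> obpos {..<p} (%i j. \<phi> (?x i j))"
 by (simp add: obpos_def op_block_psd_def)
 qed
qed

text \<open>The embeddings of both systems and the finitely many relevant elements of the TRO satisfy the hypotheses of \<open>delta_data\<close>.\<close>

theorem delta_pullback:
 assumes S: "operator_system n S" and T: "operator_system m T"
 and irr: "acts_irreducibly n S" "acts_irreducibly m T"
 and delta: "delta_equivalent TYPE('h::chilbert_space) TYPE('k::chilbert_space) n S m T"
 shows "pullback n S m T" "pullback m T n S"
proof -
 obtain \<phi> :: "complex mat => 'h \<Rightarrow>\<^sub>L 'h" and \<psi> :: "complex mat => 'k \<Rightarrow>\<^sub>L 'k"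
 where \<phi>: "unital_complete_order_embedding n S \<phi>" and \<psi>: "unital_complete_order_embedding m T \<psi>"
 and equiv: "tro_equivalent (\<phi> ` S) (\<psi> ` T)"
 using delta unfolding delta_equivalent_def by (elim exE conjE) (rule that; assumption)
 obtain M :: "('h \<Rightarrow>\<^sub>L 'k) set" where tro: "tro M" and nd: "nondegenerate M"
 and M3: "\<forall>x\<in>M. \<forall>y\<in>M. (\<forall>t\<in>\<psi> ` T. cadjoint x o\<^sub>L t o\<^sub>L y : \<phi> ` S) & (\<forall>s\<in>\<phi> ` S. x o\<^sub>L s o\<^sub>L cadjoint y : \<psi> ` T)"
 using equiv unfolding tro_equivalent_def by (elim exE conjE) (rule that; assumption)
 have TS: "cadjoint x o\<^sub>L t o\<^sub>L y : \<phi> ` S" if "x : M" "y : M" "t : \<psi> ` T" for x y t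
 by (rule M3[THEN bspec, THEN bspec, THEN conjunct1, THEN bspec]) (fact that)+
 have ST: "x o\<^sub>L s o\<^sub>L cadjoint y : \<psi> ` T" if "x : M" "y : M" "s : \<phi> ` S" for x y s
 by (rule M3[THEN bspec, THEN bspec, THEN conjunct2, THEN bspec]) (fact that)+
 let ?S = "emb ` S" and ?T = "emb ` T"
 define \<Phi> where "\<Phi> X = \<phi> (unemb n n X)" for X
 define \<Psi> where "\<Psi> X = \<psi> (unemb m m X)" for X
 note oS = opsys_emb[OF S] and oT = opsys_emb[OF T]
 have uS: "ucoe n ?S \<Phi>" unfolding \<Phi>_def by (rule ucoe_unemb[OF S \<phi>])
 have uT: "ucoe m ?T \<Psi>" unfolding \<Psi>_def by (rule ucoe_unemb[OF T \<psi>])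
 have imS: "\<Phi> ` ?S = \<phi> ` S"
 unfolding \<Phi>_def image_image using S by (intro image_cong refl) (auto simp: operator_system_def mat_subspace_def unemb_emb[of _ n n])
 have imT: "\<Psi> ` ?T = \<psi> ` T"
 unfolding \<Psi>_def image_image using T by (intro image_cong refl) (auto simp: operator_system_def mat_subspace_def unemb_emb[of _ m m])
 have idS: "id_blinfun : \<phi> ` S" "id_blinfun : \<psi> ` T"
 using \<phi> \<psi> S T unfolding unital_complete_order_embedding_def operator_system_def by (metis image_eqI)+
 have Msub: "op_subspace M" and tri: "!!x y z. x : M ==> y : M ==> z : M ==> x o\<^sub>L cadjoint y o\<^sub>L z : M"
 using tro by (auto simp: tro_def)
 have Mb: "x : bounded_ops" if "x : M" for x using Msub that by (auto simp: op_subspace_def)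
 define M' where "M' = cadjoint ` M"
 have M'b: "x : bounded_ops" "cadjoint x : M" if "x : M'" for x
 proof -
 from that obtain a where "a : M" "x = cadjoint a" unfolding M'_def by blast
 then show "x : bounded_ops" "cadjoint x : M" by (simp_all add: Mb cadjoint_bounded cadjoint_cadjoint)
 qed
 have M'sub: "op_subspace M'"
 unfolding op_subspace_def
 proof (intro conjI ballI allI subsetI)
 have ad0: "cadjoint (0 :: 'h \<Rightarrow>\<^sub>L 'k) = 0"
 using Msub by (intro cadjoint_unique) (auto simp: op_subspace_def)
 show "0 : M'" unfolding M'_def using Msub ad0 by (metis image_eqI op_subspace_def)
 fix x assume "x : M'"
 then obtain a where a: "a : M" "x = cadjoint a" by (auto simp: M'_def)
 show "scaleC_blinfun c x : M'" for c
 proof -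
 have "scaleC_blinfun c x = cadjoint (scaleC_blinfun (cnj c) a)" by (simp add: a(2) cadjoint_scaleC[OF Mb[OF a(1)]])
 then show ?thesis unfolding M'_def using Msub a(1) by (auto simp: op_subspace_def)
 qed
 fix y assume "y : M'"
 then obtain b where b: "b : M" "y = cadjoint b" by (auto simp: M'_def)
 have ab: "a + b : M" using Msub a(1) b(1) by (auto simp: op_subspace_def)
 have "cadjoint (a + b) = x + y"
 using a b Mb by (intro cadjoint_unique Mb[OF ab]) (simp add: blinfun.add_left cinner_add_left cinner_add_right cadjoint)
 then show "x + y : M'" unfolding M'_def using ab by (metis image_eqI)
 qed (use M'b in auto)
 have tri': "x o\<^sub>L cadjoint y o\<^sub>L z : M'" if xyz: "x : M'" "y : M'" "z : M'" for x y z
 proof -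
 have "cadjoint z o\<^sub>L cadjoint (cadjoint y) o\<^sub>L cadjoint x : M" by (intro tri M'b(2) xyz)
 moreover have "cadjoint (cadjoint z o\<^sub>L cadjoint (cadjoint y) o\<^sub>L cadjoint x) = x o\<^sub>L cadjoint y o\<^sub>L z"
 using xyz M'b(1) by (simp add: cadjoint_compose bounded_ops_compose cadjoint_bounded cadjoint_cadjoint bc_assoc)
 ultimately show ?thesis unfolding M'_def by (metis image_eqI)
 qed
 have "id_blinfun : products M"
 proof (rule id_in_products[OF oS uS Msub tri])
 show "cadjoint x o\<^sub>L y : \<Phi> ` ?S" if "x : M" "y : M" for x y
 unfolding imS using TS[OF that idS(2)] by (simp add: bc_id)
 show "id_blinfun : closed_span {cadjoint x o\<^sub>L y | x y. x : M & y : M}" using nd by (simp add: nondegenerate_def)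
 qed
 then obtain N :: nat and p q where pq: "!!k. k < N ==> p k : M & q k : M" "id_blinfun = (\<Sum>k<N. cadjoint (p k) o\<^sub>L q k)"
 by (rule products_sum) (rule that; assumption)
 have "id_blinfun : products M'"
 proof (rule id_in_products[OF oT uT M'sub tri'])
 show "cadjoint x o\<^sub>L y : \<Psi> ` ?T" if "x : M'" "y : M'" for x y
 unfolding imT using ST[OF M'b(2)[OF that(1)] M'b(2)[OF that(2)] idS(1)] M'b(1)[OF that(2)] by (simp add: bc_id cadjoint_cadjoint)
 have "{x o\<^sub>L cadjoint y | x y. x : M & y : M} \<subseteq> {cadjoint x o\<^sub>L y | x y. x : M' & y : M'}"
 proof
 fix Z assume "Z : {x o\<^sub>L cadjoint y | x y. x : M & y : M}"
 then obtain x y where xy: "x : M" "y : M" "Z = x o\<^sub>L cadjoint y" by blast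
 then have "Z = cadjoint (cadjoint x) o\<^sub>L cadjoint y" "cadjoint x : M'" "cadjoint y : M'"
 by (auto simp: cadjoint_cadjoint[OF Mb] M'_def)
 then show "Z : {cadjoint x o\<^sub>L y | x y. x : M' & y : M'}" by blast
 qed
 then show "id_blinfun : closed_span {cadjoint x o\<^sub>L y | x y. x : M' & y : M'}"
 using nd hull_mono unfolding nondegenerate_def closed_span_def by blast
 qed
 then obtain N' :: nat and a b where ab: "!!k. k < N' ==> a k : M' & b k : M'" "id_blinfun = (\<Sum>k<N'. cadjoint (a k) o\<^sub>L b k)"
 by (rule products_sum) (rule that; assumption)
 define I where "I = p ` {..<N} \<union> q ` {..<N} \<union> (cadjoint \<circ> a) ` {..<N'} \<union> (cadjoint \<circ> b) ` {..<N'}"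
 have IM: "x : M" if "x : I" for x using that pq(1) ab(1) M'b(2) unfolding I_def by auto
 have abb: "a k : bounded_ops & b k : bounded_ops" if "k < N'" for k using ab(1)[OF that] M'b(1) by blast
 have dTS: "cadjoint i o\<^sub>L (\<Psi> t o\<^sub>L j) : \<Phi> ` ?S" if "i : I" "j : I" "t : ?T" for i j t
 proof -
 have "\<Psi> t : \<psi> ` T" using that(3) imT by blast
 then show ?thesis unfolding imS bc_assoc[symmetric] by (rule TS[OF IM[OF that(1)] IM[OF that(2)]])
 qed
 have dST: "i o\<^sub>L (\<Phi> s o\<^sub>L cadjoint j) : \<Psi> ` ?T" if "i : I" "j : I" "s : ?S" for i j s
 proof -
 have "\<Phi> s : \<phi> ` S" using that(3) imS by blast
 then show ?thesis unfolding imT bc_assoc[symmetric] by (rule ST[OF IM[OF that(1)] IM[OF that(2)]])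
 qed
 have pqb: "p k : bounded_ops & q k : bounded_ops" if "k < N" for k using pq(1)[OF that] Mb by blast
 have u1: "(\<Sum>k<N. cadjoint (p k) o\<^sub>L q k) = id_blinfun" by (rule pq(2)[symmetric])
 have u2: "(\<Sum>k<N. cadjoint (q k) o\<^sub>L p k) = id_blinfun" by (rule flip_unit[OF pqb u1])
 have ab1: "(\<Sum>k<N'. cadjoint (a k) o\<^sub>L b k) = id_blinfun" by (rule ab(2)[symmetric])
 have ab2: "(\<Sum>k<N'. cadjoint (b k) o\<^sub>L a k) = id_blinfun" by (rule flip_unit[OF abb ab1])
 have u3: "(\<Sum>k<N'. cadjoint (a k) o\<^sub>L cadjoint (cadjoint (b k))) = id_blinfun"
 unfolding ab1[symmetric] using abb by (intro sum.cong refl) (simp add: cadjoint_cadjoint)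
 have u4: "(\<Sum>k<N'. cadjoint (b k) o\<^sub>L cadjoint (cadjoint (a k))) = id_blinfun"
 unfolding ab2[symmetric] using abb by (intro sum.cong refl) (simp add: cadjoint_cadjoint)
 have fin: "finite I" by (simp add: I_def)
 have adj: "cinner (blinfun_apply (cadjoint i) \<eta>) \<xi> = cinner \<eta> (blinfun_apply i \<xi>)" if "i : I" for i \<xi> \<eta>
 by (rule cadjoint[OF Mb[OF IM[OF that]]])
 have Ib: "i : bounded_ops" if "i : I" for i by (rule Mb[OF IM[OF that]])
 have cIb: "cadjoint i : bounded_ops" if "i : I" for i by (rule cadjoint_bounded[OF Ib[OF that]])
 have pqI: "p k : I & q k : I" if "k < N" for k using that by (auto simp: I_def)
 have abI: "cadjoint (a k) : I & cadjoint (b k) : I" if "k < N'" for k using that by (auto simp: I_def)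
 interpret d: delta_data n m ?S ?T \<Phi> \<Psi> I "%x. x" cadjoint N p q N' "%k. cadjoint (a k)" "%k. cadjoint (b k)"
 by (rule delta_data.intro; fact)
 have iS: "incompressible n ?S" by (rule irreducible_incompressible[OF oS irreducible_emb[OF S irr(1)]])
 have iT: "incompressible m ?T" by (rule irreducible_incompressible[OF oT irreducible_emb[OF T irr(2)]])
 show "pullback n S m T" by (rule pullback_of_opullback[OF S T d.incompressible_pullback[OF iS iT]])
 show "pullback m T n S"
 by (rule pullback_of_opullback[OF T S delta_data.incompressible_pullback[OF d.swap iT iS]])
qed

section \<open>Channels along a pullback\<close>

lemma sum_div_mod: "(\<Sum>l<q * r. f (l div r) (l mod r)) = (\<Sum>a<q. \<Sum>j<r :: nat. (f a j :: 'a :: comm_monoid_add))"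
 unfolding sum.cartesian_product
proof (rule sum.reindex_bij_witness[of _ "%(a, j). a * r + j" "%l. (l div r, l mod r)"])
 fix l assume "l : {..<q * r}"
 then have l: "l < q * r" by simp
 then have r: "0 < r" by (cases r) auto
 show "(l div r, l mod r) : {..<q} \<times> {..<r}" using l r by (simp add: less_mult_imp_div_less)
 show "(case (l div r, l mod r) of (a, j) => a * r + j) = l" by simp
 show "(case (l div r, l mod r) of (a, j) => f a j) = f (l div r) (l mod r)" by simp
next
 fix b assume "b : {..<q} \<times> {..<r}"
 then obtain a j where b: "b = (a, j)" "a < q" "j < r" by auto
 have "a * r + j < Suc a * r" using b(3) by simp
 also have "... \<le> q * r" using b(2) by (intro mult_le_mono1) simp
 finally show "(case b of (a, j) => a * r + j) : {..<q * r}" by (simp add: b)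
 show "((case b of (a, j) => a * r + j) div r, (case b of (a, j) => a * r + j) mod r) = b"
 using b by simp
qed

lemma div_mod_less: "l < q * r ==> l div r < q" "l < q * r ==> l mod r < (r :: nat)"
 by (auto simp: less_mult_imp_div_less) (metis mod_less_divisor mult_0_right not_gr_zero not_less_zero)

lemma div_mod_witness: "a < q ==> j < r ==> \<exists>l<q * r. l div r = a & l mod r = (j :: nat)"
proof (intro exI conjI)
 assume "a < q" "j < r"
 have "a * r + j < Suc a * r" using \<open>j < r\<close> by simp
 also have "... \<le> q * r" using \<open>a < q\<close> by (intro mult_le_mono1) simp
 finally show "a * r + j < q * r" .
 show "(a * r + j) div r = a" "(a * r + j) mod r = j" using \<open>j < r\<close> by simp_all
qed

lemma mat_trace_mult:
 assumes "x : carrier_mat r c" "y : carrier_mat c r"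
 shows "mat_trace (x * y) = (\<Sum>i<r. \<Sum>j<c. x $$ (i, j) * y $$ (j, i))"
 unfolding mat_trace_def using assms
 by (intro sum.cong) (auto simp: scalar_prod_def atLeast0LessThan intro!: sum.cong)

lemma mat_trace_comm:
 assumes "x : carrier_mat r c" "y : carrier_mat c r"
 shows "mat_trace (x * y) = mat_trace (y * x)"
 unfolding mat_trace_mult[OF assms] mat_trace_mult[OF assms(2,1)]
 by (subst sum.swap) (simp add: mult.commute)

lemma mat_trace_sum: "mat_trace (mat_sum n n f I) = (\<Sum>i\<in>I. \<Sum>j<n. f i $$ (j, j))"
 unfolding mat_trace_def by (subst sum.swap) (simp add: mat_sum_def)

text \<open>The part of the pullback property that survives in tensor powers, where no equality of spans is required.\<close>

definition connects :: "nat => complex mat set => nat => complex mat set => nat => (nat => complex mat) => bool" where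
 "connects n S m T r x \<longleftrightarrow> (\<forall>i<r. x i : carrier_mat m n) &
 mat_sum n n (%i. mat_adjoint (x i) * x i) {..<r} = 1\<^sub>m n &
 (\<forall>i<r. \<forall>j<r. \<forall>t\<in>T. mat_adjoint (x i) * t * x j : S)"

definition transport :: "nat => nat => (nat => complex mat) => complex mat => complex mat" where
 "transport m r x c = mat_sum m m (%j. x j * c * mat_adjoint (x j)) {..<r}"

lemma sandwich_carrier:
 assumes "x : carrier_mat m n" "y : carrier_mat m n" "c : carrier_mat n n"
 shows "x * c * mat_adjoint y : carrier_mat m m"
 using assms by (intro mult_carrier_mat) auto

lemma emb_sandwich_sum:
 assumes "!!i. i : I ==> v i : carrier_mat k m" "!!i. i : I ==> w i : carrier_mat k m" "c : carrier_mat m m"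
 shows "emb (mat_sum k k (%i. v i * c * mat_adjoint (w i)) I) = (\<Sum>i\<in>I. emb (v i) * emb c * ad (emb (w i)))"
proof -
 have "emb (mat_sum k k (%i. v i * c * mat_adjoint (w i)) I) = (\<Sum>i\<in>I. emb (v i * c * mat_adjoint (w i)))"
 by (rule emb_mat_sum, rule sandwich_carrier[of _ k m]) (use assms in auto)
 also have "... = (\<Sum>i\<in>I. emb (v i) * emb c * ad (emb (w i)))"
 by (rule sum.cong[OF refl], rule emb_sandwich_right[of _ k m]) (use assms in auto)
 finally show ?thesis .
qed

lemma emb_adjoint_mult_sum:
 assumes "!!i. i : I ==> v i : carrier_mat k m" "!!i. i : I ==> w i : carrier_mat k m"
 shows "emb (mat_sum m m (%i. mat_adjoint (w i) * v i) I) = (\<Sum>i\<in>I. ad (emb (w i)) * emb (v i))"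
proof -
 have "emb (mat_sum m m (%i. mat_adjoint (w i) * v i) I) = (\<Sum>i\<in>I. emb (mat_adjoint (w i) * v i))"
 by (rule emb_mat_sum, rule mult_carrier_mat[of _ m k]) (use assms in auto)
 also have "... = (\<Sum>i\<in>I. ad (emb (w i)) * emb (v i))"
 by (rule sum.cong[OF refl], rule emb_adjoint_mult[of _ k m]) (use assms in auto)
 finally show ?thesis .
qed

lemma mat_adjoint_one: "mat_adjoint (1\<^sub>m n) = (1\<^sub>m n :: complex mat)"
proof (rule eq_matI)
 fix i j assume "i < dim_row (1\<^sub>m n :: complex mat)" "j < dim_col (1\<^sub>m n :: complex mat)"
 then show "mat_adjoint (1\<^sub>m n) $$ (i, j) = (1\<^sub>m n :: complex mat) $$ (i, j)"
 by (simp add: mat_adjoint_index[OF one_carrier_mat])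
next
 have "mat_adjoint (1\<^sub>m n :: complex mat) : carrier_mat n n" by (rule mat_adjoint_carrier) simp
 from carrier_matD[OF this] show "dim_row (mat_adjoint (1\<^sub>m n :: complex mat)) = dim_row (1\<^sub>m n :: complex mat)"
 "dim_col (mat_adjoint (1\<^sub>m n :: complex mat)) = dim_col (1\<^sub>m n :: complex mat)"
 by (simp_all only: index_one_mat(2,3))
qed

lemma emb_transport:
 assumes "!!i. i < r ==> x i : carrier_mat m n" "c : carrier_mat n n"
 shows "emb (transport m r x c) = (\<Sum>j<r. emb (x j) * emb c * ad (emb (x j)))"
 unfolding transport_def by (rule emb_sandwich_sum[of _ _ m n]) (use assms in auto)

lemma transport_channel:
 assumes x: "!!i. i < r ==> x i : carrier_mat m n"
 and unit: "mat_sum n n (%i. mat_adjoint (x i) * x i) {..<r} = 1\<^sub>m n"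
 shows "quantum_channel n m (transport m r x)"
 unfolding quantum_channel_def
proof (intro conjI)
 have car: "transport m r x c : carrier_mat m m" for c by (simp add: transport_def)
 show "linear_map n m (transport m r x)"
 unfolding linear_map_def
 proof (intro conjI ballI allI car)
 fix c d :: "complex mat" and a :: complex assume c: "c : carrier_mat n n"
 show "transport m r x (a \<cdot>\<^sub>m c) = a \<cdot>\<^sub>m transport m r x c"
 using x c car by (intro emb_inj[of _ m m]) (auto simp: emb_transport[of r x m n] emb_smult[of _ n n] emb_smult[of _ m m] scl.scale_sum_right)
 assume d: "d : carrier_mat n n"
 show "transport m r x (c + d) = transport m r x c + transport m r x d"
 using x c d car
 by (intro emb_inj[of _ m m])
 (auto simp: emb_transport[of r x m n] emb_add[of _ n n] emb_add[of _ m m] algebra_simps sum.distrib)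
 qed
 show "completely_positive n m (transport m r x)"
 unfolding completely_positive_def
 proof (intro allI impI, elim conjE)
 fix p s assume s: "\<forall>i<p. \<forall>j<p. s i j : carrier_mat n n" "block_psd n p s"
 then have pos: "bpos {..<p} (%i j. emb (s i j))" using block_psd_iff[of p s n] by blast
 have "bpos {..<p} (%i j. emb (transport m r x (s i j)))"
 unfolding bpos_def
 proof
 fix \<xi>
 have "(\<Sum>i<p. \<Sum>j<p. ip (\<xi> i) (emb (transport m r x (s i j)) \<rhd> \<xi> j))
 = (\<Sum>i<p. \<Sum>j<p. \<Sum>a<r. ip (ad (emb (x a)) \<rhd> \<xi> i) (emb (s i j) \<rhd> ad (emb (x a)) \<rhd> \<xi> j))"
 using s(1) x by (intro sum.cong refl) (simp add: emb_transport[of r x m n] ap_sum_left ip_sum_right ip_ad_left)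
 also have "... = (\<Sum>i<p. \<Sum>a<r. \<Sum>j<p. ip (ad (emb (x a)) \<rhd> \<xi> i) (emb (s i j) \<rhd> ad (emb (x a)) \<rhd> \<xi> j))"
 by (intro sum.cong refl sum.swap)
 also have "... = (\<Sum>a<r. \<Sum>i<p. \<Sum>j<p. ip (ad (emb (x a)) \<rhd> \<xi> i) (emb (s i j) \<rhd> ad (emb (x a)) \<rhd> \<xi> j))"
 by (rule sum.swap)
 also have "0 \<le> ..."
 by (rule sum_nonneg) (rule pos[unfolded bpos_def, rule_format])
 finally show "0 \<le> (\<Sum>i<p. \<Sum>j<p. ip (\<xi> i) (emb (transport m r x (s i j)) \<rhd> \<xi> j))" .
 qed
 then show "block_psd m p (%i j. transport m r x (s i j))" by (subst block_psd_iff) (auto simp: car)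
 qed
 show "trace_preserving n (transport m r x)"
 unfolding trace_preserving_def
 proof
 fix c :: "complex mat" assume c: "c : carrier_mat n n"
 have "mat_trace (transport m r x c) = (\<Sum>j<r. mat_trace (x j * c * mat_adjoint (x j)))"
 unfolding transport_def mat_trace_sum using x c
 by (intro sum.cong refl) (auto simp: mat_trace_def)
 also have "... = (\<Sum>j<r. mat_trace (mat_adjoint (x j) * x j * c))"
 proof (intro sum.cong refl)
 fix j assume "j : {..<r}"
 then have xj: "x j : carrier_mat m n" using x by simp
 have "mat_trace (x j * c * mat_adjoint (x j)) = mat_trace (mat_adjoint (x j) * (x j * c))"
 using xj c by (intro mat_trace_comm[of _ m n] mult_carrier_mat) auto
 also have "mat_adjoint (x j) * (x j * c) = mat_adjoint (x j) * x j * c"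
 using xj c by (intro assoc_mult_mat[symmetric, of _ n m _ n _ n]) auto
 finally show "mat_trace (x j * c * mat_adjoint (x j)) = mat_trace (mat_adjoint (x j) * x j * c)" .
 qed
 also have "... = (\<Sum>j<r. \<Sum>a<n. \<Sum>b<n. (mat_adjoint (x j) * x j) $$ (a, b) * c $$ (b, a))"
 using x c by (intro sum.cong refl mat_trace_mult mult_carrier_mat[of _ _ m]) auto
 also have "... = (\<Sum>a<n. \<Sum>j<r. \<Sum>b<n. (mat_adjoint (x j) * x j) $$ (a, b) * c $$ (b, a))"
 by (rule sum.swap)
 also have "... = (\<Sum>a<n. \<Sum>b<n. \<Sum>j<r. (mat_adjoint (x j) * x j) $$ (a, b) * c $$ (b, a))"
 by (intro sum.cong refl sum.swap)
 also have "... = mat_trace (mat_sum n n (%i. mat_adjoint (x i) * x i) {..<r} * c)"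
 using c by (subst mat_trace_mult[of _ n n]) (auto simp: mat_sum_def sum_distrib_right)
 also have "... = mat_trace c" unfolding unit using c by simp
 finally show "mat_trace (transport m r x c) = mat_trace c" .
 qed
qed

lemma channel_compose:
 assumes "quantum_channel n m \<Theta>" "quantum_channel m k \<Phi>"
 shows "quantum_channel n k (%c. \<Phi> (\<Theta> c))"
 using assms unfolding quantum_channel_def linear_map_def completely_positive_def trace_preserving_def
 by simp

text \<open>The index \<open>l < q * r\<close> stands for the pair \<open>(l div r, l mod r)\<close>.\<close>

lemma represents_compose:
 assumes x: "!!i. i < r ==> x i : carrier_mat m n"
 and unit: "mat_sum n n (%i. mat_adjoint (x i) * x i) {..<r} = 1\<^sub>m n"
 and rep: "represents m k \<Phi> q v w"
 shows "represents n k (%c. \<Phi> (transport m r x c)) (q * r) (%l. v (l div r) * x (l mod r)) (%l. w (l div r) * x (l mod r))"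
proof -
 have vw: "v a : carrier_mat k m" "w a : carrier_mat k m" if "a < q" for a
 using rep that by (auto simp: represents_def)
 have \<Phi>: "\<Phi> c = mat_sum k k (%i. v i * c * mat_adjoint (w i)) {..<q}" if "c : carrier_mat m m" for c
 using rep that by (auto simp: represents_def)
 have one: "mat_sum m m (%i. mat_adjoint (w i) * v i) {..<q} = 1\<^sub>m m"
 using rep by (auto simp: represents_def)
 have comp: "v (l div r) * x (l mod r) : carrier_mat k n" "w (l div r) * x (l mod r) : carrier_mat k n"
 "emb (v (l div r) * x (l mod r)) = emb (v (l div r)) * emb (x (l mod r))"
 "emb (w (l div r) * x (l mod r)) = emb (w (l div r)) * emb (x (l mod r))" if "l < q * r" for l
 using vw[OF div_mod_less(1)[OF that]] x[OF div_mod_less(2)[OF that]]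
 by (auto simp: emb_mult[of _ k m _ n])
 have one': "(\<Sum>a<q. ad (emb (w a)) * emb (v a)) = pr m"
 using emb_adjoint_mult_sum[of "{..<q}" v k m w] vw by (simp add: one)
 have unit': "(\<Sum>j<r. ad (emb (x j)) * emb (x j)) = pr n"
 using emb_adjoint_mult_sum[of "{..<r}" x m n x] x by (simp add: unit)
 show ?thesis
 unfolding represents_def
 proof (intro conjI allI impI ballI comp)
 fix c :: "complex mat" assume c: "c : carrier_mat n n"
 have tc: "transport m r x c : carrier_mat m m" by (simp add: transport_def)
 show "\<Phi> (transport m r x c) = mat_sum k k (%l. v (l div r) * x (l mod r) * c * mat_adjoint (w (l div r) * x (l mod r))) {..<q * r}"
 proof (rule emb_inj[of _ k k])
 have "emb (\<Phi> (transport m r x c)) = (\<Sum>a<q. emb (v a) * emb (transport m r x c) * ad (emb (w a)))"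
 unfolding \<Phi>[OF tc] by (rule emb_sandwich_sum[of _ _ k m]) (use vw tc in auto)
 also have "... = (\<Sum>a<q. \<Sum>j<r. emb (v a) * emb (x j) * emb c * ad (emb (w a) * emb (x j)))"
 using x c by (simp add: emb_transport[of r x m n] sum_distrib_left sum_distrib_right mult.assoc)
 also have "... = (\<Sum>l<q * r. emb (v (l div r)) * emb (x (l mod r)) * emb c * ad (emb (w (l div r)) * emb (x (l mod r))))"
 by (rule sum_div_mod[symmetric])
 also have "... = emb (mat_sum k k (%l. v (l div r) * x (l mod r) * c * mat_adjoint (w (l div r) * x (l mod r))) {..<q * r})"
 using comp c by (subst emb_sandwich_sum[of _ _ k n]) (auto intro!: sum.cong)
 finally show "emb (\<Phi> (transport m r x c)) = emb (mat_sum k k (%l. v (l div r) * x (l mod r) * c * mat_adjoint (w (l div r) * x (l mod r))) {..<q * r})" .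
 qed (simp_all add: \<Phi>[OF tc])
 next
 show "mat_sum n n (%l. mat_adjoint (w (l div r) * x (l mod r)) * (v (l div r) * x (l mod r))) {..<q * r} = 1\<^sub>m n"
 proof (rule emb_inj[of _ n n])
 have "emb (mat_sum n n (%l. mat_adjoint (w (l div r) * x (l mod r)) * (v (l div r) * x (l mod r))) {..<q * r})
 = (\<Sum>l<q * r. ad (emb (w (l div r)) * emb (x (l mod r))) * (emb (v (l div r)) * emb (x (l mod r))))"
 using comp by (subst emb_mat_sum) (auto intro!: sum.cong mult_carrier_mat[of _ n k] simp: emb_adjoint_mult[of _ k n])
 also have "... = (\<Sum>a<q. \<Sum>j<r. ad (emb (w a) * emb (x j)) * (emb (v a) * emb (x j)))"
 by (rule sum_div_mod)
 also have "... = (\<Sum>j<r. \<Sum>a<q. ad (emb (x j)) * (ad (emb (w a)) * emb (v a)) * emb (x j))"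
 by (subst sum.swap) (simp add: mult.assoc)
 also have "... = (\<Sum>j<r. ad (emb (x j)) * (\<Sum>a<q. ad (emb (w a)) * emb (v a)) * emb (x j))"
 by (simp add: sum_distrib_left sum_distrib_right)
 also have "... = (\<Sum>j<r. ad (emb (x j)) * emb (x j))"
 unfolding one'
 proof (intro sum.cong refl)
 fix j assume "j : {..<r}"
 then have "pr m * emb (x j) = emb (x j)" using opsD(1)[OF emb_ops[OF x[of j]]] by simp
 then show "ad (emb (x j)) * pr m * emb (x j) = ad (emb (x j)) * emb (x j)" by (simp add: mult.assoc)
 qed
 finally show "emb (mat_sum n n (%l. mat_adjoint (w (l div r) * x (l mod r)) * (v (l div r) * x (l mod r))) {..<q * r}) = emb (1\<^sub>m n)"
 by (simp add: unit')
 qed simp_all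
 qed
qed

lemma representation_span_carrier:
 assumes "!!i. i < r ==> v i : carrier_mat k n & w i : carrier_mat k n"
 shows "representation_span n r v w \<subseteq> carrier_mat n n"
 "emb ` representation_span n r v w = scl.span {ad (emb (w i)) * emb (v j) | i j. i < r & j < r}"
proof -
 let ?X = "{mat_adjoint (w i) * v j | i j. i < r & j < r}"
 have X: "?X \<subseteq> carrier_mat n n"
 proof
 fix y assume "y : ?X"
 then obtain i j where ij: "i < r" "j < r" "y = mat_adjoint (w i) * v j" by blast
 show "y : carrier_mat n n" unfolding ij(3) using assms[OF ij(1)] assms[OF ij(2)] by (intro mult_carrier_mat[of _ n k]) auto
 qed
 show "representation_span n r v w \<subseteq> carrier_mat n n"
 unfolding representation_span_def mat_span_eq[OF X] by blast
 have "emb ` ?X = {ad (emb (w i)) * emb (v j) | i j. i < r & j < r}"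
 proof (intro equalityI subsetI)
 fix y assume "y : emb ` ?X"
 then obtain i j where ij: "i < r" "j < r" "y = emb (mat_adjoint (w i) * v j)" by blast
 then have "y = ad (emb (w i)) * emb (v j)" using assms[OF ij(1)] assms[OF ij(2)] by (simp add: emb_adjoint_mult[of _ k n])
 then show "y : {ad (emb (w i)) * emb (v j) | i j. i < r & j < r}" using ij by blast
 next
 fix y assume "y : {ad (emb (w i)) * emb (v j) | i j. i < r & j < r}"
 then obtain i j where ij: "i < r" "j < r" "y = ad (emb (w i)) * emb (v j)" by blast
 then have "y = emb (mat_adjoint (w i) * v j)" using assms[OF ij(1)] assms[OF ij(2)] by (simp add: emb_adjoint_mult[of _ k n])
 then show "y : emb ` ?X" using ij by blast
 qed
 then show "emb ` representation_span n r v w = scl.span {ad (emb (w i)) * emb (v j) | i j. i < r & j < r}"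
 unfolding representation_span_def emb_mat_span[OF X] by simp
qed

lemma sandwich_span:
 "scl.span {ad (y i) * t * y j | i j t. i < r & j < r & t : scl.span G}
 = scl.span {ad (y i) * t * y j | i j t. i < (r :: nat) & j < r & t : G}" (is "scl.span ?A = scl.span ?B")
proof
 have "?B \<subseteq> ?A" using scl.span_base[of _ G] by blast
 then show "scl.span ?B \<subseteq> scl.span ?A" by (rule scl.span_mono)
 show "scl.span ?A \<subseteq> scl.span ?B"
 proof (rule scl.span_minimal[OF _ scl.subspace_span])
 show "?A \<subseteq> scl.span ?B"
 proof
 fix z assume "z : ?A"
 then obtain i j t where z: "i < r" "j < r" "t : scl.span G" "z = ad (y i) * t * y j" by blast
 have "scl.span G \<subseteq> {t. ad (y i) * t * y j : scl.span ?B}"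
 proof (rule scl.span_minimal)
 show "G \<subseteq> {t. ad (y i) * t * y j : scl.span ?B}" using z(1,2) by (auto intro!: scl.span_base)
 show "scl.subspace {t. ad (y i) * t * y j : scl.span ?B}"
 by (auto simp: scl.subspace_def distrib_left distrib_right scl.span_zero scl.span_add scl.span_scale)
 qed
 then show "z : scl.span ?B" using z by blast
 qed
 qed
qed

lemma compose_span:
 assumes x: "!!i. i < r ==> x i : carrier_mat m n" and rep: "represents m k \<Phi> q v w"
 shows "emb ` representation_span n (q * r) (%l. v (l div r) * x (l mod r)) (%l. w (l div r) * x (l mod r))
 = scl.span {ad (emb (x i)) * t * emb (x j) | i j t. i < r & j < r & t : emb ` representation_span m q v w}"
proof -
 have vw: "v a : carrier_mat k m & w a : carrier_mat k m" if "a < q" for a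
 using rep that by (auto simp: represents_def)
 have comp: "v (l div r) * x (l mod r) : carrier_mat k n & w (l div r) * x (l mod r) : carrier_mat k n"
 "emb (v (l div r) * x (l mod r)) = emb (v (l div r)) * emb (x (l mod r))"
 "emb (w (l div r) * x (l mod r)) = emb (w (l div r)) * emb (x (l mod r))" if "l < q * r" for l
 using vw[OF div_mod_less(1)[OF that]] x[OF div_mod_less(2)[OF that]]
 by (auto simp: emb_mult[of _ k m _ n])
 let ?A = "{ad (emb (w (l div r) * x (l mod r))) * emb (v (l' div r) * x (l' mod r)) | l l'. l < q * r & l' < q * r}"
 let ?B = "{ad (emb (x i)) * t * emb (x j) | i j t. i < r & j < r & t : {ad (emb (w a)) * emb (v b) | a b. a < q & b < q}}"
 have "?A = ?B"
 proof (intro equalityI subsetI)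
 fix z assume "z : ?A"
 then obtain l l' where z: "l < q * r" "l' < q * r" "z = ad (emb (w (l div r) * x (l mod r))) * emb (v (l' div r) * x (l' mod r))" by blast
 then have "z = ad (emb (x (l mod r))) * (ad (emb (w (l div r))) * emb (v (l' div r))) * emb (x (l' mod r))"
 by (simp add: comp mult.assoc)
 then show "z : ?B" using div_mod_less[OF z(1)] div_mod_less[OF z(2)] by blast
 next
 fix z assume "z : ?B"
 then obtain i j a b where z: "i < r" "j < r" "a < q" "b < q" "z = ad (emb (x i)) * (ad (emb (w a)) * emb (v b)) * emb (x j)" by blast
 obtain l l' where l: "l < q * r" "l div r = a" "l mod r = i" "l' < q * r" "l' div r = b" "l' mod r = j"
 using div_mod_witness[OF z(3,1)] div_mod_witness[OF z(4,2)] by blast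
 have "z = ad (emb (w (l div r) * x (l mod r))) * emb (v (l' div r) * x (l' mod r))"
 unfolding comp(2)[OF l(4)] comp(3)[OF l(1)] by (simp add: l z(5) mult.assoc)
 then show "z : ?A" using l(1,4) by blast
 qed
 have e1: "emb ` representation_span n (q * r) (%l. v (l div r) * x (l mod r)) (%l. w (l div r) * x (l mod r)) = scl.span ?A"
 by (rule representation_span_carrier(2)[of _ _ k]) (rule comp(1))
 have e2: "emb ` representation_span m q v w = scl.span {ad (emb (w a)) * emb (v b) | a b. a < q & b < q}"
 by (rule representation_span_carrier(2)[of _ _ k]) (rule vw)
 show ?thesis unfolding e1 e2 sandwich_span by (rule arg_cong[OF \<open>?A = ?B\<close>])
qed

lemma operator_systemD:
 assumes "operator_system n S"
 shows "S \<subseteq> carrier_mat n n" "1\<^sub>m n : S" "x : S ==> mat_adjoint x : S"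
 using assms by (auto simp: operator_system_def mat_subspace_def)

lemma pullback_connects:
 assumes S: "S \<subseteq> carrier_mat n n" and "pullback n S m T"
 obtains r x where "connects n S m T r x"
proof -
 obtain r :: nat and x where x: "!!i. i < r ==> x i : carrier_mat m n"
 "mat_sum n n (%i. mat_adjoint (x i) * x i) {..<r} = 1\<^sub>m n"
 "S = mat_span n n {mat_adjoint (x i) * t * x j | i j t. i < r & j < r & t : T}"
 using assms(2) unfolding pullback_def by blast
 have "{mat_adjoint (x i) * t * x j | i j t. i < r & j < r & t : T} \<subseteq> S"
 unfolding x(3) mat_span_def by (rule hull_subset)
 then have "connects n S m T r x" unfolding connects_def using x(1,2) by blast
 then show thesis by (rule that)
qed

text \<open>Equality of the span with \<open>T\<close> is recorded separately, as quantum complexity requires it.\<close>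

lemma pullback_represents:
 assumes S: "S \<subseteq> carrier_mat n n" and T: "T \<subseteq> carrier_mat m m" and pb: "pullback n S m T"
 obtains r \<Theta> where "quantum_channel n m \<Theta>"
 "!!k \<Phi> q v w. represents m k \<Phi> q v w ==> representation_span m q v w \<subseteq> T ==>
 \<exists>v' w'. represents n k (%c. \<Phi> (\<Theta> c)) (q * r) v' w' & (v = w --> v' = w') &
 representation_span n (q * r) v' w' \<subseteq> S &
 (representation_span m q v w = T --> representation_span n (q * r) v' w' = S)"
proof -
 obtain r :: nat and x where x: "!!i. i < r ==> x i : carrier_mat m n"
 "mat_sum n n (%i. mat_adjoint (x i) * x i) {..<r} = 1\<^sub>m n"
 "S = mat_span n n {mat_adjoint (x i) * t * x j | i j t. i < r & j < r & t : T}"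
 using pb unfolding pullback_def by blast
 have eS: "emb ` S = scl.span {ad (emb (x i)) * t * emb (x j) | i j t. i < r & j < r & t : emb ` T}"
 unfolding x(3) by (rule pullback_span[OF T x(1)])
 show thesis
 proof (rule that)
 show "quantum_channel n m (transport m r x)" by (rule transport_channel[OF x(1,2)])
 fix k \<Phi> q v w assume rep: "represents m k \<Phi> q v w" and sub: "representation_span m q v w \<subseteq> T"
 let ?v = "%l. v (l div r) * x (l mod r)" and ?w = "%l. w (l div r) * x (l mod r)"
 have rep': "represents n k (%c. \<Phi> (transport m r x c)) (q * r) ?v ?w"
 by (rule represents_compose[OF x(1,2) rep])
 then have car: "representation_span n (q * r) ?v ?w \<subseteq> carrier_mat n n"
 by (intro representation_span_carrier(1)[of _ _ k]) (simp add: represents_def)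
 have span: "emb ` representation_span n (q * r) ?v ?w
 = scl.span {ad (emb (x i)) * t * emb (x j) | i j t. i < r & j < r & t : emb ` representation_span m q v w}"
 by (rule compose_span[OF _ rep]) (rule x(1))
 have 1: "representation_span n (q * r) ?v ?w \<subseteq> S"
 proof (rule emb_image_subset[OF car S])
 show "emb ` representation_span n (q * r) ?v ?w \<subseteq> emb ` S"
 unfolding span eS using sub by (intro scl.span_mono) blast
 qed
 have 2: "representation_span n (q * r) ?v ?w = S" if "representation_span m q v w = T"
 proof (rule antisym[OF 1], rule emb_image_subset[OF S car])
 show "emb ` S \<subseteq> emb ` representation_span n (q * r) ?v ?w" unfolding span eS that ..
 qed
 show "\<exists>v' w'. represents n k (%c. \<Phi> (transport m r x c)) (q * r) v' w' & (v = w --> v' = w') &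
 representation_span n (q * r) v' w' \<subseteq> S &
 (representation_span m q v w = T --> representation_span n (q * r) v' w' = S)"
 using rep' 1 2 by blast
 qed
qed

section \<open>Quantum complexity, subcomplexity and Haemers bound\<close>

lemma complexity_transfer:
 assumes S: "S \<subseteq> carrier_mat n n" and T: "T \<subseteq> carrier_mat m m" and pb: "pullback n S m T"
 shows "\<exists>\<Phi>. quantum_channel m k \<Phi> & channel_graph m k \<Phi> T ==>
 \<exists>\<Phi>. quantum_channel n k \<Phi> & channel_graph n k \<Phi> S"
 and "\<exists>\<Phi> R. quantum_channel m k \<Phi> & channel_graph m k \<Phi> R & R \<subseteq> T ==>
 \<exists>\<Phi> R. quantum_channel n k \<Phi> & channel_graph n k \<Phi> R & R \<subseteq> S"
 and "\<exists>\<Phi> r v w. linear_map m k \<Phi> & trace_preserving m \<Phi> &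
 represents m k \<Phi> r v w & representation_span m r v w \<subseteq> T ==>
 \<exists>\<Phi> r v w. linear_map n k \<Phi> & trace_preserving n \<Phi> &
 represents n k \<Phi> r v w & representation_span n r v w \<subseteq> S"
proof -
 obtain r \<Theta> where \<Theta>: "quantum_channel n m \<Theta>"
 and rep: "!!k \<Phi> q v w. represents m k \<Phi> q v w ==> representation_span m q v w \<subseteq> T ==>
 \<exists>v' w'. represents n k (%c. \<Phi> (\<Theta> c)) (q * r) v' w' & (v = w --> v' = w') &
 representation_span n (q * r) v' w' \<subseteq> S &
 (representation_span m q v w = T --> representation_span n (q * r) v' w' = S)"
 by (rule pullback_represents[OF S T pb]) (rule that; assumption)
 show "\<exists>\<Phi>. quantum_channel n k \<Phi> & channel_graph n k \<Phi> S"
 if "\<exists>\<Phi>. quantum_channel m k \<Phi> & channel_graph m k \<Phi> T"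
 proof -
 from that obtain \<Phi> q v where \<Phi>: "quantum_channel m k \<Phi>" "represents m k \<Phi> q v v" "T = representation_span m q v v"
 unfolding channel_graph_def by blast
 from rep[OF \<Phi>(2)] \<Phi>(3) obtain v' where "represents n k (%c. \<Phi> (\<Theta> c)) (q * r) v' v'" "representation_span n (q * r) v' v' = S"
 by auto
 then have "channel_graph n k (%c. \<Phi> (\<Theta> c)) S" unfolding channel_graph_def by blast
 with channel_compose[OF \<Theta> \<Phi>(1)] show ?thesis by blast
 qed
 show "\<exists>\<Phi> R. quantum_channel n k \<Phi> & channel_graph n k \<Phi> R & R \<subseteq> S"
 if "\<exists>\<Phi> R. quantum_channel m k \<Phi> & channel_graph m k \<Phi> R & R \<subseteq> T"
 proof -
 from that obtain \<Phi> q v where \<Phi>: "quantum_channel m k \<Phi>" "represents m k \<Phi> q v v" "representation_span m q v v \<subseteq> T"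
 unfolding channel_graph_def by blast
 from rep[OF \<Phi>(2,3)] obtain v' where "represents n k (%c. \<Phi> (\<Theta> c)) (q * r) v' v'" "representation_span n (q * r) v' v' \<subseteq> S"
 by auto
 then have "channel_graph n k (%c. \<Phi> (\<Theta> c)) (representation_span n (q * r) v' v')" "representation_span n (q * r) v' v' \<subseteq> S"
 unfolding channel_graph_def by blast+
 with channel_compose[OF \<Theta> \<Phi>(1)] show ?thesis by blast
 qed
 show "\<exists>\<Phi> r v w. linear_map n k \<Phi> & trace_preserving n \<Phi> & represents n k \<Phi> r v w & representation_span n r v w \<subseteq> S"
 if "\<exists>\<Phi> r v w. linear_map m k \<Phi> & trace_preserving m \<Phi> & represents m k \<Phi> r v w & representation_span m r v w \<subseteq> T"
 proof -
 from that obtain \<Phi> q v w where \<Phi>: "linear_map m k \<Phi>" "trace_preserving m \<Phi>" "represents m k \<Phi> q v w"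
 "representation_span m q v w \<subseteq> T" by blast
 from rep[OF \<Phi>(3,4)] obtain v' w' where "represents n k (%c. \<Phi> (\<Theta> c)) (q * r) v' w'" "representation_span n (q * r) v' w' \<subseteq> S"
 by blast
 moreover have "linear_map n k (%c. \<Phi> (\<Theta> c))" "trace_preserving n (%c. \<Phi> (\<Theta> c))"
 using \<Theta> \<Phi>(1,2) by (simp_all add: quantum_channel_def linear_map_def trace_preserving_def)
 ultimately show ?thesis by blast
 qed
qed

section \<open>Lovasz numbers\<close>

lemma channels_transfer:
 assumes S: "S \<subseteq> carrier_mat n n" and T: "T \<subseteq> carrier_mat m m" and pb: "pullback n S m T"
 obtains \<Theta> where "quantum_channel n m \<Theta>"
 "!!k \<Phi>. (k, \<Phi>) : channels m T ==> (k, %c. \<Phi> (\<Theta> c)) : channels n S"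
proof -
 obtain r \<Theta> where \<Theta>: "quantum_channel n m \<Theta>"
 and rep: "!!k \<Phi> q v w. represents m k \<Phi> q v w ==> representation_span m q v w \<subseteq> T ==>
 \<exists>v' w'. represents n k (%c. \<Phi> (\<Theta> c)) (q * r) v' w' & (v = w --> v' = w') &
 representation_span n (q * r) v' w' \<subseteq> S &
 (representation_span m q v w = T --> representation_span n (q * r) v' w' = S)"
 by (rule pullback_represents[OF S T pb]) (rule that; assumption)
 show thesis
 proof (rule that[OF \<Theta>])
 fix k \<Phi> assume "(k, \<Phi>) : channels m T"
 then obtain q v where \<Phi>: "quantum_channel m k \<Phi>" "represents m k \<Phi> q v v" "representation_span m q v v \<subseteq> T"
 unfolding channels_def channel_graph_def by blast
 from rep[OF \<Phi>(2,3)] obtain v' where "represents n k (%c. \<Phi> (\<Theta> c)) (q * r) v' v'" "representation_span n (q * r) v' v' \<subseteq> S"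
 by auto
 then have "channel_graph n k (%c. \<Phi> (\<Theta> c)) (representation_span n (q * r) v' v')" "representation_span n (q * r) v' v' \<subseteq> S"
 unfolding channel_graph_def by blast+
 with channel_compose[OF \<Theta> \<Phi>(1)] show "(k, %c. \<Phi> (\<Theta> c)) : channels n S" unfolding channels_def by blast
 qed
qed

lemma channel_states:
 assumes \<Theta>: "quantum_channel n m \<Theta>" and \<rho>: "\<rho> : states n"
 shows "\<Theta> \<rho> : states m"
proof -
 have c: "\<rho> : carrier_mat n n" "mat_trace \<rho> = 1" "!!\<xi>. \<xi> : carrier_vec n ==> 0 \<le> cip \<xi> (\<rho> *\<^sub>v \<xi>)"
 using \<rho> by (auto simp: states_def psd_def)
 have "block_psd n 1 (%_ _. \<rho>)" using c by (simp add: block_psd_def)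
 then have "block_psd m 1 (%_ _. \<Theta> \<rho>)"
 using \<Theta>[unfolded quantum_channel_def completely_positive_def, THEN conjunct2, THEN conjunct1, rule_format, of 1 "%_ _. \<rho>"] c(1)
 by simp
 then have "0 \<le> cip \<xi> (\<Theta> \<rho> *\<^sub>v \<xi>)" if "\<xi> : carrier_vec m" for \<xi>
 using that unfolding block_psd_def by (auto dest: spec[of _ "%_. \<xi>"])
 moreover have "\<Theta> \<rho> : carrier_mat m m" "mat_trace (\<Theta> \<rho>) = 1"
 using \<Theta> c by (auto simp: quantum_channel_def linear_map_def trace_preserving_def)
 ultimately show ?thesis by (simp add: states_def psd_def)
qed

text \<open>Cauchy-Schwarz inequality for the form of \<open>A\<close>.\<close>

lemma positive_entry:
 assumes "positive A"
 shows "(cmod (ip \<xi> (A \<rhd> \<eta>)))\<^sup>2 \<le> Re (ip \<xi> (A \<rhd> \<xi>)) * Re (ip \<eta> (A \<rhd> \<eta>))"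
proof -
 let ?a = "Re (ip \<xi> (A \<rhd> \<xi>))" and ?b = "Re (ip \<eta> (A \<rhd> \<eta>))" and ?c = "ip \<xi> (A \<rhd> \<eta>)"
 have pos: "0 \<le> Re (ip \<zeta> (A \<rhd> \<zeta>))" for \<zeta>
 using assms by (simp add: positive_def complex_nonneg_iff)
 have h: "ad A = A" using positive_hermitian[OF assms] by (simp add: hermitian_def)
 have sym: "ip \<eta> (A \<rhd> \<xi>) = cnj ?c" by (metis h ip_ad_left ip_commute)
 have q: "0 \<le> ?a + 2 * Re (t * ?c) + (cmod t)\<^sup>2 * ?b" for t
 proof -
 have "ip (\<xi> + smult t \<eta>) (A \<rhd> (\<xi> + smult t \<eta>))
 = ip \<xi> (A \<rhd> \<xi>) + (t * ?c + cnj (t * ?c)) + (t * cnj t) * ip \<eta> (A \<rhd> \<eta>)"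
 by (simp add: ip_add_right ip_add_left ip_smult_right ip_smult_left sym algebra_simps)
 also have "t * cnj t = complex_of_real ((cmod t)\<^sup>2)" by (rule complex_norm_square[symmetric])
 finally have eq: "ip (\<xi> + smult t \<eta>) (A \<rhd> (\<xi> + smult t \<eta>))
 = ip \<xi> (A \<rhd> \<xi>) + (t * ?c + cnj (t * ?c)) + complex_of_real ((cmod t)\<^sup>2) * ip \<eta> (A \<rhd> \<eta>)" .
 have re: "Re (complex_of_real u * w) = u * Re w" for u w by simp
 have "Re (ip (\<xi> + smult t \<eta>) (A \<rhd> (\<xi> + smult t \<eta>))) = ?a + (Re (t * ?c) + Re (t * ?c)) + (cmod t)\<^sup>2 * ?b"
 unfolding eq by (simp only: plus_complex.sel cnj.sel re)
 then have "Re (ip (\<xi> + smult t \<eta>) (A \<rhd> (\<xi> + smult t \<eta>))) = ?a + 2 * Re (t * ?c) + (cmod t)\<^sup>2 * ?b" by linarith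
 then show ?thesis using pos by metis
 qed
 have cc: "Re (of_real s * cnj ?c * ?c) = s * (cmod ?c)\<^sup>2" for s
 proof -
 have "of_real s * cnj ?c * ?c = of_real s * (?c * cnj ?c)" by (simp only: mult_ac)
 also have "... = of_real (s * (cmod ?c)\<^sup>2)" by (simp only: complex_norm_square[symmetric] of_real_mult)
 finally show ?thesis by (simp only: Re_complex_of_real)
 qed
 show ?thesis
 proof (cases "?b = 0")
 case True
 have "?c = 0"
 proof (rule ccontr)
 assume "?c ~= 0"
 then have c: "0 < (cmod ?c)\<^sup>2" by simp
 have "0 \<le> ?a + 2 * (- (?a + 1) / (cmod ?c)\<^sup>2 * (cmod ?c)\<^sup>2)"
 using q[of "of_real (- (?a + 1) / (cmod ?c)\<^sup>2) * cnj ?c"] unfolding cc True by simp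
 then show False using c pos[of \<xi>] by simp
 qed
 then show ?thesis by (simp add: True)
 next
 case False
 then have b: "0 < ?b" using pos[of \<eta>] by simp
 have "0 \<le> ?a + 2 * (- 1 / ?b * (cmod ?c)\<^sup>2) + (cmod (of_real (- 1 / ?b) * cnj ?c))\<^sup>2 * ?b"
 using q[of "of_real (- 1 / ?b) * cnj ?c"] unfolding cc .
 also have "(cmod (of_real (- 1 / ?b) * cnj ?c))\<^sup>2 * ?b = (cmod ?c)\<^sup>2 / ?b"
 using b by (simp add: norm_mult norm_divide power_mult_distrib power_divide power2_eq_square)
 finally show ?thesis using b by (simp add: field_simps)
 qed
qed

text \<open>Bounds that make the suprema and infima in the Lovasz numbers finite. The Frobenius norm of a state is at most its trace,
since the entries satisfy \<open>\<bar>\<sigma>\<^sub>i\<^sub>j\<bar>\<^sup>2 \<le> \<sigma>\<^sub>i\<^sub>i \<sigma>\<^sub>j\<^sub>j\<close>.\<close>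

lemma op_norm_state:
 assumes "\<sigma> : states k"
 shows "0 \<le> op_norm \<sigma>" "op_norm \<sigma> \<le> 1"
proof -
 have c: "\<sigma> : carrier_mat k k" "mat_trace \<sigma> = 1" "!!\<xi>. \<xi> : carrier_vec k ==> 0 \<le> cip \<xi> (\<sigma> *\<^sub>v \<xi>)"
 using assms by (auto simp: states_def psd_def)
 define A where "A = emb \<sigma>"
 have "block_psd k 1 (%_ _. \<sigma>)" using c by (simp add: block_psd_def)
 then have "bpos {..<1 :: nat} (%_ _. A)"
 unfolding A_def by (rule block_psd_iff[THEN iffD1, rotated]) (use c(1) in simp)
 then have A: "positive A" unfolding bpos_def positive_def by (auto dest: spec[of _ "%_. _"])
 have entry: "coeff (A \<rhd> bvec j) i = \<sigma> $$ (i, j)" if "i < k" "j < k" for i j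
 unfolding A_def by (rule coeff_emb[OF c(1) that])
 define d where "d i = Re (\<sigma> $$ (i, i))" for i
 have d: "(\<Sum>i<k. d i) = 1"
 using arg_cong[OF c(2), of Re] c(1) by (simp add: mat_trace_def d_def)
 have minor: "(cmod (\<sigma> $$ (i, j)))\<^sup>2 \<le> d i * d j" if "i < k" "j < k" for i j
 using positive_entry[OF A, of "bvec i" "bvec j"] that by (simp add: entry d_def)
 have vn: "(vnorm v)\<^sup>2 = (\<Sum>i<k. (cmod (v $ i))\<^sup>2)" if "v : carrier_vec k" for v
 by (simp add: vnorm_vemb[OF that] sqn_spc[OF vemb_spc[OF that]] coeff_vemb[OF that])
 have bound: "vnorm (\<sigma> *\<^sub>v v) \<le> 1" if v: "v : carrier_vec k" "vnorm v \<le> 1" for v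
 proof -
 have vn0: "0 \<le> vnorm v" by (simp add: vnorm_def cip_vemb[OF v(1) v(1)] ip_self)
 have "(vnorm (\<sigma> *\<^sub>v v))\<^sup>2 = (\<Sum>i<k. (cmod ((\<sigma> *\<^sub>v v) $ i))\<^sup>2)"
 using c(1) v(1) by (intro vn) auto
 also have "... \<le> (\<Sum>i<k. d i * 1)"
 proof (intro sum_mono)
 fix i assume i: "i : {..<k}"
 have "(\<sigma> *\<^sub>v v) $ i = (\<Sum>j<k. \<sigma> $$ (i, j) * v $ j)"
 using c(1) v(1) i by (auto simp: scalar_prod_def atLeast0LessThan intro!: sum.cong)
 then have "cmod ((\<sigma> *\<^sub>v v) $ i) \<le> (\<Sum>j<k. cmod (\<sigma> $$ (i, j)) * cmod (v $ j))"
 by (simp add: sum_norm_le norm_mult)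
 then have "(cmod ((\<sigma> *\<^sub>v v) $ i))\<^sup>2 \<le> (\<Sum>j<k. cmod (\<sigma> $$ (i, j)) * cmod (v $ j))\<^sup>2"
 by (intro power_mono) auto
 also have "... \<le> (\<Sum>j<k. (cmod (\<sigma> $$ (i, j)))\<^sup>2) * (\<Sum>j<k. (cmod (v $ j))\<^sup>2)"
 proof -
 have "(\<Sum>j<k. cmod (\<sigma> $$ (i, j)) * cmod (v $ j))
 \<le> L2_set (%j. cmod (\<sigma> $$ (i, j))) {..<k} * L2_set (%j. cmod (v $ j)) {..<k}"
 using L2_set_mult_ineq[of "%j. cmod (\<sigma> $$ (i, j))" "%j. cmod (v $ j)" "{..<k}"] by simp
 then have "(\<Sum>j<k. cmod (\<sigma> $$ (i, j)) * cmod (v $ j))\<^sup>2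
 \<le> (L2_set (%j. cmod (\<sigma> $$ (i, j))) {..<k} * L2_set (%j. cmod (v $ j)) {..<k})\<^sup>2"
 by (rule power_mono) (simp add: sum_nonneg)
 then show ?thesis by (simp add: L2_set_def power_mult_distrib sum_nonneg)
 qed
 also have "... \<le> (\<Sum>j<k. d i * d j) * 1"
 proof (rule mult_mono)
 show "(\<Sum>j<k. (cmod (\<sigma> $$ (i, j)))\<^sup>2) \<le> (\<Sum>j<k. d i * d j)"
 using i by (intro sum_mono minor) auto
 show "(\<Sum>j<k. (cmod (v $ j))\<^sup>2) \<le> 1"
 unfolding vn[OF v(1), symmetric] using v(2) vn0 by (simp add: power_le_one)
 show "0 \<le> (\<Sum>j<k. d i * d j)"
 using i by (intro sum_nonneg) (meson minor lessThan_iff order_trans zero_le_power2)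
 qed (simp add: sum_nonneg)
 also have "... = d i * 1" by (simp add: d flip: sum_distrib_left)
 finally show "(cmod ((\<sigma> *\<^sub>v v) $ i))\<^sup>2 \<le> d i * 1" .
 qed
 finally have "(vnorm (\<sigma> *\<^sub>v v))\<^sup>2 \<le> 1" by (simp add: d)
 then show ?thesis by (simp add: power_le_one_iff abs_square_le_1)
 qed
 let ?N = "{vnorm (\<sigma> *\<^sub>v \<xi>) | \<xi>. \<xi> : carrier_vec (dim_col \<sigma>) & vnorm \<xi> \<le> 1}"
 have le: "y \<le> 1" if "y : ?N" for y using that bound c(1) by auto
 have z: "vnorm (0\<^sub>v k) = 0" by (simp add: vnorm_def cip_def)
 have "\<sigma> *\<^sub>v 0\<^sub>v k = 0\<^sub>v k" using c(1) by (intro eq_vecI) auto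
 then have "0 : ?N" using z c(1) by (intro CollectI exI[of _ "0\<^sub>v k"]) auto
 then show "0 \<le> op_norm \<sigma>" unfolding op_norm_def by (rule cSup_upper) (rule bdd_aboveI[of _ 1], rule le)
 show "op_norm \<sigma> \<le> 1" unfolding op_norm_def by (rule cSup_least[OF _ le]) (use \<open>0 : ?N\<close> in blast)
qed

lemma channels_nonempty:
 assumes "operator_system n S"
 shows "channels n S ~= {}"
proof -
 have S: "mat_subspace n n S" "1\<^sub>m n : S" using assms by (auto simp: operator_system_def)
 note one = mat_adjoint_one[of n]
 have "represents n n (%c. c) 1 (%_. 1\<^sub>m n) (%_. 1\<^sub>m n)"
 unfolding represents_def by (auto simp: one mat_sum_def intro!: eq_matI)
 moreover have "representation_span n 1 (%_. 1\<^sub>m n) (%_. 1\<^sub>m n) \<subseteq> S"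
 unfolding representation_span_def mat_span_def
 by (rule hull_minimal) (use S one in auto)
 moreover have "quantum_channel n n (%c. c)"
 by (simp add: quantum_channel_def linear_map_def completely_positive_def trace_preserving_def)
 ultimately have "(n, %c. c) : channels n S" unfolding channels_def channel_graph_def by blast
 then show ?thesis by blast
qed

lemma channels_norm:
 assumes "(k, \<Phi>) : channels n S" "\<rho> : states n"
 shows "0 \<le> op_norm (\<Phi> \<rho>)" "op_norm (\<Phi> \<rho>) \<le> 1"
proof -
 have "\<Phi> \<rho> : states k" by (rule channel_states[of n k \<Phi>]) (use assms in \<open>auto simp: channels_def\<close>)
 then show "0 \<le> op_norm (\<Phi> \<rho>)" "op_norm (\<Phi> \<rho>) \<le> 1" by (rule op_norm_state)+
qed

text \<open>Each channel \<open>\<Phi>\<close> for \<open>T\<close> has the counterpart \<open>\<Phi> \<circ> \<Theta>\<close> for \<open>S\<close>, and \<open>\<Theta>\<close> maps states to states.\<close>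

lemma lovasz_mono:
 assumes S: "operator_system n S" and T: "operator_system m T" and pb: "pullback n S m T"
 and ne: "states n ~= {}"
 shows "(INF \<sigma>\<in>states m. SUP (k, \<Phi>)\<in>channels m T. op_norm (\<Phi> \<sigma>))
 \<le> (INF \<rho>\<in>states n. SUP (k, \<Phi>)\<in>channels n S. op_norm (\<Phi> \<rho>))"
 and "(SUP (k, \<Phi>)\<in>channels m T. INF \<sigma>\<in>states m. op_norm (\<Phi> \<sigma>))
 \<le> (SUP (k, \<Phi>)\<in>channels n S. INF \<rho>\<in>states n. op_norm (\<Phi> \<rho>))"
proof -
 obtain \<Theta> where \<Theta>: "quantum_channel n m \<Theta>" "!!k \<Phi>. (k, \<Phi>) : channels m T ==> (k, %c. \<Phi> (\<Theta> c)) : channels n S"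
 by (rule channels_transfer[OF operator_systemD(1)[OF S] operator_systemD(1)[OF T] pb]) (rule that; assumption)
 note neT = channels_nonempty[OF T]
 have bdd: "bdd_above ((%(k, \<Phi>). op_norm (\<Phi> \<rho>)) ` channels d R)" if "\<rho> : states d" for d R \<rho>
 proof (rule bdd_aboveI2[where M = 1])
 fix a assume a: "a : channels d R"
 obtain k \<Phi> where "a = (k, \<Phi>)" by (cases a) auto
 then show "(case a of (k, \<Phi>) => op_norm (\<Phi> \<rho>)) \<le> 1" using channels_norm(2)[of k \<Phi> d R \<rho>] a that by simp
 qed
 show "(INF \<sigma>\<in>states m. SUP (k, \<Phi>)\<in>channels m T. op_norm (\<Phi> \<sigma>))
 \<le> (INF \<rho>\<in>states n. SUP (k, \<Phi>)\<in>channels n S. op_norm (\<Phi> \<rho>))"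
 proof (rule cINF_greatest[OF ne])
 fix \<rho> assume \<rho>: "\<rho> : states n"
 have t: "\<Theta> \<rho> : states m" by (rule channel_states[OF \<Theta>(1) \<rho>])
 have "bdd_below ((%\<sigma>. SUP (k, \<Phi>)\<in>channels m T. op_norm (\<Phi> \<sigma>)) ` states m)"
 proof (rule bdd_belowI2)
 fix \<sigma> assume \<sigma>: "\<sigma> : states m"
 obtain k \<Phi> where k: "(k, \<Phi>) : channels m T" using neT by auto
 show "0 \<le> (SUP (k, \<Phi>)\<in>channels m T. op_norm (\<Phi> \<sigma>))"
 using channels_norm(1)[OF k \<sigma>] by (intro cSUP_upper2[OF bdd[OF \<sigma>] k]) simp
 qed
 then have "(INF \<sigma>\<in>states m. SUP (k, \<Phi>)\<in>channels m T. op_norm (\<Phi> \<sigma>)) \<le> (SUP (k, \<Phi>)\<in>channels m T. op_norm (\<Phi> (\<Theta> \<rho>)))"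
 by (rule cINF_lower[OF _ t])
 also have "... \<le> (SUP (k, \<Phi>)\<in>channels n S. op_norm (\<Phi> \<rho>))"
 proof (rule cSUP_least[OF neT])
 fix a assume a: "a : channels m T"
 obtain k \<Phi> where ka: "a = (k, \<Phi>)" by (cases a) auto
 show "(case a of (k, \<Phi>) => op_norm (\<Phi> (\<Theta> \<rho>))) \<le> (SUP (k, \<Phi>)\<in>channels n S. op_norm (\<Phi> \<rho>))"
 using a by (intro cSUP_upper2[OF bdd[OF \<rho>] \<Theta>(2)[of k \<Phi>]]) (simp_all add: ka)
 qed
 finally show "(INF \<sigma>\<in>states m. SUP (k, \<Phi>)\<in>channels m T. op_norm (\<Phi> \<sigma>)) \<le> (SUP (k, \<Phi>)\<in>channels n S. op_norm (\<Phi> \<rho>))" .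
 qed
 have low: "bdd_below ((%\<rho>. op_norm (\<Phi> \<rho>)) ` states d)" if "(k, \<Phi>) : channels d R" for k \<Phi> d R
 by (rule bdd_belowI2[where m = 0]) (rule channels_norm(1)[OF that])
 have bdd2: "bdd_above ((%(k, \<Phi>). INF \<rho>\<in>states n. op_norm (\<Phi> \<rho>)) ` channels n S)"
 proof (rule bdd_aboveI2)
 fix a assume a: "a : channels n S"
 obtain k \<Phi> where ka: "a = (k, \<Phi>)" by (cases a) auto
 obtain \<rho> where \<rho>: "\<rho> : states n" using ne by blast
 have "(INF \<rho>\<in>states n. op_norm (\<Phi> \<rho>)) \<le> op_norm (\<Phi> \<rho>)"
 using a \<rho> by (intro cINF_lower low[of k \<Phi> n S]) (simp_all add: ka)
 also have "... \<le> 1" using channels_norm(2) a \<rho> unfolding ka by blast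
 finally show "(case a of (k, \<Phi>) => INF \<rho>\<in>states n. op_norm (\<Phi> \<rho>)) \<le> 1" by (simp add: ka)
 qed
 show "(SUP (k, \<Phi>)\<in>channels m T. INF \<sigma>\<in>states m. op_norm (\<Phi> \<sigma>))
 \<le> (SUP (k, \<Phi>)\<in>channels n S. INF \<rho>\<in>states n. op_norm (\<Phi> \<rho>))"
 proof (rule cSUP_least[OF neT])
 fix a assume a: "a : channels m T"
 obtain k \<Phi> where ka: "a = (k, \<Phi>)" by (cases a) auto
 have c: "(k, \<Phi>) : channels m T" using a ka by simp
 have "(INF \<sigma>\<in>states m. op_norm (\<Phi> \<sigma>)) \<le> (INF \<rho>\<in>states n. op_norm (\<Phi> (\<Theta> \<rho>)))"
 proof (rule cINF_greatest[OF ne])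
 fix \<rho> assume "\<rho> : states n"
 then show "(INF \<sigma>\<in>states m. op_norm (\<Phi> \<sigma>)) \<le> op_norm (\<Phi> (\<Theta> \<rho>))"
 by (intro cINF_lower[OF low[OF c]] channel_states[OF \<Theta>(1)])
 qed
 also have "... \<le> (SUP (k, \<Phi>)\<in>channels n S. INF \<rho>\<in>states n. op_norm (\<Phi> \<rho>))"
 by (intro cSUP_upper2[OF bdd2 \<Theta>(2)[OF c]]) simp
 finally show "(case a of (k, \<Phi>) => INF \<sigma>\<in>states m. op_norm (\<Phi> \<sigma>)) \<le> (SUP (k, \<Phi>)\<in>channels n S. INF \<rho>\<in>states n. op_norm (\<Phi> \<rho>))"
 by (simp add: ka)
 qed
qed

text \<open>For \<open>n = 0\<close> there are no states; both sides are then the same infimum of the empty set.\<close>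

lemma lovasz_eq:
 assumes S: "operator_system n S" and T: "operator_system m T"
 and pb: "pullback n S m T" "pullback m T n S"
 shows "lovasz n S = lovasz m T" "lovasz_hat n S = lovasz_hat m T"
proof -
 have imp: "states d ~= {} ==> states d' ~= {}" if h: "operator_system d R" "operator_system d' R'" "pullback d R d' R'" for d R d' R'
 proof -
 obtain \<Theta> where "quantum_channel d d' \<Theta>"
 by (rule channels_transfer[OF operator_systemD(1)[OF h(1)] operator_systemD(1)[OF h(2)] h(3)]) (rule that; assumption)
 then show "states d ~= {} ==> states d' ~= {}" using channel_states by blast
 qed
 show "lovasz n S = lovasz m T" "lovasz_hat n S = lovasz_hat m T"
 proof (atomize (full), cases "states n = {}")
 case True
 then have e: "states m = {}" using imp[OF T S pb(2)] by blast
 have const: "(SUP (k, \<Phi>)\<in>channels d R. INF \<rho>\<in>{}. op_norm (\<Phi> \<rho>)) = Inf {}" if "operator_system d R" for d R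
 proof -
 have "(%(k :: nat, \<Phi> :: complex mat => complex mat). INF \<rho>\<in>({} :: complex mat set). op_norm (\<Phi> \<rho>)) ` channels d R = {Inf {}}"
 using channels_nonempty[OF that] by (auto simp: case_prod_beta)
 then show ?thesis by simp
 qed
 show "lovasz n S = lovasz m T & lovasz_hat n S = lovasz_hat m T"
 unfolding lovasz_def lovasz_hat_def True e const[OF S] const[OF T] by simp
 next
 case False
 then have ne: "states m ~= {}" using imp[OF S T pb(1)] by blast
 have "(INF \<rho>\<in>states n. SUP (k, \<Phi>)\<in>channels n S. op_norm (\<Phi> \<rho>)) = (INF \<rho>\<in>states m. SUP (k, \<Phi>)\<in>channels m T. op_norm (\<Phi> \<rho>))"
 by (rule antisym[OF lovasz_mono(1)[OF T S pb(2) ne] lovasz_mono(1)[OF S T pb(1) False]])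
 moreover have "(SUP (k, \<Phi>)\<in>channels n S. INF \<rho>\<in>states n. op_norm (\<Phi> \<rho>)) = (SUP (k, \<Phi>)\<in>channels m T. INF \<rho>\<in>states m. op_norm (\<Phi> \<rho>))"
 by (rule antisym[OF lovasz_mono(2)[OF T S pb(2) ne] lovasz_mono(2)[OF S T pb(1) False]])
 ultimately show "lovasz n S = lovasz m T & lovasz_hat n S = lovasz_hat m T"
 unfolding lovasz_def lovasz_hat_def by simp
 qed
qed

section \<open>Independence number\<close>

lemma connectsD:
 assumes "connects n S m T r x"
 shows "i < r ==> x i : carrier_mat m n"
 "(\<Sum>i<r. ad (emb (x i)) * emb (x i)) = pr n"
 "i < r ==> j < r ==> t : T ==> mat_adjoint (x i) * t * x j : S"
proof -
 show x: "i < r ==> x i : carrier_mat m n" for i using assms by (simp add: connects_def)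
 have one: "mat_sum n n (%i. mat_adjoint (x i) * x i) {..<r} = 1\<^sub>m n" using assms by (simp add: connects_def)
 show "(\<Sum>i<r. ad (emb (x i)) * emb (x i)) = pr n"
 using emb_adjoint_mult_sum[of "{..<r}" x m n x] x by (simp add: one)
 show "i < r ==> j < r ==> t : T ==> mat_adjoint (x i) * t * x j : S"
 using assms by (simp add: connects_def)
qed

lemma rank_one_perp:
 assumes S: "S \<subseteq> carrier_mat n n" and v: "\<xi> : carrier_vec n" "\<eta> : carrier_vec n"
 shows "rank_one n \<xi> \<eta> : mat_perp n S \<longleftrightarrow> (\<forall>s\<in>S. ip (vemb \<xi>) (emb s \<rhd> vemb \<eta>) = 0)"
proof -
 have "mat_trace (mat_adjoint s * rank_one n \<xi> \<eta>) = cnj (ip (vemb \<xi>) (emb s \<rhd> vemb \<eta>))" if "s : S" for s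
 proof -
 have s: "s : carrier_mat n n" using S that by blast
 have "mat_trace (mat_adjoint s * rank_one n \<xi> \<eta>) = (\<Sum>i<n. \<Sum>j<n. cnj (s $$ (j, i)) * (\<xi> $ j * cnj (\<eta> $ i)))"
 using s by (subst mat_trace_mult[of _ n n]) (auto simp: rank_one_def mat_adjoint_index[of s n n] intro!: sum.cong)
 also have "... = (\<Sum>j<n. \<Sum>i<n. cnj (s $$ (j, i)) * (\<xi> $ j * cnj (\<eta> $ i)))" by (rule sum.swap)
 also have "... = cnj (cip \<xi> (s *\<^sub>v \<eta>))"
 using s v by (auto simp: cip_def scalar_prod_def atLeast0LessThan sum_distrib_right intro!: sum.cong)
 also have "cip \<xi> (s *\<^sub>v \<eta>) = ip (vemb \<xi>) (emb s \<rhd> vemb \<eta>)"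
 unfolding emb_mult_vec[OF s v(2)] by (rule cip_vemb[OF v(1) mult_mat_vec_carrier[OF s v(2)]])
 finally show ?thesis .
 qed
 moreover have "rank_one n \<xi> \<eta> : carrier_mat n n" by (simp add: rank_one_def)
 ultimately show ?thesis by (auto simp: mat_perp_def)
qed

definition independent_family :: "nat => complex mat set => nat => bool" where
 "independent_family n S N \<longleftrightarrow> (\<exists>\<xi> :: nat => complex vec.
 (\<forall>i<N. \<xi> i : carrier_vec n) &
 (\<forall>i<N. \<forall>j<N. cip (\<xi> i) (\<xi> j) = (if i = j then 1 else 0)) &
 (\<forall>i<N. \<forall>j<N. i ~= j --> rank_one n (\<xi> i) (\<xi> j) : mat_perp n S))"

text \<open>Some \<open>x\<^sub>j \<xi>\<^sub>i\<close> is nonzero because \<open>\<Sum> x\<^sub>j\<^sup>* x\<^sub>j = 1\<close>, and its inner products with the others are values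
\<open>\<langle>\<xi>\<^sub>i, s \<xi>\<^sub>k\<rangle>\<close> with \<open>s \<in> S\<close>. Orthogonality is the case \<open>t = 1\<close>.\<close>

lemma independent_transfer:
 assumes S: "S \<subseteq> carrier_mat n n" and T: "T \<subseteq> carrier_mat m m" "1\<^sub>m m : T"
 and con: "connects n S m T r x" and ind: "independent_family n S N"
 shows "independent_family m T N"
proof -
 note x = connectsD[OF con]
 obtain \<xi> :: "nat => complex vec" where \<xi>': "(\<forall>i<N. \<xi> i : carrier_vec n) &
 (\<forall>i<N. \<forall>j<N. cip (\<xi> i) (\<xi> j) = (if i = j then 1 else 0)) &
 (\<forall>i<N. \<forall>j<N. i ~= j --> rank_one n (\<xi> i) (\<xi> j) : mat_perp n S)"
 using ind unfolding independent_family_def by (elim exE) (rule that; assumption)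
 have \<xi>: "!!i. i < N ==> \<xi> i : carrier_vec n"
 "!!i j. i < N ==> j < N ==> cip (\<xi> i) (\<xi> j) = (if i = j then 1 else 0)"
 "!!i j. i < N ==> j < N ==> i ~= j ==> rank_one n (\<xi> i) (\<xi> j) : mat_perp n S"
 using \<xi>' by simp_all
 define a where "a i = vemb (\<xi> i)" for i
 define X where "X j = emb (x j)" for j
 have X: "X j : ops m n" if "j < r" for j unfolding X_def by (rule emb_ops[OF x(1)[OF that]])
 have perp: "ip (a i) (emb s \<rhd> a j) = 0" if "i < N" "j < N" "i ~= j" "s : S" for i j s
 using \<xi>(3)[OF that(1-3)] that(4) unfolding rank_one_perp[OF S \<xi>(1)[OF that(1)] \<xi>(1)[OF that(2)]] a_def by blast
 have "\<exists>j<r. X j \<rhd> a i ~= 0" if i: "i < N" for i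
 proof (rule ccontr)
 assume "\<not> (\<exists>j<r. X j \<rhd> a i ~= 0)"
 then have "(\<Sum>j<r. ad (X j) * X j) \<rhd> a i = 0" by (simp add: ap_sum_left)
 then have "pr n \<rhd> a i = 0" unfolding X_def x(2) .
 then have "a i = 0" using vemb_spc[OF \<xi>(1)[OF i]] by (simp add: a_def spc_def)
 then show False using \<xi>(2)[OF i i] cip_vemb[OF \<xi>(1)[OF i] \<xi>(1)[OF i]] by (simp add: a_def)
 qed
 then obtain c where c: "!!i. i < N ==> c i < r & X (c i) \<rhd> a i ~= 0" by metis
 define b where "b i = X (c i) \<rhd> a i" for i
 define \<kappa> where "\<kappa> i = complex_of_real (1 / sqrt (sqn (b i)))" for i
 define \<eta> where "\<eta> i = unvemb m (smult (\<kappa> i) (b i))" for i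
 have b: "b i : spc m" "b i ~= 0" if "i < N" for i
 using ops_ap[OF X] c[OF that] by (auto simp: b_def)
 have \<eta>: "\<eta> i : carrier_vec m" "vemb (\<eta> i) = smult (\<kappa> i) (b i)" if "i < N" for i
 using b(1)[OF that] by (simp_all add: \<eta>_def vemb_unvemb)
 have orth: "ip (b i) (emb t \<rhd> b j) = 0" if ij: "i < N" "j < N" "i ~= j" and t: "t : T" for i j t
 proof -
 have "ip (b i) (emb t \<rhd> b j) = ip (a i) ((ad (X (c i)) * emb t * X (c j)) \<rhd> a j)"
 by (simp add: b_def ip_ad_right)
 also have "ad (X (c i)) * emb t * X (c j) = emb (mat_adjoint (x (c i)) * t * x (c j))"
 unfolding X_def using c ij(1,2) T(1) t by (intro emb_sandwich[symmetric, of _ m n] x(1)) auto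
 also have "ip (a i) (... \<rhd> a j) = 0" using c ij x(3)[OF _ _ t] by (intro perp) auto
 finally show ?thesis .
 qed
 have orth1: "ip (b i) (b j) = 0" if "i < N" "j < N" "i ~= j" for i j
 using orth[OF that T(2)] b(1)[OF that(2)] by (simp add: spc_def)
 show ?thesis
 unfolding independent_family_def
 proof (intro exI[of _ \<eta>] conjI allI impI \<eta>(1))
 fix i j assume ij: "i < N" "j < N"
 have cip: "cip (\<eta> i) (\<eta> j) = cnj (\<kappa> i) * \<kappa> j * ip (b i) (b j)"
 by (simp add: cip_vemb[OF \<eta>(1)[OF ij(1)] \<eta>(1)[OF ij(2)]] \<eta>(2) ij)
 show "cip (\<eta> i) (\<eta> j) = (if i = j then 1 else 0)"
 proof (cases "i = j")
 case True
 have "0 < sqn (b i)" by (rule sqn_pos[OF b(2)[OF ij(1)]])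
 then have one: "1 / sqrt (sqn (b i)) * (1 / sqrt (sqn (b i))) * sqn (b i) = 1"
 by (simp add: field_simps b(2)[OF ij(1)])
 have "cip (\<eta> i) (\<eta> j) = complex_of_real (1 / sqrt (sqn (b i)) * (1 / sqrt (sqn (b i))) * sqn (b i))"
 unfolding cip unfolding True[symmetric] by (simp only: \<kappa>_def ip_self complex_cnj_complex_of_real of_real_mult)
 then show ?thesis unfolding one using True by simp
 next
 case False
 then show ?thesis using orth1[OF ij] by (simp add: cip)
 qed
 assume "i ~= j"
 then show "rank_one m (\<eta> i) (\<eta> j) : mat_perp m T"
 using orth[OF ij] by (simp add: rank_one_perp[OF T(1) \<eta>(1)[OF ij(1)] \<eta>(1)[OF ij(2)]] \<eta>(2) ij)
 qed
qed

section \<open>Tensor powers\<close>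

lemma kronecker_carrier:
 "x : carrier_mat a b ==> y : carrier_mat c d ==> kronecker x y : carrier_mat (a * c) (b * d)"
 by (auto simp: kronecker_def)

lemma kronecker_index:
 assumes "x : carrier_mat a b" "y : carrier_mat c d" "i < a * c" "j < b * d"
 shows "kronecker x y $$ (i, j) = x $$ (i div c, j div d) * y $$ (i mod c, j mod d)"
 using assms by (auto simp: kronecker_def)

lemma kronecker_mult:
 assumes x: "x : carrier_mat a b" "x' : carrier_mat b c" and y: "y : carrier_mat a' b'" "y' : carrier_mat b' c'"
 shows "kronecker x y * kronecker x' y' = kronecker (x * x') (y * y')"
proof (rule eq_matI)
 have k: "kronecker x y : carrier_mat (a * a') (b * b')" "kronecker x' y' : carrier_mat (b * b') (c * c')"
 "kronecker (x * x') (y * y') : carrier_mat (a * a') (c * c')"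
 using kronecker_carrier[OF x(1) y(1)] kronecker_carrier[OF x(2) y(2)]
 kronecker_carrier[OF mult_carrier_mat[OF x] mult_carrier_mat[OF y]] by auto
 show "dim_row (kronecker x y * kronecker x' y') = dim_row (kronecker (x * x') (y * y'))"
 "dim_col (kronecker x y * kronecker x' y') = dim_col (kronecker (x * x') (y * y'))" using k by auto
 fix i j assume "i < dim_row (kronecker (x * x') (y * y'))" "j < dim_col (kronecker (x * x') (y * y'))"
 then have ij: "i < a * a'" "j < c * c'" using k by auto
 note d = div_mod_less[OF ij(1)] div_mod_less[OF ij(2)]
 have "(kronecker x y * kronecker x' y') $$ (i, j) = (\<Sum>l<b * b'. kronecker x y $$ (i, l) * kronecker x' y' $$ (l, j))"
 using k ij by (auto simp: scalar_prod_def atLeast0LessThan intro!: sum.cong)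
 also have "... = (\<Sum>l<b * b'. (%u w. x $$ (i div a', u) * y $$ (i mod a', w) * (x' $$ (u, j div c') * y' $$ (w, j mod c'))) (l div b') (l mod b'))"
 using ij by (intro sum.cong refl) (simp add: kronecker_index[OF x(1) y(1)] kronecker_index[OF x(2) y(2)])
 also have "... = (\<Sum>u<b. \<Sum>w<b'. x $$ (i div a', u) * y $$ (i mod a', w) * (x' $$ (u, j div c') * y' $$ (w, j mod c')))"
 by (rule sum_div_mod)
 also have "... = (\<Sum>u<b. x $$ (i div a', u) * x' $$ (u, j div c')) * (\<Sum>w<b'. y $$ (i mod a', w) * y' $$ (w, j mod c'))"
 by (simp add: sum_product mult_ac)
 also have "... = (x * x') $$ (i div a', j div c') * (y * y') $$ (i mod a', j mod c')"
 using x y d by (simp add: scalar_prod_def atLeast0LessThan)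
 also have "... = kronecker (x * x') (y * y') $$ (i, j)"
 by (rule kronecker_index[OF mult_carrier_mat[OF x] mult_carrier_mat[OF y] ij, symmetric])
 finally show "(kronecker x y * kronecker x' y') $$ (i, j) = kronecker (x * x') (y * y') $$ (i, j)" .
qed

lemma kronecker_adjoint:
 assumes "x : carrier_mat a b" "y : carrier_mat c d"
 shows "mat_adjoint (kronecker x y) = kronecker (mat_adjoint x) (mat_adjoint y)"
proof (rule eq_matI)
 note k = kronecker_carrier[OF assms] and k' = kronecker_carrier[OF mat_adjoint_carrier[OF assms(1)] mat_adjoint_carrier[OF assms(2)]]
 note ka = mat_adjoint_carrier[OF k]
 show "dim_row (mat_adjoint (kronecker x y)) = dim_row (kronecker (mat_adjoint x) (mat_adjoint y))"
 "dim_col (mat_adjoint (kronecker x y)) = dim_col (kronecker (mat_adjoint x) (mat_adjoint y))" using ka k' by auto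
 fix i j assume "i < dim_row (kronecker (mat_adjoint x) (mat_adjoint y))" "j < dim_col (kronecker (mat_adjoint x) (mat_adjoint y))"
 then have ij: "i < b * d" "j < a * c" using k' by auto
 show "mat_adjoint (kronecker x y) $$ (i, j) = kronecker (mat_adjoint x) (mat_adjoint y) $$ (i, j)"
 using div_mod_less[OF ij(1)] div_mod_less[OF ij(2)] ij
 by (simp add: mat_adjoint_index[OF k] kronecker_index[OF assms]
 kronecker_index[OF mat_adjoint_carrier[OF assms(1)] mat_adjoint_carrier[OF assms(2)]]
 mat_adjoint_index[OF assms(1)] mat_adjoint_index[OF assms(2)])
qed

lemma kronecker_one: "kronecker (1\<^sub>m a) (1\<^sub>m b) = 1\<^sub>m (a * b)"
proof (rule eq_matI)
 fix i j assume "i < dim_row (1\<^sub>m (a * b) :: complex mat)" "j < dim_col (1\<^sub>m (a * b) :: complex mat)"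
 then have ij: "i < a * b" "j < a * b" by auto
 have "i = j \<longleftrightarrow> i div b = j div b & i mod b = j mod b" by (metis div_mult_mod_eq)
 then show "kronecker (1\<^sub>m a) (1\<^sub>m b) $$ (i, j) = 1\<^sub>m (a * b) $$ (i, j)"
 using div_mod_less[OF ij(1)] div_mod_less[OF ij(2)] ij
 by (simp add: kronecker_index[OF one_carrier_mat one_carrier_mat])
qed (simp_all add: kronecker_def)

lemma mat_span_subspace: "mat_subspace r c (mat_span r c X)" if "X \<subseteq> carrier_mat r c"
 unfolding mat_span_eq[OF that] by (rule mat_subspace_vimage[OF scl.subspace_span])

lemma mat_sandwich_subspace:
 assumes V: "mat_subspace n n V" and x: "x : carrier_mat n m" and y: "y : carrier_mat m n"
 shows "mat_subspace m m {t : carrier_mat m m. x * t * y : V}"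
 unfolding mat_subspace_def
proof (intro conjI ballI allI)
 have V': "0\<^sub>m n n : V" "!!a b. a : V ==> b : V ==> a + b : V" "!!z a. a : V ==> z \<cdot>\<^sub>m a : V"
 using V by (auto simp: mat_subspace_def)
 show "0\<^sub>m m m : {t : carrier_mat m m. x * t * y : V}" using x y V'(1) by simp
 fix s assume s: "s : {t : carrier_mat m m. x * t * y : V}"
 then have sc: "s : carrier_mat m m" "x * s * y : V" by auto
 show "z \<cdot>\<^sub>m s : {t : carrier_mat m m. x * t * y : V}" for z
 proof -
 have "x * (z \<cdot>\<^sub>m s) * y = z \<cdot>\<^sub>m (x * s * y)"
 using x y sc(1) by (simp add: mult_smult_distrib[OF x sc(1)] mult_smult_assoc_mat[OF mult_carrier_mat[OF x sc(1)] y])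
 then show ?thesis using V'(3)[OF sc(2)] sc(1) by simp
 qed
 fix t assume t: "t : {t : carrier_mat m m. x * t * y : V}"
 then have tc: "t : carrier_mat m m" "x * t * y : V" by auto
 have "x * (s + t) * y = x * s * y + x * t * y"
 unfolding mult_add_distrib_mat[OF x sc(1) tc(1)]
 by (rule add_mult_distrib_mat[OF mult_carrier_mat[OF x sc(1)] mult_carrier_mat[OF x tc(1)] y])
 then show "s + t : {t : carrier_mat m m. x * t * y : V}" using V'(2)[OF sc(2) tc(2)] sc(1) tc(1) by simp
qed auto

lemma tensor_generators:
 assumes "S \<subseteq> carrier_mat n n" "R \<subseteq> carrier_mat k k"
 shows "{kronecker x y | x y. x : S & y : R} \<subseteq> carrier_mat (n * k) (n * k)"
proof
 fix z assume "z : {kronecker x y | x y. x : S & y : R}"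
 then obtain x y where z: "x : S" "y : R" "z = kronecker x y" by blast
 show "z : carrier_mat (n * k) (n * k)" unfolding z(3) using z(1,2) assms by (intro kronecker_carrier) auto
qed

lemma tensor_power_system:
 assumes S: "S \<subseteq> carrier_mat n n" "1\<^sub>m n : S"
 shows "tensor_power n S N \<subseteq> carrier_mat (n ^ N) (n ^ N)" "1\<^sub>m (n ^ N) : tensor_power n S N"
proof (induction N)
 case 0
 show "tensor_power n S 0 \<subseteq> carrier_mat (n ^ 0) (n ^ 0)" by (simp add: mat_span_subset)
 show "1\<^sub>m (n ^ 0) : tensor_power n S 0" by (simp add: mat_span_def hull_inc)
next
 case (Suc N)
 show "tensor_power n S (Suc N) \<subseteq> carrier_mat (n ^ Suc N) (n ^ Suc N)"
 unfolding tensor_power.simps power_Suc by (rule mat_span_subset[OF tensor_generators[OF S(1) Suc(1)]])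
 have "kronecker (1\<^sub>m n) (1\<^sub>m (n ^ N)) : tensor_power n S (Suc N)"
 unfolding tensor_power.simps mat_span_def by (rule hull_inc) (use S(2) Suc(2) in blast)
 then show "1\<^sub>m (n ^ Suc N) : tensor_power n S (Suc N)" by (simp add: kronecker_one)
qed

lemma mat_span_one_sandwich: "t : mat_span 1 1 {1\<^sub>m 1} ==> 1\<^sub>m 1 * t * 1\<^sub>m 1 = (t :: complex mat)"
proof -
 assume "t : mat_span 1 1 {1\<^sub>m 1}"
 then have t: "t : carrier_mat 1 1" using mat_span_subset[of "{1\<^sub>m 1}" 1 1] by auto
 then show ?thesis by simp
qed

text \<open>The operators are \<open>x\<^sub>a \<otimes> y\<^sub>b\<close>, again indexed by \<open>l = a q + b\<close>.\<close>

lemma connects_tensor_power: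
 assumes S: "S \<subseteq> carrier_mat n n" "1\<^sub>m n : S" and T: "T \<subseteq> carrier_mat m m" "1\<^sub>m m : T"
 and con: "connects n S m T r x"
 shows "\<exists>q y. connects (n ^ N) (tensor_power n S N) (m ^ N) (tensor_power m T N) q y"
proof (induction N)
 case 0
 have "connects 1 (mat_span 1 1 {1\<^sub>m 1}) 1 (mat_span 1 1 {1\<^sub>m 1}) 1 (%_. 1\<^sub>m 1)"
 unfolding connects_def using mat_adjoint_one[of 1]
 by (auto simp: mat_span_one_sandwich[unfolded One_nat_def] mat_sum_def intro!: eq_matI)
 then show ?case unfolding power_0 tensor_power.simps by blast
next
 case (Suc N)
 then obtain q y where y: "connects (n ^ N) (tensor_power n S N) (m ^ N) (tensor_power m T N) q y" by blast
 have xc: "x i : carrier_mat m n" if "i < r" for i using con that by (simp add: connects_def)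
 have yc: "y i : carrier_mat (m ^ N) (n ^ N)" if "i < q" for i using y that by (simp add: connects_def)
 have x1: "mat_sum n n (%i. mat_adjoint (x i) * x i) {..<r} = 1\<^sub>m n" using con by (simp add: connects_def)
 have y1: "mat_sum (n ^ N) (n ^ N) (%i. mat_adjoint (y i) * y i) {..<q} = 1\<^sub>m (n ^ N)" using y by (simp add: connects_def)
 define w where "w l = kronecker (x (l div q)) (y (l mod q))" for l
 have wc: "w l : carrier_mat (m ^ Suc N) (n ^ Suc N)" if "l < r * q" for l
 unfolding w_def power_Suc by (rule kronecker_carrier[OF xc[OF div_mod_less(1)[OF that]] yc[OF div_mod_less(2)[OF that]]])
 have wa: "mat_adjoint (w l) = kronecker (mat_adjoint (x (l div q))) (mat_adjoint (y (l mod q)))" if "l < r * q" for l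
 unfolding w_def by (rule kronecker_adjoint[OF xc[OF div_mod_less(1)[OF that]] yc[OF div_mod_less(2)[OF that]]])
 have "mat_sum (n ^ Suc N) (n ^ Suc N) (%l. mat_adjoint (w l) * w l) {..<r * q} = 1\<^sub>m (n ^ Suc N)"
 proof (rule eq_matI)
 fix i j assume "i < dim_row (1\<^sub>m (n ^ Suc N) :: complex mat)" "j < dim_col (1\<^sub>m (n ^ Suc N) :: complex mat)"
 then have ij: "i < n * n ^ N" "j < n * n ^ N" by auto
 note d = div_mod_less[OF ij(1)] div_mod_less[OF ij(2)]
 let ?A = "%a. mat_adjoint (x a) * x a" and ?B = "%b. mat_adjoint (y b) * y b"
 have "mat_sum (n ^ Suc N) (n ^ Suc N) (%l. mat_adjoint (w l) * w l) {..<r * q} $$ (i, j)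
 = (\<Sum>l<r * q. (mat_adjoint (w l) * w l) $$ (i, j))" using ij by (simp add: mat_sum_def)
 also have "... = (\<Sum>l<r * q. (%a b. ?A a $$ (i div n ^ N, j div n ^ N) * ?B b $$ (i mod n ^ N, j mod n ^ N)) (l div q) (l mod q))"
 proof (intro sum.cong refl)
 fix l assume "l : {..<r * q}"
 then have l: "l < r * q" by simp
 note xl = xc[OF div_mod_less(1)[OF l]] and yl = yc[OF div_mod_less(2)[OF l]]
 have "mat_adjoint (w l) * w l = kronecker (?A (l div q)) (?B (l mod q))"
 unfolding wa[OF l] unfolding w_def
 by (rule kronecker_mult[OF mat_adjoint_carrier[OF xl] xl mat_adjoint_carrier[OF yl] yl])
 then show "(mat_adjoint (w l) * w l) $$ (i, j) = (%a b. ?A a $$ (i div n ^ N, j div n ^ N) * ?B b $$ (i mod n ^ N, j mod n ^ N)) (l div q) (l mod q)"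
 using kronecker_index[OF mult_carrier_mat[OF mat_adjoint_carrier[OF xl] xl] mult_carrier_mat[OF mat_adjoint_carrier[OF yl] yl] ij]
 by simp
 qed
 also have "... = (\<Sum>a<r. \<Sum>b<q. ?A a $$ (i div n ^ N, j div n ^ N) * ?B b $$ (i mod n ^ N, j mod n ^ N))"
 by (rule sum_div_mod)
 also have "... = mat_sum n n ?A {..<r} $$ (i div n ^ N, j div n ^ N) * mat_sum (n ^ N) (n ^ N) ?B {..<q} $$ (i mod n ^ N, j mod n ^ N)"
 using d by (simp add: mat_sum_def sum_product)
 also have "... = kronecker (1\<^sub>m n) (1\<^sub>m (n ^ N)) $$ (i, j)"
 unfolding x1 y1 by (rule kronecker_index[OF one_carrier_mat one_carrier_mat ij, symmetric])
 finally show "mat_sum (n ^ Suc N) (n ^ Suc N) (%l. mat_adjoint (w l) * w l) {..<r * q} $$ (i, j) = 1\<^sub>m (n ^ Suc N) $$ (i, j)"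
 by (simp add: kronecker_one)
 qed (simp_all add: mat_sum_def)
 moreover have "mat_adjoint (w k) * t * w l : tensor_power n S (Suc N)"
 if k: "k < r * q" and l: "l < r * q" and t: "t : tensor_power m T (Suc N)" for k l t
 proof -
 have "tensor_power m T (Suc N) \<subseteq> {t : carrier_mat (m ^ Suc N) (m ^ Suc N). mat_adjoint (w k) * t * w l : tensor_power n S (Suc N)}"
 unfolding tensor_power.simps(2)[of m T] mat_span_def
 proof (rule hull_minimal)
 show "mat_subspace (m ^ Suc N) (m ^ Suc N) {t : carrier_mat (m ^ Suc N) (m ^ Suc N). mat_adjoint (w k) * t * w l : tensor_power n S (Suc N)}"
 by (rule mat_sandwich_subspace[OF _ mat_adjoint_carrier[OF wc[OF k]] wc[OF l]])
 (unfold tensor_power.simps power_Suc, rule mat_span_subspace, rule tensor_generators[OF S(1) tensor_power_system(1)[OF S]])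
 show "{kronecker x y | x y. x : T & y : tensor_power m T N} \<subseteq> {t : carrier_mat (m ^ Suc N) (m ^ Suc N). mat_adjoint (w k) * t * w l : tensor_power n S (Suc N)}"
 proof
 fix z assume "z : {kronecker x y | x y. x : T & y : tensor_power m T N}"
 then obtain t1 t2 where z: "t1 : T" "t2 : tensor_power m T N" "z = kronecker t1 t2" by blast
 have c: "t1 : carrier_mat m m" "t2 : carrier_mat (m ^ N) (m ^ N)"
 using z(1,2) T(1) tensor_power_system(1)[OF T] by auto
 note xk = xc[OF div_mod_less(1)[OF k]] and yk = yc[OF div_mod_less(2)[OF k]]
 note xl = xc[OF div_mod_less(1)[OF l]] and yl = yc[OF div_mod_less(2)[OF l]]
 have "mat_adjoint (w k) * z * w l = kronecker (mat_adjoint (x (k div q)) * t1 * x (l div q)) (mat_adjoint (y (k mod q)) * t2 * y (l mod q))"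
 unfolding wa[OF k] z(3) kronecker_mult[OF mat_adjoint_carrier[OF xk] c(1) mat_adjoint_carrier[OF yk] c(2)]
 unfolding w_def
 by (rule kronecker_mult[OF mult_carrier_mat[OF mat_adjoint_carrier[OF xk] c(1)] xl mult_carrier_mat[OF mat_adjoint_carrier[OF yk] c(2)] yl])
 moreover have "mat_adjoint (x (k div q)) * t1 * x (l div q) : S" "mat_adjoint (y (k mod q)) * t2 * y (l mod q) : tensor_power n S N"
 using con y div_mod_less[OF k] div_mod_less[OF l] z(1,2) by (simp_all add: connects_def)
 ultimately have "mat_adjoint (w k) * z * w l : tensor_power n S (Suc N)"
 unfolding tensor_power.simps mat_span_def by (intro hull_inc) blast
 moreover have "z : carrier_mat (m ^ Suc N) (m ^ Suc N)"
 unfolding z(3) power_Suc by (rule kronecker_carrier[OF c])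
 ultimately show "z : {t : carrier_mat (m ^ Suc N) (m ^ Suc N). mat_adjoint (w k) * t * w l : tensor_power n S (Suc N)}" by blast
 qed
 qed
 then show ?thesis using t by blast
 qed
 ultimately have "connects (n ^ Suc N) (tensor_power n S (Suc N)) (m ^ Suc N) (tensor_power m T (Suc N)) (r * q) w"
 unfolding connects_def using wc by blast
 then show ?case by blast
qed

lemma independence_number_alt: "independence_number n S = (GREATEST N. independent_family n S N)"
 unfolding independence_number_def independent_family_def ..

lemma independence_eq:
 assumes S: "operator_system n S" and T: "operator_system m T"
 and pb: "pullback n S m T" "pullback m T n S"
 shows "independence_number n S = independence_number m T" "shannon_capacity n S = shannon_capacity m T"
proof -
 note sS = operator_systemD(1,2)[OF S] and sT = operator_systemD(1,2)[OF T]
 obtain r x where x: "connects n S m T r x" by (rule pullback_connects[OF sS(1) pb(1)]) (rule that; assumption)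
 obtain q y where y: "connects m T n S q y" by (rule pullback_connects[OF sT(1) pb(2)]) (rule that; assumption)
 have power: "independent_family (n ^ N) (tensor_power n S N) k \<longleftrightarrow> independent_family (m ^ N) (tensor_power m T N) k" for N k
 proof -
 note tS = tensor_power_system[OF sS, of N] and tT = tensor_power_system[OF sT, of N]
 obtain r' x' where x': "connects (n ^ N) (tensor_power n S N) (m ^ N) (tensor_power m T N) r' x'"
 using connects_tensor_power[OF sS sT x] by blast
 obtain q' y' where y': "connects (m ^ N) (tensor_power m T N) (n ^ N) (tensor_power n S N) q' y'"
 using connects_tensor_power[OF sT sS y] by blast
 show ?thesis
 using independent_transfer[OF tS(1) tT x'] independent_transfer[OF tT(1) tS y'] by blast
 qed
 show "shannon_capacity n S = shannon_capacity m T"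
 unfolding shannon_capacity_def independence_number_alt power ..
 have "independent_family n S k \<longleftrightarrow> independent_family m T k" for k
 using independent_transfer[OF sS(1) sT x] independent_transfer[OF sT(1) sS y] by blast
 then show "independence_number n S = independence_number m T" by (simp add: independence_number_alt)
qed

section \<open>Invariance of the parameters\<close>

lemma pullback_parameters:
 assumes S: "operator_system n S" and T: "operator_system m T"
 and pb: "pullback n S m T" "pullback m T n S"
 shows "independence_number n S = independence_number m T &
 shannon_capacity n S = shannon_capacity m T &
 lovasz n S = lovasz m T &
 lovasz_hat n S = lovasz_hat m T &
 haemers_bound n S = haemers_bound m T &
 quantum_subcomplexity n S = quantum_subcomplexity m T &
 quantum_complexity n S = quantum_complexity m T"
proof (intro conjI independence_eq[OF assms] lovasz_eq[OF assms])
 note sS = operator_systemD(1)[OF S] and sT = operator_systemD(1)[OF T]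
 note to = complexity_transfer[OF sS sT pb(1)] and from' = complexity_transfer[OF sT sS pb(2)]
 show "haemers_bound n S = haemers_bound m T"
 unfolding haemers_bound_def by (rule arg_cong[where f = Least], rule ext, rule iffI, erule from'(3), erule to(3))
 show "quantum_subcomplexity n S = quantum_subcomplexity m T"
 unfolding quantum_subcomplexity_def by (rule arg_cong[where f = Least], rule ext, rule iffI, erule from'(2), erule to(2))
 show "quantum_complexity n S = quantum_complexity m T"
 unfolding quantum_complexity_def by (rule arg_cong[where f = Least], rule ext, rule iffI, erule from'(1), erule to(1))
qed

theorem theoremD:
  fixes n m :: nat and S T :: "complex mat set"
  assumes "operator_system n S" and "operator_system m T"
  shows
    "(mat_tro_equivalent n S m T \<longrightarrow>
        independence_number n S = independence_number m T \<and>
        shannon_capacity n S = shannon_capacity m T \<and>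
        lovasz n S = lovasz m T \<and>
        lovasz_hat n S = lovasz_hat m T \<and>
        haemers_bound n S = haemers_bound m T \<and>
        quantum_subcomplexity n S = quantum_subcomplexity m T \<and>
        quantum_complexity n S = quantum_complexity m T) \<and>
     (acts_irreducibly n S \<and> acts_irreducibly m T \<and>
      delta_equivalent TYPE('h::chilbert_space) TYPE('k::chilbert_space) n S m T \<longrightarrow>
        independence_number n S = independence_number m T \<and>
        shannon_capacity n S = shannon_capacity m T \<and>
        lovasz n S = lovasz m T \<and>
        lovasz_hat n S = lovasz_hat m T \<and>
        haemers_bound n S = haemers_bound m T \<and>
        quantum_subcomplexity n S = quantum_subcomplexity m T \<and>
        quantum_complexity n S = quantum_complexity m T)"
proof (rule conjI; rule impI; rule pullback_parameters[OF assms])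
qed (use tro_pullback[OF assms] delta_pullback[OF assms] in blast)+

end
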